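(* Let $k$ be a field of characteristic $0$ and $K=k[[h]]$. Let $A_0$ be a noetherian $k$-algebra and let $A_h$ be a deformation of $A_0$. Assume that $k$ has a left $A_0$-module structure such that there exists an integer $d$ with $\mathrm{Ext}^{i}_{A_0}(k,A_0)=\{0\}$ for $i\neq d$ and $\mathrm{Ext}^{d}_{A_0}(k,A_0)\simeq k$, and that $K$ is endowed with an $A_h$-module structure which reduces modulo $h$ to this $A_0$-module structure on $k$. Assume moreover that the $A_h$-module $K$ is of finite projective dimension. Let $\Omega_{A_h}$ be the right $A_h$-module $\mathrm{Ext}^{d}_{A_h}(K,A_h)$, and let $M$ be an $A_h$-module. Then, for every integer $i$, there is an isomorphism of $K$-modules $$\mathrm{Ext}^{i}_{A_h}(K,M)\simeq \mathrm{Tor}^{A_h}_{d-i}(\Omega_{A_h},M).$$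
   Context: A topologically free $K$-module is a $K$-module isomorphic to $V[[h]]$ for some $k$-vector space $V$. A deformation of a $k$-algebra $A_0$ is a topologically free $K$-module $A_h$ with a $K$-bilinear associative (unital) multiplication such that $A_h/hA_h\simeq A_0$ as algebras. Modules are left modules unless said otherwise. The $A_h$-module structure on $K$ is compatible with its $K$-module structure, and "reduces modulo $h$" means that $K/hK=k$ over $A_h/hA_h\simeq A_0$ is the given module. The right $A_h$-module structure on $\mathrm{Ext}^d_{A_h}(K,A_h)$ is induced by right multiplication on the coefficients $A_h$. $\mathrm{Tor}^{A_h}_j(N,-)$ denotes the $j$-th left derived functor of $N\otimes_{A_h}-$ for a right $A_h$-module $N$. *)

theory Defs
  imports
    "HOL-Computational_Algebra.Formal_Power_Series"
    "HOL-Algebra.Free_Abelian_Groups"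
    "HOL-Algebra.QuotRing"
    "HOL-Algebra.Module"
begin

section \<open>Modules over noncommutative rings\<close>

text \<open>
  The library locale for modules requires a commutative ring of scalars. The same record type is
  used here over an arbitrary ring; its fields \<open>mult\<close> and \<open>one\<close> play no role for a module.
\<close>

locale left_module = R?: ring R + M?: abelian_group M for R (structure) and M (structure) +
  assumes smult_closed [simp, intro]:
      "\<lbrakk>a \<in> carrier R; x \<in> carrier M\<rbrakk> \<Longrightarrow> a \<odot>\<^bsub>M\<^esub> x \<in> carrier M"
    and smult_l_distr:
      "\<lbrakk>a \<in> carrier R; b \<in> carrier R; x \<in> carrier M\<rbrakk> \<Longrightarrow>
        (a \<oplus> b) \<odot>\<^bsub>M\<^esub> x = a \<odot>\<^bsub>M\<^esub> x \<oplus>\<^bsub>M\<^esub> b \<odot>\<^bsub>M\<^esub> x"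
    and smult_r_distr:
      "\<lbrakk>a \<in> carrier R; x \<in> carrier M; y \<in> carrier M\<rbrakk> \<Longrightarrow>
        a \<odot>\<^bsub>M\<^esub> (x \<oplus>\<^bsub>M\<^esub> y) = a \<odot>\<^bsub>M\<^esub> x \<oplus>\<^bsub>M\<^esub> a \<odot>\<^bsub>M\<^esub> y"
    and smult_assoc1:
      "\<lbrakk>a \<in> carrier R; b \<in> carrier R; x \<in> carrier M\<rbrakk> \<Longrightarrow>
        (a \<otimes> b) \<odot>\<^bsub>M\<^esub> x = a \<odot>\<^bsub>M\<^esub> (b \<odot>\<^bsub>M\<^esub> x)"
    and smult_one [simp]: "x \<in> carrier M \<Longrightarrow> \<one> \<odot>\<^bsub>M\<^esub> x = x"

definition opposite :: "('a, 'z) ring_scheme \<Rightarrow> ('a, 'z) ring_scheme" where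
  "opposite A = A\<lparr>mult := (\<lambda>x y. y \<otimes>\<^bsub>A\<^esub> x)\<rparr>"

text \<open>In a right module \<open>N\<close> over \<open>A\<close>, the element \<open>a \<odot>\<^bsub>N\<^esub> x\<close> is to be read as \<open>x a\<close>.\<close>

abbreviation right_module ::
  "('a, 'z) ring_scheme \<Rightarrow> ('a, 'n, 'y) module_scheme \<Rightarrow> bool" where
  "right_module A N \<equiv> left_module (opposite A) N"

definition regular_module :: "('a, 'z) ring_scheme \<Rightarrow> ('a, 'a) module" where
  "regular_module A =
    \<lparr>carrier = carrier A, mult = mult A, one = one A, zero = zero A, add = add A,
     smult = mult A\<rparr>"

definition lin_maps ::
  "('s, 'z) ring_scheme \<Rightarrow> ('s, 'm, 'y) module_scheme \<Rightarrow> ('s, 'n, 'x) module_scheme \<Rightarrow>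
    ('m \<Rightarrow> 'n) set" where
  "lin_maps R M N = {f \<in> carrier M \<rightarrow> carrier N.
     (\<forall>x\<in>carrier M. \<forall>y\<in>carrier M. f (x \<oplus>\<^bsub>M\<^esub> y) = f x \<oplus>\<^bsub>N\<^esub> f y) \<and>
     (\<forall>s\<in>carrier R. \<forall>x\<in>carrier M. f (s \<odot>\<^bsub>M\<^esub> x) = s \<odot>\<^bsub>N\<^esub> f x)}"

definition isomorphic_modules ::
  "('s, 'z) ring_scheme \<Rightarrow> ('s, 'm, 'y) module_scheme \<Rightarrow> ('s, 'n, 'x) module_scheme \<Rightarrow> bool" where
  "isomorphic_modules R M N \<longleftrightarrow>
     (\<exists>f\<in>lin_maps R M N. bij_betw f (carrier M) (carrier N))"

definition quotient_module ::
  "('s, 'm, 'y) module_scheme \<Rightarrow> 'm set \<Rightarrow> ('s, 'm set) module" where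
  "quotient_module M B =
    \<lparr>carrier = a_rcosets\<^bsub>M\<^esub> B, mult = undefined, one = undefined, zero = B, add = set_add M,
     smult = (\<lambda>s X. \<Union>x\<in>X. B +>\<^bsub>M\<^esub> (s \<odot>\<^bsub>M\<^esub> x))\<rparr>"

definition left_noetherian :: "('a, 'z) ring_scheme \<Rightarrow> bool" where
  "left_noetherian A \<longleftrightarrow>
     (\<forall>I. submodule I A (regular_module A) \<longrightarrow>
       (\<exists>S. finite S \<and> S \<subseteq> carrier A \<and>
            I = \<Inter>{J. submodule J A (regular_module A) \<and> S \<subseteq> J}))"

definition noetherian :: "('a, 'z) ring_scheme \<Rightarrow> bool" where
  "noetherian A \<longleftrightarrow> left_noetherian A \<and> left_noetherian (opposite A)"


section \<open>Free and projective modules, resolutions\<close>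

definition free_module :: "('a, 'z) ring_scheme \<Rightarrow> 'i set \<Rightarrow> ('a, 'i \<Rightarrow> 'a) module" where
  "free_module A I =
    \<lparr>carrier = {f. (\<forall>i\<in>I. f i \<in> carrier A) \<and> (\<forall>i. i \<notin> I \<longrightarrow> f i = \<zero>\<^bsub>A\<^esub>) \<and>
                   finite {i. f i \<noteq> \<zero>\<^bsub>A\<^esub>}},
     mult = undefined, one = undefined,
     zero = (\<lambda>_. \<zero>\<^bsub>A\<^esub>),
     add = (\<lambda>f g i. f i \<oplus>\<^bsub>A\<^esub> g i),
     smult = (\<lambda>a f i. a \<otimes>\<^bsub>A\<^esub> f i)\<rparr>"

definition basis_vector :: "('a, 'z) ring_scheme \<Rightarrow> 'i \<Rightarrow> 'i \<Rightarrow> 'a" where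
  "basis_vector A i = (\<lambda>j. if j = i then \<one>\<^bsub>A\<^esub> else \<zero>\<^bsub>A\<^esub>)"

definition linear_extension ::
  "('a, 'z) ring_scheme \<Rightarrow> ('a, 'm, 'y) module_scheme \<Rightarrow> ('i \<Rightarrow> 'm) \<Rightarrow> ('i \<Rightarrow> 'a) \<Rightarrow> 'm" where
  "linear_extension A M g f = (\<Oplus>\<^bsub>M\<^esub>i\<in>{i. f i \<noteq> \<zero>\<^bsub>A\<^esub>}. f i \<odot>\<^bsub>M\<^esub> g i)"

text \<open>
  A module is projective if it is a direct summand of a free module. A basis indexed by a set of
  elements of \<open>P\<close> suffices, since every module is a quotient of the free module on its
  underlying set.
\<close>

definition projective :: "('a, 'z) ring_scheme \<Rightarrow> ('a, 'p, 'y) module_scheme \<Rightarrow> bool" where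
  "projective A P \<longleftrightarrow> left_module A P \<and>
     (\<exists>I :: 'p set. \<exists>s\<in>lin_maps A P (free_module A I). \<exists>r\<in>lin_maps A (free_module A I) P.
        \<forall>x\<in>carrier P. r (s x) = x)"

text \<open>
  Complexes are indexed by the integers, with differentials \<open>d i\<close> from degree \<open>i\<close> to degree
  \<open>i - 1\<close>; resolutions vanish in negative degrees.
\<close>

definition projective_resolution ::
  "('a, 'z) ring_scheme \<Rightarrow> ('a, 'n, 'y) module_scheme \<Rightarrow> (int \<Rightarrow> ('a, 'p) module) \<Rightarrow>
    (int \<Rightarrow> 'p \<Rightarrow> 'p) \<Rightarrow> ('p \<Rightarrow> 'n) \<Rightarrow> bool" where
  "projective_resolution A N P d e \<longleftrightarrow>
     (\<forall>i. projective A (P i)) \<and>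
     (\<forall>i<0. carrier (P i) = {\<zero>\<^bsub>P i\<^esub>}) \<and>
     (\<forall>i. d i \<in> lin_maps A (P i) (P (i - 1))) \<and>
     (\<forall>i\<ge>1. a_kernel (P i) (P (i - 1)) (d i) = d (i + 1) ` carrier (P (i + 1))) \<and>
     e \<in> lin_maps A (P 0) N \<and>
     a_kernel (P 0) N e = d 1 ` carrier (P 1) \<and>
     e ` carrier (P 0) = carrier N"

text \<open>
  The standard free resolution of a module \<open>N\<close>: the module in degree \<open>0\<close> is free on the
  elements of \<open>N\<close>, and the one in degree \<open>n + 1\<close> is free on formal linear combinations (lists
  of coefficients and basis elements) representing the elements of the kernel of the map
  out of degree \<open>n\<close>. Recording the basis elements as trees keeps all degrees within one type.
\<close>

datatype ('a, 'n) cell = Gen 'n | Syz "('a \<times> ('a, 'n) cell) list"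

definition cell_sum ::
  "('a, 'z) ring_scheme \<Rightarrow> ('a \<times> ('a, 'n) cell) list \<Rightarrow> ('a, 'n) cell \<Rightarrow> 'a" where
  "cell_sum A xs =
     foldr (\<lambda>(a, c) f. a \<odot>\<^bsub>free_module A UNIV\<^esub> basis_vector A c \<oplus>\<^bsub>free_module A UNIV\<^esub> f)
       xs \<zero>\<^bsub>free_module A UNIV\<^esub>"

definition std_aug ::
  "('a, 'z) ring_scheme \<Rightarrow> ('a, 'n, 'y) module_scheme \<Rightarrow> (('a, 'n) cell \<Rightarrow> 'a) \<Rightarrow> 'n" where
  "std_aug A N =
     linear_extension A N (\<lambda>c. case c of Gen x \<Rightarrow> x | Syz xs \<Rightarrow> \<zero>\<^bsub>N\<^esub>)"

definition std_diff ::
  "('a, 'z) ring_scheme \<Rightarrow> (('a, 'n) cell \<Rightarrow> 'a) \<Rightarrow> (('a, 'n) cell \<Rightarrow> 'a)" where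
  "std_diff A =
     linear_extension A (free_module A UNIV)
       (\<lambda>c. case c of Gen x \<Rightarrow> \<zero>\<^bsub>free_module A UNIV\<^esub> | Syz xs \<Rightarrow> cell_sum A xs)"

primrec std_basis ::
  "('a, 'z) ring_scheme \<Rightarrow> ('a, 'n, 'y) module_scheme \<Rightarrow> nat \<Rightarrow> ('a, 'n) cell set" where
  "std_basis A N 0 = Gen ` carrier N"
| "std_basis A N (Suc n) =
     Syz ` {xs. set xs \<subseteq> carrier A \<times> std_basis A N n \<and>
                (if n = 0 then std_aug A N (cell_sum A xs) = \<zero>\<^bsub>N\<^esub>
                 else std_diff A (cell_sum A xs) = \<zero>\<^bsub>free_module A UNIV\<^esub>)}"

definition std_res ::
  "('a, 'z) ring_scheme \<Rightarrow> ('a, 'n, 'y) module_scheme \<Rightarrow> int \<Rightarrow>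
    ('a, ('a, 'n) cell \<Rightarrow> 'a) module" where
  "std_res A N i = free_module A (if i < 0 then {} else std_basis A N (nat i))"

text \<open>
  Restricting to resolutions within the type of the standard one loses nothing: if a projective
  resolution of length at most \<open>n\<close> exists in any type, then truncating the standard resolution
  at its \<open>n\<close>-th kernel gives one (for \<open>n = 0\<close>, \<open>N\<close> is itself projective and embeds into the
  degree \<open>0\<close> module).
\<close>

definition finite_projective_dimension ::
  "('a, 'z) ring_scheme \<Rightarrow> ('a, 'n, 'y) module_scheme \<Rightarrow> bool" where
  "finite_projective_dimension A N \<longleftrightarrow>
     (\<exists>(P :: int \<Rightarrow> ('a, ('a, 'n) cell \<Rightarrow> 'a) module) d e n.
        projective_resolution A N P d e \<and> (\<forall>i>n. carrier (P i) = {\<zero>\<^bsub>P i\<^esub>}))"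


section \<open>Ext and Tor\<close>

text \<open>The homology at \<open>C\<close> of a pair of maps \<open>f\<close> from \<open>B\<close> to \<open>C\<close> and \<open>g\<close> from \<open>C\<close> to \<open>D\<close>.\<close>

definition homology ::
  "('s, 'b) module \<Rightarrow> ('b \<Rightarrow> 'c) \<Rightarrow> ('s, 'c) module \<Rightarrow> ('c \<Rightarrow> 'd) \<Rightarrow> ('s, 'd) module \<Rightarrow>
    ('s, 'c set) module" where
  "homology B f C g D = quotient_module (C\<lparr>carrier := a_kernel C D g\<rparr>) (f ` carrier B)"

text \<open>
  The homomorphisms of \<open>A\<close>-modules from \<open>P\<close> to \<open>M\<close>, with scalars acting through an additional
  action \<open>act\<close> on the coefficients \<open>M\<close>.
\<close>

definition hom_module ::
  "('a, 'z) ring_scheme \<Rightarrow> ('a, 'p, 'y) module_scheme \<Rightarrow> ('a, 'm, 'x) module_scheme \<Rightarrow>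
    ('s \<Rightarrow> 'm \<Rightarrow> 'm) \<Rightarrow> ('s, 'p \<Rightarrow> 'm) module" where
  "hom_module A P M act =
    \<lparr>carrier = lin_maps A P M \<inter> extensional (carrier P),
     mult = undefined, one = undefined,
     zero = (\<lambda>p\<in>carrier P. \<zero>\<^bsub>M\<^esub>),
     add = (\<lambda>f g. \<lambda>p\<in>carrier P. f p \<oplus>\<^bsub>M\<^esub> g p),
     smult = (\<lambda>s f. \<lambda>p\<in>carrier P. act s (f p))\<rparr>"

definition Ext_of ::
  "('a, 'z) ring_scheme \<Rightarrow> (int \<Rightarrow> ('a, 'p) module) \<Rightarrow> (int \<Rightarrow> 'p \<Rightarrow> 'p) \<Rightarrow>
    ('a, 'm, 'x) module_scheme \<Rightarrow> ('s \<Rightarrow> 'm \<Rightarrow> 'm) \<Rightarrow> int \<Rightarrow> ('s, ('p \<Rightarrow> 'm) set) module" where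
  "Ext_of A P d M act i =
     homology (hom_module A (P (i - 1)) M act)
       (\<lambda>f. compose (carrier (P i)) f (d i))
       (hom_module A (P i) M act)
       (\<lambda>f. compose (carrier (P (i + 1))) f (d (i + 1)))
       (hom_module A (P (i + 1)) M act)"

definition Ext ::
  "('a, 'z) ring_scheme \<Rightarrow> ('a, 'n, 'y) module_scheme \<Rightarrow> ('a, 'm, 'x) module_scheme \<Rightarrow>
    ('s \<Rightarrow> 'm \<Rightarrow> 'm) \<Rightarrow> int \<Rightarrow> ('s, ((('a, 'n) cell \<Rightarrow> 'a) \<Rightarrow> 'm) set) module" where
  "Ext A N M act = Ext_of A (std_res A N) (\<lambda>_. std_diff A) M act"

text \<open>
  The tensor product over \<open>A\<close> of a right module \<open>N\<close> and a left module \<open>P\<close>, with scalars acting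
  through an additional action \<open>act\<close> on \<open>N\<close>.
\<close>

definition tensor_relations ::
  "('a, 'z) ring_scheme \<Rightarrow> ('a, 'n, 'y) module_scheme \<Rightarrow> ('a, 'p, 'x) module_scheme \<Rightarrow>
    ('n \<times> 'p \<Rightarrow>\<^sub>0 int) set" where
  "tensor_relations A N P = generate (free_Abelian_group (carrier N \<times> carrier P))
    ({frag_of (x \<oplus>\<^bsub>N\<^esub> x', y) - frag_of (x, y) - frag_of (x', y) |x x' y.
        x \<in> carrier N \<and> x' \<in> carrier N \<and> y \<in> carrier P} \<union>
     {frag_of (x, y \<oplus>\<^bsub>P\<^esub> y') - frag_of (x, y) - frag_of (x, y') |x y y'.
        x \<in> carrier N \<and> y \<in> carrier P \<and> y' \<in> carrier P} \<union>
     {frag_of (a \<odot>\<^bsub>N\<^esub> x, y) - frag_of (x, a \<odot>\<^bsub>P\<^esub> y) |a x y.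
        a \<in> carrier A \<and> x \<in> carrier N \<and> y \<in> carrier P})"

definition formal_tensors ::
  "('a, 'n, 'y) module_scheme \<Rightarrow> ('a, 'p, 'x) module_scheme \<Rightarrow> ('s \<Rightarrow> 'n \<Rightarrow> 'n) \<Rightarrow>
    ('s, 'n \<times> 'p \<Rightarrow>\<^sub>0 int) module" where
  "formal_tensors N P act =
    \<lparr>carrier = carrier (free_Abelian_group (carrier N \<times> carrier P)),
     mult = undefined, one = undefined, zero = 0, add = (+),
     smult = (\<lambda>s. frag_extend (\<lambda>(x, y). frag_of (act s x, y)))\<rparr>"

definition tensor ::
  "('a, 'z) ring_scheme \<Rightarrow> ('a, 'n, 'y) module_scheme \<Rightarrow> ('a, 'p, 'x) module_scheme \<Rightarrow>
    ('s \<Rightarrow> 'n \<Rightarrow> 'n) \<Rightarrow> ('s, ('n \<times> 'p \<Rightarrow>\<^sub>0 int) set) module" where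
  "tensor A N P act = quotient_module (formal_tensors N P act) (tensor_relations A N P)"

definition tensor_map ::
  "('a, 'z) ring_scheme \<Rightarrow> ('a, 'n, 'y) module_scheme \<Rightarrow> ('a, 'q, 'x) module_scheme \<Rightarrow>
    ('p \<Rightarrow> 'q) \<Rightarrow> ('n \<times> 'p \<Rightarrow>\<^sub>0 int) set \<Rightarrow> ('n \<times> 'q \<Rightarrow>\<^sub>0 int) set" where
  "tensor_map A N Q f X =
     (\<Union>u\<in>X. {r + frag_extend (\<lambda>(x, y). frag_of (x, f y)) u |r. r \<in> tensor_relations A N Q})"

definition Tor_of ::
  "('a, 'z) ring_scheme \<Rightarrow> ('a, 'n, 'y) module_scheme \<Rightarrow> (int \<Rightarrow> ('a, 'p) module) \<Rightarrow>
    (int \<Rightarrow> 'p \<Rightarrow> 'p) \<Rightarrow> ('s \<Rightarrow> 'n \<Rightarrow> 'n) \<Rightarrow> int \<Rightarrow>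
    ('s, ('n \<times> 'p \<Rightarrow>\<^sub>0 int) set set) module" where
  "Tor_of A N P d act i =
     homology (tensor A N (P (i + 1)) act)
       (tensor_map A N (P i) (d (i + 1)))
       (tensor A N (P i) act)
       (tensor_map A N (P (i - 1)) (d i))
       (tensor A N (P (i - 1)) act)"

definition Tor ::
  "('a, 'z) ring_scheme \<Rightarrow> ('a, 'n, 'y) module_scheme \<Rightarrow> ('a, 'm, 'x) module_scheme \<Rightarrow>
    ('s \<Rightarrow> 'n \<Rightarrow> 'n) \<Rightarrow> int \<Rightarrow>
    ('s, ('n \<times> (('a, 'm) cell \<Rightarrow> 'a) \<Rightarrow>\<^sub>0 int) set set) module" where
  "Tor A N M act = Tor_of A N (std_res A M) (\<lambda>_. std_diff A) act"


section \<open>Deformations\<close>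

definition type_ring :: "'k::comm_ring_1 ring" where
  "type_ring = \<lparr>carrier = UNIV, mult = (*), one = 1, zero = 0, add = (+)\<rparr>"

definition type_module :: "('s \<Rightarrow> 'k \<Rightarrow> 'k) \<Rightarrow> ('s, 'k::comm_ring_1) module" where
  "type_module act =
    \<lparr>carrier = UNIV, mult = (*), one = 1, zero = 0, add = (+), smult = act\<rparr>"

locale assoc_algebra = Module.module R A + ring A for R (structure) and A (structure) +
  assumes smult_mult_left:
      "\<lbrakk>a \<in> carrier R; x \<in> carrier A; y \<in> carrier A\<rbrakk> \<Longrightarrow>
        (a \<odot>\<^bsub>A\<^esub> x) \<otimes>\<^bsub>A\<^esub> y = a \<odot>\<^bsub>A\<^esub> (x \<otimes>\<^bsub>A\<^esub> y)"
    and smult_mult_right: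
      "\<lbrakk>a \<in> carrier R; x \<in> carrier A; y \<in> carrier A\<rbrakk> \<Longrightarrow>
        x \<otimes>\<^bsub>A\<^esub> (a \<odot>\<^bsub>A\<^esub> y) = a \<odot>\<^bsub>A\<^esub> (x \<otimes>\<^bsub>A\<^esub> y)"

text \<open>
  The action of the base ring on a left or right module \<open>M\<close> over an algebra \<open>A\<close>, through the
  structure map of \<open>A\<close>.
\<close>

definition base_action :: "('r, 'a) module \<Rightarrow> ('a, 'm, 'y) module_scheme \<Rightarrow> 'r \<Rightarrow> 'm \<Rightarrow> 'm" where
  "base_action A M c x = (c \<odot>\<^bsub>A\<^esub> \<one>\<^bsub>A\<^esub>) \<odot>\<^bsub>M\<^esub> x"

definition power_series_module :: "('k::field, 'v) module \<Rightarrow> ('k fps, nat \<Rightarrow> 'v) module" where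
  "power_series_module V =
    \<lparr>carrier = {f. \<forall>n. f n \<in> carrier V}, mult = undefined, one = undefined,
     zero = (\<lambda>_. \<zero>\<^bsub>V\<^esub>),
     add = (\<lambda>f g n. f n \<oplus>\<^bsub>V\<^esub> g n),
     smult = (\<lambda>a f n. \<Oplus>\<^bsub>V\<^esub>i\<in>{..n}. fps_nth a i \<odot>\<^bsub>V\<^esub> f (n - i))\<rparr>"

text \<open>
  The vector space \<open>V\<close> may be taken in the type of \<open>M\<close>, as it embeds into \<open>V[[h]]\<close> as the
  constant series.
\<close>

definition topologically_free :: "('k::field fps, 'b) module \<Rightarrow> bool" where
  "topologically_free M \<longleftrightarrow> Module.module type_ring M \<and>
     (\<exists>V :: ('k, 'b) module. Module.module type_ring V \<and>
        isomorphic_modules type_ring M (power_series_module V))"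

definition h_multiples :: "('k::field fps, 'b) module \<Rightarrow> 'b set" where
  "h_multiples M = {fps_X \<odot>\<^bsub>M\<^esub> x |x. x \<in> carrier M}"

text \<open>
  A deformation comes with an isomorphism \<open>\<phi>\<close> of \<open>k\<close>-algebras from \<open>A\<^sub>h/hA\<^sub>h\<close> to \<open>A\<^sub>0\<close>; a scalar
  \<open>c\<close> in \<open>k\<close> multiplies the class of \<open>x\<close> to the class of \<open>c x\<close>.
\<close>

definition deformation ::
  "('k::field, 'a0) module \<Rightarrow> ('k fps, 'a) module \<Rightarrow> ('a set \<Rightarrow> 'a0) \<Rightarrow> bool" where
  "deformation A0 Ah \<phi> \<longleftrightarrow>
     assoc_algebra type_ring Ah \<and> topologically_free Ah \<and>
     \<phi> \<in> ring_iso (Ah Quot h_multiples Ah) A0 \<and>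
     (\<forall>c. \<forall>x\<in>carrier Ah. \<phi> (h_multiples Ah +>\<^bsub>Ah\<^esub> (fps_const c \<odot>\<^bsub>Ah\<^esub> x)) =
        c \<odot>\<^bsub>A0\<^esub> \<phi> (h_multiples Ah +>\<^bsub>Ah\<^esub> x))"

text \<open>
  A left module structure over a \<open>k\<close>-algebra on \<open>k\<close> itself (also with \<open>K\<close> in place of \<open>k\<close>),
  extending multiplication of scalars.
\<close>

definition module_structure_on_base ::
  "('k::comm_ring_1, 'a) module \<Rightarrow> ('a \<Rightarrow> 'k \<Rightarrow> 'k) \<Rightarrow> bool" where
  "module_structure_on_base A act \<longleftrightarrow> left_module A (type_module act) \<and>
     (\<forall>c x. base_action A (type_module act) c x = c * x)"

text \<open>
  The quotient \<open>K/hK\<close> is identified with \<open>k\<close> through the constant coefficient, and it is a module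
  over \<open>A\<^sub>0\<close> through \<open>\<phi>\<close>.
\<close>

definition reduces_to ::
  "('k::field fps, 'a) module \<Rightarrow> ('a set \<Rightarrow> 'a0) \<Rightarrow> ('a \<Rightarrow> 'k fps \<Rightarrow> 'k fps) \<Rightarrow>
    ('a0 \<Rightarrow> 'k \<Rightarrow> 'k) \<Rightarrow> bool" where
  "reduces_to Ah \<phi> acth act0 \<longleftrightarrow>
     (\<forall>a\<in>carrier Ah. \<forall>x. fps_nth (acth a x) 0 = act0 (\<phi> (h_multiples Ah +>\<^bsub>Ah\<^esub> a)) (fps_nth x 0))"

text \<open>
  The right \<open>A\<close>-module \<open>Ext\<^sup>i\<^sub>A(N, A)\<close>, by right multiplication on the coefficients.
\<close>

definition Ext_regular ::
  "('a, 'z) ring_scheme \<Rightarrow> ('a, 'n, 'y) module_scheme \<Rightarrow> int \<Rightarrow>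
    ('a, ((('a, 'n) cell \<Rightarrow> 'a) \<Rightarrow> 'a) set) module" where
  "Ext_regular A N = Ext A N (regular_module A) (\<lambda>a x. x \<otimes>\<^bsub>A\<^esub> a)"


section \<open>The standard resolution is a projective resolution\<close>

lemma free_left_module:
  assumes "ring A" shows "left_module A (free_module A I)"
proof -
  interpret A: ring A by fact
  have fin: "finite {i. f i \<oplus>\<^bsub>A\<^esub> g i \<noteq> \<zero>\<^bsub>A\<^esub>}"
    if "finite {i. f i \<noteq> \<zero>\<^bsub>A\<^esub>}" "finite {i. g i \<noteq> \<zero>\<^bsub>A\<^esub>}" for f g :: "_ \<Rightarrow> 'a"
    by (rule finite_subset[OF _ finite_UnI[OF that]]) auto
  have fin2: "finite {i. a \<otimes>\<^bsub>A\<^esub> f i \<noteq> \<zero>\<^bsub>A\<^esub>}"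
    if "a \<in> carrier A" "finite {i. f i \<noteq> \<zero>\<^bsub>A\<^esub>}" for a and f :: "_ \<Rightarrow> 'a"
    by (rule finite_subset[OF _ that(2)]) (use that in auto)
  have c: "f i \<in> carrier A" if "f \<in> carrier (free_module A I)" for f i
    using that by (cases "i \<in> I") (auto simp: free_module_def)
  show ?thesis
  proof (intro left_module.intro left_module_axioms.intro abelian_groupI)
    show "ring A" by fact
  next
    fix x assume x: "x \<in> carrier (free_module A I)"
    have "(\<lambda>i. \<ominus>\<^bsub>A\<^esub> x i) \<in> carrier (free_module A I)"
    proof -
      have "finite {i. \<ominus>\<^bsub>A\<^esub> x i \<noteq> \<zero>\<^bsub>A\<^esub>}"
        by (rule finite_subset[of _ "{i. x i \<noteq> \<zero>\<^bsub>A\<^esub>}"]) (use x in \<open>auto simp: free_module_def\<close>)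
      then show ?thesis using x by (auto simp: free_module_def)
    qed
    moreover have "(\<lambda>i. \<ominus>\<^bsub>A\<^esub> x i) \<oplus>\<^bsub>free_module A I\<^esub> x = \<zero>\<^bsub>free_module A I\<^esub>"
      using c[OF x] by (auto simp: free_module_def A.l_neg)
    ultimately show "\<exists>y\<in>carrier (free_module A I). y \<oplus>\<^bsub>free_module A I\<^esub> x = \<zero>\<^bsub>free_module A I\<^esub>"
      by blast
  next
    fix x y assume a: "x \<in> carrier (free_module A I)" "y \<in> carrier (free_module A I)"
    show "x \<oplus>\<^bsub>free_module A I\<^esub> y = y \<oplus>\<^bsub>free_module A I\<^esub> x"
      using a[THEN c] by (simp add: free_module_def A.a_comm)
  next
    fix x y z assume a: "x \<in> carrier (free_module A I)" "y \<in> carrier (free_module A I)" "z \<in> carrier (free_module A I)"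
    show "x \<oplus>\<^bsub>free_module A I\<^esub> y \<oplus>\<^bsub>free_module A I\<^esub> z = x \<oplus>\<^bsub>free_module A I\<^esub> (y \<oplus>\<^bsub>free_module A I\<^esub> z)"
      using a[THEN c] by (simp add: free_module_def A.a_assoc)
  next
    fix x assume a: "x \<in> carrier (free_module A I)"
    show "\<zero>\<^bsub>free_module A I\<^esub> \<oplus>\<^bsub>free_module A I\<^esub> x = x"
      using a[THEN c] by (simp add: free_module_def)
    show "\<one>\<^bsub>A\<^esub> \<odot>\<^bsub>free_module A I\<^esub> x = x"
      using a[THEN c] by (simp add: free_module_def)
  next
    fix a b x assume a: "a \<in> carrier A" "b \<in> carrier A" "x \<in> carrier (free_module A I)"
    show "(a \<oplus>\<^bsub>A\<^esub> b) \<odot>\<^bsub>free_module A I\<^esub> x = a \<odot>\<^bsub>free_module A I\<^esub> x \<oplus>\<^bsub>free_module A I\<^esub> b \<odot>\<^bsub>free_module A I\<^esub> x"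
      using a c[OF a(3)] by (simp add: free_module_def A.l_distr)
    show "(a \<otimes>\<^bsub>A\<^esub> b) \<odot>\<^bsub>free_module A I\<^esub> x = a \<odot>\<^bsub>free_module A I\<^esub> (b \<odot>\<^bsub>free_module A I\<^esub> x)"
      using a c[OF a(3)] by (simp add: free_module_def A.m_assoc)
  next
    fix a x y assume a: "a \<in> carrier A" "x \<in> carrier (free_module A I)" "y \<in> carrier (free_module A I)"
    show "a \<odot>\<^bsub>free_module A I\<^esub> (x \<oplus>\<^bsub>free_module A I\<^esub> y) = a \<odot>\<^bsub>free_module A I\<^esub> x \<oplus>\<^bsub>free_module A I\<^esub> a \<odot>\<^bsub>free_module A I\<^esub> y"
      using a c[OF a(2)] c[OF a(3)] by (simp add: free_module_def A.r_distr)
  qed (auto simp: free_module_def fin fin2)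
qed

lemma (in left_module) smult_zero_l: "x \<in> carrier M \<Longrightarrow> \<zero> \<odot>\<^bsub>M\<^esub> x = \<zero>\<^bsub>M\<^esub>"
  by (metis M.add.r_cancel_one R.l_zero R.zero_closed smult_closed smult_l_distr)

lemma (in left_module) smult_zero_r: "a \<in> carrier R \<Longrightarrow> a \<odot>\<^bsub>M\<^esub> \<zero>\<^bsub>M\<^esub> = \<zero>\<^bsub>M\<^esub>"
  by (metis M.add.r_cancel_one M.l_zero M.zero_closed smult_closed smult_r_distr)

lemma (in left_module) finsum_smult:
  assumes "finite S" "a \<in> carrier R" "f \<in> S \<rightarrow> carrier M"
  shows "a \<odot>\<^bsub>M\<^esub> (\<Oplus>\<^bsub>M\<^esub>i\<in>S. f i) = (\<Oplus>\<^bsub>M\<^esub>i\<in>S. a \<odot>\<^bsub>M\<^esub> f i)"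
  using assms
  by (induct S rule: finite_induct) (auto simp: smult_zero_r smult_r_distr Pi_def)

lemma (in left_module) linext_on:
  assumes f: "f \<in> carrier (free_module R I)" and g: "g \<in> I \<rightarrow> carrier M"
    and S: "finite S" "{i. f i \<noteq> \<zero>} \<subseteq> S" "S \<subseteq> I"
  shows "linear_extension R M g f = (\<Oplus>\<^bsub>M\<^esub>i\<in>S. f i \<odot>\<^bsub>M\<^esub> g i)"
  unfolding linear_extension_def
  apply (rule M.add.finprod_mono_neutral_cong_left[simplified])
  using assms by (auto simp: smult_zero_l free_module_def Pi_iff)

lemma (in left_module) linext_lin:
  assumes g: "g \<in> I \<rightarrow> carrier M"
  shows "linear_extension R M g \<in> lin_maps R (free_module R I) M"
proof -
  have gi: "g i \<in> carrier M" if "i \<in> I" for i using g that by auto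
  have fi: "f i \<in> carrier R" if "f \<in> carrier (free_module R I)" for f i
    using that by (cases "i \<in> I") (auto simp: free_module_def)
  have supp: "{i. f i \<noteq> \<zero>} \<subseteq> I" "finite {i. f i \<noteq> \<zero>}" if "f \<in> carrier (free_module R I)" for f
    using that by (auto simp: free_module_def)
  interpret F: left_module R "free_module R I" by (rule free_left_module) (rule R.ring_axioms)
  show ?thesis unfolding lin_maps_def
  proof (intro CollectI conjI ballI)
    show "linear_extension R M g \<in> carrier (free_module R I) \<rightarrow> carrier M"
      unfolding linear_extension_def using supp fi gi by (auto intro!: M.finsum_closed) blast
  next
    fix x y assume x: "x \<in> carrier (free_module R I)" and y: "y \<in> carrier (free_module R I)"
    let ?S = "{i. x i \<noteq> \<zero>} \<union> {i. y i \<noteq> \<zero>}"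
    have S: "finite ?S" "?S \<subseteq> I" using supp x y by auto
    have xy: "x \<oplus>\<^bsub>free_module R I\<^esub> y \<in> carrier (free_module R I)" using x y by simp
    have "linear_extension R M g (x \<oplus>\<^bsub>free_module R I\<^esub> y) = (\<Oplus>\<^bsub>M\<^esub>i\<in>?S. (x i \<oplus> y i) \<odot>\<^bsub>M\<^esub> g i)"
      by (subst linext_on[OF xy g S(1) _ S(2)]) (auto simp: free_module_def)
    also have "\<dots> = (\<Oplus>\<^bsub>M\<^esub>i\<in>?S. x i \<odot>\<^bsub>M\<^esub> g i \<oplus>\<^bsub>M\<^esub> y i \<odot>\<^bsub>M\<^esub> g i)"
      using S fi[OF x] fi[OF y] gi by (intro M.finsum_cong') (auto simp: smult_l_distr subset_iff)
    also have "\<dots> = (\<Oplus>\<^bsub>M\<^esub>i\<in>?S. x i \<odot>\<^bsub>M\<^esub> g i) \<oplus>\<^bsub>M\<^esub> (\<Oplus>\<^bsub>M\<^esub>i\<in>?S. y i \<odot>\<^bsub>M\<^esub> g i)"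
      using S fi[OF x] fi[OF y] gi by (intro M.finsum_addf) (auto simp: subset_iff)
    finally show "linear_extension R M g (x \<oplus>\<^bsub>free_module R I\<^esub> y) = linear_extension R M g x \<oplus>\<^bsub>M\<^esub> linear_extension R M g y"
      using linext_on[OF x g S(1) _ S(2)] linext_on[OF y g S(1) _ S(2)] by auto
  next
    fix a x assume a: "a \<in> carrier R" and x: "x \<in> carrier (free_module R I)"
    let ?S = "{i. x i \<noteq> \<zero>}"
    have S: "finite ?S" "?S \<subseteq> I" using supp x by auto
    have xy: "a \<odot>\<^bsub>free_module R I\<^esub> x \<in> carrier (free_module R I)" using x a by simp
    have "linear_extension R M g (a \<odot>\<^bsub>free_module R I\<^esub> x) = (\<Oplus>\<^bsub>M\<^esub>i\<in>?S. (a \<otimes> x i) \<odot>\<^bsub>M\<^esub> g i)"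
      by (subst linext_on[OF xy g S(1) _ S(2)]) (auto simp: free_module_def a)
    also have "\<dots> = (\<Oplus>\<^bsub>M\<^esub>i\<in>?S. a \<odot>\<^bsub>M\<^esub> (x i \<odot>\<^bsub>M\<^esub> g i))"
      using S fi[OF x] gi a by (intro M.finsum_cong') (auto simp: smult_assoc1 subset_iff)
    also have "\<dots> = a \<odot>\<^bsub>M\<^esub> (\<Oplus>\<^bsub>M\<^esub>i\<in>?S. x i \<odot>\<^bsub>M\<^esub> g i)"
      using S fi[OF x] gi a by (intro finsum_smult[symmetric]) (auto simp: subset_iff)
    finally show "linear_extension R M g (a \<odot>\<^bsub>free_module R I\<^esub> x) = a \<odot>\<^bsub>M\<^esub> linear_extension R M g x"
      by (simp add: linear_extension_def)
  qed
qed

lemma (in left_module) bv_in: "i \<in> I \<Longrightarrow> basis_vector R i \<in> carrier (free_module R I)"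
  by (auto simp: basis_vector_def free_module_def)

lemma (in left_module) linext_bv:
  assumes i: "i \<in> I" and g: "g \<in> I \<rightarrow> carrier M"
  shows "linear_extension R M g (basis_vector R i) = g i"
proof -
  have gi: "g i \<in> carrier M" using assms by auto
  have "linear_extension R M g (basis_vector R i) = (\<Oplus>\<^bsub>M\<^esub>j\<in>{i}. basis_vector R i j \<odot>\<^bsub>M\<^esub> g j)"
    by (rule linext_on[OF bv_in[OF i] g]) (auto simp: basis_vector_def i)
  also have "\<dots> = g i" by (simp add: basis_vector_def gi)
  finally show ?thesis .
qed

lemma cell_sum_simps:
  "cell_sum A [] = \<zero>\<^bsub>free_module A UNIV\<^esub>"
  "cell_sum A ((a,c)#xs) = a \<odot>\<^bsub>free_module A UNIV\<^esub> basis_vector A c \<oplus>\<^bsub>free_module A UNIV\<^esub> cell_sum A xs"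
  by (simp_all add: cell_sum_def)

lemma free_ops: "\<zero>\<^bsub>free_module A I\<^esub> = \<zero>\<^bsub>free_module A J\<^esub>" "add (free_module A I) = add (free_module A J)"
  "smult (free_module A I) = smult (free_module A J)"
  by (simp_all add: free_module_def)

lemma cell_sum_in:
  assumes "ring A" "set xs \<subseteq> carrier A \<times> B"
  shows "cell_sum A xs \<in> carrier (free_module A B)"
proof -
  interpret F: left_module A "free_module A B" by (rule free_left_module) fact
  show ?thesis using assms(2)
  proof (induct xs)
    case Nil then show ?case by (simp add: cell_sum_simps free_ops(1)[of A UNIV B])
  next
    case (Cons x xs)
    obtain a c where x: "x = (a,c)" by force
    then show ?case using Cons F.bv_in[of c B]
      by (simp add: cell_sum_simps free_ops(2)[of A UNIV B] free_ops(3)[of A UNIV B])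
  qed
qed

lemma cell_sum_surj:
  assumes "ring A" "f \<in> carrier (free_module A B)"
  shows "\<exists>xs. set xs \<subseteq> carrier A \<times> B \<and> cell_sum A xs = f"
  using assms(2)
proof (induct "card {i. f i \<noteq> \<zero>\<^bsub>A\<^esub>}" arbitrary: f)
  case 0
  then have "f = (\<lambda>_. \<zero>\<^bsub>A\<^esub>)" by (auto simp: free_module_def)
  then show ?case by (intro exI[of _ "[]"]) (auto simp: cell_sum_simps free_module_def)
next
  case (Suc n)
  interpret A: ring A by fact
  from Suc(2) obtain c where c: "f c \<noteq> \<zero>\<^bsub>A\<^esub>" by fastforce
  have fin: "finite {i. f i \<noteq> \<zero>\<^bsub>A\<^esub>}" using Suc by (auto simp: free_module_def)
  have s: "{i. (f(c := \<zero>\<^bsub>A\<^esub>)) i \<noteq> \<zero>\<^bsub>A\<^esub>} = {i. f i \<noteq> \<zero>\<^bsub>A\<^esub>} - {c}" by auto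
  have cB: "c \<in> B" using Suc c by (auto simp: free_module_def)
  have "f(c := \<zero>\<^bsub>A\<^esub>) \<in> carrier (free_module A B)"
    using Suc(3) unfolding free_module_def by (auto intro: finite_subset[OF _ fin])
  moreover have "n = card {i. (f(c := \<zero>\<^bsub>A\<^esub>)) i \<noteq> \<zero>\<^bsub>A\<^esub>}"
    using s Suc(2) c fin by simp
  ultimately obtain xs where xs: "set xs \<subseteq> carrier A \<times> B" "cell_sum A xs = f(c := \<zero>\<^bsub>A\<^esub>)"
    using Suc(1) by blast
  have fi: "f i \<in> carrier A" for i using Suc(3) by (cases "i \<in> B") (auto simp: free_module_def)
  have "cell_sum A ((f c, c) # xs) = f"
    using fi by (auto simp: cell_sum_simps xs free_module_def basis_vector_def)
  then show ?case using xs cB fi by (intro exI[of _ "(f c, c) # xs"]) auto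
qed

lemma lin_mono:
  assumes "g \<in> lin_maps A (free_module A I) (free_module A UNIV)"
     "g ` carrier (free_module A I) \<subseteq> carrier (free_module A J)"
  shows "g \<in> lin_maps A (free_module A I) (free_module A J)"
proof -
  have "g x \<in> carrier (free_module A J)" if "x \<in> carrier (free_module A I)" for x
    using assms(2) that by blast
  then show ?thesis using assms(1) unfolding lin_maps_def
    unfolding free_ops(2)[of A UNIV J] free_ops(3)[of A UNIV J] by blast
qed

lemma free_carrier_val:
  assumes "ring A" "f \<in> carrier (free_module A I)" shows "f i \<in> carrier A"
proof -
  interpret A: ring A by fact
  show ?thesis using assms(2) by (cases "i \<in> I") (simp_all add: free_module_def)
qed

lemma free_carrierI:
  assumes "\<And>i. i \<in> I \<Longrightarrow> f i \<in> carrier A" "\<And>i. i \<notin> I \<Longrightarrow> f i = \<zero>\<^bsub>A\<^esub>" "finite {i. f i \<noteq> \<zero>\<^bsub>A\<^esub>}"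
  shows "f \<in> carrier (free_module A I)"
  using assms by (simp add: free_module_def)

lemma free_projective:
  fixes A :: "('a, 'z) ring_scheme" and I :: "'b set"
  assumes "ring A" shows "projective A (free_module A I)"
proof -
  interpret A: ring A by fact
  interpret I: left_module A "free_module A I" by (rule free_left_module) fact
  show ?thesis
  proof (cases "\<one>\<^bsub>A\<^esub> = \<zero>\<^bsub>A\<^esub>")
    case True
    then have z: "\<And>x. x \<in> carrier A \<Longrightarrow> x = \<zero>\<^bsub>A\<^esub>" using A.one_zeroD by blast
    have ci: "f = (\<lambda>_. \<zero>\<^bsub>A\<^esub>)" if "f \<in> carrier (free_module A I)" for f
      using z[OF free_carrier_val[OF assms that]] by (rule ext)
    have 1: "(\<lambda>_ _. \<zero>\<^bsub>A\<^esub>) \<in> lin_maps A (free_module A J) (free_module A J')" for J :: "'q set" and J' :: "'r set"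
      unfolding lin_maps_def by (simp add: free_module_def)
    have 2: "\<forall>x\<in>carrier (free_module A I). (\<lambda>_ _. \<zero>\<^bsub>A\<^esub>) ((\<lambda>_ _. \<zero>\<^bsub>A\<^esub>) x) = x" using ci by simp
    show ?thesis unfolding projective_def
      apply (rule conjI[OF I.left_module_axioms])
      apply (rule exI[of _ "{}"])
      apply (rule bexI[of _ "\<lambda>_ _. \<zero>\<^bsub>A\<^esub>", OF _ 1])
      apply (rule bexI[of _ "\<lambda>_ _. \<zero>\<^bsub>A\<^esub>", OF _ 1])
      by (rule 2)
  next
    case False
    define J where "J = basis_vector A ` I"
    have inj: "inj_on (basis_vector A) I"
    proof (rule inj_onI)
      fix i j assume "basis_vector A i = basis_vector A j"
      then have "basis_vector A i i = basis_vector A j i" by simp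
      then show "i = j" using False by (simp add: basis_vector_def split: if_splits)
    qed
    define s where "s f = (\<lambda>v. if v \<in> J then f (the_inv_into I (basis_vector A) v) else \<zero>\<^bsub>A\<^esub>)" for f :: "'b \<Rightarrow> 'a"
    define r where "r F = (\<lambda>i. if i \<in> I then F (basis_vector A i) else \<zero>\<^bsub>A\<^esub>)" for F :: "('b \<Rightarrow> 'a) \<Rightarrow> 'a"
    have inv: "the_inv_into I (basis_vector A) (basis_vector A i) = i" if "i \<in> I" for i
      using inj that by (rule the_inv_into_f_f)
    have s_in: "s f \<in> carrier (free_module A J)" if f: "f \<in> carrier (free_module A I)" for f
    proof (rule free_carrierI)
      show "v \<in> J \<Longrightarrow> s f v \<in> carrier A" for v using free_carrier_val[OF assms f] by (simp add: s_def)
      show "v \<notin> J \<Longrightarrow> s f v = \<zero>\<^bsub>A\<^esub>" for v by (simp add: s_def)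
      have "finite {i. f i \<noteq> \<zero>\<^bsub>A\<^esub>}" using f by (simp add: free_module_def)
      then have "finite (basis_vector A ` {i. f i \<noteq> \<zero>\<^bsub>A\<^esub>})" by simp
      moreover have "{v. s f v \<noteq> \<zero>\<^bsub>A\<^esub>} \<subseteq> basis_vector A ` {i. f i \<noteq> \<zero>\<^bsub>A\<^esub>}"
      proof
        fix v assume "v \<in> {v. s f v \<noteq> \<zero>\<^bsub>A\<^esub>}"
        then have v: "s f v \<noteq> \<zero>\<^bsub>A\<^esub>" by simp
        then have "v \<in> J" unfolding s_def by metis
        then obtain i where "i \<in> I" "v = basis_vector A i" by (auto simp: J_def)
        then show "v \<in> basis_vector A ` {i. f i \<noteq> \<zero>\<^bsub>A\<^esub>}" using v inv by (simp add: s_def J_def)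
      qed
      ultimately show "finite {v. s f v \<noteq> \<zero>\<^bsub>A\<^esub>}" by (rule rev_finite_subset)
    qed
    have r_in: "r F \<in> carrier (free_module A I)" if F: "F \<in> carrier (free_module A J)" for F
    proof (rule free_carrierI)
      show "i \<in> I \<Longrightarrow> r F i \<in> carrier A" for i using free_carrier_val[OF assms F] by (simp add: r_def)
      show "i \<notin> I \<Longrightarrow> r F i = \<zero>\<^bsub>A\<^esub>" for i by (simp add: r_def)
      have fin: "finite {v. F v \<noteq> \<zero>\<^bsub>A\<^esub>}" using F by (simp add: free_module_def)
      have sub: "{i. r F i \<noteq> \<zero>\<^bsub>A\<^esub>} \<subseteq> I" by (auto simp: r_def)
      show "finite {i. r F i \<noteq> \<zero>\<^bsub>A\<^esub>}"
      proof (rule inj_on_finite[OF inj_on_subset[OF inj sub] _ fin])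
        show "basis_vector A ` {i. r F i \<noteq> \<zero>\<^bsub>A\<^esub>} \<subseteq> {v. F v \<noteq> \<zero>\<^bsub>A\<^esub>}"
          unfolding r_def by (simp add: image_subset_iff)
      qed
    qed
    have 1: "s \<in> lin_maps A (free_module A I) (free_module A J)"
      unfolding lin_maps_def using s_in by (simp add: Pi_def) (simp add: free_module_def s_def fun_eq_iff)
    have 2: "r \<in> lin_maps A (free_module A J) (free_module A I)"
      unfolding lin_maps_def using r_in by (simp add: Pi_def) (simp add: free_module_def r_def fun_eq_iff)
    have 3: "r (s f) = f" if "f \<in> carrier (free_module A I)" for f
    proof
      fix i show "r (s f) i = f i"
        using that inv by (cases "i \<in> I") (simp_all add: r_def s_def J_def free_module_def)
    qed
    show ?thesis unfolding projective_def
      apply (rule conjI[OF I.left_module_axioms])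
      apply (rule exI[of _ J])
      apply (rule bexI[OF _ 1])
      apply (rule bexI[OF _ 2])
      by (rule ballI) (rule 3)
  qed
qed

theorem std_resolution:
  fixes A :: "('a, 'z) ring_scheme" and N :: "('a, 'b, 'y) module_scheme"
  assumes "left_module A N"
  shows "projective_resolution A N (std_res A N) (\<lambda>_. std_diff A) (std_aug A N)"
proof -
  interpret N: left_module A N by fact
  have A: "ring A" by (rule N.R.ring_axioms)
  define P where "P n = free_module A (std_basis A N n)" for n
  have P: "std_res A N i = (if i < 0 then free_module A {} else P (nat i))" for i
    by (simp add: std_res_def P_def)
  interpret F: left_module A "free_module A UNIV" by (rule free_left_module) fact
  define bd where "bd = (\<lambda>c :: ('a,'b) cell. case c of Gen x \<Rightarrow> \<zero>\<^bsub>free_module A UNIV\<^esub> | Syz xs \<Rightarrow> cell_sum A xs)"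
  have sd: "std_diff A = linear_extension A (free_module A UNIV) bd" by (simp add: std_diff_def bd_def)
  have sub: "carrier (P n) \<subseteq> carrier (free_module A UNIV)" for n
    proof
    fix f assume "f \<in> carrier (P n)"
    then show "f \<in> carrier (free_module A UNIV)"
      using free_carrier_val[OF A, of f "std_basis A N n"] unfolding P_def by (intro free_carrierI) (auto simp: free_module_def)
  qed
  have bd_in: "bd c \<in> carrier (P (n - 1))" if "c \<in> std_basis A N n" for c n
  proof (cases n)
    case 0 then show ?thesis using that by (auto simp: bd_def P_def free_module_def)
  next
    case (Suc m) then show ?thesis using that by (auto simp: bd_def P_def intro!: cell_sum_in[OF A])
  qed
  have bdU: "bd \<in> std_basis A N n \<rightarrow> carrier (free_module A UNIV)" for n
    using bd_in sub by blast
  have d_ext: "std_diff A \<in> lin_maps A (P n) (free_module A UNIV)" for n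
    unfolding P_def sd by (rule F.linext_lin[OF bdU])
  have d_eqn: "std_diff A f = linear_extension A (P (n-1)) bd f" if "f \<in> carrier (P n)" for f n
  proof -
    interpret Q: left_module A "P (n-1)" unfolding P_def by (rule free_left_module) fact
    have f: "finite {i. f i \<noteq> \<zero>\<^bsub>A\<^esub>}" "{i. f i \<noteq> \<zero>\<^bsub>A\<^esub>} \<subseteq> std_basis A N n" "\<And>i. i \<in> std_basis A N n \<Longrightarrow> f i \<in> carrier A"
      using that by (auto simp: P_def free_module_def)
    have "finsum (free_module A UNIV) (\<lambda>i. f i \<odot>\<^bsub>P (n-1)\<^esub> bd i) S = finsum (P (n-1)) (\<lambda>i. f i \<odot>\<^bsub>P (n-1)\<^esub> bd i) S"
      if "finite S" "S \<subseteq> std_basis A N n" for S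
      using that
    proof (induct S)
      case empty show ?case unfolding F.M.finsum_empty Q.M.finsum_empty unfolding P_def by (rule free_ops(1))
    next
      case (insert x S)
      have m: "(\<lambda>i. f i \<odot>\<^bsub>P (n-1)\<^esub> bd i) \<in> S \<rightarrow> carrier (P (n-1))" "f x \<odot>\<^bsub>P (n-1)\<^esub> bd x \<in> carrier (P (n-1))"
        using insert f bd_in[of _ n] by (auto simp del: One_nat_def intro!: Q.smult_closed)
      show ?case
      proof -
        have "finsum (free_module A UNIV) (\<lambda>i. f i \<odot>\<^bsub>P (n-1)\<^esub> bd i) (insert x S)
          = f x \<odot>\<^bsub>P (n-1)\<^esub> bd x \<oplus>\<^bsub>free_module A UNIV\<^esub> finsum (free_module A UNIV) (\<lambda>i. f i \<odot>\<^bsub>P (n-1)\<^esub> bd i) S"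
          by (rule F.M.finsum_insert) (use insert m sub[of "n-1"] in \<open>auto simp del: One_nat_def\<close>)
        moreover have "finsum (P (n-1)) (\<lambda>i. f i \<odot>\<^bsub>P (n-1)\<^esub> bd i) (insert x S)
          = f x \<odot>\<^bsub>P (n-1)\<^esub> bd x \<oplus>\<^bsub>P (n-1)\<^esub> finsum (P (n-1)) (\<lambda>i. f i \<odot>\<^bsub>P (n-1)\<^esub> bd i) S"
          by (rule Q.M.finsum_insert) (use insert m in \<open>auto simp del: One_nat_def\<close>)
        moreover have "add (free_module A UNIV) = add (P (n-1))" unfolding P_def by (rule free_ops(2))
        ultimately show ?thesis using insert by (simp del: One_nat_def)
      qed
    qed
    then show ?thesis unfolding sd linear_extension_def
      using f unfolding P_def free_ops(3)[of A UNIV "std_basis A N (n-1)"] by (simp del: One_nat_def)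
  qed
  have d_lin: "std_diff A \<in> lin_maps A (P n) (P (n - 1))" for n
    unfolding P_def
  proof (rule lin_mono)
    show "std_diff A \<in> lin_maps A (free_module A (std_basis A N n)) (free_module A UNIV)"
      using d_ext[of n] by (simp add: P_def)
    interpret Q: left_module A "P (n-1)" unfolding P_def by (rule free_left_module) fact
    have "linear_extension A (P (n-1)) bd \<in> lin_maps A (P n) (P (n-1))"
      using Q.linext_lin[of bd "std_basis A N n"] bd_in by (auto simp: P_def)
    then show "std_diff A ` carrier (free_module A (std_basis A N n)) \<subseteq> carrier (free_module A (std_basis A N (n - 1)))"
      using d_eqn[of _ n] by (auto simp: P_def lin_maps_def Pi_iff)
  qed
  define ev where "ev = (\<lambda>c :: ('a,'b) cell. case c of Gen x \<Rightarrow> x | Syz xs \<Rightarrow> \<zero>\<^bsub>N\<^esub>)"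
  have sa: "std_aug A N = linear_extension A N ev" by (simp add: std_aug_def ev_def)
  have ev: "ev \<in> std_basis A N 0 \<rightarrow> carrier N" by (auto simp: ev_def)
  have e_lin: "std_aug A N \<in> lin_maps A (P 0) N"
    unfolding sa P_def by (rule N.linext_lin[OF ev])
  have d_bv: "std_diff A (basis_vector A c) = bd c" if "c \<in> std_basis A N n" for c n
    unfolding sd by (rule F.linext_bv[OF that bdU])
  have e_surj: "std_aug A N ` carrier (P 0) = carrier N"
  proof
    show "std_aug A N ` carrier (P 0) \<subseteq> carrier N" using e_lin by (auto simp: lin_maps_def)
    show "carrier N \<subseteq> std_aug A N ` carrier (P 0)"
    proof
      fix x assume x: "x \<in> carrier N"
      have "std_aug A N (basis_vector A (Gen x)) = x"
        unfolding sa using N.linext_bv[OF _ ev, of "Gen x"] x by (simp add: ev_def)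
      moreover have "basis_vector A (Gen x) \<in> carrier (P 0)"
        unfolding P_def by (rule N.bv_in) (use x in auto)
      ultimately show "x \<in> std_aug A N ` carrier (P 0)" by force
    qed
  qed
  have exact: "{f \<in> carrier (P n). q f = \<zero>\<^bsub>Q\<^esub>} = std_diff A ` carrier (P (Suc n))"
    if q: "q \<in> lin_maps A (P n) Q" and Q: "left_module A Q"
      and b: "std_basis A N (Suc n) = Syz ` {xs. set xs \<subseteq> carrier A \<times> std_basis A N n \<and> q (cell_sum A xs) = \<zero>\<^bsub>Q\<^esub>}"
    for q and Q :: "('a, 'x, 'w) module_scheme" and n
  proof -
    interpret Q: left_module A Q by fact
    interpret PS: left_module A "P (Suc n)" unfolding P_def by (rule free_left_module) fact
    interpret Pn: left_module A "P n" unfolding P_def by (rule free_left_module) fact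
    have dl: "std_diff A \<in> lin_maps A (P (Suc n)) (P n)" using d_lin[of "Suc n"] by simp
    show ?thesis
    proof (intro equalityI subsetI)
      fix f assume "f \<in> {f \<in> carrier (P n). q f = \<zero>\<^bsub>Q\<^esub>}"
      then have f: "f \<in> carrier (P n)" "q f = \<zero>\<^bsub>Q\<^esub>" by auto
      obtain xs where xs: "set xs \<subseteq> carrier A \<times> std_basis A N n" "cell_sum A xs = f"
        using cell_sum_surj[OF A] f(1) unfolding P_def by blast
      then have c: "Syz xs \<in> std_basis A N (Suc n)" using b f by auto
      have "std_diff A (basis_vector A (Syz xs)) = f" using d_bv[OF c] xs by (simp add: bd_def)
      moreover have "basis_vector A (Syz xs) \<in> carrier (P (Suc n))" unfolding P_def by (rule N.bv_in[OF c])
      ultimately show "f \<in> std_diff A ` carrier (P (Suc n))" by blast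
    next
      fix y assume "y \<in> std_diff A ` carrier (P (Suc n))"
      then obtain f where f: "f \<in> carrier (P (Suc n))" "y = std_diff A f" by auto
      have y: "y \<in> carrier (P n)" using dl f by (auto simp: lin_maps_def)
      obtain xs where xs: "set xs \<subseteq> carrier A \<times> std_basis A N (Suc n)" "cell_sum A xs = f"
        using cell_sum_surj[OF A] f(1) unfolding P_def by blast
      have zz: "g \<zero>\<^bsub>U\<^esub> = \<zero>\<^bsub>V\<^esub>" if "g \<in> lin_maps A U V" "left_module A U" "left_module A V"
        for g and U :: "('a,'u,'u1) module_scheme" and V :: "('a,'v,'v1) module_scheme"
      proof -
        interpret U: left_module A U by fact
        interpret V: left_module A V by fact
        have "g (\<zero>\<^bsub>U\<^esub> \<oplus>\<^bsub>U\<^esub> \<zero>\<^bsub>U\<^esub>) = g \<zero>\<^bsub>U\<^esub> \<oplus>\<^bsub>V\<^esub> g \<zero>\<^bsub>U\<^esub>" "g \<zero>\<^bsub>U\<^esub> \<in> carrier V"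
          using that(1) U.M.zero_closed unfolding lin_maps_def by blast+
        then show ?thesis by simp
      qed
      have "q (std_diff A (cell_sum A xs)) = \<zero>\<^bsub>Q\<^esub>" using xs(1)
      proof (induct xs)
        case Nil
        have "std_diff A \<zero>\<^bsub>P (Suc n)\<^esub> = \<zero>\<^bsub>P n\<^esub>" by (rule zz[OF dl PS.left_module_axioms Pn.left_module_axioms])
        moreover have "q \<zero>\<^bsub>P n\<^esub> = \<zero>\<^bsub>Q\<^esub>" by (rule zz[OF q Pn.left_module_axioms Q])
        ultimately show ?case by (simp add: cell_sum_simps P_def free_ops(1)[of A UNIV "std_basis A N (Suc n)"])
      next
        case (Cons x xs)
        obtain a c where x: "x = (a,c)" by force
        have a: "a \<in> carrier A" and c: "c \<in> std_basis A N (Suc n)" using Cons x by auto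
        have b1: "basis_vector A c \<in> carrier (P (Suc n))" unfolding P_def by (rule N.bv_in[OF c])
        have c1: "cell_sum A xs \<in> carrier (P (Suc n))" unfolding P_def by (rule cell_sum_in[OF A]) (use Cons in auto)
        have "cell_sum A (x # xs) = a \<odot>\<^bsub>P (Suc n)\<^esub> basis_vector A c \<oplus>\<^bsub>P (Suc n)\<^esub> cell_sum A xs"
          unfolding x cell_sum_simps P_def by (simp only: free_ops(2)[of A UNIV "std_basis A N (Suc n)"] free_ops(3)[of A UNIV "std_basis A N (Suc n)"])
        then have "std_diff A (cell_sum A (x # xs)) = a \<odot>\<^bsub>P n\<^esub> std_diff A (basis_vector A c) \<oplus>\<^bsub>P n\<^esub> std_diff A (cell_sum A xs)"
          using dl a b1 c1 PS.smult_closed by (simp add: lin_maps_def)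
        moreover have m: "std_diff A (basis_vector A c) \<in> carrier (P n)" "std_diff A (cell_sum A xs) \<in> carrier (P n)"
          using dl b1 c1 by (auto simp: lin_maps_def)
        ultimately have "q (std_diff A (cell_sum A (x # xs))) = a \<odot>\<^bsub>Q\<^esub> q (std_diff A (basis_vector A c)) \<oplus>\<^bsub>Q\<^esub> q (std_diff A (cell_sum A xs))"
          using q a Pn.smult_closed by (simp add: lin_maps_def)
        moreover have "q (std_diff A (basis_vector A c)) = \<zero>\<^bsub>Q\<^esub>"
          using d_bv[OF c] c b by (auto simp: bd_def)
        ultimately show ?case using Cons a by (simp add: Q.smult_zero_r)
      qed
      then show "y \<in> {f \<in> carrier (P n). q f = \<zero>\<^bsub>Q\<^esub>}" using y f xs by auto
    qed
  qed
  have ex0: "a_kernel (P 0) N (std_aug A N) = std_diff A ` carrier (P 1)"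
    using exact[OF e_lin N.left_module_axioms] by (simp add: a_kernel_def kernel_def)
  have exS: "a_kernel (P (Suc n)) (P n) (std_diff A) = std_diff A ` carrier (P (Suc (Suc n)))" for n
  proof -
    have "left_module A (P n)" unfolding P_def by (rule free_left_module) fact
    moreover have "std_diff A \<in> lin_maps A (P (Suc n)) (P n)" using d_lin[of "Suc n"] by simp
    ultimately have "{f \<in> carrier (P (Suc n)). std_diff A f = \<zero>\<^bsub>P n\<^esub>} = std_diff A ` carrier (P (Suc (Suc n)))"
      by (intro exact) (auto simp: P_def free_module_def)
    then show ?thesis by (simp add: a_kernel_def kernel_def)
  qed
  have triv: "carrier (free_module A {}) = {\<zero>\<^bsub>free_module A ({} :: ('a,'b) cell set)\<^esub>}"
    by (auto simp: free_module_def)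
  have d0: "std_diff A f = \<zero>\<^bsub>free_module A UNIV\<^esub>" if "f \<in> carrier (P 0)" for f
  proof -
    have "finite {i. f i \<noteq> \<zero>\<^bsub>A\<^esub>}" "{i. f i \<noteq> \<zero>\<^bsub>A\<^esub>} \<subseteq> Gen ` carrier N"
      using that by (auto simp: P_def free_module_def)
    moreover have "f i \<in> carrier A" for i by (rule free_carrier_val[OF A that[unfolded P_def]])
    ultimately have "f i \<odot>\<^bsub>free_module A UNIV\<^esub> bd i = \<zero>\<^bsub>free_module A UNIV\<^esub>" if "i \<in> {i. f i \<noteq> \<zero>\<^bsub>A\<^esub>}" for i
      using that by (force simp: bd_def F.smult_zero_r)
    then show ?thesis unfolding sd linear_extension_def
      by (rule F.M.add.finprod_one_eqI[simplified])
  qed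
  show ?thesis
    unfolding projective_resolution_def
  proof (intro conjI allI impI)
    fix i :: int
    show "projective A (std_res A N i)" by (simp add: std_res_def free_projective[OF A])
    show "i < 0 \<Longrightarrow> carrier (std_res A N i) = {\<zero>\<^bsub>std_res A N i\<^esub>}" by (simp add: P triv)
    show "std_diff A \<in> lin_maps A (std_res A N i) (std_res A N (i - 1))"
    proof (cases "i \<le> 0")
      case True
      have "f \<in> carrier (P 0)" if "f \<in> carrier (std_res A N i)" for f
        using that True triv by (auto simp: P P_def free_module_def split: if_splits)
      then have z: "std_diff A f = \<zero>\<^bsub>free_module A UNIV\<^esub>" if "f \<in> carrier (std_res A N i)" for f
        using that d0 by blast
      have l: "left_module A (std_res A N i)" unfolding std_res_def by (rule free_left_module) fact
      have cl: "x \<oplus>\<^bsub>std_res A N i\<^esub> y \<in> carrier (std_res A N i)" "a \<in> carrier A \<Longrightarrow> a \<odot>\<^bsub>std_res A N i\<^esub> y \<in> carrier (std_res A N i)"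
        if "x \<in> carrier (std_res A N i)" "y \<in> carrier (std_res A N i)" for x y a
        using l that by (auto simp: left_module_def abelian_group_def left_module_axioms_def intro: abelian_monoid.a_closed)
      show ?thesis unfolding lin_maps_def using True z cl
        by (auto simp: P[of "i-1"]) (auto simp: free_module_def)
    next
      case False
      then have "nat (i - 1) = nat i - 1" by simp
      then show ?thesis using False d_lin[of "nat i"] by (simp add: P)
    qed
    show "1 \<le> i \<Longrightarrow> a_kernel (std_res A N i) (std_res A N (i - 1)) (std_diff A) = std_diff A ` carrier (std_res A N (i + 1))"
    proof -
      assume i: "1 \<le> i"
      then have "nat i = Suc (nat (i - 1))" "nat (i+1) = Suc (Suc (nat (i - 1)))" by auto
      then show ?thesis using i exS[of "nat (i - 1)"] by (simp add: P)
    qed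
    show "std_aug A N \<in> lin_maps A (std_res A N 0) N" using e_lin by (simp add: P)
    show "a_kernel (std_res A N 0) N (std_aug A N) = std_diff A ` carrier (std_res A N 1)"
      using ex0 by (simp add: P)
    show "std_aug A N ` carrier (std_res A N 0) = carrier N" using e_surj by (simp add: P)
  qed
qed

end

theory Submission
  imports Defs
begin

text \<open>
  Since \<open>A\<^sub>0\<close> is noetherian and \<open>A\<^sub>h\<close> is \<open>h\<close>-torsion free, complete and separated, \<open>K\<close> has a resolution \<open>F\<close>
  by finitely generated free \<open>A\<^sub>h\<close>-modules, and \<open>F/hF\<close> is a free resolution of \<open>k\<close> over \<open>A\<^sub>0\<close>. If \<open>i \<noteq> d\<close>,
  a cocycle of \<open>Hom(F, A\<^sub>h)\<close> in degree \<open>i\<close> is a coboundary modulo \<open>h\<close>, hence a coboundary by successive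
  approximation; as each \<open>F\<^sub>p\<close> is finitely generated, the same follows for \<open>Hom(F, T)\<close> with \<open>T\<close> free.

  Now let \<open>T\<close> be a free resolution of \<open>M\<close> and consider the double complex \<open>Hom(F\<^sub>p, T\<^sub>q)\<close>. Its columns
  resolve \<open>Hom(F\<^sub>p, M)\<close>, and its rows are exact outside \<open>p = d\<close>, where their cohomology is \<open>\<Omega> \<otimes> T\<^sub>q\<close>.
  A diagram chase along the diagonal from \<open>(i, 0)\<close> to \<open>(d, d - i)\<close> therefore identifies \<open>Ext\<^sup>i(K, M)\<close>
  with \<open>Tor\<^sub>d\<^sub>-\<^sub>i(\<Omega>, M)\<close>. The finite projective dimension of \<open>K\<close> is what makes the chase work for
  \<open>p \<ge> d\<close>: there it needs boundaries of the rows with values in the image of \<open>T\<^sub>q\<^sub>+\<^sub>1\<close> to lift, which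
  holds for large \<open>p\<close> and descends.
\<close>


section \<open>Abelian groups with operators and their subquotients\<close>

text \<open>The obstacle is that no single resolution of \<open>K\<close> has all the properties
  needed. The standard one, in which the Ext groups of the statement are formed, is free on huge
  sets; the one given by finite projective dimension need not be finitely generated; and
  \<open>F\<close> is finitely generated but possibly infinite. All computations are therefore made
  with \<open>F\<close>, and the other two resolutions reach it only through the comparison of Hom
  cohomology. In particular finite projective dimension survives only as this statement: for large
  \<open>p\<close>, every \<open>p\<close>-cocycle on \<open>F\<close> with values in a module
  \<open>X\<close> is a coboundary. It is applied with \<open>X\<close> the image I_q of T_(q+1) in
  T_q. Such a module need not be free, so the exactness of the rows says nothing about it directly.
  The descent from large \<open>p\<close> to every \<open>p > d\<close> is dimension shifting along
  0 -> I_(q+1) -> T_(q+1) -> I_q -> 0, which trades one degree of \<open>p\<close> for one of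
  \<open>q\<close>. For \<open>i > d\<close> the same vanishing shows that Hom(F, M) has no
  cohomology, as Tor in negative degree demands.\<close>

locale op_group = abelian_group C
  for S :: "('s, 'z) ring_scheme" and C :: "('s, 'c, 'y) module_scheme" (structure) +
  assumes op_closed [simp, intro]: "\<lbrakk>s \<in> carrier S; x \<in> carrier C\<rbrakk> \<Longrightarrow> s \<odot> x \<in> carrier C"
    and op_add: "\<lbrakk>s \<in> carrier S; x \<in> carrier C; y \<in> carrier C\<rbrakk> \<Longrightarrow> s \<odot> (x \<oplus> y) = s \<odot> x \<oplus> s \<odot> y"

text \<open>\<open>op_group\<close> asks only that each scalar acts additively and imposes no ring
  axiom on \<open>S\<close>. One theory of subquotients thus serves left modules over
  \<open>A\<close>, right modules (scalars in \<open>opposite A\<close>), and Hom and tensor groups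
  with scalars in the base ring.\<close>

lemma left_module_op_group: "left_module R M \<Longrightarrow> op_group R M"
  by (simp add: left_module_def left_module_axioms_def op_group_def op_group_axioms_def)

lemma (in op_group) op_zero: "s \<in> carrier S \<Longrightarrow> s \<odot> \<zero> = \<zero>"
  by (metis add.r_cancel_one l_zero zero_closed op_closed op_add)

text \<open>Negation is listed among the closure conditions because an arbitrary operator domain
  \<open>S\<close> need not contain an element acting as -1.\<close>

definition op_sub :: "('s, 'z) ring_scheme \<Rightarrow> ('s, 'c, 'y) module_scheme \<Rightarrow> 'c set \<Rightarrow> bool" where
  "op_sub S C B \<longleftrightarrow> B \<subseteq> carrier C \<and> \<zero>\<^bsub>C\<^esub> \<in> B \<and> (\<forall>x\<in>B. \<forall>y\<in>B. x \<oplus>\<^bsub>C\<^esub> y \<in> B) \<and>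
     (\<forall>x\<in>B. \<ominus>\<^bsub>C\<^esub> x \<in> B) \<and> (\<forall>s\<in>carrier S. \<forall>x\<in>B. s \<odot>\<^bsub>C\<^esub> x \<in> B)"

lemma op_subD:
  assumes "op_sub S C B"
  shows "B \<subseteq> carrier C" "\<zero>\<^bsub>C\<^esub> \<in> B" "\<lbrakk>x \<in> B; y \<in> B\<rbrakk> \<Longrightarrow> x \<oplus>\<^bsub>C\<^esub> y \<in> B" "x \<in> B \<Longrightarrow> \<ominus>\<^bsub>C\<^esub> x \<in> B"
    "\<lbrakk>s \<in> carrier S; x \<in> B\<rbrakk> \<Longrightarrow> s \<odot>\<^bsub>C\<^esub> x \<in> B" "\<lbrakk>x \<in> B; y \<in> B\<rbrakk> \<Longrightarrow> x \<ominus>\<^bsub>C\<^esub> y \<in> B"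
  using assms by (auto simp: op_sub_def a_minus_def)

lemma op_sub_mem: "\<lbrakk>op_sub S C B; x \<in> B\<rbrakk> \<Longrightarrow> x \<in> carrier C"
  using op_subD(1) by blast

lemma (in op_group) op_sub_op_group:
  assumes B: "op_sub S C B"
  shows "op_group S (C\<lparr>carrier := B\<rparr>)"
proof (intro op_group.intro abelian_groupI op_group_axioms.intro)
  note m = op_sub_mem[OF B]
  fix x assume x: "x \<in> carrier (C\<lparr>carrier := B\<rparr>)"
  then show "\<exists>y\<in>carrier (C\<lparr>carrier := B\<rparr>). y \<oplus>\<^bsub>C\<lparr>carrier := B\<rparr>\<^esub> x = \<zero>\<^bsub>C\<lparr>carrier := B\<rparr>\<^esub>"
    using op_subD(4)[OF B] m by (intro bexI[of _ "\<ominus> x"]) (auto simp: l_neg)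
qed (use op_subD[OF B] op_sub_mem[OF B] in \<open>auto simp: a_ac op_add\<close>)

lemma (in op_group) a_inv_sub:
  assumes B: "op_sub S C B" and x: "x \<in> B"
  shows "\<ominus>\<^bsub>C\<lparr>carrier := B\<rparr>\<^esub> x = \<ominus> x"
proof -
  interpret B: op_group S "C\<lparr>carrier := B\<rparr>" by (rule op_sub_op_group[OF B])
  have "\<ominus> x \<in> B" "x \<in> carrier C" using op_subD(4)[OF B x] op_sub_mem[OF B x] by auto
  then show ?thesis using B.minus_equality[of "\<ominus> x" x] x by (simp add: l_neg)
qed

lemma (in op_group) op_sub_restrict:
  assumes Z: "op_sub S C Z" and B: "op_sub S C B" and "B \<subseteq> Z"
  shows "op_sub S (C\<lparr>carrier := Z\<rparr>) B"
  using op_subD[OF B] assms a_inv_sub[OF Z] by (auto simp: op_sub_def subset_iff)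

context
  fixes S :: "('s, 'z) ring_scheme" and C :: "('s, 'c, 'y) module_scheme"
    and D :: "('s, 'e, 'x) module_scheme" and f
  assumes C: "op_group S C" and D: "op_group S D" and f: "f \<in> lin_maps S C D"
begin

interpretation C: op_group S C by (rule C)
interpretation D: op_group S D by (rule D)

lemma lin_closed: "x \<in> carrier C \<Longrightarrow> f x \<in> carrier D"
  using f by (auto simp: lin_maps_def)

lemma lin_add: "x \<in> carrier C \<Longrightarrow> y \<in> carrier C \<Longrightarrow> f (x \<oplus>\<^bsub>C\<^esub> y) = f x \<oplus>\<^bsub>D\<^esub> f y"
  using f by (auto simp: lin_maps_def)

lemma lin_smult: "s \<in> carrier S \<Longrightarrow> x \<in> carrier C \<Longrightarrow> f (s \<odot>\<^bsub>C\<^esub> x) = s \<odot>\<^bsub>D\<^esub> f x"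
  using f by (auto simp: lin_maps_def)

lemma lin_zero: "f \<zero>\<^bsub>C\<^esub> = \<zero>\<^bsub>D\<^esub>"
proof -
  have "f \<zero>\<^bsub>C\<^esub> \<oplus>\<^bsub>D\<^esub> f \<zero>\<^bsub>C\<^esub> = f \<zero>\<^bsub>C\<^esub>" using lin_add[of "\<zero>\<^bsub>C\<^esub>" "\<zero>\<^bsub>C\<^esub>"] by simp
  then show ?thesis using lin_closed[of "\<zero>\<^bsub>C\<^esub>"] by simp
qed

lemma lin_neg: "x \<in> carrier C \<Longrightarrow> f (\<ominus>\<^bsub>C\<^esub> x) = \<ominus>\<^bsub>D\<^esub> f x"
  using lin_add[of "\<ominus>\<^bsub>C\<^esub> x" x] lin_closed
  by (intro D.minus_equality[symmetric]) (auto simp: C.l_neg lin_zero)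

lemma lin_minus: "x \<in> carrier C \<Longrightarrow> y \<in> carrier C \<Longrightarrow> f (x \<ominus>\<^bsub>C\<^esub> y) = f x \<ominus>\<^bsub>D\<^esub> f y"
  by (simp add: a_minus_def lin_add lin_neg)

lemma op_sub_image: "op_sub S C B \<Longrightarrow> op_sub S D (f ` B)"
  unfolding op_sub_def using lin_closed
  by (auto simp: subset_iff lin_zero[symmetric])
     (metis imageI lin_add lin_neg lin_smult)+

lemma op_sub_kernel: "op_sub S C (a_kernel C D f)"
  by (auto simp: op_sub_def a_kernel_def' lin_zero lin_add lin_neg lin_smult)
     (metis D.op_zero)

end

lemma (in op_group) op_sub_carrier: "op_sub S C (carrier C)"
  by (auto simp: op_sub_def)

lemma (in op_group) op_sub_Int: "op_sub S C A \<Longrightarrow> op_sub S C B \<Longrightarrow> op_sub S C (A \<inter> B)"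
  by (auto simp: op_sub_def)

lemma (in op_group) op_neg: "s \<in> carrier S \<Longrightarrow> x \<in> carrier C \<Longrightarrow> s \<odot> (\<ominus> x) = \<ominus> (s \<odot> x)"
  by (metis a_inv_closed l_neg minus_equality op_add op_closed op_zero)

lemma (in op_group) minus_add_cancel: "x \<in> carrier C \<Longrightarrow> y \<in> carrier C \<Longrightarrow> (x \<ominus> y) \<oplus> y = x"
  by (simp add: a_minus_def a_assoc l_neg)

lemma (in op_group) add_minus_cancel: "x \<in> carrier C \<Longrightarrow> y \<in> carrier C \<Longrightarrow> (x \<oplus> y) \<ominus> y = x"
  by (simp add: a_minus_def a_assoc r_neg)

lemma (in op_group) minus_self: "x \<in> carrier C \<Longrightarrow> x \<ominus> x = \<zero>"
  by (simp add: a_minus_def r_neg)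

lemma (in op_group) minus_eq_zero: "x \<in> carrier C \<Longrightarrow> y \<in> carrier C \<Longrightarrow> x \<ominus> y = \<zero> \<longleftrightarrow> x = y"
  by (metis l_zero minus_add_cancel minus_self)

section \<open>Cosets and quotients by stable subgroups\<close>

lemma (in op_group) coset_eq_iff:
  assumes B: "op_sub S C B" and x: "x \<in> carrier C" and y: "y \<in> carrier C"
  shows "B +> x = B +> y \<longleftrightarrow> x \<ominus> y \<in> B"
proof
  assume "B +> x = B +> y"
  moreover have "x \<in> B +> x" using op_subD(2)[OF B] x by (force simp: a_r_coset_def')
  ultimately obtain b where "b \<in> B" "x = b \<oplus> y" by (auto simp: a_r_coset_def')
  then show "x \<ominus> y \<in> B" using op_sub_mem[OF B] y by (simp add: add_minus_cancel)
next
  assume m: "x \<ominus> y \<in> B"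
  have *: "B +> u \<subseteq> B +> v" if "u \<ominus> v \<in> B" and uv: "u \<in> carrier C" "v \<in> carrier C" for u v
  proof
    fix z assume "z \<in> B +> u"
    then obtain b where b: "b \<in> B" "z = b \<oplus> u" by (auto simp: a_r_coset_def')
    then have "z = (b \<oplus> (u \<ominus> v)) \<oplus> v" using op_sub_mem[OF B] uv
      by (simp add: a_assoc minus_add_cancel)
    then show "z \<in> B +> v" using op_subD(3)[OF B b(1) that(1)] by (auto simp: a_r_coset_def')
  qed
  have "y \<ominus> x = \<ominus> (x \<ominus> y)" using x y by (simp add: a_minus_def minus_add a_comm)
  then have "y \<ominus> x \<in> B" using op_subD(4)[OF B m] by simp
  then show "B +> x = B +> y" using * m x y by blast
qed

lemma (in op_group) coset_zero: "op_sub S C B \<Longrightarrow> B +> \<zero> = B"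
  using op_sub_mem[of S C B] by (auto simp: a_r_coset_def')

lemma (in op_group) coset_add:
  assumes B: "op_sub S C B" and x: "x \<in> carrier C" and y: "y \<in> carrier C"
  shows "set_add C (B +> x) (B +> y) = B +> (x \<oplus> y)"
proof (intro equalityI subsetI)
  fix z assume "z \<in> set_add C (B +> x) (B +> y)"
  then obtain b c where b: "b \<in> B" "c \<in> B" "z = (b \<oplus> x) \<oplus> (c \<oplus> y)"
    by (auto simp: a_r_coset_def' set_add_def' )
  then have "z = (b \<oplus> c) \<oplus> (x \<oplus> y)" using op_sub_mem[OF B] x y by (simp add: a_ac)
  then show "z \<in> B +> (x \<oplus> y)" using op_subD(3)[OF B b(1,2)] by (auto simp: a_r_coset_def')
next
  fix z assume "z \<in> B +> (x \<oplus> y)"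
  then obtain b where b: "b \<in> B" "z = b \<oplus> (x \<oplus> y)" by (auto simp: a_r_coset_def')
  then have "z = (b \<oplus> x) \<oplus> (\<zero> \<oplus> y)" using op_sub_mem[OF B] x y by (simp add: a_ac)
  then show "z \<in> set_add C (B +> x) (B +> y)" using b(1) op_subD(2)[OF B]
    unfolding a_r_coset_def' set_add_def' by blast
qed

text \<open>The scalar action of \<open>quotient_module\<close> is a union over all representatives
  of a coset. It collapses because two representatives differ by an element of \<open>B\<close>, and
  \<open>B\<close> is stable under \<open>s\<close>.\<close>

lemma (in op_group) coset_smult:
  assumes B: "op_sub S C B" and x: "x \<in> carrier C" and s: "s \<in> carrier S"
  shows "(\<Union>y\<in>B +> x. B +> (s \<odot> y)) = B +> (s \<odot> x)"
proof -
  have "B +> (s \<odot> y) = B +> (s \<odot> x)" if "y \<in> B +> x" for y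
  proof -
    from that obtain b where b: "b \<in> B" "y = b \<oplus> x" unfolding a_r_coset_def' by blast
    then have "s \<odot> y \<ominus> s \<odot> x = s \<odot> b" using op_sub_mem[OF B] x s
      by (simp add: op_add add_minus_cancel)
    then show ?thesis using b op_sub_mem[OF B] x s op_subD(5)[OF B s b(1)] by (subst coset_eq_iff[OF B]) auto
  qed
  moreover have "x \<in> B +> x" using op_subD(2)[OF B] x by (force simp: a_r_coset_def')
  ultimately show ?thesis by blast
qed

lemma carrier_quotient: "carrier (quotient_module C B) = (\<lambda>x. B +>\<^bsub>C\<^esub> x) ` carrier C"
  by (auto simp: quotient_module_def A_RCOSETS_def')

lemma zero_quotient: "\<zero>\<^bsub>quotient_module C B\<^esub> = B"
  by (simp add: quotient_module_def)

context op_group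
begin

lemma add_quotient:
  assumes "op_sub S C B" "x \<in> carrier C" "y \<in> carrier C"
  shows "(B +> x) \<oplus>\<^bsub>quotient_module C B\<^esub> (B +> y) = B +> (x \<oplus> y)"
  using coset_add[OF assms] by (simp add: quotient_module_def)

lemma smult_quotient:
  assumes "op_sub S C B" "x \<in> carrier C" "s \<in> carrier S"
  shows "s \<odot>\<^bsub>quotient_module C B\<^esub> (B +> x) = B +> (s \<odot> x)"
  using coset_smult[OF assms] by (simp add: quotient_module_def)

lemma op_group_quotient:
  assumes B: "op_sub S C B"
  shows "op_group S (quotient_module C B)"
proof (intro op_group.intro abelian_groupI op_group_axioms.intro)
  show "\<zero>\<^bsub>quotient_module C B\<^esub> \<in> carrier (quotient_module C B)"
    unfolding carrier_quotient zero_quotient using coset_zero[OF B] by blast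
  fix x assume x: "x \<in> carrier (quotient_module C B)"
  then obtain x' where x': "x' \<in> carrier C" "x = B +> x'" by (auto simp: carrier_quotient)
  show "\<exists>y\<in>carrier (quotient_module C B). y \<oplus>\<^bsub>quotient_module C B\<^esub> x = \<zero>\<^bsub>quotient_module C B\<^esub>"
    using x' by (intro bexI[of _ "B +> (\<ominus> x')"])
      (auto simp: carrier_quotient add_quotient[OF B] l_neg coset_zero[OF B] zero_quotient)
  show "\<zero>\<^bsub>quotient_module C B\<^esub> \<oplus>\<^bsub>quotient_module C B\<^esub> x = x"
    using add_quotient[OF B zero_closed x'(1)] x' by (simp add: zero_quotient coset_zero[OF B])
qed (auto simp: carrier_quotient add_quotient[OF B] smult_quotient[OF B] a_ac op_add)

end

text \<open>
  An isomorphism of subquotients \<open>Z/B \<cong> Z'/B'\<close> given by a linear relation between representatives, so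
  that the choices made in a diagram chase need not be shown to be coherent.
\<close>

definition sq_iso ::
  "('s, 'z) ring_scheme \<Rightarrow> ('s, 'c, 'y) module_scheme \<Rightarrow> 'c set \<Rightarrow> 'c set \<Rightarrow>
    ('s, 'e, 'x) module_scheme \<Rightarrow> 'e set \<Rightarrow> 'e set \<Rightarrow> bool" where
  "sq_iso S C Z B C' Z' B' \<longleftrightarrow> (\<exists>\<rho>. (\<forall>x y. \<rho> x y \<longrightarrow> x \<in> Z \<and> y \<in> Z') \<and>
     (\<forall>x\<in>Z. \<exists>y. \<rho> x y) \<and> (\<forall>y\<in>Z'. \<exists>x. \<rho> x y) \<and>
     (\<forall>x y x' y'. \<rho> x y \<longrightarrow> \<rho> x' y' \<longrightarrow> \<rho> (x \<oplus>\<^bsub>C\<^esub> x') (y \<oplus>\<^bsub>C'\<^esub> y')) \<and>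
     (\<forall>s\<in>carrier S. \<forall>x y. \<rho> x y \<longrightarrow> \<rho> (s \<odot>\<^bsub>C\<^esub> x) (s \<odot>\<^bsub>C'\<^esub> y)) \<and>
     (\<forall>x y. \<rho> x y \<longrightarrow> (x \<in> B \<longleftrightarrow> y \<in> B')))"

lemma sq_isoI:
  assumes "\<And>x y. \<rho> x y \<Longrightarrow> x \<in> Z" "\<And>x y. \<rho> x y \<Longrightarrow> y \<in> Z'"
    "\<And>x. x \<in> Z \<Longrightarrow> \<exists>y. \<rho> x y" "\<And>y. y \<in> Z' \<Longrightarrow> \<exists>x. \<rho> x y"
    "\<And>x y x' y'. \<rho> x y \<Longrightarrow> \<rho> x' y' \<Longrightarrow> \<rho> (x \<oplus>\<^bsub>C\<^esub> x') (y \<oplus>\<^bsub>C'\<^esub> y')"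
    "\<And>s x y. s \<in> carrier S \<Longrightarrow> \<rho> x y \<Longrightarrow> \<rho> (s \<odot>\<^bsub>C\<^esub> x) (s \<odot>\<^bsub>C'\<^esub> y)"
    "\<And>x y. \<rho> x y \<Longrightarrow> x \<in> B \<Longrightarrow> y \<in> B'" "\<And>x y. \<rho> x y \<Longrightarrow> y \<in> B' \<Longrightarrow> x \<in> B"
  shows "sq_iso S C Z B C' Z' B'"
  unfolding sq_iso_def using assms by (intro exI[of _ \<rho>]) blast

lemma sq_iso_sym: "sq_iso S C Z B C' Z' B' \<Longrightarrow> sq_iso S C' Z' B' C Z B"
  unfolding sq_iso_def
proof (elim exE conjE, intro exI conjI)
  fix \<rho> assume r: "\<forall>x y. \<rho> x y \<longrightarrow> x \<in> Z \<and> y \<in> Z'"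
     "\<forall>x\<in>Z. \<exists>y. \<rho> x y" "\<forall>y\<in>Z'. \<exists>x. \<rho> x y"
     "\<forall>x y x' y'. \<rho> x y \<longrightarrow> \<rho> x' y' \<longrightarrow> \<rho> (x \<oplus>\<^bsub>C\<^esub> x') (y \<oplus>\<^bsub>C'\<^esub> y')"
     "\<forall>s\<in>carrier S. \<forall>x y. \<rho> x y \<longrightarrow> \<rho> (s \<odot>\<^bsub>C\<^esub> x) (s \<odot>\<^bsub>C'\<^esub> y)"
     "\<forall>x y. \<rho> x y \<longrightarrow> (x \<in> B \<longleftrightarrow> y \<in> B')"
  let ?r = "\<lambda>y x. \<rho> x y"
  show "\<forall>x y. ?r x y \<longrightarrow> x \<in> Z' \<and> y \<in> Z" using r(1) by simp
  show "\<forall>x\<in>Z'. \<exists>y. ?r x y" "\<forall>y\<in>Z. \<exists>x. ?r x y" using r(2,3) by simp_all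
  show "\<forall>x y x' y'. ?r x y \<longrightarrow> ?r x' y' \<longrightarrow> ?r (x \<oplus>\<^bsub>C'\<^esub> x') (y \<oplus>\<^bsub>C\<^esub> y')" using r(4) by simp
  show "\<forall>s\<in>carrier S. \<forall>x y. ?r x y \<longrightarrow> ?r (s \<odot>\<^bsub>C'\<^esub> x) (s \<odot>\<^bsub>C\<^esub> y)" using r(5) by simp
  show "\<forall>x y. ?r x y \<longrightarrow> (x \<in> B' \<longleftrightarrow> y \<in> B)" using r(6) by simp
qed

lemma sq_iso_trans:
  assumes "sq_iso S C Z B C' Z' B'" "sq_iso S C' Z' B' C'' Z'' B''"
  shows "sq_iso S C Z B C'' Z'' B''"
proof -
  from assms(1) obtain \<rho> where r: "\<forall>x y. \<rho> x y \<longrightarrow> x \<in> Z \<and> y \<in> Z'"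
     "\<forall>x\<in>Z. \<exists>y. \<rho> x y" "\<forall>y\<in>Z'. \<exists>x. \<rho> x y"
     "\<forall>x y x' y'. \<rho> x y \<longrightarrow> \<rho> x' y' \<longrightarrow> \<rho> (x \<oplus>\<^bsub>C\<^esub> x') (y \<oplus>\<^bsub>C'\<^esub> y')"
     "\<forall>s\<in>carrier S. \<forall>x y. \<rho> x y \<longrightarrow> \<rho> (s \<odot>\<^bsub>C\<^esub> x) (s \<odot>\<^bsub>C'\<^esub> y)"
     "\<forall>x y. \<rho> x y \<longrightarrow> (x \<in> B \<longleftrightarrow> y \<in> B')" unfolding sq_iso_def by (elim exE conjE) (rule that; assumption)
  from assms(2) obtain \<sigma> where s: "\<forall>x y. \<sigma> x y \<longrightarrow> x \<in> Z' \<and> y \<in> Z''"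
     "\<forall>x\<in>Z'. \<exists>y. \<sigma> x y" "\<forall>y\<in>Z''. \<exists>x. \<sigma> x y"
     "\<forall>x y x' y'. \<sigma> x y \<longrightarrow> \<sigma> x' y' \<longrightarrow> \<sigma> (x \<oplus>\<^bsub>C'\<^esub> x') (y \<oplus>\<^bsub>C''\<^esub> y')"
     "\<forall>s\<in>carrier S. \<forall>x y. \<sigma> x y \<longrightarrow> \<sigma> (s \<odot>\<^bsub>C'\<^esub> x) (s \<odot>\<^bsub>C''\<^esub> y)"
     "\<forall>x y. \<sigma> x y \<longrightarrow> (x \<in> B' \<longleftrightarrow> y \<in> B'')" unfolding sq_iso_def by (elim exE conjE) (rule that; assumption)
  show ?thesis
  proof (rule sq_isoI[where \<rho> = "\<lambda>x z. \<exists>y. \<rho> x y \<and> \<sigma> y z"])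
    fix x z assume "\<exists>y. \<rho> x y \<and> \<sigma> y z"
    then obtain y where y: "\<rho> x y" "\<sigma> y z" by (elim exE conjE)
    show "x \<in> Z" "z \<in> Z''" using r(1) s(1) y by simp_all
    show "x \<in> B \<Longrightarrow> z \<in> B''" "z \<in> B'' \<Longrightarrow> x \<in> B" using r(6) s(6) y by simp_all
    show "\<exists>y. \<rho> (a \<odot>\<^bsub>C\<^esub> x) y \<and> \<sigma> y (a \<odot>\<^bsub>C''\<^esub> z)" if "a \<in> carrier S" for a
      by (rule exI[of _ "a \<odot>\<^bsub>C'\<^esub> y"]) (use that y r(5) s(5) in simp)
    fix x' z' assume "\<exists>y. \<rho> x' y \<and> \<sigma> y z'"
    then obtain y' where y': "\<rho> x' y'" "\<sigma> y' z'" by (elim exE conjE)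
    show "\<exists>y. \<rho> (x \<oplus>\<^bsub>C\<^esub> x') y \<and> \<sigma> y (z \<oplus>\<^bsub>C''\<^esub> z')"
      by (rule exI[of _ "y \<oplus>\<^bsub>C'\<^esub> y'"]) (use y y' r(4) s(4) in simp)
  next
    fix x assume "x \<in> Z"
    then obtain y where y: "\<rho> x y" by (rule r(2)[rule_format, THEN exE])
    then have "y \<in> Z'" using r(1) by simp
    then obtain z where "\<sigma> y z" by (rule s(2)[rule_format, THEN exE])
    then show "\<exists>z y. \<rho> x y \<and> \<sigma> y z" using y by (intro exI conjI)
  next
    fix z assume "z \<in> Z''"
    then obtain y where y: "\<sigma> y z" by (rule s(3)[rule_format, THEN exE])
    then have "y \<in> Z'" using s(1) by simp
    then obtain x where "\<rho> x y" by (rule r(3)[rule_format, THEN exE])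
    then show "\<exists>x y. \<rho> x y \<and> \<sigma> y z" using y by (intro exI conjI)
  qed
qed

text \<open>All partners of one element agree modulo \<open>B'\<close>, so a choice of partners
  induces a map on cosets. That it is well defined and that it is injective are the two directions
  of the equivalence \<open>key\<close>.\<close>

lemma sq_iso_isomorphic:
  assumes C: "op_group S C" "op_sub S C Z" "op_sub S C B" "B \<subseteq> Z"
    and C': "op_group S C'" "op_sub S C' Z'" "op_sub S C' B'" "B' \<subseteq> Z'"
    and iso: "sq_iso S C Z B C' Z' B'"
  shows "isomorphic_modules S (quotient_module (C\<lparr>carrier := Z\<rparr>) B) (quotient_module (C'\<lparr>carrier := Z'\<rparr>) B')"
proof -
  let ?C = "C\<lparr>carrier := Z\<rparr>" and ?C' = "C'\<lparr>carrier := Z'\<rparr>"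
  interpret C: op_group S C by fact
  interpret C': op_group S C' by fact
  interpret Z: op_group S ?C by (rule C.op_sub_op_group) fact
  interpret Z': op_group S ?C' by (rule C'.op_sub_op_group) fact
  have B: "op_sub S ?C B" by (rule C.op_sub_restrict) fact+
  have B': "op_sub S ?C' B'" by (rule C'.op_sub_restrict) fact+
  from iso obtain \<rho> where r0: "\<forall>x y. \<rho> x y \<longrightarrow> x \<in> Z \<and> y \<in> Z'"
     "\<forall>x\<in>Z. \<exists>y. \<rho> x y" "\<forall>y\<in>Z'. \<exists>x. \<rho> x y"
     "\<forall>x y x' y'. \<rho> x y \<longrightarrow> \<rho> x' y' \<longrightarrow> \<rho> (x \<oplus>\<^bsub>C\<^esub> x') (y \<oplus>\<^bsub>C'\<^esub> y')"
     "\<forall>s\<in>carrier S. \<forall>x y. \<rho> x y \<longrightarrow> \<rho> (s \<odot>\<^bsub>C\<^esub> x) (s \<odot>\<^bsub>C'\<^esub> y)"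
     "\<forall>x y. \<rho> x y \<longrightarrow> (x \<in> B \<longleftrightarrow> y \<in> B')" unfolding sq_iso_def by (elim exE conjE) (rule that; assumption)
  have r: "\<And>x y. \<rho> x y \<Longrightarrow> x \<in> Z \<and> y \<in> Z'"
     "\<And>x. x\<in>Z \<Longrightarrow> \<exists>y. \<rho> x y" "\<And>y. y\<in>Z' \<Longrightarrow> \<exists>x. \<rho> x y"
     "\<And>x y x' y'. \<rho> x y \<Longrightarrow> \<rho> x' y' \<Longrightarrow> \<rho> (x \<oplus>\<^bsub>C\<^esub> x') (y \<oplus>\<^bsub>C'\<^esub> y')"
     "\<And>s x y. s\<in>carrier S \<Longrightarrow> \<rho> x y \<Longrightarrow> \<rho> (s \<odot>\<^bsub>C\<^esub> x) (s \<odot>\<^bsub>C'\<^esub> y)"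
     "\<And>x y. \<rho> x y \<Longrightarrow> (x \<in> B \<longleftrightarrow> y \<in> B')"
    using r0(1) apply blast using r0(2) apply blast using r0(3) apply blast using r0(4) apply blast
    using r0(5) apply blast using r0(6) apply blast done
  \<comment> \<open>A relation need not respect subtraction, so the negative of \<open>x'\<close>
    gets a partner \<open>z\<close> of its own. As \<open>x'\<close> and its negative add up to
    zero, \<open>y'\<close> plus \<open>z\<close> lies in \<open>B'\<close>; hence \<open>z\<close>
    may replace the negative of \<open>y'\<close> modulo \<open>B'\<close>.\<close>
  have key: "x \<ominus>\<^bsub>?C\<^esub> x' \<in> B \<longleftrightarrow> y \<ominus>\<^bsub>?C'\<^esub> y' \<in> B'" if "\<rho> x y" "\<rho> x' y'" for x y x' y'
  proof -
    note m = r(1)[OF that(1)] r(1)[OF that(2)]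
    then obtain z where z: "\<rho> (\<ominus>\<^bsub>?C\<^esub> x') z" using r(2) Z.a_inv_closed[of x'] by auto
    have mz: "z \<in> Z'" using r(1)[OF z] by simp
    have "\<rho> \<zero>\<^bsub>?C\<^esub> (y' \<oplus>\<^bsub>?C'\<^esub> z)" using r(4)[OF that(2) z] m Z.r_neg[of x'] by simp
    then have b: "y' \<oplus>\<^bsub>?C'\<^esub> z \<in> B'" using r(6)[of "\<zero>\<^bsub>?C\<^esub>"] op_subD(2)[OF B] by simp
    have yz: "y \<in> carrier ?C'" "y' \<in> carrier ?C'" "z \<in> carrier ?C'" using m mz by simp_all
    have e: "y \<oplus>\<^bsub>?C'\<^esub> z = (y \<ominus>\<^bsub>?C'\<^esub> y') \<oplus>\<^bsub>?C'\<^esub> (y' \<oplus>\<^bsub>?C'\<^esub> z)"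
      using Z'.a_assoc[OF Z'.minus_closed[OF yz(1,2)] yz(2,3)] Z'.minus_add_cancel[OF yz(1,2)] by argo
    have e2: "y \<ominus>\<^bsub>?C'\<^esub> y' = (y \<oplus>\<^bsub>?C'\<^esub> z) \<ominus>\<^bsub>?C'\<^esub> (y' \<oplus>\<^bsub>?C'\<^esub> z)"
      unfolding e by (intro Z'.add_minus_cancel[symmetric] Z'.minus_closed Z'.a_closed yz)
    have "x \<ominus>\<^bsub>?C\<^esub> x' \<in> B \<longleftrightarrow> y \<oplus>\<^bsub>?C'\<^esub> z \<in> B'"
      using r(6)[OF r(4)[OF that(1) z]] by (simp add: a_minus_def)
    also have "\<dots> \<longleftrightarrow> y \<ominus>\<^bsub>?C'\<^esub> y' \<in> B'"
      unfolding e using op_subD(3)[OF B' _ b] op_subD(6)[OF B' _ b] e2[unfolded e] by metis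
    finally show ?thesis .
  qed
  define g where "g x = (SOME y. \<rho> x y)" for x
  have g: "\<rho> x (g x)" if "x \<in> Z" for x using r(2)[OF that] unfolding g_def by (rule someI_ex)
  have gZ: "g x \<in> Z'" if "x \<in> Z" for x using r(1)[OF g[OF that]] by simp
  define F where "F X = B' +>\<^bsub>?C'\<^esub> (g (SOME x. x \<in> Z \<and> X = B +>\<^bsub>?C\<^esub> x))" for X
  have F: "F (B +>\<^bsub>?C\<^esub> x) = B' +>\<^bsub>?C'\<^esub> y" if "\<rho> x y" for x y
  proof -
    have x: "x \<in> Z" "y \<in> Z'" using r(1)[OF that] by auto
    define x1 where "x1 = (SOME u. u \<in> Z \<and> B +>\<^bsub>?C\<^esub> x = B +>\<^bsub>?C\<^esub> u)"
    have x1: "x1 \<in> Z \<and> B +>\<^bsub>?C\<^esub> x = B +>\<^bsub>?C\<^esub> x1"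
      unfolding x1_def by (rule someI[of _ x]) (use x in simp)
    then have "x1 \<ominus>\<^bsub>?C\<^esub> x \<in> B" using Z.coset_eq_iff[OF B, of x1 x] x by simp
    then have "g x1 \<ominus>\<^bsub>?C'\<^esub> y \<in> B'" using key[OF g that] x1 by blast
    then have "B' +>\<^bsub>?C'\<^esub> g x1 = B' +>\<^bsub>?C'\<^esub> y" using Z'.coset_eq_iff[OF B', of "g x1" y] x x1 gZ by simp
    then show ?thesis unfolding F_def x1_def[symmetric] .
  qed
  have lin: "F \<in> lin_maps S (quotient_module ?C B) (quotient_module ?C' B')"
    unfolding lin_maps_def
  proof (intro CollectI conjI ballI Pi_I)
    fix X assume "X \<in> carrier (quotient_module ?C B)"
    then obtain x where x: "x \<in> Z" "X = B +>\<^bsub>?C\<^esub> x" by (auto simp: carrier_quotient)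
    show "F X \<in> carrier (quotient_module ?C' B')"
      unfolding x(2) F[OF g[OF x(1)]] carrier_quotient using gZ[OF x(1)] by simp
    fix s assume s: "s \<in> carrier S"
    show "F (s \<odot>\<^bsub>quotient_module ?C B\<^esub> X) = s \<odot>\<^bsub>quotient_module ?C' B'\<^esub> F X"
      using F[OF g[OF x(1)]] F[OF r(5)[OF s g[OF x(1)]]] x gZ[OF x(1)] s
        Z.smult_quotient[OF B, of x s] Z'.smult_quotient[OF B', of "g x" s] by simp
  next
    fix X Y assume "X \<in> carrier (quotient_module ?C B)" "Y \<in> carrier (quotient_module ?C B)"
    then obtain x y where x: "x \<in> Z" "X = B +>\<^bsub>?C\<^esub> x" and y: "y \<in> Z" "Y = B +>\<^bsub>?C\<^esub> y"
      by (auto simp: carrier_quotient)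
    show "F (X \<oplus>\<^bsub>quotient_module ?C B\<^esub> Y) = F X \<oplus>\<^bsub>quotient_module ?C' B'\<^esub> F Y"
      using F[OF g[OF x(1)]] F[OF g[OF y(1)]] F[OF r(4)[OF g[OF x(1)] g[OF y(1)]]] x y gZ[OF x(1)] gZ[OF y(1)]
        Z.add_quotient[OF B, of x y] Z'.add_quotient[OF B', of "g x" "g y"] by simp
  qed
  have "inj_on F (carrier (quotient_module ?C B))"
  proof (rule inj_onI)
    fix X Y assume "X \<in> carrier (quotient_module ?C B)" "Y \<in> carrier (quotient_module ?C B)" and e: "F X = F Y"
    then obtain x y where x: "x \<in> Z" "X = B +>\<^bsub>?C\<^esub> x" and y: "y \<in> Z" "Y = B +>\<^bsub>?C\<^esub> y"
      by (auto simp: carrier_quotient)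
    have "B' +>\<^bsub>?C'\<^esub> g x = B' +>\<^bsub>?C'\<^esub> g y" using e F[OF g[OF x(1)]] F[OF g[OF y(1)]] x y by simp
    then have "g x \<ominus>\<^bsub>?C'\<^esub> g y \<in> B'" by (intro Z'.coset_eq_iff[OF B', THEN iffD1]) (use gZ x y in simp_all)
    then have "x \<ominus>\<^bsub>?C\<^esub> y \<in> B" using key[OF g g] x y by blast
    then show "X = Y" unfolding x(2) y(2) by (intro Z.coset_eq_iff[OF B, THEN iffD2]) (use x y in simp_all)
  qed
  moreover have "F ` carrier (quotient_module ?C B) = carrier (quotient_module ?C' B')"
  proof
    show "F ` carrier (quotient_module ?C B) \<subseteq> carrier (quotient_module ?C' B')"
      using lin by (auto simp: lin_maps_def)
    show "carrier (quotient_module ?C' B') \<subseteq> F ` carrier (quotient_module ?C B)"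
    proof
      fix Y assume "Y \<in> carrier (quotient_module ?C' B')"
      then obtain y where y: "y \<in> Z'" "Y = B' +>\<^bsub>?C'\<^esub> y" by (auto simp: carrier_quotient)
      then obtain x where x: "\<rho> x y" using r(3) by blast
      then have "Y = F (B +>\<^bsub>?C\<^esub> x)" using F y by simp
      then show "Y \<in> F ` carrier (quotient_module ?C B)" using r(1)[OF x] by (auto simp: carrier_quotient)
    qed
  qed
  ultimately show ?thesis using lin unfolding isomorphic_modules_def bij_betw_def by blast
qed

lemma quotient_trivial:
  assumes C: "op_group S C" "op_sub S C Z" "op_sub S C B" "B \<subseteq> Z"
    and t: "carrier (quotient_module (C\<lparr>carrier := Z\<rparr>) B) = {\<zero>\<^bsub>quotient_module (C\<lparr>carrier := Z\<rparr>) B\<^esub>}"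
  shows "Z = B"
proof -
  interpret C: op_group S C by fact
  interpret Z: op_group S "C\<lparr>carrier := Z\<rparr>" by (rule C.op_sub_op_group) fact
  have B: "op_sub S (C\<lparr>carrier := Z\<rparr>) B" by (rule C.op_sub_restrict) fact+
  have "x \<in> B" if x: "x \<in> Z" for x
  proof -
    have "B +>\<^bsub>C\<lparr>carrier := Z\<rparr>\<^esub> x = B" using t x by (auto simp: carrier_quotient zero_quotient)
    then have "B +>\<^bsub>C\<lparr>carrier := Z\<rparr>\<^esub> x = B +>\<^bsub>C\<lparr>carrier := Z\<rparr>\<^esub> \<zero>\<^bsub>C\<lparr>carrier := Z\<rparr>\<^esub>" by (simp only: Z.coset_zero[OF B])
    then have "x \<ominus>\<^bsub>C\<lparr>carrier := Z\<rparr>\<^esub> \<zero>\<^bsub>C\<lparr>carrier := Z\<rparr>\<^esub> \<in> B" by (intro Z.coset_eq_iff[OF B, THEN iffD1]) (use x Z.zero_closed in auto)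
    then show ?thesis using x Z.minus_add_cancel[OF _ Z.zero_closed, of x] Z.r_zero[OF Z.minus_closed[OF _ Z.zero_closed], of x] by simp
  qed
  then show ?thesis using assms by blast
qed

section \<open>Double complexes with exact columns\<close>

text \<open>The model is \<open>C p q\<close> = Hom(F_p, T_q) and \<open>D p\<close> = Hom(F_p, M):
  \<open>dl\<close> comes from \<open>F\<close> and raises \<open>p\<close>, \<open>dd\<close> comes
  from \<open>T\<close> and lowers \<open>q\<close>. The two commute without a sign since no total
  complex is ever formed. \<open>bounded\<close> says that far to the right the rows formed by the
  images of \<open>dd\<close> are exact.\<close>

locale double_complex =
  fixes S :: "('s, 'z) ring_scheme" and C :: "int \<Rightarrow> int \<Rightarrow> ('s, 'x) module" and D :: "int \<Rightarrow> ('s, 'y) module"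
    and dl dd :: "int \<Rightarrow> 'x \<Rightarrow> 'x" and dD :: "int \<Rightarrow> 'y \<Rightarrow> 'y" and ep :: "int \<Rightarrow> 'x \<Rightarrow> 'y" and d :: int
  assumes opC: "op_group S (C p q)" and opD: "op_group S (D p)"
    and dl: "dl p \<in> lin_maps S (C p q) (C (p + 1) q)"
    and dd: "dd p \<in> lin_maps S (C p q) (C p (q - 1))"
    and dD: "dD p \<in> lin_maps S (D p) (D (p + 1))"
    and ep: "ep p \<in> lin_maps S (C p 0) (D p)"
    and dldl: "x \<in> carrier (C p q) \<Longrightarrow> dl (p + 1) (dl p x) = \<zero>\<^bsub>C (p + 2) q\<^esub>"
    and dddd: "x \<in> carrier (C p q) \<Longrightarrow> dd p (dd p x) = \<zero>\<^bsub>C p (q - 2)\<^esub>"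
    and comm: "x \<in> carrier (C p q) \<Longrightarrow> dl p (dd p x) = dd (p + 1) (dl p x)"
    and comm_ep: "x \<in> carrier (C p 0) \<Longrightarrow> dD p (ep p x) = ep (p + 1) (dl p x)"
    and col_exact: "\<lbrakk>q \<ge> 1; x \<in> carrier (C p q); dd p x = \<zero>\<^bsub>C p (q - 1)\<^esub>\<rbrakk> \<Longrightarrow> \<exists>y\<in>carrier (C p (q + 1)). x = dd p y"
    and row_exact: "\<lbrakk>p \<noteq> d; x \<in> carrier (C p q); dl p x = \<zero>\<^bsub>C (p + 1) q\<^esub>\<rbrakk> \<Longrightarrow> \<exists>y\<in>carrier (C (p - 1) q). x = dl (p - 1) y"
    and ep_surj: "y \<in> carrier (D p) \<Longrightarrow> \<exists>x\<in>carrier (C p 0). ep p x = y"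
    and ep_exact: "\<lbrakk>x \<in> carrier (C p 0); ep p x = \<zero>\<^bsub>D p\<^esub>\<rbrakk> \<Longrightarrow> \<exists>y\<in>carrier (C p 1). x = dd p y"
    and ep_dd: "x \<in> carrier (C p 1) \<Longrightarrow> ep p (dd p x) = \<zero>\<^bsub>D p\<^esub>"
    and neg: "q < 0 \<Longrightarrow> carrier (C p q) = {\<zero>\<^bsub>C p q\<^esub>}"
    and bounded: "\<exists>N. \<forall>p>N. \<forall>q\<ge>0. \<forall>x\<in>carrier (C p (q + 1)). dl p (dd p x) = \<zero>\<^bsub>C (p + 1) q\<^esub> \<longrightarrow>
      (\<exists>u\<in>carrier (C (p - 1) (q + 1)). dd p x = dl (p - 1) (dd (p - 1) u))"
begin

lemmas dl_add = lin_add[OF opC opC dl] and dd_add = lin_add[OF opC opC dd]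
  and dl_minus = lin_minus[OF opC opC dl] and dd_minus = lin_minus[OF opC opC dd]
  and dl_smult = lin_smult[OF opC opC dl] and dd_smult = lin_smult[OF opC opC dd]
  and dl_zero = lin_zero[OF opC opC dl] and dd_zero = lin_zero[OF opC opC dd]

lemma dl_closed: "x \<in> carrier (C p q) \<Longrightarrow> p' = p + 1 \<Longrightarrow> dl p x \<in> carrier (C p' q)"
  using lin_closed[OF opC opC dl] by simp

lemma dd_closed: "x \<in> carrier (C p q) \<Longrightarrow> q' = q - 1 \<Longrightarrow> dd p x \<in> carrier (C p q')"
  using lin_closed[OF opC opC dd] by simp

lemma C_closed: "x \<in> carrier (C p q) \<Longrightarrow> y \<in> carrier (C p q) \<Longrightarrow> x \<oplus>\<^bsub>C p q\<^esub> y \<in> carrier (C p q)"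
  "x \<in> carrier (C p q) \<Longrightarrow> y \<in> carrier (C p q) \<Longrightarrow> x \<ominus>\<^bsub>C p q\<^esub> y \<in> carrier (C p q)"
  "s \<in> carrier S \<Longrightarrow> x \<in> carrier (C p q) \<Longrightarrow> s \<odot>\<^bsub>C p q\<^esub> x \<in> carrier (C p q)"
  "\<zero>\<^bsub>C p q\<^esub> \<in> carrier (C p q)"
proof -
  interpret op_group S "C p q" by (rule opC)
  show "x \<in> carrier (C p q) \<Longrightarrow> y \<in> carrier (C p q) \<Longrightarrow> x \<oplus>\<^bsub>C p q\<^esub> y \<in> carrier (C p q)"
  "x \<in> carrier (C p q) \<Longrightarrow> y \<in> carrier (C p q) \<Longrightarrow> x \<ominus>\<^bsub>C p q\<^esub> y \<in> carrier (C p q)"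
  "s \<in> carrier S \<Longrightarrow> x \<in> carrier (C p q) \<Longrightarrow> s \<odot>\<^bsub>C p q\<^esub> x \<in> carrier (C p q)"
  "\<zero>\<^bsub>C p q\<^esub> \<in> carrier (C p q)" by auto
qed

lemma C_zero: "x \<in> carrier (C p q) \<Longrightarrow> \<zero>\<^bsub>C p q\<^esub> \<oplus>\<^bsub>C p q\<^esub> x = x"
  "x \<in> carrier (C p q) \<Longrightarrow> x \<oplus>\<^bsub>C p q\<^esub> \<zero>\<^bsub>C p q\<^esub> = x"
  "x \<in> carrier (C p q) \<Longrightarrow> x \<ominus>\<^bsub>C p q\<^esub> x = \<zero>\<^bsub>C p q\<^esub>"
  "s \<in> carrier S \<Longrightarrow> s \<odot>\<^bsub>C p q\<^esub> \<zero>\<^bsub>C p q\<^esub> = \<zero>\<^bsub>C p q\<^esub>"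
proof -
  interpret op_group S "C p q" by (rule opC)
  show "x \<in> carrier (C p q) \<Longrightarrow> \<zero>\<^bsub>C p q\<^esub> \<oplus>\<^bsub>C p q\<^esub> x = x" "x \<in> carrier (C p q) \<Longrightarrow> x \<oplus>\<^bsub>C p q\<^esub> \<zero>\<^bsub>C p q\<^esub> = x"
  "x \<in> carrier (C p q) \<Longrightarrow> x \<ominus>\<^bsub>C p q\<^esub> x = \<zero>\<^bsub>C p q\<^esub>"
  "s \<in> carrier S \<Longrightarrow> s \<odot>\<^bsub>C p q\<^esub> \<zero>\<^bsub>C p q\<^esub> = \<zero>\<^bsub>C p q\<^esub>"
    by (auto simp: minus_self op_zero)
qed

lemma C_minus_add:
  assumes "x \<in> carrier (C p q)" "y \<in> carrier (C p q)"
  shows "x = y \<oplus>\<^bsub>C p q\<^esub> (x \<ominus>\<^bsub>C p q\<^esub> y)" "x = (x \<ominus>\<^bsub>C p q\<^esub> y) \<oplus>\<^bsub>C p q\<^esub> y"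
proof -
  interpret op_group S "C p q" by (rule opC)
  show "x = y \<oplus>\<^bsub>C p q\<^esub> (x \<ominus>\<^bsub>C p q\<^esub> y)" "x = (x \<ominus>\<^bsub>C p q\<^esub> y) \<oplus>\<^bsub>C p q\<^esub> y"
    using assms minus_add_cancel[of x y] by (auto simp: a_comm)
qed

lemma C_add_add:
  assumes "x \<in> carrier (C p q)" "y \<in> carrier (C p q)" "x' \<in> carrier (C p q)" "y' \<in> carrier (C p q)"
  shows "(x \<oplus>\<^bsub>C p q\<^esub> y) \<oplus>\<^bsub>C p q\<^esub> (x' \<oplus>\<^bsub>C p q\<^esub> y') = (x \<oplus>\<^bsub>C p q\<^esub> x') \<oplus>\<^bsub>C p q\<^esub> (y \<oplus>\<^bsub>C p q\<^esub> y')"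
proof -
  interpret op_group S "C p q" by (rule opC)
  show ?thesis using assms by (simp add: a_ac)
qed

lemma D_zero: "\<zero>\<^bsub>D p\<^esub> \<in> carrier (D p)" "x \<in> carrier (D p) \<Longrightarrow> x \<ominus>\<^bsub>D p\<^esub> x = \<zero>\<^bsub>D p\<^esub>"
   "x \<in> carrier (D p) \<Longrightarrow> x \<ominus>\<^bsub>D p\<^esub> \<zero>\<^bsub>D p\<^esub> = x" "x \<in> carrier (D p) \<Longrightarrow> x \<oplus>\<^bsub>D p\<^esub> \<zero>\<^bsub>D p\<^esub> = x"
proof -
  interpret op_group S "D p" by (rule opD)
  show "\<zero>\<^bsub>D p\<^esub> \<in> carrier (D p)" "x \<in> carrier (D p) \<Longrightarrow> x \<ominus>\<^bsub>D p\<^esub> x = \<zero>\<^bsub>D p\<^esub>" "x \<in> carrier (D p) \<Longrightarrow> x \<oplus>\<^bsub>D p\<^esub> \<zero>\<^bsub>D p\<^esub> = x"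
    by (auto simp: minus_self)
  show "x \<in> carrier (D p) \<Longrightarrow> x \<ominus>\<^bsub>D p\<^esub> \<zero>\<^bsub>D p\<^esub> = x" using minus_add_cancel[of x "\<zero>\<^bsub>D p\<^esub>"] minus_closed[of x "\<zero>\<^bsub>D p\<^esub>"] by simp
qed

text \<open>
  The subquotients \<open>UZ/UB\<close> form the diagonal of the chase: \<open>UZ/UB\<close> at \<open>(i, 0)\<close> is the cohomology of \<open>D\<close>
  at \<open>i\<close>, at \<open>(d, q)\<close> it is the homology at \<open>q\<close> of the row cohomology, and for \<open>p \<noteq> d\<close> it does not change
  from \<open>(p, q)\<close> to \<open>(p + 1, q + 1)\<close>.
\<close>

definition UZ :: "int \<Rightarrow> int \<Rightarrow> 'x set" where
  "UZ p q = {w \<in> carrier (C p q). dl p w \<in> dd (p + 1) ` carrier (C (p + 1) (q + 1)) \<and>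
     dd p w \<in> dl (p - 1) ` carrier (C (p - 1) (q - 1))}"

definition UB :: "int \<Rightarrow> int \<Rightarrow> 'x set" where
  "UB p q = {dl (p - 1) u \<oplus>\<^bsub>C p q\<^esub> dd p v |u v. u \<in> carrier (C (p - 1) q) \<and> v \<in> carrier (C p (q + 1))}"

text \<open>In contrast to \<open>UZ d q\<close>, where \<open>dl\<close> of an element only has to
  lift along \<open>dd\<close>, here it has to vanish. \<open>HZ\<close> and \<open>HB\<close> are
  the preimages in \<open>C d q\<close> of the cycles and boundaries of the complex that
  \<open>dd\<close> induces on the row cohomology at \<open>d\<close>, so that this cohomology need
  not be formed first.\<close>

definition HZ :: "int \<Rightarrow> 'x set" where
  "HZ q = {w \<in> carrier (C d q). dl d w = \<zero>\<^bsub>C (d + 1) q\<^esub> \<and>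
     dd d w \<in> dl (d - 1) ` carrier (C (d - 1) (q - 1))}"

definition HB :: "int \<Rightarrow> 'x set" where
  "HB q = {dl (d - 1) u \<oplus>\<^bsub>C d q\<^esub> dd d v |u v. u \<in> carrier (C (d - 1) q) \<and>
     v \<in> carrier (C d (q + 1)) \<and> dl d v = \<zero>\<^bsub>C (d + 1) (q + 1)\<^esub>}"

lemma UZ_add: "x \<in> UZ p q \<Longrightarrow> y \<in> UZ p q \<Longrightarrow> x \<oplus>\<^bsub>C p q\<^esub> y \<in> UZ p q"
  unfolding UZ_def
proof safe
  fix u v u' v' assume a: "x \<in> carrier (C p q)" "y \<in> carrier (C p q)" "u \<in> carrier (C (p + 1) (q + 1))"
   "dl p x = dd (p + 1) u" "v \<in> carrier (C (p + 1) (q + 1))" "dl p y = dd (p + 1) v"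
   "u' \<in> carrier (C (p - 1) (q - 1))" "dd p x = dl (p - 1) u'" "v' \<in> carrier (C (p - 1) (q - 1))" "dd p y = dl (p - 1) v'"
  show "x \<oplus>\<^bsub>C p q\<^esub> y \<in> carrier (C p q)" using a by (simp add: C_closed)
  show "dl p (x \<oplus>\<^bsub>C p q\<^esub> y) \<in> dd (p + 1) ` carrier (C (p + 1) (q + 1))"
    using a dd_add[of u "p+1" "q+1" v] by (intro image_eqI[of _ _ "u \<oplus>\<^bsub>C (p + 1) (q + 1)\<^esub> v"]) (auto simp: C_closed dl_add)
  show "dd p (x \<oplus>\<^bsub>C p q\<^esub> y) \<in> dl (p - 1) ` carrier (C (p - 1) (q - 1))"
    using a dl_add[of u' "p-1" "q-1" v'] by (intro image_eqI[of _ _ "u' \<oplus>\<^bsub>C (p - 1) (q - 1)\<^esub> v'"]) (auto simp: C_closed dd_add)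
qed

lemma UZ_smult: "s \<in> carrier S \<Longrightarrow> x \<in> UZ p q \<Longrightarrow> s \<odot>\<^bsub>C p q\<^esub> x \<in> UZ p q"
  unfolding UZ_def
proof safe
  fix u u' assume a: "s \<in> carrier S" "x \<in> carrier (C p q)" "u \<in> carrier (C (p + 1) (q + 1))"
   "dl p x = dd (p + 1) u" "u' \<in> carrier (C (p - 1) (q - 1))" "dd p x = dl (p - 1) u'"
  show "s \<odot>\<^bsub>C p q\<^esub> x \<in> carrier (C p q)" using a by (simp add: C_closed)
  show "dl p (s \<odot>\<^bsub>C p q\<^esub> x) \<in> dd (p + 1) ` carrier (C (p + 1) (q + 1))"
    using a dd_smult[of s u "p+1" "q+1"] by (intro image_eqI[of _ _ "s \<odot>\<^bsub>C (p + 1) (q + 1)\<^esub> u"]) (auto simp: C_closed dl_smult)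
  show "dd p (s \<odot>\<^bsub>C p q\<^esub> x) \<in> dl (p - 1) ` carrier (C (p - 1) (q - 1))"
    using a dl_smult[of s u' "p-1" "q-1"] by (intro image_eqI[of _ _ "s \<odot>\<^bsub>C (p - 1) (q - 1)\<^esub> u'"]) (auto simp: C_closed dd_smult)
qed

lemma dl_image_row:
  assumes "x \<in> carrier (C p q)" "dl p x = \<zero>\<^bsub>C (p + 1) q\<^esub>" "p \<noteq> d"
  shows "x \<in> dl (p - 1) ` carrier (C (p - 1) q)"
  using row_exact[OF assms(3,1,2)] by blast

lemma dl_dd_minus:
  assumes "x \<in> carrier (C p q)" "y \<in> carrier (C p (q + 1))" "dl p x = dl p (dd p y)"
  shows "dl p (x \<ominus>\<^bsub>C p q\<^esub> dd p y) = \<zero>\<^bsub>C (p + 1) q\<^esub>"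
  using assms dl_minus[of x p q "dd p y"] dd_closed[of y p "q+1" q] dl_closed[of x p q "p+1"] C_zero(3) by simp

text \<open>Elements \<open>w\<close> and \<open>w'\<close> correspond if
  \<open>dl p w = dd (p + 1) w'\<close>; partners exist on both sides by the two conditions in
  \<open>UZ\<close>. Columns are used only in degree \<open>q + 1\<close>, which is at least 1, and
  rows only at position \<open>p\<close>, which accounts for the two hypotheses.\<close>

lemma U_shift:
  assumes p: "p \<noteq> d" and q: "q \<ge> 0"
  shows "sq_iso S (C p q) (UZ p q) (UB p q) (C (p + 1) (q + 1)) (UZ (p + 1) (q + 1)) (UB (p + 1) (q + 1))"
proof (rule sq_isoI[where \<rho> = "\<lambda>w w'. w \<in> UZ p q \<and> w' \<in> UZ (p + 1) (q + 1) \<and> dl p w = dd (p + 1) w'"])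
  fix w assume w: "w \<in> UZ p q"
  then obtain w' where w': "w' \<in> carrier (C (p + 1) (q + 1))" "dl p w = dd (p + 1) w'" and wc: "w \<in> carrier (C p q)"
    unfolding UZ_def by blast
  have "dd (p + 2) (dl (p + 1) w') = dl (p + 1) (dl p w)" using comm[OF w'(1)] w'(2) by (simp add: add.commute)
  then have "dd (p + 2) (dl (p + 1) w') = \<zero>\<^bsub>C (p + 2) q\<^esub>" using dldl[OF wc] by simp
  then have "\<exists>y\<in>carrier (C (p + 2) (q + 2)). dl (p + 1) w' = dd (p + 2) y"
    using col_exact[of "q + 1" "dl (p + 1) w'" "p + 2"] q dl_closed[OF w'(1), of "p+2"] by (simp add: add.commute)
  moreover have "p + 1 + 1 = p + 2" "q + 1 + 1 = q + 2" "p + 1 - 1 = p" "q + 1 - 1 = q" by auto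
  ultimately have "w' \<in> UZ (p + 1) (q + 1)" unfolding UZ_def mem_Collect_eq
    using w'(1) w'(2)[symmetric] wc by (metis imageI)
  then show "\<exists>y. w \<in> UZ p q \<and> y \<in> UZ (p + 1) (q + 1) \<and> dl p w = dd (p + 1) y" using w w' by blast
next
  fix w' assume w': "w' \<in> UZ (p + 1) (q + 1)"
  then obtain w where w: "w \<in> carrier (C p q)" "dd (p + 1) w' = dl p w" and wc: "w' \<in> carrier (C (p + 1) (q + 1))"
    unfolding UZ_def by auto
  have "dl p (dd p w) = dd (p + 1) (dd (p + 1) w')" using comm[OF w(1)] w(2) by simp
  then have "dl p (dd p w) = \<zero>\<^bsub>C (p + 1) (q - 1)\<^esub>" using dddd[OF wc] by simp
  then have "dd p w \<in> dl (p - 1) ` carrier (C (p - 1) (q - 1))" using dd_closed[OF w(1)] p by (intro dl_image_row) auto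
  then have "w \<in> UZ p q" unfolding UZ_def using w(1) w(2)[symmetric] wc by auto
  then show "\<exists>w. w \<in> UZ p q \<and> w' \<in> UZ (p + 1) (q + 1) \<and> dl p w = dd (p + 1) w'" using w w' by metis
next
  fix w w' assume a: "w \<in> UZ p q \<and> w' \<in> UZ (p + 1) (q + 1) \<and> dl p w = dd (p + 1) w'"
  then have wc: "w \<in> carrier (C p q)" "w' \<in> carrier (C (p + 1) (q + 1))" unfolding UZ_def by auto
  {
    assume "w \<in> UB p q"
    then obtain u v where u: "u \<in> carrier (C (p - 1) q)" and v: "v \<in> carrier (C p (q + 1))"
      and w: "w = dl (p - 1) u \<oplus>\<^bsub>C p q\<^esub> dd p v" unfolding UB_def by blast
    have m: "dl (p - 1) u \<in> carrier (C p q)" "dd p v \<in> carrier (C p q)" "dl p v \<in> carrier (C (p + 1) (q + 1))"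
      using dl_closed[OF u] dd_closed[OF v] dl_closed[OF v] by auto
    have "dl p w = dl p (dl (p - 1) u) \<oplus>\<^bsub>C (p + 1) q\<^esub> dl p (dd p v)" unfolding w using m by (intro dl_add)
    also have "\<dots> = dd (p + 1) (dl p v)" using dldl[OF u] comm[OF v] C_zero(1) dd_closed[OF m(3)] by (simp add: add.commute)
    finally have "dd (p + 1) w' = dd (p + 1) (dl p v)" using a by simp
    then have "dd (p + 1) (w' \<ominus>\<^bsub>C (p + 1) (q + 1)\<^esub> dl p v) = \<zero>\<^bsub>C (p + 1) q\<^esub>"
      using dd_minus[OF wc(2) m(3)] C_zero(3) dd_closed[OF m(3)] by simp
    then obtain v' where "v' \<in> carrier (C (p + 1) (q + 1 + 1))" "w' \<ominus>\<^bsub>C (p + 1) (q + 1)\<^esub> dl p v = dd (p + 1) v'"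
      using col_exact[of "q + 1" "w' \<ominus>\<^bsub>C (p + 1) (q + 1)\<^esub> dl p v" "p + 1"] C_closed(2)[OF wc(2) m(3)] q by auto
    then show "w' \<in> UB (p + 1) (q + 1)" unfolding UB_def using C_minus_add(1)[OF wc(2) m(3)] v by auto
  next
    assume "w' \<in> UB (p + 1) (q + 1)"
    then obtain v v' where v: "v \<in> carrier (C p (q + 1))" and v': "v' \<in> carrier (C (p + 1) (q + 2))"
      and w': "w' = dl p v \<oplus>\<^bsub>C (p + 1) (q + 1)\<^esub> dd (p + 1) v'" unfolding UB_def by (auto simp: add.commute)
    have m: "dl p v \<in> carrier (C (p + 1) (q + 1))" "dd (p + 1) v' \<in> carrier (C (p + 1) (q + 1))" "dd p v \<in> carrier (C p q)"
      using dl_closed[OF v] dd_closed[OF v', of "q + 1"] dd_closed[OF v] by simp_all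
    have "dl p w = dd (p + 1) (dl p v) \<oplus>\<^bsub>C (p + 1) (q + 1 - 1)\<^esub> dd (p + 1) (dd (p + 1) v')"
      using a w' dd_add[OF m(1,2)] by simp
    then have "dl p w = dl p (dd p v)" using dddd[OF v'] comm[OF v] C_zero(2) dl_closed[OF m(3)] by simp
    then have "dl p (w \<ominus>\<^bsub>C p q\<^esub> dd p v) = \<zero>\<^bsub>C (p + 1) q\<^esub>" by (rule dl_dd_minus[OF wc(1) v])
    then obtain u where "u \<in> carrier (C (p - 1) q)" "w \<ominus>\<^bsub>C p q\<^esub> dd p v = dl (p - 1) u"
      using row_exact[OF p] C_closed(2)[OF wc(1) m(3)] by blast
    then show "w \<in> UB p q" unfolding UB_def using C_minus_add(2)[OF wc(1) m(3)] v by auto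
  }
next
  fix x y x' y' assume "x \<in> UZ p q \<and> y \<in> UZ (p + 1) (q + 1) \<and> dl p x = dd (p + 1) y"
    "x' \<in> UZ p q \<and> y' \<in> UZ (p + 1) (q + 1) \<and> dl p x' = dd (p + 1) y'"
  then show "x \<oplus>\<^bsub>C p q\<^esub> x' \<in> UZ p q \<and> y \<oplus>\<^bsub>C (p + 1) (q + 1)\<^esub> y' \<in> UZ (p + 1) (q + 1) \<and>
      dl p (x \<oplus>\<^bsub>C p q\<^esub> x') = dd (p + 1) (y \<oplus>\<^bsub>C (p + 1) (q + 1)\<^esub> y')"
    using UZ_add[of x p q x'] UZ_add[of y "p+1" "q+1" y'] dl_add[of x p q x'] dd_add[of y "p+1" "q+1" y']
    by (simp add: UZ_def)
next
  fix s x y assume "s \<in> carrier S" "x \<in> UZ p q \<and> y \<in> UZ (p + 1) (q + 1) \<and> dl p x = dd (p + 1) y"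
  then show "s \<odot>\<^bsub>C p q\<^esub> x \<in> UZ p q \<and> s \<odot>\<^bsub>C (p + 1) (q + 1)\<^esub> y \<in> UZ (p + 1) (q + 1) \<and>
      dl p (s \<odot>\<^bsub>C p q\<^esub> x) = dd (p + 1) (s \<odot>\<^bsub>C (p + 1) (q + 1)\<^esub> y)"
    using UZ_smult[of s x p q] UZ_smult[of s y "p+1" "q+1"] dl_smult[of s x p q] dd_smult[of s y "p+1" "q+1"]
    by (simp add: UZ_def)
qed auto

lemma U_chain:
  assumes "i + int n \<le> d"
  shows "sq_iso S (C i 0) (UZ i 0) (UB i 0) (C (i + int n) (int n)) (UZ (i + int n) (int n)) (UB (i + int n) (int n))"
  using assms
proof (induction n)
  case 0
  show ?case by (rule sq_isoI[where \<rho> = "\<lambda>x y. x = y \<and> x \<in> UZ i 0"]) (auto simp: UZ_add UZ_smult)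
next
  case (Suc n)
  have "i + int (Suc n) = i + int n + 1" "int (Suc n) = int n + 1" by auto
  moreover have "i + int n \<noteq> d" "i + int n \<le> d" using Suc.prems by auto
  ultimately show ?case using sq_iso_trans[OF Suc.IH U_shift[of "i + int n" "int n"]]
    by (simp only: of_nat_0_le_iff simp_thms)
qed

text \<open>This is the connecting map for the images of \<open>dd\<close>: an image cocycle
  \<open>dd p x\<close> gives the image cocycle \<open>dl p x = dd (p + 1) y\<close> one step
  further right and up. If the latter bounds, then \<open>x\<close> can be corrected by some
  \<open>dd p u\<close> to a row cocycle, which bounds since \<open>p\<close> is not
  \<open>d\<close>; applying \<open>dd\<close> to its primitive proves the claim.\<close>

lemma vanish:
  assumes "p > d" "q \<ge> 0" "x \<in> carrier (C p (q + 1))" "dl p (dd p x) = \<zero>\<^bsub>C (p + 1) q\<^esub>"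
  shows "\<exists>u\<in>carrier (C (p - 1) (q + 1)). dd p x = dl (p - 1) (dd (p - 1) u)"
proof -
  obtain N where N: "\<forall>p>N. \<forall>q\<ge>0. \<forall>x\<in>carrier (C p (q + 1)). dl p (dd p x) = \<zero>\<^bsub>C (p + 1) q\<^esub> \<longrightarrow>
      (\<exists>u\<in>carrier (C (p - 1) (q + 1)). dd p x = dl (p - 1) (dd (p - 1) u))" using bounded by blast
  show ?thesis using assms
  \<comment> \<open>The step refers to \<open>(p + 1, q + 1)\<close>, so \<open>q\<close> and
    \<open>x\<close> are generalised along with \<open>p\<close>. In the base case \<open>p\<close>
    exceeds \<open>N\<close>.\<close>
  proof (induction "nat (N + 1 - p)" arbitrary: p q x)
    case 0
    then show ?case using N by auto
  next
    case (Suc n)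
    note x = Suc.prems(3)
    have q: "q + 1 - 1 = q" "q + 1 + 1 = q + 2" by auto
    have "dd (p + 1) (dl p x) = \<zero>\<^bsub>C (p + 1) q\<^esub>" using comm[OF x] Suc.prems(4) by simp
    then obtain y where y: "y \<in> carrier (C (p + 1) (q + 1 + 1))" "dl p x = dd (p + 1) y"
      using col_exact[of "q + 1" "dl p x" "p + 1"] dl_closed[OF x] Suc.prems(2) by auto
    have "dl (p + 1) (dd (p + 1) y) = \<zero>\<^bsub>C (p + 1 + 1) (q + 1)\<^esub>" using dldl[OF x] y by (simp add: add.commute)
    then obtain u where u: "u \<in> carrier (C (p + 1 - 1) (q + 1 + 1))" "dd (p + 1) y = dl (p + 1 - 1) (dd (p + 1 - 1) u)"
    proof -
      have n: "n = nat (N + 1 - (p + 1))" using Suc.hyps(2) by simp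
      have "p + 1 > d" "q + 1 \<ge> 0" using Suc.prems by auto
      from Suc.hyps(1)[OF n this y(1)] show thesis using that \<open>dl (p + 1) (dd (p + 1) y) = _\<close> by blast
    qed
    have u': "u \<in> carrier (C p (q + 1 + 1))" "dl p x = dl p (dd p u)" using u y by auto
    have du: "dd p u \<in> carrier (C p (q + 1))" by (rule dd_closed[OF u'(1)]) simp
    have "dl p (x \<ominus>\<^bsub>C p (q + 1)\<^esub> dd p u) = \<zero>\<^bsub>C (p + 1) (q + 1)\<^esub>" by (rule dl_dd_minus[OF x u'(1) u'(2)])
    then obtain v where v: "v \<in> carrier (C (p - 1) (q + 1))" "x \<ominus>\<^bsub>C p (q + 1)\<^esub> dd p u = dl (p - 1) v"
      using row_exact[of p] Suc.prems(1) C_closed(2)[OF x du] by force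
    have "dl (p - 1) (dd (p - 1) v) = dd p (dl (p - 1) v)" using comm[OF v(1)] by simp
    also have "\<dots> = dd p x \<ominus>\<^bsub>C p q\<^esub> dd p (dd p u)" using dd_minus[OF x du] v(2) by simp
    also have "\<dots> = dd p x"
      using dddd[OF u'(1)] C_minus_add(2)[of "dd p x" p q "\<zero>\<^bsub>C p q\<^esub>"] C_closed C_zero(2) dd_closed[OF x] by simp
    finally show ?case using v by metis
  qed
qed

lemma HZ_add: "x \<in> HZ q \<Longrightarrow> y \<in> HZ q \<Longrightarrow> x \<oplus>\<^bsub>C d q\<^esub> y \<in> HZ q"
  unfolding HZ_def
proof safe
  fix u' v' assume a: "x \<in> carrier (C d q)" "y \<in> carrier (C d q)" "dl d x = \<zero>\<^bsub>C (d + 1) q\<^esub>" "dl d y = \<zero>\<^bsub>C (d + 1) q\<^esub>"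
   "u' \<in> carrier (C (d - 1) (q - 1))" "dd d x = dl (d - 1) u'" "v' \<in> carrier (C (d - 1) (q - 1))" "dd d y = dl (d - 1) v'"
  show "x \<oplus>\<^bsub>C d q\<^esub> y \<in> carrier (C d q)" using a by (simp add: C_closed)
  show "dl d (x \<oplus>\<^bsub>C d q\<^esub> y) = \<zero>\<^bsub>C (d + 1) q\<^esub>" using a by (simp add: dl_add C_zero C_closed)
  show "dd d (x \<oplus>\<^bsub>C d q\<^esub> y) \<in> dl (d - 1) ` carrier (C (d - 1) (q - 1))"
    using a dl_add[of u' "d-1" "q-1" v'] by (intro image_eqI[of _ _ "u' \<oplus>\<^bsub>C (d - 1) (q - 1)\<^esub> v'"]) (auto simp: C_closed dd_add)
qed

lemma HZ_smult: "s \<in> carrier S \<Longrightarrow> x \<in> HZ q \<Longrightarrow> s \<odot>\<^bsub>C d q\<^esub> x \<in> HZ q"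
  unfolding HZ_def
proof safe
  fix u' assume a: "s \<in> carrier S" "x \<in> carrier (C d q)" "dl d x = \<zero>\<^bsub>C (d + 1) q\<^esub>"
   "u' \<in> carrier (C (d - 1) (q - 1))" "dd d x = dl (d - 1) u'"
  show "s \<odot>\<^bsub>C d q\<^esub> x \<in> carrier (C d q)" using a by (simp add: C_closed)
  show "dl d (s \<odot>\<^bsub>C d q\<^esub> x) = \<zero>\<^bsub>C (d + 1) q\<^esub>" using a by (simp add: dl_smult C_zero)
  show "dd d (s \<odot>\<^bsub>C d q\<^esub> x) \<in> dl (d - 1) ` carrier (C (d - 1) (q - 1))"
    using a dl_smult[of s u' "d-1" "q-1"] by (intro image_eqI[of _ _ "s \<odot>\<^bsub>C (d - 1) (q - 1)\<^esub> u'"]) (auto simp: C_closed dd_smult)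
qed

lemma U_to_H:
  assumes q: "q \<ge> 0"
  shows "sq_iso S (C d q) (UZ d q) (UB d q) (C d q) (HZ q) (HB q)"
proof (rule sq_isoI[where \<rho> = "\<lambda>w y. w \<in> UZ d q \<and> y \<in> HZ q \<and> (\<exists>v\<in>carrier (C d (q + 1)). w = y \<oplus>\<^bsub>C d q\<^esub> dd d v)"])
  fix w assume w: "w \<in> UZ d q"
  then obtain w' where w': "w' \<in> carrier (C (d + 1) (q + 1))" "dl d w = dd (d + 1) w'" and wc: "w \<in> carrier (C d q)"
    and ddw: "dd d w \<in> dl (d - 1) ` carrier (C (d - 1) (q - 1))"
    unfolding UZ_def by blast
  have "dl (d + 1) (dd (d + 1) w') = \<zero>\<^bsub>C (d + 1 + 1) q\<^esub>" using dldl[OF wc] w' by (simp add: add.commute)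
  then obtain v where v: "v \<in> carrier (C d (q + 1))" "dl d w = dl d (dd d v)"
    using vanish[of "d + 1" q w'] w' q by auto
  have dv: "dd d v \<in> carrier (C d q)" using dd_closed[OF v(1)] by simp
  let ?y = "w \<ominus>\<^bsub>C d q\<^esub> dd d v"
  have y: "?y \<in> carrier (C d q)" by (rule C_closed(2)[OF wc dv])
  have "dd d ?y = dd d w \<ominus>\<^bsub>C d (q - 1)\<^esub> \<zero>\<^bsub>C d (q - 1)\<^esub>" using dd_minus[OF wc dv] dddd[OF v(1)] by simp
  also have "\<dots> = dd d w"
    using C_minus_add(2)[of "dd d w" d "q - 1" "\<zero>\<^bsub>C d (q - 1)\<^esub>"] C_closed C_zero(2) dd_closed[OF wc] by simp
  finally have "?y \<in> HZ q" unfolding HZ_def using y dl_dd_minus[OF wc v] ddw by simp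
  then show "\<exists>y. w \<in> UZ d q \<and> y \<in> HZ q \<and> (\<exists>v\<in>carrier (C d (q + 1)). w = y \<oplus>\<^bsub>C d q\<^esub> dd d v)"
    using w v(1) C_minus_add(2)[OF wc dv] by blast
next
  fix y assume y: "y \<in> HZ q"
  have "dd (d + 1) \<zero>\<^bsub>C (d + 1) (q + 1)\<^esub> = \<zero>\<^bsub>C (d + 1) q\<^esub>" using dd_zero[of "d + 1" "q + 1"] by simp
  then have "\<zero>\<^bsub>C (d + 1) q\<^esub> \<in> dd (d + 1) ` carrier (C (d + 1) (q + 1))" using C_closed(4) by (metis imageI)
  then have 1: "y \<in> UZ d q" using y unfolding HZ_def UZ_def by auto
  have "dd d \<zero>\<^bsub>C d (q + 1)\<^esub> = \<zero>\<^bsub>C d q\<^esub>" using dd_zero[of d "q + 1"] by simp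
  then have "y = y \<oplus>\<^bsub>C d q\<^esub> dd d \<zero>\<^bsub>C d (q + 1)\<^esub>" using y C_zero(2) unfolding HZ_def by simp
  then show "\<exists>w. w \<in> UZ d q \<and> y \<in> HZ q \<and> (\<exists>v\<in>carrier (C d (q + 1)). w = y \<oplus>\<^bsub>C d q\<^esub> dd d v)"
    using 1 y C_closed(4) by blast
next
  fix w y assume "w \<in> UZ d q \<and> y \<in> HZ q \<and> (\<exists>v\<in>carrier (C d (q + 1)). w = y \<oplus>\<^bsub>C d q\<^esub> dd d v)"
  then obtain v where wy: "w \<in> UZ d q" "y \<in> HZ q" and v: "v \<in> carrier (C d (q + 1))" and w: "w = y \<oplus>\<^bsub>C d q\<^esub> dd d v" by blast
  have yc: "y \<in> carrier (C d q)" "dl d y = \<zero>\<^bsub>C (d + 1) q\<^esub>" using wy unfolding HZ_def by auto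
  have dv: "dd d v \<in> carrier (C d q)" using dd_closed[OF v] by simp
  {
    assume "w \<in> UB d q"
    then obtain u v' where u: "u \<in> carrier (C (d - 1) q)" and v': "v' \<in> carrier (C d (q + 1))"
      and w': "w = dl (d - 1) u \<oplus>\<^bsub>C d q\<^esub> dd d v'" unfolding UB_def by blast
    have m: "dl (d - 1) u \<in> carrier (C d q)" "dd d v' \<in> carrier (C d q)" using dl_closed[OF u] dd_closed[OF v'] by auto
    \<comment> \<open>Now \<open>y\<close> equals \<open>dl (d - 1) u\<close> plus
      \<open>dd d ?t\<close>, but \<open>HB\<close> wants a row cocycle in place of
      \<open>?t\<close>. A second use of \<open>vanish\<close>, in degree \<open>q + 1\<close>,
      supplies \<open>z\<close> such that \<open>?t\<close> minus \<open>dd d z\<close> is one; this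
      leaves \<open>dd d ?t\<close> unchanged.\<close>
    let ?t = "v' \<ominus>\<^bsub>C d (q + 1)\<^esub> v"
    have t: "?t \<in> carrier (C d (q + 1))" by (rule C_closed(2)[OF v' v])
    have dt: "dd d ?t = dd d v' \<ominus>\<^bsub>C d q\<^esub> dd d v" using dd_minus[OF v' v] by simp
    interpret G: op_group S "C d q" by (rule opC)
    have y: "y = dl (d - 1) u \<oplus>\<^bsub>C d q\<^esub> dd d ?t"
      unfolding dt using w w' yc dv m
      by (metis G.a_assoc G.a_inv_closed G.add_minus_cancel a_minus_def)
    have "dl d (dd d ?t) = dl d (dl (d - 1) u) \<oplus>\<^bsub>C (d + 1) q\<^esub> dl d (dd d ?t)"
      using dldl[OF u] C_zero(1) dl_closed[OF dd_closed[OF t]] by (simp add: add.commute)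
    also have "\<dots> = dl d y" unfolding y using dl_add[OF m(1), of "dd d ?t"] dd_closed[OF t] by simp
    finally have "dl d (dd d ?t) = \<zero>\<^bsub>C (d + 1) q\<^esub>" using yc by simp
    then have "dd (d + 1) (dl d ?t) = \<zero>\<^bsub>C (d + 1) q\<^esub>" using comm[OF t] by simp
    then obtain x where x: "x \<in> carrier (C (d + 1) (q + 1 + 1))" "dl d ?t = dd (d + 1) x"
      using col_exact[of "q + 1" "dl d ?t" "d + 1"] dl_closed[OF t] q by auto
    have "dl (d + 1) (dd (d + 1) x) = \<zero>\<^bsub>C (d + 1 + 1) (q + 1)\<^esub>" using dldl[OF t] x by (simp add: add.commute)
    then obtain z where z: "z \<in> carrier (C d (q + 1 + 1))" "dl d ?t = dl d (dd d z)"
      using vanish[of "d + 1" "q + 1" x] x q by auto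
    have dz: "dd d z \<in> carrier (C d (q + 1))" by (rule dd_closed[OF z(1)]) simp
    let ?s = "?t \<ominus>\<^bsub>C d (q + 1)\<^esub> dd d z"
    have s: "?s \<in> carrier (C d (q + 1))" "dl d ?s = \<zero>\<^bsub>C (d + 1) (q + 1)\<^esub>"
      using C_closed(2)[OF t dz] dl_dd_minus[OF t z] by auto
    have "dd d ?s = dd d ?t \<ominus>\<^bsub>C d q\<^esub> \<zero>\<^bsub>C d q\<^esub>" using dd_minus[OF t dz] dddd[OF z(1)] by simp
    also have "\<dots> = dd d ?t"
      using C_minus_add(2)[of "dd d ?t" d q "\<zero>\<^bsub>C d q\<^esub>"] C_closed C_zero(2) dd_closed[OF t] by simp
    finally have "y = dl (d - 1) u \<oplus>\<^bsub>C d q\<^esub> dd d ?s" using y by simp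
    then show "y \<in> HB q" unfolding HB_def mem_Collect_eq using s u by (intro exI conjI)
  next
    assume "y \<in> HB q"
    then obtain u t where u: "u \<in> carrier (C (d - 1) q)" and t: "t \<in> carrier (C d (q + 1))"
      and y: "y = dl (d - 1) u \<oplus>\<^bsub>C d q\<^esub> dd d t" unfolding HB_def by blast
    interpret G: op_group S "C d q" by (rule opC)
    have m: "dl (d - 1) u \<in> carrier (C d q)" "dd d t \<in> carrier (C d q)" using dl_closed[OF u] dd_closed[OF t] by auto
    have "w = dl (d - 1) u \<oplus>\<^bsub>C d q\<^esub> dd d (t \<oplus>\<^bsub>C d (q + 1)\<^esub> v)"
      unfolding w y using m dv dd_add[OF t v] by (simp add: G.a_assoc)
    then show "w \<in> UB d q" unfolding UB_def using u C_closed(1)[OF t v] by blast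
  }
next
  fix x y x' y' assume "x \<in> UZ d q \<and> y \<in> HZ q \<and> (\<exists>v\<in>carrier (C d (q + 1)). x = y \<oplus>\<^bsub>C d q\<^esub> dd d v)"
     "x' \<in> UZ d q \<and> y' \<in> HZ q \<and> (\<exists>v\<in>carrier (C d (q + 1)). x' = y' \<oplus>\<^bsub>C d q\<^esub> dd d v)"
  then obtain v v' where a: "x \<in> UZ d q" "y \<in> HZ q" "x' \<in> UZ d q" "y' \<in> HZ q"
     and v: "v \<in> carrier (C d (q + 1))" "x = y \<oplus>\<^bsub>C d q\<^esub> dd d v" "v' \<in> carrier (C d (q + 1))" "x' = y' \<oplus>\<^bsub>C d q\<^esub> dd d v'" by blast
  have "y \<in> carrier (C d q)" "y' \<in> carrier (C d q)" using a unfolding HZ_def by auto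
  then have "x \<oplus>\<^bsub>C d q\<^esub> x' = (y \<oplus>\<^bsub>C d q\<^esub> y') \<oplus>\<^bsub>C d q\<^esub> dd d (v \<oplus>\<^bsub>C d (q + 1)\<^esub> v')"
    using v dd_add[OF v(1,3)] C_add_add dd_closed[OF v(1)] dd_closed[OF v(3)] by simp
  then show "x \<oplus>\<^bsub>C d q\<^esub> x' \<in> UZ d q \<and> y \<oplus>\<^bsub>C d q\<^esub> y' \<in> HZ q \<and> (\<exists>v\<in>carrier (C d (q + 1)). x \<oplus>\<^bsub>C d q\<^esub> x' = y \<oplus>\<^bsub>C d q\<^esub> y' \<oplus>\<^bsub>C d q\<^esub> dd d v)"
    using a UZ_add HZ_add C_closed(1)[OF v(1,3)] by blast
next
  fix s x y assume s: "s \<in> carrier S" and "x \<in> UZ d q \<and> y \<in> HZ q \<and> (\<exists>v\<in>carrier (C d (q + 1)). x = y \<oplus>\<^bsub>C d q\<^esub> dd d v)"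
  then obtain v where a: "x \<in> UZ d q" "y \<in> HZ q" and v: "v \<in> carrier (C d (q + 1))" "x = y \<oplus>\<^bsub>C d q\<^esub> dd d v" by blast
  interpret G: op_group S "C d q" by (rule opC)
  have "y \<in> carrier (C d q)" using a unfolding HZ_def by auto
  then have "s \<odot>\<^bsub>C d q\<^esub> x = s \<odot>\<^bsub>C d q\<^esub> y \<oplus>\<^bsub>C d q\<^esub> dd d (s \<odot>\<^bsub>C d (q + 1)\<^esub> v)"
    using v dd_smult[OF s v(1)] dd_closed[OF v(1)] s G.op_add by simp
  then show "s \<odot>\<^bsub>C d q\<^esub> x \<in> UZ d q \<and> s \<odot>\<^bsub>C d q\<^esub> y \<in> HZ q \<and> (\<exists>v\<in>carrier (C d (q + 1)). s \<odot>\<^bsub>C d q\<^esub> x = s \<odot>\<^bsub>C d q\<^esub> y \<oplus>\<^bsub>C d q\<^esub> dd d v)"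
    using a s UZ_smult HZ_smult C_closed(3)[OF s v(1)] by blast
qed auto

section \<open>The ends of the diagonal\<close>

lemma D_to_U:
  "sq_iso S (D i) {x \<in> carrier (D i). dD i x = \<zero>\<^bsub>D (i + 1)\<^esub>} (dD (i - 1) ` carrier (D (i - 1)))
    (C i 0) (UZ i 0) (UB i 0)"
proof (rule sq_isoI[where \<rho> = "\<lambda>x w. x \<in> carrier (D i) \<and> dD i x = \<zero>\<^bsub>D (i + 1)\<^esub> \<and> w \<in> UZ i 0 \<and> ep i w = x"])
  \<comment> \<open>Row -1 is zero, so the second condition in \<open>UZ i 0\<close> holds
    automatically.\<close>
  have triv: "dd i w \<in> dl (i - 1) ` carrier (C (i - 1) (0 - 1))" if "w \<in> carrier (C i 0)" for w
    using neg[of "-1" i] neg[of "-1" "i - 1"] dd_closed[OF that] dl_zero[of "i - 1" "-1"] by auto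
  fix x assume "x \<in> {x \<in> carrier (D i). dD i x = \<zero>\<^bsub>D (i + 1)\<^esub>}"
  then have x: "x \<in> carrier (D i)" "dD i x = \<zero>\<^bsub>D (i + 1)\<^esub>" by auto
  obtain w where w: "w \<in> carrier (C i 0)" "ep i w = x" using ep_surj x by blast
  have "ep (i + 1) (dl i w) = \<zero>\<^bsub>D (i + 1)\<^esub>" using comm_ep[OF w(1)] w(2) x by simp
  then have "dl i w \<in> dd (i + 1) ` carrier (C (i + 1) 1)" using ep_exact dl_closed[OF w(1)] by blast
  then have "w \<in> UZ i 0" unfolding UZ_def using w triv by simp
  then show "\<exists>w. x \<in> carrier (D i) \<and> dD i x = \<zero>\<^bsub>D (i + 1)\<^esub> \<and> w \<in> UZ i 0 \<and> ep i w = x" using x w by blast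
next
  fix w assume w: "w \<in> UZ i 0"
  then obtain v where wc: "w \<in> carrier (C i 0)" and v: "v \<in> carrier (C (i + 1) 1)" "dl i w = dd (i + 1) v" unfolding UZ_def by auto
  have "ep i w \<in> carrier (D i)" using lin_closed[OF opC opD ep wc] .
  moreover have "dD i (ep i w) = \<zero>\<^bsub>D (i + 1)\<^esub>" using comm_ep[OF wc] v ep_dd by simp
  ultimately show "\<exists>x. x \<in> carrier (D i) \<and> dD i x = \<zero>\<^bsub>D (i + 1)\<^esub> \<and> w \<in> UZ i 0 \<and> ep i w = x" using w by blast
next
  fix x w assume "x \<in> carrier (D i) \<and> dD i x = \<zero>\<^bsub>D (i + 1)\<^esub> \<and> w \<in> UZ i 0 \<and> ep i w = x"
  then have x: "x \<in> carrier (D i)" "ep i w = x" and w: "w \<in> UZ i 0" "w \<in> carrier (C i 0)" unfolding UZ_def by auto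
  {
    assume "x \<in> dD (i - 1) ` carrier (D (i - 1))"
    then obtain y u where u: "u \<in> carrier (C (i - 1) 0)" "ep (i - 1) u = y" "x = dD (i - 1) y" using ep_surj by blast
    have e: "ep i (dl (i - 1) u) = x" using comm_ep[OF u(1)] u by simp
    have m: "dl (i - 1) u \<in> carrier (C i 0)" using dl_closed[OF u(1)] by simp
    have "ep i (w \<ominus>\<^bsub>C i 0\<^esub> dl (i - 1) u) = \<zero>\<^bsub>D i\<^esub>"
      using lin_minus[OF opC opD ep w(2) m] e x D_zero by simp
    then obtain v where "v \<in> carrier (C i 1)" "w \<ominus>\<^bsub>C i 0\<^esub> dl (i - 1) u = dd i v"
      using ep_exact C_closed(2)[OF w(2) m] by blast
    then show "w \<in> UB i 0" unfolding UB_def using C_minus_add(1)[OF w(2) m] u by auto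
  next
    assume "w \<in> UB i 0"
    then obtain u v where u: "u \<in> carrier (C (i - 1) 0)" and v: "v \<in> carrier (C i 1)"
      and w': "w = dl (i - 1) u \<oplus>\<^bsub>C i 0\<^esub> dd i v" unfolding UB_def by auto
    have m: "dl (i - 1) u \<in> carrier (C i 0)" "dd i v \<in> carrier (C i 0)" using dl_closed[OF u] dd_closed[OF v] by auto
    have "x = ep i (dl (i - 1) u) \<oplus>\<^bsub>D i\<^esub> \<zero>\<^bsub>D i\<^esub>" using lin_add[OF opC opD ep m] w' x ep_dd[OF v] by simp
    also have "\<dots> = dD (i - 1) (ep (i - 1) u)" using comm_ep[OF u] lin_closed[OF opC opD ep m(1)] D_zero by simp
    finally show "x \<in> dD (i - 1) ` carrier (D (i - 1))" using lin_closed[OF opC opD ep u] by blast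
  }
next
  fix x y x' y' assume "x \<in> carrier (D i) \<and> dD i x = \<zero>\<^bsub>D (i + 1)\<^esub> \<and> y \<in> UZ i 0 \<and> ep i y = x"
    "x' \<in> carrier (D i) \<and> dD i x' = \<zero>\<^bsub>D (i + 1)\<^esub> \<and> y' \<in> UZ i 0 \<and> ep i y' = x'"
  note a = this
  then have "y \<in> carrier (C i 0)" "y' \<in> carrier (C i 0)" unfolding UZ_def by auto
  then show "x \<oplus>\<^bsub>D i\<^esub> x' \<in> carrier (D i) \<and> dD i (x \<oplus>\<^bsub>D i\<^esub> x') = \<zero>\<^bsub>D (i + 1)\<^esub> \<and>
       y \<oplus>\<^bsub>C i 0\<^esub> y' \<in> UZ i 0 \<and> ep i (y \<oplus>\<^bsub>C i 0\<^esub> y') = x \<oplus>\<^bsub>D i\<^esub> x'"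
    using a UZ_add[of y i 0 y'] lin_add[OF opC opD ep, of y i y'] lin_add[OF opD opD dD, of x i x'] D_zero(1,4)
      abelian_monoid.a_closed[OF abelian_group.axioms(1)[OF op_group.axioms(1)[OF opD]], of x i x'] by auto
next
  fix s x y assume s: "s \<in> carrier S" and a: "x \<in> carrier (D i) \<and> dD i x = \<zero>\<^bsub>D (i + 1)\<^esub> \<and> y \<in> UZ i 0 \<and> ep i y = x"
  then have y: "y \<in> carrier (C i 0)" unfolding UZ_def by auto
  interpret G: op_group S "D i" by (rule opD)
  interpret G1: op_group S "D (i + 1)" by (rule opD)
  show "s \<odot>\<^bsub>D i\<^esub> x \<in> carrier (D i) \<and> dD i (s \<odot>\<^bsub>D i\<^esub> x) = \<zero>\<^bsub>D (i + 1)\<^esub> \<and>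
       s \<odot>\<^bsub>C i 0\<^esub> y \<in> UZ i 0 \<and> ep i (s \<odot>\<^bsub>C i 0\<^esub> y) = s \<odot>\<^bsub>D i\<^esub> x"
    using UZ_smult[of s y i 0] lin_smult[OF opC opD ep, of s y i] lin_smult[OF opD opD dD, of s x i] s a y G1.op_zero by auto
qed auto

text \<open>To the right of \<open>d\<close> there is no diagonal left to follow: the group it
  should reach sits in a row of negative index. What has to be shown is that \<open>D\<close> is
  exact there, again by correcting a lift with \<open>vanish\<close> before using row
  exactness.\<close>

lemma D_exact_above:
  assumes i: "i > d" and x: "x \<in> carrier (D i)" "dD i x = \<zero>\<^bsub>D (i + 1)\<^esub>"
  shows "x \<in> dD (i - 1) ` carrier (D (i - 1))"
proof -
  obtain w where w: "w \<in> carrier (C i 0)" "ep i w = x" using ep_surj x by blast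
  have "ep (i + 1) (dl i w) = \<zero>\<^bsub>D (i + 1)\<^esub>" using comm_ep[OF w(1)] w(2) x by simp
  then obtain y where y: "y \<in> carrier (C (i + 1) 1)" "dl i w = dd (i + 1) y" using ep_exact dl_closed[OF w(1)] by blast
  have "dl (i + 1) (dd (i + 1) y) = \<zero>\<^bsub>C (i + 1 + 1) 0\<^esub>" using dldl[OF w(1)] y by (simp add: add.commute)
  then obtain u where u: "u \<in> carrier (C i (0 + 1))" "dl i w = dl i (dd i u)"
    using vanish[of "i + 1" 0 y] y i by auto
  have du: "dd i u \<in> carrier (C i 0)" using dd_closed[OF u(1)] by simp
  obtain v where v: "v \<in> carrier (C (i - 1) 0)" "w \<ominus>\<^bsub>C i 0\<^esub> dd i u = dl (i - 1) v"
    using row_exact[of i, OF _ C_closed(2)[OF w(1) du] dl_dd_minus[OF w(1) u]] i by blast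
  have "x = ep i (w \<ominus>\<^bsub>C i 0\<^esub> dd i u)"
    using lin_minus[OF opC opD ep w(1) du] ep_dd u w x D_zero(3) by simp
  also have "\<dots> = dD (i - 1) (ep (i - 1) v)" using v comm_ep[OF v(1)] by simp
  finally show ?thesis using lin_closed[OF opC opD ep v(1)] by blast
qed

theorem D_to_H:
  "sq_iso S (D i) {x \<in> carrier (D i). dD i x = \<zero>\<^bsub>D (i + 1)\<^esub>} (dD (i - 1) ` carrier (D (i - 1)))
    (C d (d - i)) (HZ (d - i)) (HB (d - i))"
proof (cases "i \<le> d")
  case True
  then have n: "i + int (nat (d - i)) = d" "int (nat (d - i)) = d - i" by auto
  show ?thesis
    using sq_iso_trans[OF sq_iso_trans[OF D_to_U U_chain[of i "nat (d - i)"]]] U_to_H[of "d - i"] n by simp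
next
  case False
  let ?q = "d - i"
  have c: "carrier (C p ?q) = {\<zero>\<^bsub>C p ?q\<^esub>}" for p using neg False by simp
  have B: "\<zero>\<^bsub>C d ?q\<^esub> \<in> HB ?q"
  proof -
    have "\<zero>\<^bsub>C d ?q\<^esub> = dl (d - 1) \<zero>\<^bsub>C (d - 1) ?q\<^esub> \<oplus>\<^bsub>C d ?q\<^esub> dd d \<zero>\<^bsub>C d (?q + 1)\<^esub>"
      using dl_zero[of "d - 1" ?q] dd_zero[of d "?q + 1"] C_zero(1) C_closed(4) by simp
    then show ?thesis unfolding HB_def using C_closed(4) dl_zero[of d "?q + 1"] by blast
  qed
  have Z: "HZ ?q = {\<zero>\<^bsub>C d ?q\<^esub>}"
  proof -
    have "dd d \<zero>\<^bsub>C d ?q\<^esub> = dl (d - 1) \<zero>\<^bsub>C (d - 1) (?q - 1)\<^esub>"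
      using dl_zero[of "d - 1" "?q - 1"] dd_zero[of d ?q] by simp
    then have "dd d \<zero>\<^bsub>C d ?q\<^esub> \<in> dl (d - 1) ` carrier (C (d - 1) (?q - 1))" using C_closed(4) by blast
    then show ?thesis unfolding HZ_def c using dl_zero[of d ?q] by auto
  qed
  interpret G: op_group S "D i" by (rule opD)
  interpret G1: op_group S "D (i + 1)" by (rule opD)
  have z: "dD i \<zero>\<^bsub>D i\<^esub> = \<zero>\<^bsub>D (i + 1)\<^esub>" by (rule lin_zero[OF opD opD dD])
  show ?thesis
  \<comment> \<open>Both subquotients are trivial, so every cocycle may be related to every element
    of \<open>HZ ?q\<close>.\<close>
  proof (rule sq_isoI[where \<rho> = "\<lambda>x y. x \<in> carrier (D i) \<and> dD i x = \<zero>\<^bsub>D (i + 1)\<^esub> \<and> y \<in> HZ ?q"])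
    show "\<exists>x. x \<in> carrier (D i) \<and> dD i x = \<zero>\<^bsub>D (i + 1)\<^esub> \<and> y \<in> HZ ?q" if "y \<in> HZ ?q" for y
      using that z D_zero(1) by blast
  qed (use D_exact_above[of i] False B lin_add[OF opD opD dD, of _ i] lin_smult[OF opD opD dD, of _ _ i] in
        \<open>auto simp: Z C_zero C_closed G1.op_zero\<close>)
qed

end

section \<open>Homomorphisms and projective resolutions\<close>

lemma (in op_group) minus_zero: "x \<in> carrier C \<Longrightarrow> x \<ominus> \<zero> = x"
  by (metis add_minus_cancel r_zero zero_closed)

lemma lin_mapsD:
  assumes "f \<in> lin_maps A M N"
  shows "x \<in> carrier M \<Longrightarrow> f x \<in> carrier N"
    "\<lbrakk>x \<in> carrier M; y \<in> carrier M\<rbrakk> \<Longrightarrow> f (x \<oplus>\<^bsub>M\<^esub> y) = f x \<oplus>\<^bsub>N\<^esub> f y"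
    "\<lbrakk>a \<in> carrier A; x \<in> carrier M\<rbrakk> \<Longrightarrow> f (a \<odot>\<^bsub>M\<^esub> x) = a \<odot>\<^bsub>N\<^esub> f x"
  using assms by (auto simp: lin_maps_def)

lemma lin_mapsI:
  assumes "\<And>x. x \<in> carrier M \<Longrightarrow> f x \<in> carrier N"
    "\<And>x y. \<lbrakk>x \<in> carrier M; y \<in> carrier M\<rbrakk> \<Longrightarrow> f (x \<oplus>\<^bsub>M\<^esub> y) = f x \<oplus>\<^bsub>N\<^esub> f y"
    "\<And>a x. \<lbrakk>a \<in> carrier A; x \<in> carrier M\<rbrakk> \<Longrightarrow> f (a \<odot>\<^bsub>M\<^esub> x) = a \<odot>\<^bsub>N\<^esub> f x"
  shows "f \<in> lin_maps A M N"
  using assms by (auto simp: lin_maps_def)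

lemmas lin_zero_mod = lin_zero[OF left_module_op_group left_module_op_group]
  and lin_neg_mod = lin_neg[OF left_module_op_group left_module_op_group]
  and lin_minus_mod = lin_minus[OF left_module_op_group left_module_op_group]

lemma lin_maps_compose:
  assumes "f \<in> lin_maps A M N" "g \<in> lin_maps A N Q"
  shows "(\<lambda>x. g (f x)) \<in> lin_maps A M Q"
  by (rule lin_mapsI) (simp_all add: lin_mapsD[OF assms(1)] lin_mapsD[OF assms(2)])

lemma lin_maps_restrict:
  assumes "left_module A M" "f \<in> lin_maps A M N"
  shows "restrict f (carrier M) \<in> lin_maps A M N"
proof -
  interpret left_module A M by fact
  show ?thesis by (rule lin_mapsI) (simp_all add: lin_mapsD[OF assms(2)])
qed

lemma lin_maps_zero:
  assumes "left_module A N"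
  shows "(\<lambda>_. \<zero>\<^bsub>N\<^esub>) \<in> lin_maps A M N"
proof -
  interpret left_module A N by fact
  show ?thesis by (rule lin_mapsI) (simp_all add: smult_zero_r)
qed

lemma lin_maps_add:
  assumes "left_module A N" "f \<in> lin_maps A M N" "g \<in> lin_maps A M N"
  shows "(\<lambda>x. f x \<oplus>\<^bsub>N\<^esub> g x) \<in> lin_maps A M N"
proof -
  interpret left_module A N by fact
  show ?thesis
    by (rule lin_mapsI) (simp_all add: lin_mapsD[OF assms(2)] lin_mapsD[OF assms(3)] M.a_ac smult_r_distr)
qed

lemma lin_maps_minus:
  assumes "left_module A N" "f \<in> lin_maps A M N" "g \<in> lin_maps A M N"
  shows "(\<lambda>x. f x \<ominus>\<^bsub>N\<^esub> g x) \<in> lin_maps A M N"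
proof -
  interpret left_module A N by fact
  interpret O: op_group A N by (rule left_module_op_group) fact
  show ?thesis
    by (rule lin_mapsI)
      (simp_all add: a_minus_def lin_mapsD[OF assms(2)] lin_mapsD[OF assms(3)] M.a_ac M.minus_add smult_r_distr O.op_neg)
qed

lemma free_induct [consumes 2, case_names zero step]:
  assumes "ring A" "x \<in> carrier (free_module A I)"
    and 0: "P \<zero>\<^bsub>free_module A I\<^esub>"
    and step: "\<And>a i y. \<lbrakk>a \<in> carrier A; i \<in> I; y \<in> carrier (free_module A I); P y\<rbrakk> \<Longrightarrow>
      P (a \<odot>\<^bsub>free_module A I\<^esub> basis_vector A i \<oplus>\<^bsub>free_module A I\<^esub> y)"
  shows "P x"
  using assms(2)
proof (induct "card {i. x i \<noteq> \<zero>\<^bsub>A\<^esub>}" arbitrary: x)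
  case 0
  then have "x = \<zero>\<^bsub>free_module A I\<^esub>" by (auto simp: free_module_def)
  then show ?case using assms(3) by simp
next
  case (Suc n)
  interpret A: ring A by fact
  from Suc(2) obtain c where c: "x c \<noteq> \<zero>\<^bsub>A\<^esub>" by fastforce
  have fin: "finite {i. x i \<noteq> \<zero>\<^bsub>A\<^esub>}" using Suc by (auto simp: free_module_def)
  have s: "{i. (x(c := \<zero>\<^bsub>A\<^esub>)) i \<noteq> \<zero>\<^bsub>A\<^esub>} = {i. x i \<noteq> \<zero>\<^bsub>A\<^esub>} - {c}" by auto
  have cI: "c \<in> I" using Suc c by (auto simp: free_module_def)
  have m: "x(c := \<zero>\<^bsub>A\<^esub>) \<in> carrier (free_module A I)"
    using Suc(3) unfolding free_module_def by (auto intro: finite_subset[OF _ fin])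
  moreover have "n = card {i. (x(c := \<zero>\<^bsub>A\<^esub>)) i \<noteq> \<zero>\<^bsub>A\<^esub>}"
    using s Suc(2) c fin by simp
  ultimately have "P (x(c := \<zero>\<^bsub>A\<^esub>))" using Suc(1) by blast
  then have "P (x c \<odot>\<^bsub>free_module A I\<^esub> basis_vector A c \<oplus>\<^bsub>free_module A I\<^esub> x(c := \<zero>\<^bsub>A\<^esub>))"
    using step cI m free_carrier_val[OF assms(1) Suc(3)] by blast
  moreover have "x c \<odot>\<^bsub>free_module A I\<^esub> basis_vector A c \<oplus>\<^bsub>free_module A I\<^esub> x(c := \<zero>\<^bsub>A\<^esub>) = x"
    using free_carrier_val[OF assms(1) Suc(3)] by (auto simp: free_module_def basis_vector_def)
  ultimately show ?case by simp
qed

lemma basis_vector_closed: "ring A \<Longrightarrow> i \<in> I \<Longrightarrow> basis_vector A i \<in> carrier (free_module A I)"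
  by (rule left_module.bv_in[OF free_left_module])

lemma free_maps_eq:
  assumes "ring A" "left_module A X" "f \<in> lin_maps A (free_module A I) X" "g \<in> lin_maps A (free_module A I) X"
    and "\<And>i. i \<in> I \<Longrightarrow> f (basis_vector A i) = g (basis_vector A i)"
    and "x \<in> carrier (free_module A I)"
  shows "f x = g x"
  using assms(1,6)
proof (induct rule: free_induct)
  case zero
  then show ?case using lin_zero_mod[OF free_left_module[OF assms(1)] assms(2,3)]
      lin_zero_mod[OF free_left_module[OF assms(1)] assms(2,4)] by simp
next
  case (step a i y)
  interpret F: left_module A "free_module A I" by (rule free_left_module) fact
  show ?case
    using step assms(5) basis_vector_closed[OF assms(1), of i I] lin_mapsD[OF assms(3)] lin_mapsD[OF assms(4)] by simp
qed

lemma projective_module: "projective A P \<Longrightarrow> left_module A P"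
  by (simp add: projective_def)

text \<open>In place of surjectivity of \<open>g\<close> there is the pointwise condition that
  \<open>f\<close> takes values in the image of \<open>g\<close>. This allows lifting along the
  differentials of a resolution without turning their images into modules.\<close>

lemma projective_lift:
  fixes P :: "('a, 'p, 'y) module_scheme"
  assumes P: "projective A P" and X: "left_module A X" and Y: "left_module A Y"
    and f: "f \<in> lin_maps A P X" and g: "g \<in> lin_maps A Y X"
    and sub: "\<And>x. x \<in> carrier P \<Longrightarrow> f x \<in> g ` carrier Y"
  obtains h where "h \<in> lin_maps A P Y" "\<And>x. x \<in> carrier P \<Longrightarrow> g (h x) = f x"
proof -
  interpret Y: left_module A Y by fact
  have A: "ring A" by (rule Y.R.ring_axioms)
  from P obtain I :: "'p set" and s r where s: "s \<in> lin_maps A P (free_module A I)" and r: "r \<in> lin_maps A (free_module A I) P"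
    and rs: "\<forall>x\<in>carrier P. r (s x) = x" unfolding projective_def by (elim conjE exE bexE) (rule that; assumption)
  have "\<forall>i\<in>I. \<exists>y. y \<in> carrier Y \<and> g y = f (r (basis_vector A i))"
  proof
    fix i assume "i \<in> I"
    then have "r (basis_vector A i) \<in> carrier P" by (rule lin_mapsD(1)[OF r basis_vector_closed[OF A]])
    from sub[OF this] show "\<exists>y. y \<in> carrier Y \<and> g y = f (r (basis_vector A i))" by force
  qed
  then obtain y where y: "\<forall>i\<in>I. y i \<in> carrier Y \<and> g (y i) = f (r (basis_vector A i))" by metis
  then have yI: "y \<in> I \<rightarrow> carrier Y" by auto
  define t where "t = linear_extension A Y y"
  have t: "t \<in> lin_maps A (free_module A I) Y" unfolding t_def by (rule Y.linext_lin[OF yI])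
  have "g (t x) = f (r x)" if "x \<in> carrier (free_module A I)" for x
    by (rule free_maps_eq[OF A X lin_maps_compose[OF t g] lin_maps_compose[OF r f] _ that])
      (use y Y.linext_bv[OF _ yI] in \<open>simp add: t_def\<close>)
  then have "g (t (s x)) = f x" if "x \<in> carrier P" for x using that rs lin_mapsD(1)[OF s that] by simp
  then show thesis using that[OF lin_maps_compose[OF s t]] by blast
qed

text \<open>This is the condition under which Hom(P, X) is stable under a scalar action on
  \<open>X\<close>. It will hold for right multiplication on \<open>A\<close> itself, for scalars
  acting through the centre of \<open>A\<close>, and for the identity action.\<close>

definition commuting_action ::
  "('a, 'z) ring_scheme \<Rightarrow> ('a, 'm, 'y) module_scheme \<Rightarrow> ('s, 'w) ring_scheme \<Rightarrow> ('s \<Rightarrow> 'm \<Rightarrow> 'm) \<Rightarrow> bool" where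
  "commuting_action A X S act \<longleftrightarrow> (\<forall>s\<in>carrier S. act s \<in> lin_maps A X X)"

lemma hom_sel:
  "carrier (hom_module A P X act) = lin_maps A P X \<inter> extensional (carrier P)"
  "\<zero>\<^bsub>hom_module A P X act\<^esub> = (\<lambda>p\<in>carrier P. \<zero>\<^bsub>X\<^esub>)"
  "f \<oplus>\<^bsub>hom_module A P X act\<^esub> g = (\<lambda>p\<in>carrier P. f p \<oplus>\<^bsub>X\<^esub> g p)"
  "s \<odot>\<^bsub>hom_module A P X act\<^esub> f = (\<lambda>p\<in>carrier P. act s (f p))"
  by (simp_all add: hom_module_def)

lemma hom_restrictI:
  assumes "left_module A P" "f \<in> lin_maps A P X"
  shows "restrict f (carrier P) \<in> carrier (hom_module A P X act)"
  using lin_maps_restrict[OF assms] by (simp add: hom_sel)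

lemma hom_eqI:
  assumes "f \<in> carrier (hom_module A P X act)" "g \<in> carrier (hom_module A P X act)"
    "\<And>x. x \<in> carrier P \<Longrightarrow> f x = g x"
  shows "f = g"
  using assms by (intro extensionalityI[of f "carrier P" g]) (auto simp: hom_sel)

lemma hom_op_group:
  assumes "left_module A P" "left_module A X" "commuting_action A X S act"
  shows "op_group S (hom_module A P X act)"
proof (intro op_group.intro abelian_groupI op_group_axioms.intro)
  interpret P: left_module A P by fact
  interpret X: left_module A X by fact
  let ?H = "hom_module A P X act"
  have c: "f x \<in> carrier X" if "f \<in> carrier ?H" "x \<in> carrier P" for f x
    using that by (auto simp: hom_sel intro: lin_mapsD)
  {
    fix f g assume f: "f \<in> carrier ?H" and g: "g \<in> carrier ?H"
    show "f \<oplus>\<^bsub>?H\<^esub> g \<in> carrier ?H" using f g lin_maps_restrict[OF assms(1) lin_maps_add[OF assms(2), of f P g]] by (simp add: hom_sel)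
    show "f \<oplus>\<^bsub>?H\<^esub> g = g \<oplus>\<^bsub>?H\<^esub> f" using c[OF f] c[OF g] by (auto simp: hom_sel X.M.a_comm)
    fix h assume h: "h \<in> carrier ?H"
    show "f \<oplus>\<^bsub>?H\<^esub> g \<oplus>\<^bsub>?H\<^esub> h = f \<oplus>\<^bsub>?H\<^esub> (g \<oplus>\<^bsub>?H\<^esub> h)"
      using c[OF f] c[OF g] c[OF h] by (auto simp: hom_sel X.M.a_assoc)
  next
    show z: "\<zero>\<^bsub>?H\<^esub> \<in> carrier ?H" using lin_maps_restrict[OF assms(1) lin_maps_zero[OF assms(2)]] by (simp add: hom_sel)
    fix f assume f: "f \<in> carrier ?H"
    show "\<zero>\<^bsub>?H\<^esub> \<oplus>\<^bsub>?H\<^esub> f = f"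
      by (rule extensionalityI[of _ "carrier P"]) (use f c[OF f] in \<open>auto simp: hom_sel\<close>)
    have "restrict (\<lambda>x. \<zero>\<^bsub>X\<^esub> \<ominus>\<^bsub>X\<^esub> f x) (carrier P) \<in> carrier ?H"
      by (rule hom_restrictI[OF assms(1) lin_maps_minus[OF assms(2) lin_maps_zero[OF assms(2)]]]) (use f in \<open>simp add: hom_sel\<close>)
    moreover have "restrict (\<lambda>x. \<zero>\<^bsub>X\<^esub> \<ominus>\<^bsub>X\<^esub> f x) (carrier P) \<oplus>\<^bsub>?H\<^esub> f = \<zero>\<^bsub>?H\<^esub>"
      using c[OF f] by (auto simp: hom_sel a_minus_def X.M.l_neg)
    ultimately show "\<exists>g\<in>carrier ?H. g \<oplus>\<^bsub>?H\<^esub> f = \<zero>\<^bsub>?H\<^esub>" by blast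
    fix s assume s: "s \<in> carrier S"
    then have a: "act s \<in> lin_maps A X X" using assms(3) by (simp add: commuting_action_def)
    show "s \<odot>\<^bsub>?H\<^esub> f \<in> carrier ?H"
      using f lin_maps_restrict[OF assms(1) lin_maps_compose[OF _ a, of f P]] by (simp add: hom_sel)
    fix g assume g: "g \<in> carrier ?H"
    show "s \<odot>\<^bsub>?H\<^esub> (f \<oplus>\<^bsub>?H\<^esub> g) = s \<odot>\<^bsub>?H\<^esub> f \<oplus>\<^bsub>?H\<^esub> s \<odot>\<^bsub>?H\<^esub> g"
      using c[OF f] c[OF g] lin_mapsD(2)[OF a] by (auto simp: hom_sel)
  }
qed

lemma hom_precompose:
  assumes "left_module A Q" "\<phi> \<in> lin_maps A Q P"
  shows "(\<lambda>f. compose (carrier Q) f \<phi>) \<in> lin_maps S (hom_module A P X act) (hom_module A Q X act)"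
proof (rule lin_mapsI)
  fix f assume f: "f \<in> carrier (hom_module A P X act)"
  show "compose (carrier Q) f \<phi> \<in> carrier (hom_module A Q X act)"
    using f hom_restrictI[OF assms(1) lin_maps_compose[OF assms(2), of f X]] by (simp add: hom_sel compose_def)
qed (use lin_mapsD(1)[OF assms(2)] in \<open>auto simp: hom_sel compose_def\<close>)

lemma hom_postcompose:
  assumes "left_module A P" "g \<in> lin_maps A X Y"
    "\<And>s x. s \<in> carrier S \<Longrightarrow> x \<in> carrier X \<Longrightarrow> g (act s x) = act' s (g x)"
  shows "(\<lambda>f. compose (carrier P) g f) \<in> lin_maps S (hom_module A P X act) (hom_module A P Y act')"
proof (rule lin_mapsI)
  fix f assume f: "f \<in> carrier (hom_module A P X act)"
  show "compose (carrier P) g f \<in> carrier (hom_module A P Y act')"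
    using f hom_restrictI[OF assms(1) lin_maps_compose[OF _ assms(2), of f P]] by (simp add: hom_sel compose_def)
  fix s assume s: "s \<in> carrier S"
  show "compose (carrier P) g (s \<odot>\<^bsub>hom_module A P X act\<^esub> f) = s \<odot>\<^bsub>hom_module A P Y act'\<^esub> compose (carrier P) g f"
    using f assms(3)[OF s] by (auto simp: hom_sel compose_def lin_maps_def Pi_iff intro!: restrict_ext)
next
  fix f f' assume "f \<in> carrier (hom_module A P X act)" "f' \<in> carrier (hom_module A P X act)"
  then show "compose (carrier P) g (f \<oplus>\<^bsub>hom_module A P X act\<^esub> f') =
       compose (carrier P) g f \<oplus>\<^bsub>hom_module A P Y act'\<^esub> compose (carrier P) g f'"
    using lin_mapsD(2)[OF assms(2)] by (auto simp: hom_sel compose_def lin_maps_def Pi_iff)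
qed

text \<open>No scalar action occurs here or in \<open>coboundaries\<close>. A vanishing result
  stated as an inclusion of these sets can therefore be proved with one action on the coefficients
  and used with another.\<close>

definition cocycles ::
  "('a, 'z) ring_scheme \<Rightarrow> (int \<Rightarrow> ('a, 'p) module) \<Rightarrow> (int \<Rightarrow> 'p \<Rightarrow> 'p) \<Rightarrow> ('a, 'm, 'x) module_scheme \<Rightarrow> int \<Rightarrow> ('p \<Rightarrow> 'm) set" where
  "cocycles A P d X i = {f \<in> lin_maps A (P i) X \<inter> extensional (carrier (P i)).
     \<forall>x\<in>carrier (P (i + 1)). f (d (i + 1) x) = \<zero>\<^bsub>X\<^esub>}"

text \<open>The primitive \<open>g\<close> is any linear map, extensional or not, which spares
  restrictions later; \<open>coboundaries_eq_image\<close> confirms that this yields the image of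
  the Hom complex.\<close>

definition coboundaries ::
  "('a, 'z) ring_scheme \<Rightarrow> (int \<Rightarrow> ('a, 'p) module) \<Rightarrow> (int \<Rightarrow> 'p \<Rightarrow> 'p) \<Rightarrow> ('a, 'm, 'x) module_scheme \<Rightarrow> int \<Rightarrow> ('p \<Rightarrow> 'm) set" where
  "coboundaries A P d X i = {f \<in> lin_maps A (P i) X \<inter> extensional (carrier (P i)).
     \<exists>g\<in>lin_maps A (P (i - 1)) X. \<forall>x\<in>carrier (P i). f x = g (d i x)}"

locale complex =
  fixes A :: "('a, 'z) ring_scheme" and P :: "int \<Rightarrow> ('a, 'p) module" and d :: "int \<Rightarrow> 'p \<Rightarrow> 'p"
  assumes Pmod: "left_module A (P i)"
    and d_lin: "d i \<in> lin_maps A (P i) (P (i - 1))"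
    and d_d: "x \<in> carrier (P (i + 1)) \<Longrightarrow> d i (d (i + 1) x) = \<zero>\<^bsub>P (i - 1)\<^esub>"
begin

lemma d_lin': "d (i + 1) \<in> lin_maps A (P (i + 1)) (P i)"
  using d_lin[of "i + 1"] by simp

lemma cocycles_eq_kernel:
  fixes X :: "('a, 'm, 'x) module_scheme"
  shows "cocycles A P d X i = a_kernel (hom_module A (P i) X act) (hom_module A (P (i + 1)) X act)
     (\<lambda>f. compose (carrier (P (i + 1))) f (d (i + 1)))"
proof -
  have "(compose (carrier (P (i + 1))) f (d (i + 1)) = (\<lambda>p\<in>carrier (P (i + 1)). \<zero>\<^bsub>X\<^esub>)) \<longleftrightarrow>
     (\<forall>x\<in>carrier (P (i + 1)). f (d (i + 1) x) = \<zero>\<^bsub>X\<^esub>)" for f :: "_ \<Rightarrow> 'm"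
    by (auto simp: compose_def fun_eq_iff restrict_def)
  then show ?thesis by (auto simp: cocycles_def a_kernel_def' hom_sel)
qed

lemma coboundaries_eq_image:
  "coboundaries A P d X i =
    (\<lambda>f. compose (carrier (P i)) f (d i)) ` carrier (hom_module A (P (i - 1)) X act)"
proof (intro equalityI subsetI)
  fix f assume "f \<in> coboundaries A P d X i"
  then obtain g where f: "f \<in> lin_maps A (P i) X" "f \<in> extensional (carrier (P i))"
    and g: "g \<in> lin_maps A (P (i - 1)) X" "\<forall>x\<in>carrier (P i). f x = g (d i x)" by (auto simp: coboundaries_def)
  have "f = compose (carrier (P i)) (restrict g (carrier (P (i - 1)))) (d i)"
    by (rule extensionalityI[of _ "carrier (P i)"]) (use f g lin_mapsD(1)[OF d_lin] in \<open>auto simp: compose_def\<close>)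
  then show "f \<in> (\<lambda>f. compose (carrier (P i)) f (d i)) ` carrier (hom_module A (P (i - 1)) X act)"
    using hom_restrictI[OF Pmod g(1)] by blast
next
  fix f assume "f \<in> (\<lambda>f. compose (carrier (P i)) f (d i)) ` carrier (hom_module A (P (i - 1)) X act)"
  then obtain g where g: "g \<in> carrier (hom_module A (P (i - 1)) X act)" "f = compose (carrier (P i)) g (d i)" by blast
  have "f \<in> carrier (hom_module A (P i) X act)"
    unfolding g(2) by (rule lin_mapsD(1)[OF hom_precompose[OF Pmod d_lin] g(1)])
  moreover have "\<forall>x\<in>carrier (P i). f x = g (d i x)" using g(2) by (simp add: compose_def)
  ultimately show "f \<in> coboundaries A P d X i" using g(1) by (auto simp: coboundaries_def hom_sel)
qed

lemma Ext_of_eq: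
  "Ext_of A P d X act i = quotient_module ((hom_module A (P i) X act)\<lparr>carrier := cocycles A P d X i\<rparr>) (coboundaries A P d X i)"
  by (simp add: Ext_of_def homology_def cocycles_eq_kernel[where act = act] coboundaries_eq_image[where act = act])

context
  fixes X :: "('a, 'm, 'x) module_scheme" and S :: "('s, 'w) ring_scheme" and act
  assumes X: "left_module A X" and act: "commuting_action A X S act"
begin

lemmas hom_og = hom_op_group[OF Pmod X act]

lemma op_sub_cocycles: "op_sub S (hom_module A (P i) X act) (cocycles A P d X i)"
  unfolding cocycles_eq_kernel[where act = act]
  by (rule op_sub_kernel[OF hom_og hom_og hom_precompose[OF Pmod d_lin']])

lemma op_sub_coboundaries: "op_sub S (hom_module A (P i) X act) (coboundaries A P d X i)"
  unfolding coboundaries_eq_image[where act = act]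
  by (rule op_sub_image[OF hom_og hom_og hom_precompose[OF Pmod d_lin] op_group.op_sub_carrier[OF hom_og]])

lemma coboundaries_subset: "coboundaries A P d X i \<subseteq> cocycles A P d X i"
proof
  fix f assume "f \<in> coboundaries A P d X i"
  then obtain g where f: "f \<in> lin_maps A (P i) X" "f \<in> extensional (carrier (P i))"
    and g: "g \<in> lin_maps A (P (i - 1)) X" "\<forall>x\<in>carrier (P i). f x = g (d i x)" by (auto simp: coboundaries_def)
  have "f (d (i + 1) x) = \<zero>\<^bsub>X\<^esub>" if "x \<in> carrier (P (i + 1))" for x
    using g(2) d_d[OF that] lin_mapsD(1)[OF d_lin' that] lin_zero_mod[OF Pmod X g(1)] by simp
  then show "f \<in> cocycles A P d X i" using f by (auto simp: cocycles_def)
qed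

end

end

section \<open>Projective resolutions and their comparison\<close>

locale resolution =
  fixes A :: "('a, 'z) ring_scheme" and N :: "('a, 'n, 'y) module_scheme"
    and P :: "int \<Rightarrow> ('a, 'p) module" and d :: "int \<Rightarrow> 'p \<Rightarrow> 'p" and e :: "'p \<Rightarrow> 'n"
  assumes res: "projective_resolution A N P d e" and N: "left_module A N"
begin

lemma proj: "projective A (P i)" and neg: "i < 0 \<Longrightarrow> carrier (P i) = {\<zero>\<^bsub>P i\<^esub>}"
  and d_lin: "d i \<in> lin_maps A (P i) (P (i - 1))"
  and e_lin: "e \<in> lin_maps A (P 0) N"
  using res by (auto simp: projective_resolution_def)

lemma e_surj: "y \<in> carrier N \<Longrightarrow> \<exists>x\<in>carrier (P 0). e x = y"
  using res unfolding projective_resolution_def by (metis imageE)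

lemma e_exact: "x \<in> carrier (P 0) \<Longrightarrow> e x = \<zero>\<^bsub>N\<^esub> \<Longrightarrow> x \<in> d 1 ` carrier (P 1)"
  using res unfolding projective_resolution_def a_kernel_def' by blast

lemma e_d: "x \<in> carrier (P 1) \<Longrightarrow> e (d 1 x) = \<zero>\<^bsub>N\<^esub>"
  using res unfolding projective_resolution_def a_kernel_def' by blast

lemma Pmod: "left_module A (P i)"
  by (rule projective_module[OF proj])

lemma exact: "i \<ge> 1 \<Longrightarrow> x \<in> carrier (P i) \<Longrightarrow> d i x = \<zero>\<^bsub>P (i - 1)\<^esub> \<Longrightarrow> x \<in> d (i + 1) ` carrier (P (i + 1))"
  using res unfolding projective_resolution_def a_kernel_def' by blast

lemma d_d: "x \<in> carrier (P (i + 1)) \<Longrightarrow> d i (d (i + 1) x) = \<zero>\<^bsub>P (i - 1)\<^esub>"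
proof (cases "i \<ge> 1")
  case True
  assume x: "x \<in> carrier (P (i + 1))"
  have "a_kernel (P i) (P (i - 1)) (d i) = d (i + 1) ` carrier (P (i + 1))"
    using res True unfolding projective_resolution_def by blast
  then show ?thesis using x unfolding a_kernel_def' by blast
next
  case False
  assume x: "x \<in> carrier (P (i + 1))"
  then have "d i (d (i + 1) x) \<in> carrier (P (i - 1))"
    using lin_mapsD(1)[OF d_lin[of i]] lin_mapsD(1)[OF d_lin[of "i + 1"]] by simp
  then show ?thesis using neg[of "i - 1"] False by simp
qed

sublocale complex A P d
  by (intro complex.intro Pmod d_lin d_d)

end

locale two_resolutions = P: resolution A N P d e + Q: resolution A N Q d' e'
  for A :: "('a, 'z) ring_scheme" and N :: "('a, 'n, 'y) module_scheme"
    and P :: "int \<Rightarrow> ('a, 'p) module" and d e and Q :: "int \<Rightarrow> ('a, 'q) module" and d' e'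
begin

lemma chain_map:
  obtains \<phi> where "\<And>i. \<phi> i \<in> lin_maps A (P i) (Q i)"
    "\<And>i x. x \<in> carrier (P i) \<Longrightarrow> d' i (\<phi> i x) = \<phi> (i - 1) (d i x)"
    "\<And>x. x \<in> carrier (P 0) \<Longrightarrow> e' (\<phi> 0 x) = e x"
proof -
  \<comment> \<open>Besides linearity the invariant records that the map sends boundaries to
    boundaries of \<open>Q\<close>. This is exactly what \<open>projective_lift\<close> needs to
    produce the map in the next degree, and exactness of \<open>Q\<close> restores it there.\<close>
  define R where "R n f \<longleftrightarrow> f \<in> lin_maps A (P (int n)) (Q (int n)) \<and> (n = 0 \<longrightarrow> (\<forall>x\<in>carrier (P 0). e' (f x) = e x)) \<and>
     (\<forall>x\<in>carrier (P (int n + 1)). f (d (int n + 1) x) \<in> d' (int n + 1) ` carrier (Q (int n + 1)))" for n f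
  define L where "L n f g \<longleftrightarrow> (\<forall>x\<in>carrier (P (int n + 1)). d' (int n + 1) (g x) = f (d (int n + 1) x))" for n and f g :: "'p \<Rightarrow> 'q"
  have "\<exists>f. \<forall>n. R n (f n) \<and> L n (f n) (f (Suc n))"
  proof (rule dependent_nat_choice)
    obtain f where f: "f \<in> lin_maps A (P 0) (Q 0)" "\<And>x. x \<in> carrier (P 0) \<Longrightarrow> e' (f x) = e x"
    proof (rule projective_lift[OF P.proj[of 0] P.N Q.Pmod[of 0] P.e_lin Q.e_lin])
      fix x assume "x \<in> carrier (P 0)"
      then show "e x \<in> e' ` carrier (Q 0)" using lin_mapsD(1)[OF P.e_lin] Q.e_surj by force
    qed blast
    have "f (d 1 x) \<in> d' 1 ` carrier (Q 1)" if "x \<in> carrier (P 1)" for x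
    proof -
      have "d 1 x \<in> carrier (P 0)" using lin_mapsD(1)[OF P.d_lin[of 1] that] by simp
      then show ?thesis using f P.e_d[OF that] lin_mapsD(1)[OF f(1)] by (intro Q.e_exact) auto
    qed
    then show "\<exists>f. R 0 f" unfolding R_def using f by auto
  next
    fix f n assume R: "R n f"
    then have f: "f \<in> lin_maps A (P (int n)) (Q (int n))" by (simp add: R_def)
    have dl: "d (int n + 1) \<in> lin_maps A (P (int n + 1)) (P (int n))" by (rule P.d_lin')
    have dl': "d' (int n + 1) \<in> lin_maps A (Q (int n + 1)) (Q (int n))" by (rule Q.d_lin')
    obtain g where g: "g \<in> lin_maps A (P (int n + 1)) (Q (int n + 1))"
       "\<And>x. x \<in> carrier (P (int n + 1)) \<Longrightarrow> d' (int n + 1) (g x) = f (d (int n + 1) x)"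
      by (rule projective_lift[OF P.proj Q.Pmod Q.Pmod lin_maps_compose[OF dl f] dl']) (use R in \<open>auto simp: R_def\<close>)
    have "g (d (int n + 2) x) \<in> d' (int n + 2) ` carrier (Q (int n + 2))" if x: "x \<in> carrier (P (int n + 2))" for x
    proof -
      have i: "int n + 1 + 1 = int n + 2" by simp
      have dx: "d (int n + 2) x \<in> carrier (P (int n + 1))" using lin_mapsD(1)[OF P.d_lin'[of "int n + 1"]] x unfolding i by simp
      have "d' (int n + 1) (g (d (int n + 2) x)) = f (d (int n + 1) (d (int n + 2) x))" by (rule g(2)[OF dx])
      also have "\<dots> = \<zero>\<^bsub>Q (int n + 1 - 1)\<^esub>"
        using P.d_d[of x "int n + 1"] x lin_zero_mod[OF P.Pmod Q.Pmod f] by (simp add: i)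
      finally show ?thesis using Q.exact[of "int n + 1", OF _ lin_mapsD(1)[OF g(1) dx]] by (simp add: i)
    qed
    then have "R (Suc n) g" unfolding R_def using g(1) by (simp add: add.commute)
    then show "\<exists>g. R (Suc n) g \<and> L n f g" unfolding L_def using g(2) by blast
  qed
  then obtain f where "\<forall>n. R n (f n) \<and> L n (f n) (f (Suc n))" by (rule exE)
  then have f: "R n (f n)" "L n (f n) (f (Suc n))" for n by simp_all
  define \<phi> where "\<phi> i = (if i < 0 then (\<lambda>_. \<zero>\<^bsub>Q i\<^esub>) else f (nat i))" for i
  have l: "\<phi> i \<in> lin_maps A (P i) (Q i)" for i
    using f(1)[of "nat i"] lin_maps_zero[OF Q.Pmod] by (cases "i < 0") (simp_all add: \<phi>_def R_def)
  have "d' i (\<phi> i x) = \<phi> (i - 1) (d i x)" if x: "x \<in> carrier (P i)" for i x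
  proof (cases "i \<ge> 1")
    case True
    then have "int (nat (i - 1)) = i - 1" "Suc (nat (i - 1)) = nat i" by auto
    then show ?thesis using True f(2)[of "nat (i - 1)"] x by (simp add: L_def \<phi>_def)
  next
    case False
    have "d' i (\<phi> i x) \<in> carrier (Q (i - 1))" by (rule lin_mapsD(1)[OF Q.d_lin lin_mapsD(1)[OF l x]])
    moreover have "\<phi> (i - 1) (d i x) \<in> carrier (Q (i - 1))" by (rule lin_mapsD(1)[OF l lin_mapsD(1)[OF P.d_lin x]])
    ultimately show ?thesis using Q.neg[of "i - 1"] False by simp
  qed
  moreover have "e' (\<phi> 0 x) = e x" if "x \<in> carrier (P 0)" for x using f(1)[of 0] that by (simp add: R_def \<phi>_def)
  ultimately show thesis by (rule that[OF l])
qed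

end

context resolution
begin

lemma homotopy:
  assumes \<chi>: "\<And>i. \<chi> i \<in> lin_maps A (P i) (P i)"
    and \<chi>d: "\<And>i x. x \<in> carrier (P i) \<Longrightarrow> d i (\<chi> i x) = \<chi> (i - 1) (d i x)"
    and \<chi>e: "\<And>x. x \<in> carrier (P 0) \<Longrightarrow> e (\<chi> 0 x) = \<zero>\<^bsub>N\<^esub>"
  obtains s where "\<And>i. s i \<in> lin_maps A (P (i - 1)) (P i)"
    "\<And>i x. x \<in> carrier (P i) \<Longrightarrow> d (i + 1) (s (i + 1) x) = \<chi> i x \<ominus>\<^bsub>P i\<^esub> s i (d i x)"
proof -
  \<comment> \<open>The \<open>n\<close>-th map goes from degree \<open>n\<close> to degree
    \<open>n + 1\<close>, so it becomes \<open>s (n + 1)\<close>. The invariant asks that the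
    remaining part of \<open>\<chi>\<close> in degree \<open>n + 1\<close> consists of boundaries,
    which is the condition for lifting it to the next map.\<close>
  define R where "R n f \<longleftrightarrow> f \<in> lin_maps A (P (int n)) (P (int n + 1)) \<and>
     (\<forall>x\<in>carrier (P (int n + 1)). \<chi> (int n + 1) x \<ominus>\<^bsub>P (int n + 1)\<^esub> f (d (int n + 1) x) \<in> d (int n + 2) ` carrier (P (int n + 2)))
     \<and> (n = 0 \<longrightarrow> (\<forall>x\<in>carrier (P 0). d 1 (f x) = \<chi> 0 x))" for n f
  define L where "L n f g \<longleftrightarrow> (\<forall>x\<in>carrier (P (int n + 1)). d (int n + 2) (g x) =
     \<chi> (int n + 1) x \<ominus>\<^bsub>P (int n + 1)\<^esub> f (d (int n + 1) x))" for n and f g :: "'p \<Rightarrow> 'p"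
  have "\<exists>f. \<forall>n. R n (f n) \<and> L n (f n) (f (Suc n))"
  proof (rule dependent_nat_choice)
    have d1: "d 1 \<in> lin_maps A (P 1) (P 0)" using d_lin[of 1] by simp
    obtain f where f: "f \<in> lin_maps A (P 0) (P 1)" "\<And>x. x \<in> carrier (P 0) \<Longrightarrow> d 1 (f x) = \<chi> 0 x"
      by (rule projective_lift[OF proj[of 0] Pmod[of 0] Pmod[of 1] \<chi>[of 0] d1])
        (use \<chi>e e_exact lin_mapsD(1)[OF \<chi>[of 0]] in blast)+
    have "\<chi> 1 x \<ominus>\<^bsub>P 1\<^esub> f (d 1 x) \<in> d 2 ` carrier (P 2)" if x: "x \<in> carrier (P 1)" for x
    proof -
      interpret P0: op_group A "P 0" by (rule left_module_op_group[OF Pmod])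
      interpret P1: op_group A "P 1" by (rule left_module_op_group[OF Pmod])
      have m: "d 1 x \<in> carrier (P 0)" "f (d 1 x) \<in> carrier (P 1)" "\<chi> 1 x \<in> carrier (P 1)" "\<chi> 0 (d 1 x) \<in> carrier (P 0)"
        using lin_mapsD(1)[OF d1 x] lin_mapsD(1)[OF f(1)] lin_mapsD(1)[OF \<chi> x] lin_mapsD(1)[OF \<chi>] by auto
      have "d 1 (\<chi> 1 x \<ominus>\<^bsub>P 1\<^esub> f (d 1 x)) = \<zero>\<^bsub>P (1 - 1)\<^esub>"
        using lin_minus_mod[OF Pmod Pmod d1 m(3,2)] \<chi>d[OF x] f(2)[OF m(1)] P0.minus_self[OF m(4)] by simp
      from exact[OF _ _ this] show ?thesis using m by simp
    qed
    then show "\<exists>f. R 0 f" unfolding R_def using f by auto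
  next
    fix f n assume R: "R n f"
    then have f: "f \<in> lin_maps A (P (int n)) (P (int n + 1))" by (simp add: R_def)
    have i: "int n + 1 + 1 = int n + 2" "int n + 2 - 1 = int n + 1" "int n + 2 + 1 = int n + 3" by simp_all
    have dl: "d (int n + 1) \<in> lin_maps A (P (int n + 1)) (P (int n))" by (rule d_lin')
    have dl2: "d (int n + 2) \<in> lin_maps A (P (int n + 2)) (P (int n + 1))" using d_lin'[of "int n + 1"] by (simp add: i)
    have dl3: "d (int n + 3) \<in> lin_maps A (P (int n + 3)) (P (int n + 2))" using d_lin'[of "int n + 2"] by (simp add: i)
    obtain g where g: "g \<in> lin_maps A (P (int n + 1)) (P (int n + 2))"
       "\<And>x. x \<in> carrier (P (int n + 1)) \<Longrightarrow> d (int n + 2) (g x) = \<chi> (int n + 1) x \<ominus>\<^bsub>P (int n + 1)\<^esub> f (d (int n + 1) x)"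
      by (rule projective_lift[OF proj Pmod Pmod lin_maps_minus[OF Pmod \<chi> lin_maps_compose[OF dl f]] dl2])
        (use R in \<open>auto simp: R_def\<close>)
    have "\<chi> (int n + 2) x \<ominus>\<^bsub>P (int n + 2)\<^esub> g (d (int n + 2) x) \<in> d (int n + 3) ` carrier (P (int n + 3))"
      if x: "x \<in> carrier (P (int n + 2))" for x
    proof -
      interpret P1: op_group A "P (int n + 1)" by (rule left_module_op_group[OF Pmod])
      interpret P2: op_group A "P (int n + 2)" by (rule left_module_op_group[OF Pmod])
      have m: "d (int n + 2) x \<in> carrier (P (int n + 1))" "g (d (int n + 2) x) \<in> carrier (P (int n + 2))"
          "\<chi> (int n + 2) x \<in> carrier (P (int n + 2))" "\<chi> (int n + 1) (d (int n + 2) x) \<in> carrier (P (int n + 1))"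
        using lin_mapsD(1)[OF dl2 x] lin_mapsD(1)[OF g(1)] lin_mapsD(1)[OF \<chi> x] lin_mapsD(1)[OF \<chi>] by auto
      have dd: "d (int n + 1) (d (int n + 2) x) = \<zero>\<^bsub>P (int n)\<^esub>" using d_d[of x "int n + 1"] x by (simp add: i)
      have fz: "f \<zero>\<^bsub>P (int n)\<^esub> = \<zero>\<^bsub>P (int n + 1)\<^esub>" by (rule lin_zero_mod[OF Pmod Pmod f])
      have "d (int n + 2) (\<chi> (int n + 2) x \<ominus>\<^bsub>P (int n + 2)\<^esub> g (d (int n + 2) x))
        = \<chi> (int n + 1) (d (int n + 2) x) \<ominus>\<^bsub>P (int n + 1)\<^esub> (\<chi> (int n + 1) (d (int n + 2) x) \<ominus>\<^bsub>P (int n + 1)\<^esub> \<zero>\<^bsub>P (int n + 1)\<^esub>)"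
        using lin_minus_mod[OF Pmod Pmod dl2 m(3,2)] \<chi>d[OF x] g(2)[OF m(1)] dd fz by (simp add: i)
      also have "\<dots> = \<zero>\<^bsub>P (int n + 2 - 1)\<^esub>"
        using P1.minus_self[OF m(4)] P1.minus_zero[OF m(4)] by (simp add: i)
      finally show ?thesis using exact[of "int n + 2", OF _ P2.minus_closed[OF m(3,2)]] by (simp add: i)
    qed
    then have "R (Suc n) g" unfolding R_def using g(1) by (simp add: add.commute)
    then show "\<exists>g. R (Suc n) g \<and> L n f g" unfolding L_def using g(2) by blast
  qed
  then obtain f where "\<forall>n. R n (f n) \<and> L n (f n) (f (Suc n))" by (rule exE)
  then have f: "R n (f n)" "L n (f n) (f (Suc n))" for n by simp_all
  define s where "s i = (if i < 1 then (\<lambda>_. \<zero>\<^bsub>P i\<^esub>) else f (nat (i - 1)))" for i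
  have l: "s i \<in> lin_maps A (P (i - 1)) (P i)" for i
    using f(1)[of "nat (i - 1)"] lin_maps_zero[OF Pmod] by (cases "i < 1") (simp_all add: s_def R_def)
  have "d (i + 1) (s (i + 1) x) = \<chi> i x \<ominus>\<^bsub>P i\<^esub> s i (d i x)" if x: "x \<in> carrier (P i)" for i x
  proof -
    interpret Pi: op_group A "P i" by (rule left_module_op_group[OF Pmod])
    consider "i \<ge> 1" | "i = 0" | "i < 0" by linarith
    then show ?thesis
    proof cases
      case 1
      then have "int (nat (i - 1)) = i - 1" "Suc (nat (i - 1)) = nat i" by auto
      then show ?thesis using 1 f(2)[of "nat (i - 1)"] x by (simp add: L_def s_def add.commute)
    next
      case 2
      have "\<chi> 0 x \<in> carrier (P 0)" using lin_mapsD(1)[OF \<chi>] x 2 by simp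
      then have "\<chi> 0 x \<ominus>\<^bsub>P 0\<^esub> \<zero>\<^bsub>P 0\<^esub> = \<chi> 0 x" using 2 Pi.minus_zero by simp
      then show ?thesis using 2 f(1)[of 0] x by (simp add: R_def s_def)
    next
      case 3
      have "s (i + 1) x \<in> carrier (P (i + 1))" using lin_mapsD(1)[OF l[of "i + 1"]] x by simp
      then have "d (i + 1) (s (i + 1) x) \<in> carrier (P i)" by (rule lin_mapsD(1)[OF d_lin'])
      moreover have "\<chi> i x \<ominus>\<^bsub>P i\<^esub> s i (d i x) \<in> carrier (P i)"
        by (rule Pi.minus_closed[OF lin_mapsD(1)[OF \<chi> x] lin_mapsD(1)[OF l lin_mapsD(1)[OF d_lin x]]])
      ultimately show ?thesis using neg[OF 3] by simp
    qed
  qed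
  then show thesis by (rule that[OF l])
qed

text \<open>The difference of the identity and \<open>\<chi>\<close> lies over zero on
  \<open>N\<close> and so has a contracting homotopy \<open>s\<close>. A cocycle \<open>f\<close>
  kills the term in which a differential is applied last, and the other term gives \<open>u\<close>
  as \<open>f\<close> after \<open>s i\<close>.\<close>

lemma chain_endomorphism:
  assumes \<chi>: "\<And>i. \<chi> i \<in> lin_maps A (P i) (P i)"
    and \<chi>d: "\<And>i x. x \<in> carrier (P i) \<Longrightarrow> d i (\<chi> i x) = \<chi> (i - 1) (d i x)"
    and \<chi>e: "\<And>x. x \<in> carrier (P 0) \<Longrightarrow> e (\<chi> 0 x) = e x"
    and X: "left_module A X" and f: "f \<in> cocycles A P d X i"
  obtains u where "u \<in> lin_maps A (P (i - 1)) X" "\<And>x. x \<in> carrier (P i) \<Longrightarrow> f x = f (\<chi> i x) \<oplus>\<^bsub>X\<^esub> u (d i x)"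
proof -
  have id: "(\<lambda>x. x) \<in> lin_maps A (P i) (P i)" for i by (rule lin_mapsI) auto
  have fl: "f \<in> lin_maps A (P i) X" and fd: "\<And>x. x \<in> carrier (P (i + 1)) \<Longrightarrow> f (d (i + 1) x) = \<zero>\<^bsub>X\<^esub>"
    using f by (auto simp: cocycles_def)
  obtain s where s: "\<And>i. s i \<in> lin_maps A (P (i - 1)) (P i)"
    and sd: "\<And>i x. x \<in> carrier (P i) \<Longrightarrow> d (i + 1) (s (i + 1) x) = (x \<ominus>\<^bsub>P i\<^esub> \<chi> i x) \<ominus>\<^bsub>P i\<^esub> s i (d i x)"
  proof (rule homotopy[where \<chi> = "\<lambda>i x. x \<ominus>\<^bsub>P i\<^esub> \<chi> i x"])
    show "(\<lambda>x. x \<ominus>\<^bsub>P i\<^esub> \<chi> i x) \<in> lin_maps A (P i) (P i)" for i by (rule lin_maps_minus[OF Pmod id \<chi>])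
    show "d i (x \<ominus>\<^bsub>P i\<^esub> \<chi> i x) = d i x \<ominus>\<^bsub>P (i - 1)\<^esub> \<chi> (i - 1) (d i x)" if "x \<in> carrier (P i)" for i x
      using lin_minus_mod[OF Pmod Pmod d_lin that lin_mapsD(1)[OF \<chi> that]] \<chi>d[OF that] by simp
    show "e (x \<ominus>\<^bsub>P 0\<^esub> \<chi> 0 x) = \<zero>\<^bsub>N\<^esub>" if "x \<in> carrier (P 0)" for x
      using lin_minus_mod[OF Pmod N e_lin that lin_mapsD(1)[OF \<chi> that]] \<chi>e[OF that]
        op_group.minus_self[OF left_module_op_group[OF N] lin_mapsD(1)[OF e_lin that]] by simp
  qed blast
  show thesis
  proof (rule that)
    show "(\<lambda>x. f (s i x)) \<in> lin_maps A (P (i - 1)) X" by (rule lin_maps_compose[OF s fl])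
    fix x assume x: "x \<in> carrier (P i)"
    interpret Pi: op_group A "P i" by (rule left_module_op_group[OF Pmod])
    interpret XO: op_group A X by (rule left_module_op_group[OF X])
    have m: "\<chi> i x \<in> carrier (P i)" "s i (d i x) \<in> carrier (P i)" "s (i + 1) x \<in> carrier (P (i + 1))"
      using lin_mapsD(1)[OF \<chi> x] lin_mapsD(1)[OF s lin_mapsD(1)[OF d_lin x]] lin_mapsD(1)[OF s[of "i + 1"]] x by auto
    note fm = lin_mapsD(1)[OF fl x] lin_mapsD(1)[OF fl m(1)] lin_mapsD(1)[OF fl m(2)]
    have "\<zero>\<^bsub>X\<^esub> = f ((x \<ominus>\<^bsub>P i\<^esub> \<chi> i x) \<ominus>\<^bsub>P i\<^esub> s i (d i x))" using fd[OF m(3)] sd[OF x] by simp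
    also have "\<dots> = (f x \<ominus>\<^bsub>X\<^esub> f (\<chi> i x)) \<ominus>\<^bsub>X\<^esub> f (s i (d i x))"
      using lin_minus_mod[OF Pmod X fl Pi.minus_closed[OF x m(1)] m(2)] lin_minus_mod[OF Pmod X fl x m(1)] by simp
    finally have "f x \<ominus>\<^bsub>X\<^esub> f (\<chi> i x) = f (s i (d i x))"
      using XO.minus_eq_zero[OF XO.minus_closed[OF fm(1,2)] fm(3)] by simp
    then show "f x = f (\<chi> i x) \<oplus>\<^bsub>X\<^esub> f (s i (d i x))"
      using XO.minus_add_cancel[OF fm(1,2)] fm by (simp add: XO.a_comm)
  qed
qed

end

context two_resolutions
begin

theorem comparison:
  assumes X: "left_module A X" and act: "commuting_action A X S act"
  shows "sq_iso S (hom_module A (P i) X act) (cocycles A P d X i) (coboundaries A P d X i)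
    (hom_module A (Q i) X act) (cocycles A Q d' X i) (coboundaries A Q d' X i)"
proof -
  interpret QP: two_resolutions A N Q d' e' P d e by unfold_locales
  interpret XO: op_group A X by (rule left_module_op_group[OF X])
  obtain \<phi> where \<phi>: "\<And>i. \<phi> i \<in> lin_maps A (P i) (Q i)"
    and \<phi>d: "\<And>i x. x \<in> carrier (P i) \<Longrightarrow> d' i (\<phi> i x) = \<phi> (i - 1) (d i x)"
    and \<phi>e: "\<And>x. x \<in> carrier (P 0) \<Longrightarrow> e' (\<phi> 0 x) = e x" by (rule chain_map) blast
  obtain \<psi> where \<psi>: "\<And>i. \<psi> i \<in> lin_maps A (Q i) (P i)"
    and \<psi>d: "\<And>i x. x \<in> carrier (Q i) \<Longrightarrow> d i (\<psi> i x) = \<psi> (i - 1) (d' i x)"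
    and \<psi>e: "\<And>x. x \<in> carrier (Q 0) \<Longrightarrow> e (\<psi> 0 x) = e' x" by (rule QP.chain_map) blast
  have hP: "\<exists>u\<in>lin_maps A (P (i - 1)) X. \<forall>x\<in>carrier (P i). f x = f (\<psi> i (\<phi> i x)) \<oplus>\<^bsub>X\<^esub> u (d i x)"
    if f: "f \<in> cocycles A P d X i" for f
  proof (rule P.chain_endomorphism[OF _ _ _ X f, of "\<lambda>i x. \<psi> i (\<phi> i x)"])
    show "(\<lambda>x. \<psi> i (\<phi> i x)) \<in> lin_maps A (P i) (P i)" for i by (rule lin_maps_compose[OF \<phi> \<psi>])
    show "d i (\<psi> i (\<phi> i x)) = \<psi> (i - 1) (\<phi> (i - 1) (d i x))" if "x \<in> carrier (P i)" for i x
      using \<phi>d[OF that] \<psi>d[OF lin_mapsD(1)[OF \<phi> that]] by simp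
    show "e (\<psi> 0 (\<phi> 0 x)) = e x" if "x \<in> carrier (P 0)" for x
      using \<phi>e[OF that] \<psi>e[OF lin_mapsD(1)[OF \<phi> that]] by simp
  qed blast
  have hQ: "\<exists>u\<in>lin_maps A (Q (i - 1)) X. \<forall>x\<in>carrier (Q i). g x = g (\<phi> i (\<psi> i x)) \<oplus>\<^bsub>X\<^esub> u (d' i x)"
    if g: "g \<in> cocycles A Q d' X i" for g
  proof (rule Q.chain_endomorphism[OF _ _ _ X g, of "\<lambda>i x. \<phi> i (\<psi> i x)"])
    show "(\<lambda>x. \<phi> i (\<psi> i x)) \<in> lin_maps A (Q i) (Q i)" for i by (rule lin_maps_compose[OF \<psi> \<phi>])
    show "d' i (\<phi> i (\<psi> i x)) = \<phi> (i - 1) (\<psi> (i - 1) (d' i x))" if "x \<in> carrier (Q i)" for i x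
      using \<psi>d[OF that] \<phi>d[OF lin_mapsD(1)[OF \<psi> that]] by simp
    show "e' (\<phi> 0 (\<psi> 0 x)) = e' x" if "x \<in> carrier (Q 0)" for x
      using \<psi>e[OF that] \<phi>e[OF lin_mapsD(1)[OF \<psi> that]] by simp
  qed blast
  have pull: "restrict (\<lambda>x. g (\<phi> i x)) (carrier (P i)) \<in> cocycles A P d X i" if g: "g \<in> cocycles A Q d' X i" for g
  proof -
    have gl: "g \<in> lin_maps A (Q i) X" and gd: "\<And>x. x \<in> carrier (Q (i + 1)) \<Longrightarrow> g (d' (i + 1) x) = \<zero>\<^bsub>X\<^esub>"
      using g by (auto simp: cocycles_def)
    show ?thesis unfolding cocycles_def
      using lin_maps_restrict[OF P.Pmod lin_maps_compose[OF \<phi> gl]] lin_mapsD(1)[OF P.d_lin'[of i]]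
        gd lin_mapsD(1)[OF \<phi>[of "i + 1"]] \<phi>d[of _ "i + 1", symmetric] by auto
  qed
  have push: "restrict (\<lambda>x. f (\<psi> i x)) (carrier (Q i)) \<in> cocycles A Q d' X i" if f: "f \<in> cocycles A P d X i" for f
  proof -
    have fl: "f \<in> lin_maps A (P i) X" and fd: "\<And>x. x \<in> carrier (P (i + 1)) \<Longrightarrow> f (d (i + 1) x) = \<zero>\<^bsub>X\<^esub>"
      using f by (auto simp: cocycles_def)
    show ?thesis unfolding cocycles_def
      using lin_maps_restrict[OF Q.Pmod lin_maps_compose[OF \<psi> fl]] lin_mapsD(1)[OF Q.d_lin'[of i]]
        fd lin_mapsD(1)[OF \<psi>[of "i + 1"]] \<psi>d[of _ "i + 1", symmetric] by auto
  qed
  \<comment> \<open>The relation says that \<open>f\<close> is cohomologous to the pullback of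
    \<open>g\<close> along \<open>\<phi>\<close>. The map \<open>\<psi>\<close> stays out of it: it
    only supplies a partner for each \<open>f\<close> and a primitive of \<open>g\<close> from one
    of \<open>f\<close>. Allowing a coboundary \<open>u\<close> is what makes the relation total, as
    \<open>\<psi>\<close> after \<open>\<phi>\<close> is the identity only up to homotopy.\<close>
  define \<rho> where "\<rho> f g \<longleftrightarrow> f \<in> cocycles A P d X i \<and> g \<in> cocycles A Q d' X i \<and>
    (\<exists>u\<in>lin_maps A (P (i - 1)) X. \<forall>x\<in>carrier (P i). f x = g (\<phi> i x) \<oplus>\<^bsub>X\<^esub> u (d i x))" for f g
  note oP = P.op_sub_cocycles[OF X act, of i] and oQ = Q.op_sub_cocycles[OF X act, of i]
  have c: "f \<in> lin_maps A (P i) X" if "f \<in> cocycles A P d X i" for f using that by (simp add: cocycles_def)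
  have c': "f \<in> lin_maps A (Q i) X" if "f \<in> cocycles A Q d' X i" for f using that by (simp add: cocycles_def)
  show ?thesis
  proof (rule sq_isoI[where \<rho> = \<rho>])
    show "\<exists>g. \<rho> f g" if f: "f \<in> cocycles A P d X i" for f
    proof -
      obtain u where u: "u\<in>lin_maps A (P (i - 1)) X" "\<forall>x\<in>carrier (P i). f x = f (\<psi> i (\<phi> i x)) \<oplus>\<^bsub>X\<^esub> u (d i x)"
        using hP[OF f] by blast
      then show ?thesis unfolding \<rho>_def using push[OF f] f lin_mapsD(1)[OF \<phi>[of i]]
        by (intro exI[of _ "restrict (\<lambda>x. f (\<psi> i x)) (carrier (Q i))"]) auto
    qed
    show "\<exists>f. \<rho> f g" if g: "g \<in> cocycles A Q d' X i" for g
    proof -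
      have "g (\<phi> i x) \<oplus>\<^bsub>X\<^esub> \<zero>\<^bsub>X\<^esub> = g (\<phi> i x)" if "x \<in> carrier (P i)" for x
        using lin_mapsD(1)[OF c'[OF g] lin_mapsD(1)[OF \<phi> that]] by simp
      then show ?thesis unfolding \<rho>_def using pull[OF g] g lin_maps_zero[OF X, of "P (i - 1)"]
        by (intro exI[of _ "restrict (\<lambda>x. g (\<phi> i x)) (carrier (P i))"] conjI bexI[of _ "\<lambda>_. \<zero>\<^bsub>X\<^esub>"]) auto
    qed
    show "\<rho> (f \<oplus>\<^bsub>hom_module A (P i) X act\<^esub> f') (g \<oplus>\<^bsub>hom_module A (Q i) X act\<^esub> g')" if r: "\<rho> f g" "\<rho> f' g'" for f g f' g'
    proof -
      obtain u u' where u: "u\<in>lin_maps A (P (i - 1)) X" "\<forall>x\<in>carrier (P i). f x = g (\<phi> i x) \<oplus>\<^bsub>X\<^esub> u (d i x)"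
        and u': "u'\<in>lin_maps A (P (i - 1)) X" "\<forall>x\<in>carrier (P i). f' x = g' (\<phi> i x) \<oplus>\<^bsub>X\<^esub> u' (d i x)"
        and m: "f \<in> cocycles A P d X i" "f' \<in> cocycles A P d X i" "g \<in> cocycles A Q d' X i" "g' \<in> cocycles A Q d' X i"
        using r by (auto simp: \<rho>_def)
      have "\<forall>x\<in>carrier (P i). (f \<oplus>\<^bsub>hom_module A (P i) X act\<^esub> f') x =
        (g \<oplus>\<^bsub>hom_module A (Q i) X act\<^esub> g') (\<phi> i x) \<oplus>\<^bsub>X\<^esub> (u (d i x) \<oplus>\<^bsub>X\<^esub> u' (d i x))"
        using u(2) u'(2) lin_mapsD(1)[OF c'[OF m(3)]] lin_mapsD(1)[OF c'[OF m(4)]] lin_mapsD(1)[OF \<phi>[of i]]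
          lin_mapsD(1)[OF u(1)] lin_mapsD(1)[OF u'(1)] lin_mapsD(1)[OF P.d_lin[of i]] by (simp add: hom_sel XO.a_ac)
      then show ?thesis unfolding \<rho>_def
        by (intro conjI op_subD(3)[OF oP m(1,2)] op_subD(3)[OF oQ m(3,4)] bexI[OF _ lin_maps_add[OF X u(1) u'(1)]])
    qed
    show "\<rho> (s \<odot>\<^bsub>hom_module A (P i) X act\<^esub> f) (s \<odot>\<^bsub>hom_module A (Q i) X act\<^esub> g)" if s: "s \<in> carrier S" and r: "\<rho> f g" for s f g
    proof -
      obtain u where u: "u\<in>lin_maps A (P (i - 1)) X" "\<forall>x\<in>carrier (P i). f x = g (\<phi> i x) \<oplus>\<^bsub>X\<^esub> u (d i x)"
        and m: "f \<in> cocycles A P d X i" "g \<in> cocycles A Q d' X i"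
        using r by (auto simp: \<rho>_def)
      have a: "act s \<in> lin_maps A X X" using act s by (simp add: commuting_action_def)
      have "\<forall>x\<in>carrier (P i). (s \<odot>\<^bsub>hom_module A (P i) X act\<^esub> f) x =
        (s \<odot>\<^bsub>hom_module A (Q i) X act\<^esub> g) (\<phi> i x) \<oplus>\<^bsub>X\<^esub> act s (u (d i x))"
        using u(2) lin_mapsD(1)[OF c'[OF m(2)]] lin_mapsD(1)[OF \<phi>[of i]]
          lin_mapsD(1)[OF u(1)] lin_mapsD(1)[OF P.d_lin[of i]] lin_mapsD(2)[OF a] by (simp add: hom_sel)
      then show ?thesis unfolding \<rho>_def
        by (intro conjI op_subD(5)[OF oP s m(1)] op_subD(5)[OF oQ s m(2)] bexI[OF _ lin_maps_compose[OF u(1) a]])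
    qed
    show "g \<in> coboundaries A Q d' X i" if r: "\<rho> f g" and f: "f \<in> coboundaries A P d X i" for f g
    proof -
      obtain u where u: "u\<in>lin_maps A (P (i - 1)) X" "\<forall>x\<in>carrier (P i). f x = g (\<phi> i x) \<oplus>\<^bsub>X\<^esub> u (d i x)"
        and m: "f \<in> cocycles A P d X i" "g \<in> cocycles A Q d' X i"
        using r by (auto simp: \<rho>_def)
      obtain v where v: "v \<in> lin_maps A (P (i - 1)) X" "\<forall>x\<in>carrier (P i). f x = v (d i x)" using f by (auto simp: coboundaries_def)
      obtain w where w: "w\<in>lin_maps A (Q (i - 1)) X" "\<forall>x\<in>carrier (Q i). g x = g (\<phi> i (\<psi> i x)) \<oplus>\<^bsub>X\<^esub> w (d' i x)"
        using hQ[OF m(2)] by blast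
      \<comment> \<open>The primitives \<open>v\<close> and \<open>u\<close> of \<open>f\<close> and
        of its deviation from the pullback combine to a primitive of the pullback of
        \<open>g\<close>, which \<open>\<psi>\<close> moves to \<open>Q\<close>. The summand
        \<open>w\<close> accounts for the difference between \<open>g\<close> and its pullback along
        \<open>\<phi>\<close> after \<open>\<psi>\<close>.\<close>
      let ?t = "\<lambda>y. (v (\<psi> (i - 1) y) \<ominus>\<^bsub>X\<^esub> u (\<psi> (i - 1) y)) \<oplus>\<^bsub>X\<^esub> w y"
      have t: "?t \<in> lin_maps A (Q (i - 1)) X"
        by (rule lin_maps_add[OF X lin_maps_minus[OF X lin_maps_compose[OF \<psi> v(1)] lin_maps_compose[OF \<psi> u(1)]] w(1)])
      have "g x = ?t (d' i x)" if x: "x \<in> carrier (Q i)" for x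
      proof -
        let ?y = "\<psi> i x"
        have y: "?y \<in> carrier (P i)" using lin_mapsD(1)[OF \<psi> x] .
        then have dy: "d i ?y \<in> carrier (P (i - 1))" using lin_mapsD(1)[OF P.d_lin] by blast
        have "v (d i ?y) = g (\<phi> i ?y) \<oplus>\<^bsub>X\<^esub> u (d i ?y)" using u(2) v(2) y by simp
        then have "v (d i ?y) \<ominus>\<^bsub>X\<^esub> u (d i ?y) = g (\<phi> i ?y)"
          using XO.add_minus_cancel lin_mapsD(1)[OF c'[OF m(2)] lin_mapsD(1)[OF \<phi> y]] lin_mapsD(1)[OF u(1) dy] by simp
        then show ?thesis using w(2) x \<psi>d[OF x] by simp
      qed
      then show ?thesis using t m(2) by (auto simp: coboundaries_def cocycles_def)
    qed
    show "f \<in> coboundaries A P d X i" if r: "\<rho> f g" and g: "g \<in> coboundaries A Q d' X i" for f g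
    proof -
      obtain u where u: "u\<in>lin_maps A (P (i - 1)) X" "\<forall>x\<in>carrier (P i). f x = g (\<phi> i x) \<oplus>\<^bsub>X\<^esub> u (d i x)"
        and m: "f \<in> cocycles A P d X i" "g \<in> cocycles A Q d' X i"
        using r by (auto simp: \<rho>_def)
      obtain v where v: "v \<in> lin_maps A (Q (i - 1)) X" "\<forall>x\<in>carrier (Q i). g x = v (d' i x)" using g by (auto simp: coboundaries_def)
      have "f x = v (\<phi> (i - 1) (d i x)) \<oplus>\<^bsub>X\<^esub> u (d i x)" if x: "x \<in> carrier (P i)" for x
        using u(2) v(2) x lin_mapsD(1)[OF \<phi> x] \<phi>d[OF x] by simp
      then show ?thesis using lin_maps_add[OF X lin_maps_compose[OF \<phi> v(1)] u(1)] m(1)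
        by (auto simp: coboundaries_def cocycles_def)
    qed
  qed (auto simp: \<rho>_def)
qed

end

section \<open>Finitely generated free modules\<close>

lemma regular_sel:
  "carrier (regular_module A) = carrier A" "\<zero>\<^bsub>regular_module A\<^esub> = \<zero>\<^bsub>A\<^esub>"
  "x \<oplus>\<^bsub>regular_module A\<^esub> y = x \<oplus>\<^bsub>A\<^esub> y" "a \<odot>\<^bsub>regular_module A\<^esub> x = a \<otimes>\<^bsub>A\<^esub> x"
  by (simp_all add: regular_module_def)

lemma regular_left_module:
  assumes "ring A" shows "left_module A (regular_module A)"
proof -
  interpret A: ring A by fact
  show ?thesis
    by (intro left_module.intro left_module_axioms.intro abelian_groupI)
      (auto simp: regular_sel A.a_ac A.m_assoc A.l_distr A.r_distr A.ring_axioms intro: bexI[of _ "\<ominus>\<^bsub>A\<^esub> _"] A.l_neg)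
qed

lemma free_sel:
  "\<zero>\<^bsub>free_module A I\<^esub> i = \<zero>\<^bsub>A\<^esub>" "(f \<oplus>\<^bsub>free_module A I\<^esub> g) i = f i \<oplus>\<^bsub>A\<^esub> g i"
  "(a \<odot>\<^bsub>free_module A I\<^esub> f) i = a \<otimes>\<^bsub>A\<^esub> f i"
  by (simp_all add: free_module_def)

lemma free_zero_outside: "f \<in> carrier (free_module A I) \<Longrightarrow> i \<notin> I \<Longrightarrow> f i = \<zero>\<^bsub>A\<^esub>"
  by (simp add: free_module_def)

lemma free_neg:
  assumes "ring A" "f \<in> carrier (free_module A I)"
  shows "(\<ominus>\<^bsub>free_module A I\<^esub> f) i = \<ominus>\<^bsub>A\<^esub> (f i)"
proof -
  interpret A: ring A by fact
  interpret F: left_module A "free_module A I" by (rule free_left_module) fact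
  have "(\<ominus>\<^bsub>free_module A I\<^esub> f \<oplus>\<^bsub>free_module A I\<^esub> f) i = \<zero>\<^bsub>A\<^esub>" using F.M.l_neg[OF assms(2)] by (simp add: free_sel)
  then show ?thesis
    by (intro A.minus_equality[symmetric])
      (use free_carrier_val[OF assms(1,2)] free_carrier_val[OF assms(1) F.M.a_inv_closed[OF assms(2)]] in \<open>simp_all add: free_sel\<close>)
qed

lemma free_minus:
  assumes "ring A" "f \<in> carrier (free_module A I)" "g \<in> carrier (free_module A I)"
  shows "(f \<ominus>\<^bsub>free_module A I\<^esub> g) i = f i \<ominus>\<^bsub>A\<^esub> g i"
  using assms by (simp add: a_minus_def free_sel free_neg)

lemma free_finite_carrier:
  assumes "finite I"
  shows "carrier (free_module A I) = {f. (\<forall>i\<in>I. f i \<in> carrier A) \<and> (\<forall>i. i \<notin> I \<longrightarrow> f i = \<zero>\<^bsub>A\<^esub>)}"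
proof -
  have "finite {i. f i \<noteq> \<zero>\<^bsub>A\<^esub>}" if "\<forall>i. i \<notin> I \<longrightarrow> f i = \<zero>\<^bsub>A\<^esub>" for f :: "_ \<Rightarrow> 'b"
    by (rule finite_subset[OF _ assms]) (use that in auto)
  then show ?thesis by (auto simp: free_module_def)
qed

lemma coordinate_lin: "ring A \<Longrightarrow> (\<lambda>f. f i) \<in> lin_maps A (free_module A I) (regular_module A)"
  by (rule lin_mapsI) (simp_all add: regular_sel free_sel free_carrier_val)

section \<open>Submodules of finite free modules over a noetherian ring\<close>

lemma op_sub_iff_submodule:
  assumes "op_group R M"
  shows "op_sub R M I \<longleftrightarrow> submodule I R M"
proof -
  interpret op_group R M by fact
  show ?thesis
  proof
    assume "op_sub R M I"
    note s = op_subD[OF this]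
    show "submodule I R M"
      by (intro submodule.intro subgroup.intro submodule_axioms.intro)
        (use s in \<open>auto simp: a_inv_def[symmetric]\<close>)
  next
    assume "submodule I R M"
    then interpret I: submodule I R M .
    show "op_sub R M I" unfolding op_sub_def
      using I.subset I.m_closed I.one_closed I.m_inv_closed I.smult_closed by (auto simp: a_inv_def)
  qed
qed

text \<open>Generation is kept in the form of a minimality property, as in the definition of
  \<open>left_noetherian\<close>. It passes through images and coordinates without any handling of
  linear combinations.\<close>

lemma left_noetherian_gen:
  assumes A: "ring A" and n: "left_noetherian A" and I: "op_sub A (regular_module A) I"
  obtains S where "finite S" "S \<subseteq> I" "\<And>J. op_sub A (regular_module A) J \<Longrightarrow> S \<subseteq> J \<Longrightarrow> I \<subseteq> J"
proof -
  note e = op_sub_iff_submodule[OF left_module_op_group[OF regular_left_module[OF A]]]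
  obtain S where S: "finite S" "I = \<Inter>{J. submodule J A (regular_module A) \<and> S \<subseteq> J}"
    using n[unfolded left_noetherian_def, rule_format, OF I[unfolded e]] by (elim exE conjE)
  have "S \<subseteq> I" unfolding S(2) by blast
  moreover have "I \<subseteq> J" if "op_sub A (regular_module A) J" "S \<subseteq> J" for J unfolding S(2) using that unfolding e by blast
  ultimately show thesis using that S(1) by blast
qed

text \<open>Since a free module consists of functions vanishing outside the index set, the free
  module of rank \<open>n\<close> is literally a subset of the one of rank \<open>n + 1\<close>, and
  no inclusion map is needed.\<close>

lemma op_sub_free_last:
  assumes A: "ring A" and W: "op_sub A (free_module A {..<Suc n}) W"
  shows "op_sub A (free_module A {..<n}) {w \<in> W. w n = \<zero>\<^bsub>A\<^esub>}"
proof -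
  interpret A: ring A by fact
  let ?F = "free_module A {..<n}" and ?G = "free_module A {..<Suc n}"
  have sub: "w \<in> carrier ?F" if "w \<in> W" "w n = \<zero>\<^bsub>A\<^esub>" for w
    using op_sub_mem[OF W that(1)] that(2) by (auto simp: free_finite_carrier less_Suc_eq)
  have n: "\<ominus>\<^bsub>?F\<^esub> w = \<ominus>\<^bsub>?G\<^esub> w" if "w \<in> W" "w n = \<zero>\<^bsub>A\<^esub>" for w
    using free_neg[OF A sub[OF that]] free_neg[OF A op_sub_mem[OF W that(1)]] by (auto simp: fun_eq_iff)
  note o = free_ops[of A "{..<n}" "{..<Suc n}"]
  show ?thesis unfolding op_sub_def o
    using sub op_subD[OF W] n free_neg[OF A op_sub_mem[OF W]] by (auto simp: free_sel o)
qed

lemma op_sub_free_coordinate: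
  assumes A: "ring A" and W: "op_sub A (free_module A I) W"
  shows "op_sub A (regular_module A) ((\<lambda>w. w i) ` W)"
  by (rule op_sub_image[OF left_module_op_group[OF free_left_module[OF A]] left_module_op_group[OF regular_left_module[OF A]]
      coordinate_lin[OF A] W])

text \<open>Induction along 0 -> A^n -> A^(n+1) -> A -> 0: generators of the part with last
  coordinate zero are joined to lifts of generators of the left ideal of last coordinates.\<close>

lemma noetherian_submodule_gen:
  assumes A: "ring A" and noe: "left_noetherian A" and "op_sub A (free_module A {..<n :: nat}) Z"
  shows "\<exists>S. finite S \<and> S \<subseteq> Z \<and> (\<forall>W. op_sub A (free_module A {..<n}) W \<longrightarrow> S \<subseteq> W \<longrightarrow> Z \<subseteq> W)"
  using assms(3)
proof (induction n arbitrary: Z)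
  case 0
  have "Z \<subseteq> {\<zero>\<^bsub>free_module A {..<0 :: nat}\<^esub>}" using op_subD(1)[OF 0] by (auto simp: free_module_def)
  then show ?case using op_subD(2) by (intro exI[of _ "{}"]) blast
next
  case (Suc n)
  let ?F = "free_module A {..<n}" and ?G = "free_module A {..<Suc n}"
  interpret G: op_group A ?G by (rule left_module_op_group[OF free_left_module[OF A]])
  have Z': "op_sub A ?F {z \<in> Z. z n = \<zero>\<^bsub>A\<^esub>}" by (rule op_sub_free_last[OF A Suc.prems])
  from Suc.IH[OF this] obtain S' where S0: "finite S'" "S' \<subseteq> {z \<in> Z. z n = \<zero>\<^bsub>A\<^esub>}"
    "\<forall>W. op_sub A ?F W \<longrightarrow> S' \<subseteq> W \<longrightarrow> {z \<in> Z. z n = \<zero>\<^bsub>A\<^esub>} \<subseteq> W" by (elim exE conjE)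
  note S' = S0(1,2) S0(3)[rule_format]
  obtain S0 where S0: "finite S0" "S0 \<subseteq> (\<lambda>z. z n) ` Z"
    "\<And>J. op_sub A (regular_module A) J \<Longrightarrow> S0 \<subseteq> J \<Longrightarrow> (\<lambda>z. z n) ` Z \<subseteq> J"
    by (rule left_noetherian_gen[OF A noe op_sub_free_coordinate[OF A Suc.prems, of n]]) blast
  obtain L where L: "finite L" "L \<subseteq> Z" "S0 = (\<lambda>z. z n) ` L" using finite_subset_image[OF S0(1,2)] by metis
  have "Z \<subseteq> W" if W: "op_sub A ?G W" "S' \<union> L \<subseteq> W" for W
  proof
    fix z assume z: "z \<in> Z"
    \<comment> \<open>Comparing with the intersection and not with \<open>W\<close> alone provides a
      \<open>w\<close> with the right last coordinate that also lies in \<open>Z\<close>, so that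
      the difference of \<open>z\<close> and \<open>w\<close> falls into the part covered by the
      induction hypothesis.\<close>
    have WZ: "op_sub A ?G (W \<inter> Z)" by (rule G.op_sub_Int[OF W(1) Suc.prems])
    have "S0 \<subseteq> (\<lambda>z. z n) ` (W \<inter> Z)" using L W(2) by auto
    then have "(\<lambda>z. z n) ` Z \<subseteq> (\<lambda>z. z n) ` (W \<inter> Z)" by (rule S0(3)[OF op_sub_free_coordinate[OF A WZ]])
    then have "z n \<in> (\<lambda>z. z n) ` (W \<inter> Z)" using imageI[OF z, of "\<lambda>z. z n"] by (rule subsetD)
    then obtain w where w: "w \<in> W" "w \<in> Z" "w n = z n" by auto
    have c: "z \<in> carrier ?G" "w \<in> carrier ?G" using op_sub_mem[OF Suc.prems] z w by auto
    interpret A: ring A by fact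
    have "z \<ominus>\<^bsub>?G\<^esub> w \<in> Z" using op_subD(6)[OF Suc.prems z w(2)] .
    moreover have "(z \<ominus>\<^bsub>?G\<^esub> w) n = \<zero>\<^bsub>A\<^esub>"
      using free_minus[OF A c] w(3) free_carrier_val[OF A c(1)] by (simp add: a_minus_def A.r_neg)
    moreover have "{z \<in> Z. z n = \<zero>\<^bsub>A\<^esub>} \<subseteq> {w \<in> W. w n = \<zero>\<^bsub>A\<^esub>}"
      by (rule S'(3)[OF op_sub_free_last[OF A W(1)]]) (use S'(2) W(2) in auto)
    ultimately have "z \<ominus>\<^bsub>?G\<^esub> w \<in> W" by blast
    then show "z \<in> W" using op_subD(3)[OF W(1) _ w(1), of "z \<ominus>\<^bsub>?G\<^esub> w"] G.minus_add_cancel[OF c] by simp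
  qed
  then show ?case using S' L by (intro exI[of _ "S' \<union> L"]) auto
qed

text \<open>Numbering the generators by an initial segment of the natural numbers keeps all finite
  free modules in the type \<open>nat \<Rightarrow> 'a\<close>, as a resolution indexed by degree
  requires.\<close>

lemma noetherian_submodule_image:
  fixes Z :: "(nat \<Rightarrow> 'a) set" and n :: nat
  assumes A: "ring A" and noe: "left_noetherian A" and Z: "op_sub A (free_module A {..<n}) Z"
  obtains m :: nat and g where "g \<in> {..<m} \<rightarrow> Z"
    "Z \<subseteq> linear_extension A (free_module A {..<n}) g ` carrier (free_module A {..<m})"
proof -
  let ?F = "free_module A {..<n}"
  interpret F: left_module A ?F by (rule free_left_module) fact
  from noetherian_submodule_gen[OF A noe Z]
  obtain S where S0: "finite S" "S \<subseteq> Z" "\<forall>W. op_sub A ?F W \<longrightarrow> S \<subseteq> W \<longrightarrow> Z \<subseteq> W" by (elim exE conjE)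
  note S = S0(1,2) S0(3)[rule_format]
  obtain m :: nat and g where g: "S = g ` {..<m}" using finite_imp_nat_seg_image_inj_on[OF S(1)] by (metis lessThan_def)
  have gF: "g \<in> {..<m} \<rightarrow> carrier ?F" using g S(2) op_subD(1)[OF Z] by auto
  have "op_sub A ?F (linear_extension A ?F g ` carrier (free_module A {..<m}))"
    by (rule op_sub_image[OF left_module_op_group[OF free_left_module[OF A]] left_module_op_group[OF free_left_module[OF A]]
        F.linext_lin[OF gF] op_group.op_sub_carrier[OF left_module_op_group[OF free_left_module[OF A]]]])
  moreover have "S \<subseteq> linear_extension A ?F g ` carrier (free_module A {..<m})"
  proof
    fix x assume "x \<in> S"
    then obtain j where j: "j \<in> {..<m}" "x = g j" using g by blast
    have "x = linear_extension A ?F g (basis_vector A j)" using F.linext_bv[OF j(1) gF] j(2) by simp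
    then show "x \<in> linear_extension A ?F g ` carrier (free_module A {..<m})" using basis_vector_closed[OF A j(1)] by (rule image_eqI)
  qed
  ultimately have "Z \<subseteq> linear_extension A ?F g ` carrier (free_module A {..<m})" by (rule S(3))
  then show thesis using that g S(2) by blast
qed

section \<open>Complete filtered modules\<close>

definition h_complete :: "('s, 'c, 'y) module_scheme \<Rightarrow> 's \<Rightarrow> bool" where
  "h_complete C h \<longleftrightarrow> (\<forall>c. (\<forall>n. c n \<in> carrier C) \<longrightarrow>
     (\<exists>s. \<forall>n::nat. s n \<in> carrier C \<and> s n = c n \<oplus>\<^bsub>C\<^esub> h \<odot>\<^bsub>C\<^esub> s (Suc n)))"

text \<open>In a torsion-free module this says that only zero is divisible by every power of
  \<open>h\<close>: the successive quotients are then unique and form such a sequence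
  \<open>w\<close>. The formulation avoids powers of an element of an operator domain.\<close>

definition h_separated :: "('s, 'c, 'y) module_scheme \<Rightarrow> 's \<Rightarrow> bool" where
  "h_separated C h \<longleftrightarrow> (\<forall>w. (\<forall>n::nat. w n \<in> carrier C \<and> w n = h \<odot>\<^bsub>C\<^esub> w (Suc n)) \<longrightarrow> w 0 = \<zero>\<^bsub>C\<^esub>)"

definition h_torsion_free :: "('s, 'c, 'y) module_scheme \<Rightarrow> 's \<Rightarrow> bool" where
  "h_torsion_free C h \<longleftrightarrow> (\<forall>x\<in>carrier C. h \<odot>\<^bsub>C\<^esub> x = \<zero>\<^bsub>C\<^esub> \<longrightarrow> x = \<zero>\<^bsub>C\<^esub>)"

text \<open>Successive approximation; the sequence \<open>s\<close> stands for the tails of the series \<open>\<Sum> h\<^sup>n c\<^sub>n\<close>.\<close>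

lemma h_approximation:
  assumes C: "op_group S C" and D: "op_group S D" and G: "G \<in> lin_maps S C D" and h: "h \<in> carrier S"
    and compl: "h_complete C h" and sep: "h_separated D h" and Z: "Z \<subseteq> carrier D"
    and step: "\<And>z. z \<in> Z \<Longrightarrow> \<exists>c\<in>carrier C. \<exists>z'\<in>Z. z = G c \<oplus>\<^bsub>D\<^esub> h \<odot>\<^bsub>D\<^esub> z'"
  shows "Z \<subseteq> G ` carrier C"
proof
  interpret D: op_group S D by fact
  interpret C: op_group S C by fact
  fix z0 assume z0: "z0 \<in> Z"
  define nx where "nx z = (SOME z'. z' \<in> Z \<and> (\<exists>c\<in>carrier C. z = G c \<oplus>\<^bsub>D\<^esub> h \<odot>\<^bsub>D\<^esub> z'))" for z
  have nx: "nx z \<in> Z \<and> (\<exists>c\<in>carrier C. z = G c \<oplus>\<^bsub>D\<^esub> h \<odot>\<^bsub>D\<^esub> nx z)" if "z \<in> Z" for z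
    unfolding nx_def by (rule someI_ex) (use step[OF that] in blast)
  define z where "z n = (nx ^^ n) z0" for n
  have z: "z n \<in> Z" for n by (induction n) (use z0 nx in \<open>auto simp: z_def\<close>)
  have "\<forall>n. \<exists>c. c \<in> carrier C \<and> z n = G c \<oplus>\<^bsub>D\<^esub> h \<odot>\<^bsub>D\<^esub> z (Suc n)"
    using nx[OF z] by (auto simp: z_def)
  then obtain c where c: "\<And>n. c n \<in> carrier C" "\<And>n. z n = G (c n) \<oplus>\<^bsub>D\<^esub> h \<odot>\<^bsub>D\<^esub> z (Suc n)" by metis
  obtain s where s: "\<And>n. s n \<in> carrier C" "\<And>n. s n = c n \<oplus>\<^bsub>C\<^esub> h \<odot>\<^bsub>C\<^esub> s (Suc n)"
    using compl c(1) unfolding h_complete_def by metis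
  have zD: "z n \<in> carrier D" for n using z Z by blast
  note Gc = lin_mapsD(1)[OF G]
  \<comment> \<open>The error left after summation in stage \<open>n\<close> is \<open>h\<close>
    times the error in stage \<open>n + 1\<close>, so it is infinitely divisible and vanishes by
    separatedness.\<close>
  have "z n \<ominus>\<^bsub>D\<^esub> G (s n) = h \<odot>\<^bsub>D\<^esub> (z (Suc n) \<ominus>\<^bsub>D\<^esub> G (s (Suc n)))" for n
  proof -
    have "G (s n) = G (c n) \<oplus>\<^bsub>D\<^esub> h \<odot>\<^bsub>D\<^esub> G (s (Suc n))"
      using s(2)[of n] lin_mapsD(2)[OF G c(1), of "h \<odot>\<^bsub>C\<^esub> s (Suc n)" n] lin_mapsD(3)[OF G h s(1)] s(1) h by simp
    moreover have "(a \<oplus>\<^bsub>D\<^esub> x) \<ominus>\<^bsub>D\<^esub> (a \<oplus>\<^bsub>D\<^esub> y) = x \<ominus>\<^bsub>D\<^esub> y"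
      if "a \<in> carrier D" "x \<in> carrier D" "y \<in> carrier D" for a x y
    proof -
      have "(a \<oplus>\<^bsub>D\<^esub> x) \<ominus>\<^bsub>D\<^esub> (a \<oplus>\<^bsub>D\<^esub> y) = x \<oplus>\<^bsub>D\<^esub> (a \<oplus>\<^bsub>D\<^esub> (\<ominus>\<^bsub>D\<^esub> a \<oplus>\<^bsub>D\<^esub> \<ominus>\<^bsub>D\<^esub> y))"
        using that by (simp add: a_minus_def D.minus_add D.a_ac)
      then show ?thesis using that by (simp add: D.r_neg2 a_minus_def)
    qed
    moreover have "h \<odot>\<^bsub>D\<^esub> (z (Suc n) \<ominus>\<^bsub>D\<^esub> G (s (Suc n))) = h \<odot>\<^bsub>D\<^esub> z (Suc n) \<ominus>\<^bsub>D\<^esub> h \<odot>\<^bsub>D\<^esub> G (s (Suc n))"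
      using zD Gc[OF s(1)] h by (simp add: a_minus_def D.op_add D.op_neg)
    ultimately show ?thesis using c(2)[of n] Gc[OF c(1)] Gc[OF s(1)] zD h by simp
  qed
  moreover have "z n \<ominus>\<^bsub>D\<^esub> G (s n) \<in> carrier D" for n by (rule D.minus_closed[OF zD Gc[OF s(1)]])
  ultimately have "z 0 \<ominus>\<^bsub>D\<^esub> G (s 0) = \<zero>\<^bsub>D\<^esub>"
    by (intro sep[unfolded h_separated_def, rule_format, of "\<lambda>n. z n \<ominus>\<^bsub>D\<^esub> G (s n)"] conjI)
  then have "z0 = G (s 0)" using D.minus_eq_zero[OF zD Gc[OF s(1)], of 0 0] by (simp add: z_def)
  then show "z0 \<in> G ` carrier C" using s(1) by blast
qed

text \<open>What the homological part uses of a deformation: \<open>\<eta>\<close> is the image of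
  \<open>h\<close> in \<open>A\<close>, and \<open>\<pi>\<close> is the reduction onto
  \<open>A0\<close>. \<open>pi_ker\<close> together with \<open>pi_eta\<close> says that the kernel
  of \<open>\<pi>\<close> is generated by \<open>\<eta>\<close>.\<close>

locale h_adic = A: ring A + A0: ring A0
  for A :: "('a, 'z) ring_scheme" and A0 :: "('b, 'w) ring_scheme" and \<eta> :: 'a and \<pi> :: "'a \<Rightarrow> 'b" +
  assumes eta: "\<eta> \<in> carrier A"
    and central: "a \<in> carrier A \<Longrightarrow> a \<otimes>\<^bsub>A\<^esub> \<eta> = \<eta> \<otimes>\<^bsub>A\<^esub> a"
    and tf: "h_torsion_free (regular_module A) \<eta>"
    and compl: "h_complete (regular_module A) \<eta>"
    and sep: "h_separated (regular_module A) \<eta>"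
    and pi_hom: "\<pi> \<in> ring_hom A A0"
    and pi_surj: "\<pi> ` carrier A = carrier A0"
    and pi_ker: "\<lbrakk>a \<in> carrier A; \<pi> a = \<zero>\<^bsub>A0\<^esub>\<rbrakk> \<Longrightarrow> \<exists>b\<in>carrier A. a = \<eta> \<otimes>\<^bsub>A\<^esub> b"
    and pi_eta: "\<pi> \<eta> = \<zero>\<^bsub>A0\<^esub>"
    and noeth: "left_noetherian A0"
begin

interpretation pi: ring_hom_ring A A0 \<pi>
  by (rule ring_hom_ringI2[OF A.ring_axioms A0.ring_axioms pi_hom])

lemma pi_lift: "b \<in> carrier A0 \<Longrightarrow> \<exists>a\<in>carrier A. \<pi> a = b"
  using pi_surj by (metis imageE)

lemma tfD: "a \<in> carrier A \<Longrightarrow> \<eta> \<otimes>\<^bsub>A\<^esub> a = \<zero>\<^bsub>A\<^esub> \<Longrightarrow> a = \<zero>\<^bsub>A\<^esub>"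
  using tf by (simp add: h_torsion_free_def regular_sel)

lemma complete_series:
  assumes "\<And>n. c n \<in> carrier A"
  obtains s where "\<And>n. s n \<in> carrier A" "\<And>n. s n = c n \<oplus>\<^bsub>A\<^esub> \<eta> \<otimes>\<^bsub>A\<^esub> s (Suc n)"
  using compl[unfolded h_complete_def regular_sel] assms by meson

lemma free_torsion_free: "h_torsion_free (free_module A I) \<eta>"
  unfolding h_torsion_free_def
proof (intro ballI impI ext)
  fix x i assume x: "x \<in> carrier (free_module A I)" and e: "\<eta> \<odot>\<^bsub>free_module A I\<^esub> x = \<zero>\<^bsub>free_module A I\<^esub>"
  have "\<eta> \<otimes>\<^bsub>A\<^esub> x i = \<zero>\<^bsub>A\<^esub>" using fun_cong[OF e, of i] by (simp add: free_sel)
  then show "x i = \<zero>\<^bsub>free_module A I\<^esub> i" using tfD free_carrier_val[OF A.ring_axioms x] by (simp add: free_sel)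
qed

lemma free_separated: "h_separated (free_module A I) \<eta>"
  unfolding h_separated_def
proof (intro allI impI ext)
  fix w :: "nat \<Rightarrow> _" and i assume w: "\<forall>n. w n \<in> carrier (free_module A I) \<and> w n = \<eta> \<odot>\<^bsub>free_module A I\<^esub> w (Suc n)"
  have "w n i \<in> carrier A" for n by (rule free_carrier_val[OF A.ring_axioms conjunct1[OF w[rule_format, of n]]])
  moreover have "w n i = \<eta> \<otimes>\<^bsub>A\<^esub> w (Suc n) i" for n using fun_cong[OF conjunct2[OF w[rule_format, of n]], of i] by (simp only: free_sel)
  ultimately have "w 0 i = \<zero>\<^bsub>A\<^esub>"
    by (intro sep[unfolded h_separated_def regular_sel, rule_format, of "\<lambda>n. w n i"] conjI)
  then show "w 0 i = \<zero>\<^bsub>free_module A I\<^esub> i" by (simp only: free_sel)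
qed

text \<open>Series are summed in each coordinate. Finiteness of \<open>I\<close> guarantees that the
  sum is finitely supported again; torsion-freeness and separatedness above are coordinatewise for
  any index set.\<close>

lemma free_complete:
  assumes "finite I"
  shows "h_complete (free_module A I) \<eta>"
  unfolding h_complete_def
proof (intro allI impI)
  fix c :: "nat \<Rightarrow> _" assume c: "\<forall>n. c n \<in> carrier (free_module A I)"
  have "\<exists>s. \<forall>n. s n \<in> carrier A \<and> s n = c n i \<oplus>\<^bsub>A\<^esub> \<eta> \<otimes>\<^bsub>A\<^esub> s (Suc n)" for i
    using complete_series[of "\<lambda>n. c n i"] c free_carrier_val[OF A.ring_axioms] by metis
  then obtain s where s: "\<And>i n. s i n \<in> carrier A" "\<And>i n. s i n = c n i \<oplus>\<^bsub>A\<^esub> \<eta> \<otimes>\<^bsub>A\<^esub> s i (Suc n)" by metis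
  define t where "t n i = (if i \<in> I then s i n else \<zero>\<^bsub>A\<^esub>)" for n i
  have "t n \<in> carrier (free_module A I)" for n unfolding free_finite_carrier[OF assms] using s(1) by (auto simp: t_def)
  moreover have "t n = c n \<oplus>\<^bsub>free_module A I\<^esub> \<eta> \<odot>\<^bsub>free_module A I\<^esub> t (Suc n)" for n
  proof
    fix i
    show "t n i = (c n \<oplus>\<^bsub>free_module A I\<^esub> \<eta> \<odot>\<^bsub>free_module A I\<^esub> t (Suc n)) i"
      using s(2)[of i n] c eta free_zero_outside[of "c n" A I i] by (simp add: t_def free_sel)
  qed
  ultimately show "\<exists>s. \<forall>n. s n \<in> carrier (free_module A I) \<and> s n = c n \<oplus>\<^bsub>free_module A I\<^esub> \<eta> \<odot>\<^bsub>free_module A I\<^esub> s (Suc n)"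
    by blast
qed

text \<open>Restriction of scalars along \<open>\<pi>\<close>. With it a map from an
  \<open>A\<close>-module to an \<open>A0\<close>-module is an ordinary member of
  \<open>lin_maps A\<close>.\<close>

definition rs :: "('b, 'm, 'y) module_scheme \<Rightarrow> ('a, 'm) module" where
  "rs M = \<lparr>carrier = carrier M, mult = undefined, one = undefined, zero = zero M, add = add M,
     smult = (\<lambda>a. smult M (\<pi> a))\<rparr>"

lemma rs_sel: "carrier (rs M) = carrier M" "\<zero>\<^bsub>rs M\<^esub> = \<zero>\<^bsub>M\<^esub>" "x \<oplus>\<^bsub>rs M\<^esub> y = x \<oplus>\<^bsub>M\<^esub> y"
  "a \<odot>\<^bsub>rs M\<^esub> x = \<pi> a \<odot>\<^bsub>M\<^esub> x"
  by (simp_all add: rs_def)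

lemma rs_left_module:
  assumes "left_module A0 M" shows "left_module A (rs M)"
proof -
  interpret M: left_module A0 M by fact
  show ?thesis
  proof (intro left_module.intro left_module_axioms.intro abelian_groupI)
    show "x \<in> carrier (rs M) \<Longrightarrow> \<exists>y\<in>carrier (rs M). y \<oplus>\<^bsub>rs M\<^esub> x = \<zero>\<^bsub>rs M\<^esub>" for x
      unfolding rs_sel by (rule bexI[of _ "\<ominus>\<^bsub>M\<^esub> x"]) (auto simp: M.M.l_neg)
  qed (auto simp: rs_sel A.ring_axioms M.M.a_ac M.smult_l_distr M.smult_r_distr M.smult_assoc1)
qed

lemma rs_lin: "f \<in> lin_maps A0 M N \<Longrightarrow> f \<in> lin_maps A (rs M) (rs N)"
  by (auto simp: lin_maps_def rs_sel)

lemma rs_a_inv: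
  assumes M: "left_module A0 M" and x: "x \<in> carrier M" shows "\<ominus>\<^bsub>rs M\<^esub> x = \<ominus>\<^bsub>M\<^esub> x"
proof -
  interpret M: left_module A0 M by fact
  interpret R: left_module A "rs M" by (rule rs_left_module) fact
  show ?thesis using R.M.minus_equality[of "\<ominus>\<^bsub>M\<^esub> x" x] x by (simp add: rs_sel M.M.l_neg)
qed

text \<open>Surjectivity of \<open>\<pi>\<close>: every scalar of \<open>A0\<close> acts as some
  scalar of \<open>A\<close>.\<close>

lemma rs_op_sub:
  assumes M: "left_module A0 M" and B: "op_sub A (rs M) B" shows "op_sub A0 M B"
proof -
  have c: "x \<in> carrier M" if "x \<in> B" for x using op_subD(1)[OF B] that by (auto simp: rs_sel)
  have "s \<odot>\<^bsub>M\<^esub> x \<in> B" if "s \<in> carrier A0" "x \<in> B" for s x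
    using pi_lift[OF that(1)] op_subD(5)[OF B _ that(2)] by (auto simp: rs_sel)
  then show ?thesis unfolding op_sub_def
    using op_subD(2,3,4)[OF B] c rs_a_inv[OF M c] by (auto simp: rs_sel)
qed

section \<open>Reduction of free modules modulo \<open>\<eta>\<close>\<close>

definition red :: "('i \<Rightarrow> 'a) \<Rightarrow> 'i \<Rightarrow> 'b" where "red f = (\<lambda>i. \<pi> (f i))"

lemma red_lin: "red \<in> lin_maps A (free_module A I) (rs (free_module A0 I))"
proof (rule lin_mapsI)
  fix f assume f: "f \<in> carrier (free_module A I)"
  have "finite {i. \<pi> (f i) \<noteq> \<zero>\<^bsub>A0\<^esub>}"
    by (rule finite_subset[of _ "{i. f i \<noteq> \<zero>\<^bsub>A\<^esub>}"]) (use f in \<open>auto simp: free_module_def\<close>)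
  then show "red f \<in> carrier (rs (free_module A0 I))"
    using f by (auto simp: rs_sel free_module_def red_def)
qed (auto simp: rs_sel free_sel red_def free_carrier_val[OF A.ring_axioms] fun_eq_iff)

lemma red_closed: "f \<in> carrier (free_module A I) \<Longrightarrow> red f \<in> carrier (free_module A0 I)"
  using lin_mapsD(1)[OF red_lin] by (simp add: rs_sel)

lemma red_surj:
  assumes "g \<in> carrier (free_module A0 I)"
  shows "\<exists>f\<in>carrier (free_module A I). red f = g"
proof -
  \<comment> \<open>Zero coordinates must be lifted to zero, otherwise the lift could lose finite
    support. The same precaution is taken for quotients by \<open>\<eta>\<close> in
    \<open>red_zero\<close>.\<close>
  have "\<exists>a. a \<in> carrier A \<and> \<pi> a = g i \<and> (g i = \<zero>\<^bsub>A0\<^esub> \<longrightarrow> a = \<zero>\<^bsub>A\<^esub>)" for i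
    using pi_lift[OF free_carrier_val[OF A0.ring_axioms assms, of i]] by (cases "g i = \<zero>\<^bsub>A0\<^esub>") auto
  then obtain f where f: "\<And>i. f i \<in> carrier A" "\<And>i. \<pi> (f i) = g i" "\<And>i. g i = \<zero>\<^bsub>A0\<^esub> \<Longrightarrow> f i = \<zero>\<^bsub>A\<^esub>" by metis
  have "finite {i. f i \<noteq> \<zero>\<^bsub>A\<^esub>}"
    by (rule finite_subset[of _ "{i. g i \<noteq> \<zero>\<^bsub>A0\<^esub>}"]) (use f(3) assms in \<open>auto simp: free_module_def\<close>)
  then have "f \<in> carrier (free_module A I)" using f assms by (auto simp: free_module_def)
  then show ?thesis using f(2) by (auto simp: red_def)
qed

lemma red_zero:
  assumes f: "f \<in> carrier (free_module A I)" and z: "red f = \<zero>\<^bsub>free_module A0 I\<^esub>"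
  shows "\<exists>g\<in>carrier (free_module A I). f = \<eta> \<odot>\<^bsub>free_module A I\<^esub> g"
proof -
  have "\<exists>b. b \<in> carrier A \<and> f i = \<eta> \<otimes>\<^bsub>A\<^esub> b \<and> (f i = \<zero>\<^bsub>A\<^esub> \<longrightarrow> b = \<zero>\<^bsub>A\<^esub>)" for i
  proof (cases "f i = \<zero>\<^bsub>A\<^esub>")
    case True then show ?thesis using eta by auto
  next
    case False
    have "\<pi> (f i) = \<zero>\<^bsub>A0\<^esub>" using fun_cong[OF z, of i] by (simp add: red_def free_sel)
    then show ?thesis using pi_ker[OF free_carrier_val[OF A.ring_axioms f, of i]] False by blast
  qed
  then obtain g where g: "\<And>i. g i \<in> carrier A" "\<And>i. f i = \<eta> \<otimes>\<^bsub>A\<^esub> g i" "\<And>i. f i = \<zero>\<^bsub>A\<^esub> \<Longrightarrow> g i = \<zero>\<^bsub>A\<^esub>" by metis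
  have "finite {i. g i \<noteq> \<zero>\<^bsub>A\<^esub>}"
    by (rule finite_subset[of _ "{i. f i \<noteq> \<zero>\<^bsub>A\<^esub>}"]) (use g(3) f in \<open>auto simp: free_module_def\<close>)
  then have "g \<in> carrier (free_module A I)" using g f by (auto simp: free_module_def)
  moreover have "f = \<eta> \<odot>\<^bsub>free_module A I\<^esub> g" by (rule ext) (simp add: free_sel g(2)[symmetric])
  ultimately show ?thesis by blast
qed

lemma red_basis: "red (basis_vector A i) = basis_vector A0 i"
  by (auto simp: red_def basis_vector_def)

lemma red_eta: "f \<in> carrier (free_module A I) \<Longrightarrow> red (\<eta> \<odot>\<^bsub>free_module A I\<^esub> f) = \<zero>\<^bsub>free_module A0 I\<^esub>"
  by (auto simp: red_def free_sel pi_eta eta free_carrier_val[OF A.ring_axioms])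

text \<open>A map out of a free module is given by its values on the basis, and reduction maps basis
  to basis. So maps into an \<open>A0\<close>-module are the same over \<open>A\<close> and over
  \<open>A0\<close>.\<close>

lemma reduced_map:
  assumes X: "left_module A0 X" and f: "f \<in> lin_maps A (free_module A I) (rs X)"
  obtains f0 where "f0 \<in> lin_maps A0 (free_module A0 I) X"
    "\<And>x. x \<in> carrier (free_module A I) \<Longrightarrow> f0 (red x) = f x"
proof -
  interpret X: left_module A0 X by fact
  let ?g = "\<lambda>i. f (basis_vector A i)"
  have g: "?g \<in> I \<rightarrow> carrier X"
    using lin_mapsD(1)[OF f basis_vector_closed[OF A.ring_axioms]] by (auto simp: rs_sel)
  have l: "linear_extension A0 X ?g \<in> lin_maps A0 (free_module A0 I) X" by (rule X.linext_lin[OF g])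
  have "linear_extension A0 X ?g (red x) = f x" if "x \<in> carrier (free_module A I)" for x
    by (rule free_maps_eq[OF A.ring_axioms rs_left_module[OF X] lin_maps_compose[OF red_lin rs_lin[OF l]] f _ that])
      (simp add: red_basis X.linext_bv[OF _ g])
  then show thesis using that l by blast
qed

text \<open>The reduction of the kernel is a submodule of a finite free module over the noetherian
  ring \<open>A0\<close> and so finitely generated; lifts of generators generate the kernel by
  successive approximation. The kernel is saturated because \<open>X\<close> is torsion-free, and
  this keeps the approximation inside it.\<close>

lemma kernel_generators:
  fixes n :: nat
  assumes X: "left_module A X" and Xtf: "h_torsion_free X \<eta>" and q: "q \<in> lin_maps A (free_module A {..<n}) X"
  obtains m :: nat and g where "g \<in> lin_maps A (free_module A {..<m}) (free_module A {..<n})"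
    "g ` carrier (free_module A {..<m}) = {x \<in> carrier (free_module A {..<n}). q x = \<zero>\<^bsub>X\<^esub>}"
proof -
  let ?F = "free_module A {..<n}" and ?E = "free_module A0 {..<n}"
  let ?Z = "a_kernel ?F X q"
  interpret F: left_module A ?F by (rule free_left_module[OF A.ring_axioms])
  interpret FO: op_group A ?F by (rule left_module_op_group[OF F.left_module_axioms])
  interpret F0: left_module A0 ?E by (rule free_left_module[OF A0.ring_axioms])
  have Z: "op_sub A ?F ?Z" by (rule op_sub_kernel[OF FO.op_group_axioms left_module_op_group[OF X] q])
  have "op_sub A0 ?E (red ` ?Z)"
    by (rule rs_op_sub[OF F0.left_module_axioms op_sub_image[OF FO.op_group_axioms
       left_module_op_group[OF rs_left_module[OF F0.left_module_axioms]] red_lin Z]])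
  then obtain m :: nat and g0 where g0: "g0 \<in> {..<m} \<rightarrow> red ` ?Z"
    "red ` ?Z \<subseteq> linear_extension A0 ?E g0 ` carrier (free_module A0 {..<m})"
    by (rule noetherian_submodule_image[OF A0.ring_axioms noeth])
  have "\<forall>j\<in>{..<m}. \<exists>z. z \<in> ?Z \<and> red z = g0 j" 
  proof
    fix j assume "j \<in> {..<m}"
    then have "g0 j \<in> red ` ?Z" using g0(1) by (rule funcset_mem[rotated])
    then show "\<exists>z. z \<in> ?Z \<and> red z = g0 j" by (elim imageE) (intro exI conjI, assumption, rule sym)
  qed
  from bchoice[OF this] obtain g where "\<forall>j\<in>{..<m}. g j \<in> ?Z \<and> red (g j) = g0 j" by (rule exE)
  then have g: "\<And>j. j < m \<Longrightarrow> g j \<in> ?Z" "\<And>j. j < m \<Longrightarrow> red (g j) = g0 j" by simp_all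
  let ?Fm = "free_module A {..<m}"
  let ?G = "linear_extension A ?F g"
  have gF: "g \<in> {..<m} \<rightarrow> carrier ?F" using g(1) op_sub_mem[OF Z] by auto
  have G: "?G \<in> lin_maps A ?Fm ?F" by (rule F.linext_lin[OF gF])
  have GZ: "q (?G c) = \<zero>\<^bsub>X\<^esub>" if "c \<in> carrier ?Fm" for c
    by (rule free_maps_eq[OF A.ring_axioms X lin_maps_compose[OF G q] lin_maps_zero[OF X] _ that])
      (use g(1) F.linext_bv[OF _ gF] in \<open>auto simp: a_kernel_def'\<close>)
  have g0F: "g0 \<in> {..<m} \<rightarrow> carrier ?E"
    using red_closed[OF op_sub_mem[OF Z g(1)]] g(2) by (intro Pi_I) simp
  have G0: "linear_extension A0 ?E g0 \<in> lin_maps A0 (free_module A0 {..<m}) ?E" by (rule F0.linext_lin[OF g0F])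
  have Gred: "red (?G c) = linear_extension A0 ?E g0 (red c)" if "c \<in> carrier ?Fm" for c
    by (rule free_maps_eq[OF A.ring_axioms rs_left_module[OF F0.left_module_axioms] lin_maps_compose[OF G red_lin]
      lin_maps_compose[OF red_lin rs_lin[OF G0]] _ that])
      (use g(2) F.linext_bv[OF _ gF] F0.linext_bv[OF _ g0F] in \<open>auto simp: red_basis\<close>)
  have "?Z \<subseteq> ?G ` carrier ?Fm"
  proof (rule h_approximation[OF left_module_op_group[OF free_left_module[OF A.ring_axioms]] FO.op_group_axioms G eta
      free_complete[OF finite_lessThan] free_separated op_subD(1)[OF Z]])
    fix z assume z: "z \<in> ?Z"
    then have zF: "z \<in> carrier ?F" by (simp add: a_kernel_def')
    from z have "red z \<in> linear_extension A0 ?E g0 ` carrier (free_module A0 {..<m})" using g0(2) by blast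
    then obtain c0 where c0: "c0 \<in> carrier (free_module A0 {..<m})" "red z = linear_extension A0 ?E g0 c0" by blast
    obtain c where c: "c \<in> carrier ?Fm" "red c = c0" using red_surj[OF c0(1)] by blast
    have GcF: "?G c \<in> carrier ?F" by (rule lin_mapsD(1)[OF G c(1)])
    have GcZ: "?G c \<in> ?Z" using GcF GZ[OF c(1)] by (simp add: a_kernel_def')
    have "red (z \<ominus>\<^bsub>?F\<^esub> ?G c) = red z \<ominus>\<^bsub>rs ?E\<^esub> red (?G c)"
      by (rule lin_minus_mod[OF F.left_module_axioms rs_left_module[OF F0.left_module_axioms] red_lin zF GcF])
    also have "\<dots> = \<zero>\<^bsub>rs ?E\<^esub>"
      unfolding Gred[OF c(1)] c(2) c0(2)
      by (rule op_group.minus_self[OF left_module_op_group[OF rs_left_module[OF F0.left_module_axioms]]])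
       (use lin_mapsD(1)[OF G0 c0(1)] in \<open>simp add: rs_sel\<close>)
    finally obtain z1 where z1: "z1 \<in> carrier ?F" "z \<ominus>\<^bsub>?F\<^esub> ?G c = \<eta> \<odot>\<^bsub>?F\<^esub> z1"
      using red_zero[OF F.M.minus_closed[OF zF GcF]] by (auto simp: rs_sel)
    \<comment> \<open>Saturation: \<open>\<eta>\<close> times \<open>z1\<close> lies in the kernel,
      so \<open>\<eta>\<close> kills \<open>q z1\<close>, and torsion-freeness of \<open>X\<close>
      puts \<open>z1\<close> into the kernel.\<close>
    have "z \<ominus>\<^bsub>?F\<^esub> ?G c \<in> ?Z" by (rule op_subD(6)[OF Z z GcZ])
    then have "\<eta> \<odot>\<^bsub>X\<^esub> q z1 = \<zero>\<^bsub>X\<^esub>" using z1 lin_mapsD(3)[OF q eta z1(1)] by (simp add: a_kernel_def')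
    then have "q z1 = \<zero>\<^bsub>X\<^esub>" using Xtf lin_mapsD(1)[OF q z1(1)] by (simp add: h_torsion_free_def)
    then have "z1 \<in> ?Z" using z1 by (simp add: a_kernel_def')
    moreover have "z = ?G c \<oplus>\<^bsub>?F\<^esub> \<eta> \<odot>\<^bsub>?F\<^esub> z1"
      using FO.minus_add_cancel[OF zF GcF] z1 GcF F.M.a_comm[of "\<eta> \<odot>\<^bsub>?F\<^esub> z1" "?G c"] eta by simp
    ultimately show "\<exists>c\<in>carrier ?Fm. \<exists>z'\<in>?Z. z = ?G c \<oplus>\<^bsub>?F\<^esub> \<eta> \<odot>\<^bsub>?F\<^esub> z'" using c(1) by blast
  qed
  moreover have "?G ` carrier ?Fm \<subseteq> ?Z" using GZ lin_mapsD(1)[OF G] by (auto simp: a_kernel_def')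
  ultimately have "?G ` carrier ?Fm = {x \<in> carrier ?F. q x = \<zero>\<^bsub>X\<^esub>}" by (auto simp: a_kernel_def')
  then show thesis using that G by blast
qed

end

section \<open>Cohomology with coefficients in a free module\<close>

text \<open>Every value is a combination of the images of the finitely many basis vectors, each of
  which has finite support.\<close>

lemma finite_coordinates:
  fixes m :: nat
  assumes A: "ring A" and f: "f \<in> lin_maps A (free_module A {..<m}) (free_module A B)"
  shows "finite {b. \<exists>x\<in>carrier (free_module A {..<m}). f x b \<noteq> \<zero>\<^bsub>A\<^esub>}"
proof (rule finite_subset)
  let ?T = "\<Union>j<m. {b. f (basis_vector A j) b \<noteq> \<zero>\<^bsub>A\<^esub>}"
  have "finite {b. f (basis_vector A j) b \<noteq> \<zero>\<^bsub>A\<^esub>}" if "j < m" for j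
  proof -
    have "f (basis_vector A j) \<in> carrier (free_module A B)"
      using that by (intro lin_mapsD(1)[OF f basis_vector_closed[OF A]]) simp
    then show ?thesis by (simp add: free_module_def)
  qed
  then show "finite ?T" by simp
  show "{b. \<exists>x\<in>carrier (free_module A {..<m}). f x b \<noteq> \<zero>\<^bsub>A\<^esub>} \<subseteq> ?T"
  proof (rule subsetI, rule ccontr)
    fix b assume b: "b \<in> {b. \<exists>x\<in>carrier (free_module A {..<m}). f x b \<noteq> \<zero>\<^bsub>A\<^esub>}" and n: "b \<notin> ?T"
    have "f x b = \<zero>\<^bsub>regular_module A\<^esub>" if "x \<in> carrier (free_module A {..<m})" for x
      by (rule free_maps_eq[OF A regular_left_module[OF A] lin_maps_compose[OF f coordinate_lin[OF A]]
          lin_maps_zero[OF regular_left_module[OF A]] _ that]) (use n in \<open>simp add: regular_sel\<close>)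
    then show False using b by (simp add: regular_sel)
  qed
qed

lemma lin_maps_from_coordinates:
  assumes A: "ring A" and B': "finite B'" "B' \<subseteq> B"
    and u: "\<And>b. b \<in> B' \<Longrightarrow> u b \<in> lin_maps A P (regular_module A)"
  shows "(\<lambda>x b. if b \<in> B' then u b x else \<zero>\<^bsub>A\<^esub>) \<in> lin_maps A P (free_module A B)"
proof (rule lin_mapsI)
  interpret A: ring A by fact
  fix x assume x: "x \<in> carrier P"
  show "(\<lambda>b. if b \<in> B' then u b x else \<zero>\<^bsub>A\<^esub>) \<in> carrier (free_module A B)"
  proof (rule free_carrierI)
    show "finite {b. (if b \<in> B' then u b x else \<zero>\<^bsub>A\<^esub>) \<noteq> \<zero>\<^bsub>A\<^esub>}"
      by (rule finite_subset[OF _ B'(1)]) auto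
  qed (use lin_mapsD(1)[OF u x] B'(2) in \<open>auto simp: regular_sel\<close>)
  fix a assume a: "a \<in> carrier A"
  show "(\<lambda>b. if b \<in> B' then u b (a \<odot>\<^bsub>P\<^esub> x) else \<zero>\<^bsub>A\<^esub>) =
         a \<odot>\<^bsub>free_module A B\<^esub> (\<lambda>b. if b \<in> B' then u b x else \<zero>\<^bsub>A\<^esub>)"
    using lin_mapsD(3)[OF u a x] a by (auto simp: free_sel regular_sel)
next
  interpret A: ring A by fact
  fix x y assume xy: "x \<in> carrier P" "y \<in> carrier P"
  show "(\<lambda>b. if b \<in> B' then u b (x \<oplus>\<^bsub>P\<^esub> y) else \<zero>\<^bsub>A\<^esub>) =
           (\<lambda>b. if b \<in> B' then u b x else \<zero>\<^bsub>A\<^esub>) \<oplus>\<^bsub>free_module A B\<^esub> (\<lambda>b. if b \<in> B' then u b y else \<zero>\<^bsub>A\<^esub>)"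
    using lin_mapsD(2)[OF u xy] by (auto simp: free_sel regular_sel)
qed

definition coordinate_map where
  "coordinate_map P f b = restrict (\<lambda>x. f x b) (carrier P)"

lemma coordinate_cocycle:
  assumes A: "ring A" and "complex A P d" and f: "f \<in> cocycles A P d (free_module A B) i"
  shows "coordinate_map (P i) f b \<in> cocycles A P d (regular_module A) i"
proof -
  interpret complex A P d by fact
  have fl: "f \<in> lin_maps A (P i) (free_module A B)" using f by (simp add: cocycles_def)
  show ?thesis
    using f lin_mapsD(1)[OF d_lin'[of i]] lin_maps_restrict[OF Pmod lin_maps_compose[OF fl coordinate_lin[OF A]]]
    by (auto simp: cocycles_def coordinate_map_def free_sel regular_sel)
qed

lemma coordinate_coboundary:
  assumes A: "ring A" and "complex A P d" and f: "f \<in> coboundaries A P d (free_module A B) i"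
  shows "coordinate_map (P i) f b \<in> coboundaries A P d (regular_module A) i"
proof -
  interpret complex A P d by fact
  have fl: "f \<in> lin_maps A (P i) (free_module A B)" using f by (simp add: coboundaries_def)
  obtain g where g: "g \<in> lin_maps A (P (i - 1)) (free_module A B)" "\<forall>x\<in>carrier (P i). f x = g (d i x)"
    using f by (auto simp: coboundaries_def)
  show ?thesis unfolding coboundaries_def
    using lin_maps_restrict[OF Pmod lin_maps_compose[OF fl coordinate_lin[OF A]]] lin_maps_compose[OF g(1) coordinate_lin[OF A]] g(2)
    by (auto simp: coordinate_map_def intro!: bexI[of _ "\<lambda>x. g x b"])
qed

text \<open>Primitives of the coordinates assemble to a map into a free module only if almost all of
  them vanish. Since \<open>P i\<close> has a finite basis, \<open>f\<close> meets finitely many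
  coordinates; a primitive is chosen for these and zero is taken for the others.\<close>

lemma coboundary_from_coordinates:
  fixes m :: nat
  assumes A: "ring A" and Pi: "P i = free_module A {..<m}" and d: "d i \<in> lin_maps A (P i) (P (i - 1))"
    and f: "f \<in> lin_maps A (P i) (free_module A B)" "f \<in> extensional (carrier (P i))"
    and c: "\<And>b. b \<in> B \<Longrightarrow> coordinate_map (P i) f b \<in> coboundaries A P d (regular_module A) i"
  shows "f \<in> coboundaries A P d (free_module A B) i"
proof -
  let ?B = "{b. \<exists>x\<in>carrier (P i). f x b \<noteq> \<zero>\<^bsub>A\<^esub>}"
  have fin: "finite ?B" using finite_coordinates[OF A] f(1) unfolding Pi by blast
  have sub: "?B \<subseteq> B" using lin_mapsD(1)[OF f(1)] free_zero_outside by fastforce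
  have "\<forall>b\<in>?B. \<exists>u. u \<in> lin_maps A (P (i - 1)) (regular_module A) \<and> (\<forall>x\<in>carrier (P i). f x b = u (d i x))"
  proof
    fix b assume "b \<in> ?B"
    then have "coordinate_map (P i) f b \<in> coboundaries A P d (regular_module A) i" using sub c by blast
    then obtain u where "u \<in> lin_maps A (P (i - 1)) (regular_module A)" "\<forall>x\<in>carrier (P i). coordinate_map (P i) f b x = u (d i x)"
      unfolding coboundaries_def by blast
    then show "\<exists>u. u \<in> lin_maps A (P (i - 1)) (regular_module A) \<and> (\<forall>x\<in>carrier (P i). f x b = u (d i x))"
      by (auto simp: coordinate_map_def)
  qed
  from bchoice[OF this] obtain u where u: "\<forall>b\<in>?B. u b \<in> lin_maps A (P (i - 1)) (regular_module A) \<and> (\<forall>x\<in>carrier (P i). f x b = u b (d i x))"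
    by (rule exE)
  let ?g = "\<lambda>x b. if b \<in> ?B then u b x else \<zero>\<^bsub>A\<^esub>"
  have "?g \<in> lin_maps A (P (i - 1)) (free_module A B)"
    by (rule lin_maps_from_coordinates[OF A fin sub conjunct1[OF bspec[OF u]]])
  moreover have "f x = ?g (d i x)" if x: "x \<in> carrier (P i)" for x
  proof
    fix b show "f x b = ?g (d i x) b"
    proof (cases "b \<in> ?B")
      case True
      then show ?thesis using bspec[OF conjunct2[OF bspec[OF u True]] x] by simp
    next
      case False
      then show ?thesis using x by simp
    qed
  qed
  ultimately show ?thesis using f unfolding coboundaries_def by (intro CollectI conjI IntI bexI[of _ ?g] ballI)
qed

lemma right_multiplication_commutes: "ring A \<Longrightarrow> commuting_action A (regular_module A) (opposite A) (\<lambda>a x. x \<otimes>\<^bsub>A\<^esub> a)"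
  unfolding commuting_action_def
proof
  assume "ring A"
  then interpret A: ring A .
  fix a assume "a \<in> carrier (opposite A)"
  then have "a \<in> carrier A" by (simp add: opposite_def)
  then show "(\<lambda>x. x \<otimes>\<^bsub>A\<^esub> a) \<in> lin_maps A (regular_module A) (regular_module A)"
    by (intro lin_mapsI) (simp_all add: regular_sel A.l_distr A.m_assoc)
qed

context h_adic
begin

lemma finite_free_resolution:
  fixes n0 :: nat
  assumes N: "left_module A N" and Ntf: "h_torsion_free N \<eta>"
    and e: "e \<in> lin_maps A (free_module A {..<n0}) N" and surj: "e ` carrier (free_module A {..<n0}) = carrier N"
  obtains rk :: "int \<Rightarrow> nat" and dF where "projective_resolution A N (\<lambda>i. free_module A {..<rk i}) dF e"
proof -
  let ?F = "\<lambda>n::nat. free_module A {..<n}"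
  \<comment> \<open>A triple \<open>(m, n, g)\<close> encodes a map \<open>g\<close> from rank
    \<open>m\<close> to rank \<open>n\<close>, so that dependent choice constructs ranks and
    differentials together. The \<open>k\<close>-th triple is the differential out of degree
    \<open>k + 1\<close>; \<open>Q\<close> says that consecutive triples fit and are exact.\<close>
  define P :: "nat \<Rightarrow> nat \<times> nat \<times> ((nat \<Rightarrow> 'a) \<Rightarrow> (nat \<Rightarrow> 'a)) \<Rightarrow> bool" where
    "P k s \<longleftrightarrow> snd (snd s) \<in> lin_maps A (?F (fst s)) (?F (fst (snd s))) \<and>
      (k = 0 \<longrightarrow> fst (snd s) = n0 \<and> snd (snd s) ` carrier (?F (fst s)) = {x \<in> carrier (?F n0). e x = \<zero>\<^bsub>N\<^esub>})" for k s
  define Q :: "nat \<Rightarrow> nat \<times> nat \<times> ((nat \<Rightarrow> 'a) \<Rightarrow> (nat \<Rightarrow> 'a)) \<Rightarrow> nat \<times> nat \<times> ((nat \<Rightarrow> 'a) \<Rightarrow> (nat \<Rightarrow> 'a)) \<Rightarrow> bool" where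
    "Q k s t \<longleftrightarrow> fst (snd t) = fst s \<and>
      snd (snd t) ` carrier (?F (fst t)) = {x \<in> carrier (?F (fst s)). snd (snd s) x = \<zero>\<^bsub>?F (fst (snd s))\<^esub>}" for k s t
  have "\<exists>f. \<forall>n. P n (f n) \<and> Q n (f n) (f (Suc n))"
  proof (rule dependent_nat_choice)
    obtain m :: nat and g where "g \<in> lin_maps A (?F m) (?F n0)" "g ` carrier (?F m) = {x \<in> carrier (?F n0). e x = \<zero>\<^bsub>N\<^esub>}"
      by (rule kernel_generators[OF N Ntf e])
    then show "\<exists>s. P 0 s" unfolding P_def by (intro exI[of _ "(m, n0, g)"]) simp
  next
    fix s k assume "P k s"
    then have s: "snd (snd s) \<in> lin_maps A (?F (fst s)) (?F (fst (snd s)))" by (simp add: P_def)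
    obtain m :: nat and g where "g \<in> lin_maps A (?F m) (?F (fst s))"
      "g ` carrier (?F m) = {x \<in> carrier (?F (fst s)). snd (snd s) x = \<zero>\<^bsub>?F (fst (snd s))\<^esub>}"
      by (rule kernel_generators[OF free_left_module[OF A.ring_axioms] free_torsion_free s])
    then show "\<exists>t. P (Suc k) t \<and> Q k s t" unfolding P_def Q_def by (intro exI[of _ "(m, fst s, g)"]) simp
  qed
  then obtain f where "\<forall>n. P n (f n) \<and> Q n (f n) (f (Suc n))" by (rule exE)
  then have f: "P n (f n)" "Q n (f n) (f (Suc n))" for n by simp_all
  \<comment> \<open>Degree 0 has the given rank \<open>n0\<close>, and the triple with index
    \<open>i - 1\<close> belongs to degree \<open>i\<close>. Negative degrees get rank 0 and
    differentials out of degrees \<open>i \<le> 0\<close> are zero.\<close>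
  define rk where "rk i = (if i < 0 then 0 else if i = 0 then n0 else fst (f (nat (i - 1))))" for i
  define dF where "dF i = (if i \<le> 0 then (\<lambda>_ _. \<zero>\<^bsub>A\<^esub>) else snd (snd (f (nat (i - 1)))))" for i
  have cod: "fst (snd (f (nat (i - 1)))) = rk (i - 1)" if "i \<ge> 1" for i
  proof (cases "i = 1")
    case True then show ?thesis using f(1)[of 0] by (simp add: P_def rk_def)
  next
    case False
    then have "nat (i - 1) = Suc (nat (i - 2))" "i \<ge> 2" using that by auto
    then show ?thesis using f(2)[of "nat (i - 2)"] by (simp add: Q_def rk_def)
  qed
  have "projective_resolution A N (\<lambda>i. ?F (rk i)) dF e"
    unfolding projective_resolution_def
  proof (intro conjI allI impI)
    fix i :: int
    show "projective A (?F (rk i))" by (rule free_projective[OF A.ring_axioms])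
    show "i < 0 \<Longrightarrow> carrier (?F (rk i)) = {\<zero>\<^bsub>?F (rk i)\<^esub>}" by (auto simp: rk_def free_module_def)
    show "dF i \<in> lin_maps A (?F (rk i)) (?F (rk (i - 1)))"
    proof (cases "i \<le> 0")
      case True
      have "(\<lambda>_. \<zero>\<^bsub>?F (rk (i - 1))\<^esub>) \<in> lin_maps A (?F (rk i)) (?F (rk (i - 1)))"
        by (rule lin_maps_zero[OF free_left_module[OF A.ring_axioms]])
      moreover have "\<zero>\<^bsub>?F (rk (i - 1))\<^esub> = (\<lambda>_. \<zero>\<^bsub>A\<^esub>)" by (simp add: free_module_def)
      ultimately show ?thesis using True by (simp add: dF_def)
    next
      case False
      then have "rk i = fst (f (nat (i - 1)))" by (simp add: rk_def)
      then show ?thesis using f(1)[of "nat (i - 1)"] False cod[of i] by (simp add: dF_def P_def)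
    qed
    show "a_kernel (?F (rk i)) (?F (rk (i - 1))) (dF i) = dF (i + 1) ` carrier (?F (rk (i + 1)))" if i: "i \<ge> 1"
    proof -
      have n: "nat (i + 1 - 1) = Suc (nat (i - 1))" using i by simp
      have "rk i = fst (f (nat (i - 1)))" "rk (i + 1) = fst (f (Suc (nat (i - 1))))" using i n by (simp_all add: rk_def)
      moreover have "dF i = snd (snd (f (nat (i - 1))))" "dF (i + 1) = snd (snd (f (Suc (nat (i - 1)))))" using i n by (simp_all add: dF_def)
      ultimately show ?thesis using f(2)[of "nat (i - 1)"] cod[OF i] by (simp add: Q_def a_kernel_def')
    qed
    show "e \<in> lin_maps A (?F (rk 0)) N" "e ` carrier (?F (rk 0)) = carrier N" using e surj by (simp_all add: rk_def)
    show "a_kernel (?F (rk 0)) N e = dF 1 ` carrier (?F (rk 1))"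
      using f(1)[of 0] by (simp add: P_def rk_def dF_def a_kernel_def')
  qed
  then show thesis by (rule that)
qed

end

text \<open>The map \<open>\<nu>\<close> presents \<open>N0\<close> as the quotient of
  \<open>N\<close> by \<open>\<eta>\<close>. Torsion-freeness of \<open>N\<close> is what makes the
  reduction of the resolution exact again.\<close>

locale h_adic_resolution = h_adic A A0 \<eta> \<pi> + F: resolution A N "\<lambda>i. free_module A {..<rk i}" dF e
  for A :: "('a, 'z) ring_scheme" and A0 :: "('b, 'w) ring_scheme" and \<eta> :: 'a and \<pi> :: "'a \<Rightarrow> 'b"
    and N :: "('a, 'n, 'y) module_scheme" and rk :: "int \<Rightarrow> nat" and dF and e +
  fixes N0 :: "('b, 'm, 'x) module_scheme" and \<nu> :: "'n \<Rightarrow> 'm"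
  assumes N0: "left_module A0 N0" and Ntf: "h_torsion_free N \<eta>"
    and nu: "\<nu> \<in> lin_maps A N (rs N0)" and nu_surj: "\<nu> ` carrier N = carrier N0"
    and nu_ker: "\<lbrakk>x \<in> carrier N; \<nu> x = \<zero>\<^bsub>N0\<^esub>\<rbrakk> \<Longrightarrow> \<exists>y\<in>carrier N. x = \<eta> \<odot>\<^bsub>N\<^esub> y"
begin

section \<open>The reduced resolution\<close>

abbreviation FF :: "int \<Rightarrow> ('a, nat \<Rightarrow> 'a) module" where "FF i \<equiv> free_module A {..<rk i}"
abbreviation EE :: "int \<Rightarrow> ('b, nat \<Rightarrow> 'b) module" where "EE i \<equiv> free_module A0 {..<rk i}"

lemma EE_module: "left_module A0 (EE i)"
  by (rule free_left_module[OF A0.ring_axioms])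

text \<open>The differential induced modulo \<open>\<eta>\<close>. Existence comes from
  \<open>reduced_map\<close>, and as \<open>red\<close> is onto, the choice leaves no freedom on
  \<open>EE i\<close>.\<close>

definition d0 :: "int \<Rightarrow> (nat \<Rightarrow> 'b) \<Rightarrow> nat \<Rightarrow> 'b" where
  "d0 i = (SOME g. g \<in> lin_maps A0 (EE i) (EE (i - 1)) \<and> (\<forall>x\<in>carrier (FF i). g (red x) = red (dF i x)))"

definition e0 :: "(nat \<Rightarrow> 'b) \<Rightarrow> 'm" where
  "e0 = (SOME g. g \<in> lin_maps A0 (EE 0) N0 \<and> (\<forall>x\<in>carrier (FF 0). g (red x) = \<nu> (e x)))"

lemma d0: "d0 i \<in> lin_maps A0 (EE i) (EE (i - 1)) \<and> (\<forall>x\<in>carrier (FF i). d0 i (red x) = red (dF i x))"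
proof -
  obtain g where "g \<in> lin_maps A0 (EE i) (EE (i - 1))" "\<And>x. x \<in> carrier (FF i) \<Longrightarrow> g (red x) = red (dF i x)"
    by (rule reduced_map[OF EE_module lin_maps_compose[OF F.d_lin red_lin]]) blast
  then have "\<exists>g. g \<in> lin_maps A0 (EE i) (EE (i - 1)) \<and> (\<forall>x\<in>carrier (FF i). g (red x) = red (dF i x))" by blast
  then show ?thesis unfolding d0_def by (rule someI_ex)
qed

lemma e0: "e0 \<in> lin_maps A0 (EE 0) N0 \<and> (\<forall>x\<in>carrier (FF 0). e0 (red x) = \<nu> (e x))"
proof -
  obtain g where "g \<in> lin_maps A0 (EE 0) N0" "\<And>x. x \<in> carrier (FF 0) \<Longrightarrow> g (red x) = \<nu> (e x)"
    by (rule reduced_map[OF N0 lin_maps_compose[OF F.e_lin nu]]) blast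
  then have "\<exists>g. g \<in> lin_maps A0 (EE 0) N0 \<and> (\<forall>x\<in>carrier (FF 0). g (red x) = \<nu> (e x))" by blast
  then show ?thesis unfolding e0_def by (rule someI_ex)
qed

text \<open>By exactness the cokernel of \<open>dF i\<close> embeds into a torsion-free module,
  \<open>N\<close> if \<open>i = 1\<close> and the term in degree \<open>i - 2\<close> otherwise.
  Hence \<open>\<eta>\<close> acts injectively on it.\<close>

lemma eta_image:
  assumes i: "i \<ge> 1" and z: "z \<in> carrier (FF (i - 1))" and x: "x \<in> carrier (FF i)"
    and e: "dF i x = \<eta> \<odot>\<^bsub>FF (i - 1)\<^esub> z"
  shows "z \<in> dF i ` carrier (FF i)"
proof (cases "i = 1")
  case True
  have z0: "z \<in> carrier (FF 0)" using z True by simp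
  have "\<eta> \<odot>\<^bsub>N\<^esub> e z = e (dF 1 x)" using e lin_mapsD(3)[OF F.e_lin eta z0] True by simp
  also have "\<dots> = \<zero>\<^bsub>N\<^esub>" using F.e_d x True by simp
  finally have "e z = \<zero>\<^bsub>N\<^esub>" using Ntf lin_mapsD(1)[OF F.e_lin z0] by (simp add: h_torsion_free_def)
  then show ?thesis using F.e_exact[OF z0] True by simp
next
  case False
  have ii: "i - 1 + 1 = i" by simp
  have "\<eta> \<odot>\<^bsub>FF (i - 1 - 1)\<^esub> dF (i - 1) z = dF (i - 1) (dF i x)" using e lin_mapsD(3)[OF F.d_lin[of "i - 1"] eta z] by simp
  also have "\<dots> = \<zero>\<^bsub>FF (i - 1 - 1)\<^esub>" using F.d_d[of x "i - 1"] x by (simp add: ii)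
  finally have "dF (i - 1) z = \<zero>\<^bsub>FF (i - 1 - 1)\<^esub>"
    using free_torsion_free[of "{..<rk (i - 1 - 1)}"] lin_mapsD(1)[OF F.d_lin[of "i - 1"] z] by (simp add: h_torsion_free_def)
  then show ?thesis using F.exact[of "i - 1" z] z i False by (simp add: ii)
qed

text \<open>The reduction does not see the multiple of \<open>\<eta>\<close>, so it suffices that
  \<open>x\<close> bounds after such a correction. This finishes exactness both in degree 0 and in
  positive degrees.\<close>

lemma red_zero_boundary:
  assumes i: "i \<ge> 0" and x: "x \<in> carrier (FF i)" and w: "w \<in> carrier (FF i)"
    and u: "x \<ominus>\<^bsub>FF i\<^esub> \<eta> \<odot>\<^bsub>FF i\<^esub> w \<in> dF (i + 1) ` carrier (FF (i + 1))"
  shows "red x \<in> d0 (i + 1) ` carrier (EE (i + 1))"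
proof -
  interpret Fi: left_module A "FF i" by (rule F.Pmod)
  interpret Fo: op_group A "FF i" by (rule left_module_op_group[OF F.Pmod])
  interpret Ei: left_module A0 "EE i" by (rule EE_module)
  obtain v where v: "v \<in> carrier (FF (i + 1))" "x \<ominus>\<^bsub>FF i\<^esub> \<eta> \<odot>\<^bsub>FF i\<^esub> w = dF (i + 1) v" using u by blast
  have dv: "dF (i + 1) v \<in> carrier (FF i)" using lin_mapsD(1)[OF F.d_lin' v(1)] .
  have "x = dF (i + 1) v \<oplus>\<^bsub>FF i\<^esub> \<eta> \<odot>\<^bsub>FF i\<^esub> w" using Fo.minus_add_cancel[OF x, of "\<eta> \<odot>\<^bsub>FF i\<^esub> w"] w eta v(2) by simp
  then have "red x = red (dF (i + 1) v) \<oplus>\<^bsub>EE i\<^esub> red (\<eta> \<odot>\<^bsub>FF i\<^esub> w)"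
    using lin_mapsD(2)[OF red_lin dv, of "\<eta> \<odot>\<^bsub>FF i\<^esub> w"] w eta by (simp add: rs_sel)
  also have "\<dots> = red (dF (i + 1) v)" using red_eta[OF w] red_closed[OF dv] by simp
  also have "\<dots> = d0 (i + 1) (red v)" using d0 v(1) by simp
  finally show ?thesis using red_closed[OF v(1)] by simp
qed

text \<open>A cycle modulo \<open>\<eta>\<close> lifts to some \<open>x\<close> whose differential
  is \<open>\<eta>\<close> times an element \<open>z\<close>. By \<open>eta_image\<close> this
  \<open>z\<close> is the differential of some \<open>w\<close>, so \<open>x\<close> minus
  \<open>\<eta>\<close> times \<open>w\<close> is a true cycle with the same reduction, and
  exactness of \<open>F\<close> applies. In degree 0 the role of \<open>eta_image\<close> is taken
  by surjectivity of \<open>e\<close>.\<close>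

theorem reduced_resolution: "projective_resolution A0 N0 EE d0 e0"
  unfolding projective_resolution_def
proof (intro conjI allI impI)
  fix i :: int
  show "projective A0 (EE i)" by (rule free_projective[OF A0.ring_axioms])
  show "carrier (EE i) = {\<zero>\<^bsub>EE i\<^esub>}" if "i < 0"
  proof -
    have "y = \<zero>\<^bsub>EE i\<^esub>" if y: "y \<in> carrier (EE i)" for y
    proof -
      obtain x where "x \<in> carrier (FF i)" "red x = y" using red_surj[OF y] by blast
      then show ?thesis using F.neg[OF \<open>i < 0\<close>] lin_zero_mod[OF F.Pmod rs_left_module[OF EE_module] red_lin[of "{..<rk i}"]] by (simp add: rs_sel)
    qed
    moreover have "\<zero>\<^bsub>EE i\<^esub> \<in> carrier (EE i)" by (simp add: free_module_def)
    ultimately show ?thesis by blast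
  qed
  show "d0 i \<in> lin_maps A0 (EE i) (EE (i - 1))" using d0 by blast
  show "a_kernel (EE i) (EE (i - 1)) (d0 i) = d0 (i + 1) ` carrier (EE (i + 1))" if i: "i \<ge> 1"
  proof (intro equalityI subsetI)
    fix y assume "y \<in> a_kernel (EE i) (EE (i - 1)) (d0 i)"
    then have y: "y \<in> carrier (EE i)" "d0 i y = \<zero>\<^bsub>EE (i - 1)\<^esub>" by (auto simp: a_kernel_def')
    obtain x where x: "x \<in> carrier (FF i)" "red x = y" using red_surj[OF y(1)] by blast
    have dx: "dF i x \<in> carrier (FF (i - 1))" by (rule lin_mapsD(1)[OF F.d_lin x(1)])
    have "red (dF i x) = \<zero>\<^bsub>EE (i - 1)\<^esub>" using d0 x y by metis
    then obtain z where z: "z \<in> carrier (FF (i - 1))" "dF i x = \<eta> \<odot>\<^bsub>FF (i - 1)\<^esub> z" using red_zero[OF dx] by blast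
    obtain w where w: "w \<in> carrier (FF i)" "z = dF i w" using eta_image[OF i z(1) x(1) z(2)] by blast
    interpret Fi: left_module A "FF i" by (rule F.Pmod)
    interpret Fj: op_group A "FF (i - 1)" by (rule left_module_op_group[OF F.Pmod])
    have ew: "\<eta> \<odot>\<^bsub>FF i\<^esub> w \<in> carrier (FF i)" using w eta by simp
    have "dF i (x \<ominus>\<^bsub>FF i\<^esub> \<eta> \<odot>\<^bsub>FF i\<^esub> w) = \<zero>\<^bsub>FF (i - 1)\<^esub>"
      using lin_minus_mod[OF F.Pmod F.Pmod F.d_lin x(1) ew] lin_mapsD(3)[OF F.d_lin eta w(1)] z w Fj.minus_self[OF dx] by simp
    then have "x \<ominus>\<^bsub>FF i\<^esub> \<eta> \<odot>\<^bsub>FF i\<^esub> w \<in> dF (i + 1) ` carrier (FF (i + 1))"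
      by (rule F.exact[OF i Fi.M.minus_closed[OF x(1) ew]])
    then show "y \<in> d0 (i + 1) ` carrier (EE (i + 1))" using red_zero_boundary[OF _ x(1) w(1)] i x(2) by simp
  next
    fix y assume "y \<in> d0 (i + 1) ` carrier (EE (i + 1))"
    then obtain v0 where v0: "v0 \<in> carrier (EE (i + 1))" "y = d0 (i + 1) v0" by blast
    obtain v where v: "v \<in> carrier (FF (i + 1))" "red v = v0" using red_surj[OF v0(1)] by blast
    have dv: "dF (i + 1) v \<in> carrier (FF i)" by (rule lin_mapsD(1)[OF F.d_lin' v(1)])
    have y: "y = red (dF (i + 1) v)" using d0 v v0 by metis
    have "d0 i y = red (dF i (dF (i + 1) v))" unfolding y using d0 dv by blast
    also have "\<dots> = \<zero>\<^bsub>EE (i - 1)\<^esub>"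
      using F.d_d[OF v(1)] lin_zero_mod[OF F.Pmod rs_left_module[OF EE_module] red_lin[of "{..<rk (i - 1)}"]] by (simp add: rs_sel)
    finally show "y \<in> a_kernel (EE i) (EE (i - 1)) (d0 i)" using red_closed[OF dv] by (simp add: a_kernel_def' y)
  qed
  show "e0 \<in> lin_maps A0 (EE 0) N0" using e0 by blast
  show "e0 ` carrier (EE 0) = carrier N0"
  proof (intro equalityI subsetI)
    fix y assume "y \<in> e0 ` carrier (EE 0)" then show "y \<in> carrier N0" using lin_mapsD(1)[OF conjunct1[OF e0]] by blast
  next
    fix y assume "y \<in> carrier N0"
    then obtain n where n: "n \<in> carrier N" "\<nu> n = y" using nu_surj by (metis imageE)
    then obtain x where x: "x \<in> carrier (FF 0)" "e x = n" using F.e_surj by blast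
    have "e0 (red x) = y" using e0 x n by blast
    then show "y \<in> e0 ` carrier (EE 0)" using red_closed[OF x(1)] by blast
  qed
  show "a_kernel (EE 0) N0 e0 = d0 1 ` carrier (EE 1)"
  proof (intro equalityI subsetI)
    fix y assume "y \<in> a_kernel (EE 0) N0 e0"
    then have y: "y \<in> carrier (EE 0)" "e0 y = \<zero>\<^bsub>N0\<^esub>" by (auto simp: a_kernel_def')
    obtain x where x: "x \<in> carrier (FF 0)" "red x = y" using red_surj[OF y(1)] by blast
    have ex: "e x \<in> carrier N" by (rule lin_mapsD(1)[OF F.e_lin x(1)])
    have "\<nu> (e x) = \<zero>\<^bsub>N0\<^esub>" using e0 x y by metis
    then obtain z where z: "z \<in> carrier N" "e x = \<eta> \<odot>\<^bsub>N\<^esub> z" using nu_ker[OF ex] by blast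
    obtain w where w: "w \<in> carrier (FF 0)" "e w = z" using F.e_surj[OF z(1)] by blast
    interpret Fi: left_module A "FF 0" by (rule F.Pmod)
    interpret No: op_group A N by (rule left_module_op_group[OF F.N])
    have ew: "\<eta> \<odot>\<^bsub>FF 0\<^esub> w \<in> carrier (FF 0)" using w eta by simp
    have "e (x \<ominus>\<^bsub>FF 0\<^esub> \<eta> \<odot>\<^bsub>FF 0\<^esub> w) = \<zero>\<^bsub>N\<^esub>"
      using lin_minus_mod[OF F.Pmod F.N F.e_lin x(1) ew] lin_mapsD(3)[OF F.e_lin eta w(1)] z w No.minus_self[OF ex] by simp
    then have "x \<ominus>\<^bsub>FF 0\<^esub> \<eta> \<odot>\<^bsub>FF 0\<^esub> w \<in> dF 1 ` carrier (FF 1)"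
      by (rule F.e_exact[OF Fi.M.minus_closed[OF x(1) ew]])
    then show "y \<in> d0 1 ` carrier (EE 1)" using red_zero_boundary[of 0, OF _ x(1) w(1)] x(2) by simp
  next
    fix y assume "y \<in> d0 1 ` carrier (EE 1)"
    then obtain v0 where v0: "v0 \<in> carrier (EE 1)" "y = d0 1 v0" by blast
    obtain v where v: "v \<in> carrier (FF 1)" "red v = v0" using red_surj[OF v0(1)] by blast
    have dv: "dF 1 v \<in> carrier (FF 0)" using lin_mapsD(1)[OF F.d_lin[of 1] v(1)] by simp
    have y: "y = red (dF 1 v)" using d0 v v0 by metis
    have "e0 y = \<nu> (e (dF 1 v))" unfolding y using e0 dv by blast
    also have "\<dots> = \<zero>\<^bsub>N0\<^esub>" using F.e_d[OF v(1)] lin_zero_mod[OF F.N rs_left_module[OF N0] nu] by (simp add: rs_sel)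
    finally show "y \<in> a_kernel (EE 0) N0 e0" using red_closed[OF dv] by (simp add: a_kernel_def' y)
  qed
qed

section \<open>Lifting the vanishing of cohomology from \<open>A0\<close> to
  \<open>A\<close>\<close>

lemma pi_lin: "\<pi> \<in> lin_maps A (regular_module A) (rs (regular_module A0))"
proof -
  interpret pi: ring_hom_ring A A0 \<pi> by (rule ring_hom_ringI2[OF A.ring_axioms A0.ring_axioms pi_hom])
  show ?thesis by (rule lin_mapsI) (simp_all add: rs_sel regular_sel)
qed

lemma eta_mult_lin: "(\<lambda>a. \<eta> \<otimes>\<^bsub>A\<^esub> a) \<in> lin_maps A (regular_module A) (regular_module A)"
proof (rule lin_mapsI)
  fix a x assume "a \<in> carrier A" "x \<in> carrier (regular_module A)"
  then show "\<eta> \<otimes>\<^bsub>A\<^esub> (a \<odot>\<^bsub>regular_module A\<^esub> x) = a \<odot>\<^bsub>regular_module A\<^esub> (\<eta> \<otimes>\<^bsub>A\<^esub> x)"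
    using central[of a] eta by (simp add: regular_sel A.m_assoc[symmetric])
qed (simp_all add: regular_sel eta A.r_distr)

text \<open>The reduction of \<open>z\<close> has a primitive over \<open>A0\<close>, whose lift
  \<open>b\<close> leaves a remainder divisible by \<open>\<eta>\<close>. For the iteration the
  quotient \<open>z'\<close> must itself be a cocycle: it is, because \<open>\<eta>\<close> times
  its value on a boundary is zero and \<open>A\<close> is torsion-free.\<close>

lemma cocycle_mod_eta:
  assumes van: "cocycles A0 EE d0 (regular_module A0) i \<subseteq> coboundaries A0 EE d0 (regular_module A0) i"
    and z: "z \<in> cocycles A FF dF (regular_module A) i"
  shows "\<exists>b\<in>lin_maps A (FF (i - 1)) (regular_module A). \<exists>z'\<in>cocycles A FF dF (regular_module A) i.
    \<forall>x\<in>carrier (FF i). z x = b (dF i x) \<oplus>\<^bsub>A\<^esub> \<eta> \<otimes>\<^bsub>A\<^esub> z' x"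
proof -
  let ?R = "regular_module A" and ?S = "regular_module A0"
  interpret R: left_module A ?R by (rule regular_left_module[OF A.ring_axioms])
  interpret RO: op_group A ?R by (rule left_module_op_group[OF R.left_module_axioms])
  have SM: "left_module A0 ?S" by (rule regular_left_module[OF A0.ring_axioms])
  have RS: "left_module A (rs ?S)" by (rule rs_left_module[OF SM])
  have zl: "z \<in> lin_maps A (FF i) ?R" and zd: "\<And>x. x \<in> carrier (FF (i + 1)) \<Longrightarrow> z (dF (i + 1) x) = \<zero>\<^bsub>A\<^esub>"
    using z by (auto simp: cocycles_def regular_sel)
  obtain z0 where z0: "z0 \<in> lin_maps A0 (EE i) ?S" "\<And>x. x \<in> carrier (FF i) \<Longrightarrow> z0 (red x) = \<pi> (z x)"
    by (rule reduced_map[OF SM lin_maps_compose[OF zl pi_lin]]) blast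
  have "z0 (d0 (i + 1) y) = \<zero>\<^bsub>?S\<^esub>" if y: "y \<in> carrier (EE (i + 1))" for y
  proof -
    obtain x where x: "x \<in> carrier (FF (i + 1))" "red x = y" using red_surj[OF y] by blast
    have dx: "dF (i + 1) x \<in> carrier (FF i)" by (rule lin_mapsD(1)[OF F.d_lin' x(1)])
    have "d0 (i + 1) y = red (dF (i + 1) x)" using d0 x by metis
    then have "z0 (d0 (i + 1) y) = \<pi> (z (dF (i + 1) x))" using z0(2)[OF dx] by simp
    then show ?thesis using zd[OF x(1)] lin_zero_mod[OF R.left_module_axioms RS pi_lin] by (simp add: regular_sel rs_sel)
  qed
  moreover have d0c: "d0 (i + 1) y \<in> carrier (EE i)" if "y \<in> carrier (EE (i + 1))" for y
    using lin_mapsD(1)[OF conjunct1[OF d0[of "i + 1"]] that] by simp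
  ultimately have "restrict z0 (carrier (EE i)) \<in> cocycles A0 EE d0 ?S i"
    using lin_maps_restrict[OF EE_module z0(1)] by (simp add: cocycles_def)
  then have "restrict z0 (carrier (EE i)) \<in> coboundaries A0 EE d0 ?S i" using van by blast
  then obtain b0 where b0: "b0 \<in> lin_maps A0 (EE (i - 1)) ?S" "\<forall>y\<in>carrier (EE i). restrict z0 (carrier (EE i)) y = b0 (d0 i y)"
    unfolding coboundaries_def by blast
  obtain b where b: "b \<in> lin_maps A (FF (i - 1)) ?R" "\<And>x. x \<in> carrier (FF (i - 1)) \<Longrightarrow> \<pi> (b x) = b0 (red x)"
  proof (rule projective_lift[OF F.proj[of "i - 1"] RS R.left_module_axioms lin_maps_compose[OF red_lin rs_lin[OF b0(1)]] pi_lin])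
    fix x assume "x \<in> carrier (FF (i - 1))"
    then have "b0 (red x) \<in> carrier A0" using lin_mapsD(1)[OF b0(1) red_closed] by (simp add: regular_sel)
    then show "b0 (red x) \<in> \<pi> ` carrier ?R" using pi_surj by (simp add: regular_sel)
  qed blast
  let ?y = "\<lambda>x. z x \<ominus>\<^bsub>?R\<^esub> b (dF i x)"
  have y: "?y \<in> lin_maps A (FF i) ?R" by (rule lin_maps_minus[OF R.left_module_axioms zl lin_maps_compose[OF F.d_lin b(1)]])
  \<comment> \<open>The division by \<open>\<eta>\<close> is carried out as a lift along
    multiplication by \<open>\<eta>\<close>, which is \<open>A\<close>-linear as
    \<open>\<eta>\<close> is central. Projectivity of the source then makes the quotient linear at
    once.\<close>
  obtain z' where z': "z' \<in> lin_maps A (FF i) ?R" "\<And>x. x \<in> carrier (FF i) \<Longrightarrow> \<eta> \<otimes>\<^bsub>A\<^esub> z' x = ?y x"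
  proof (rule projective_lift[OF F.proj R.left_module_axioms R.left_module_axioms y eta_mult_lin])
    fix x assume x: "x \<in> carrier (FF i)"
    have dx: "dF i x \<in> carrier (FF (i - 1))" by (rule lin_mapsD(1)[OF F.d_lin x])
    have "\<pi> (?y x) = \<pi> (z x) \<ominus>\<^bsub>rs ?S\<^esub> \<pi> (b (dF i x))"
      by (rule lin_minus_mod[OF R.left_module_axioms RS pi_lin lin_mapsD(1)[OF zl x] lin_mapsD(1)[OF b(1) dx]])
    also have "\<pi> (b (dF i x)) = \<pi> (z x)"
      using b(2)[OF dx] b0(2) d0 red_closed[OF x] z0(2)[OF x] x by (metis restrict_apply')
    also have "\<pi> (z x) \<ominus>\<^bsub>rs ?S\<^esub> \<pi> (z x) = \<zero>\<^bsub>rs ?S\<^esub>"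
      by (rule op_group.minus_self[OF left_module_op_group[OF RS] lin_mapsD(1)[OF pi_lin lin_mapsD(1)[OF zl x]]])
    finally have "\<pi> (?y x) = \<zero>\<^bsub>A0\<^esub>" by (simp add: rs_sel regular_sel)
    moreover have "?y x \<in> carrier A" using lin_mapsD(1)[OF y x] by (simp add: regular_sel)
    ultimately show "?y x \<in> (\<lambda>a. \<eta> \<otimes>\<^bsub>A\<^esub> a) ` carrier ?R" using pi_ker by (auto simp: regular_sel)
  qed blast
  have "z' (dF (i + 1) x) = \<zero>\<^bsub>A\<^esub>" if x: "x \<in> carrier (FF (i + 1))" for x
  proof (rule tfD)
    have dx: "dF (i + 1) x \<in> carrier (FF i)" by (rule lin_mapsD(1)[OF F.d_lin' x])
    show "z' (dF (i + 1) x) \<in> carrier A" using lin_mapsD(1)[OF z'(1) dx] by (simp add: regular_sel)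
    have "\<eta> \<otimes>\<^bsub>A\<^esub> z' (dF (i + 1) x) = z (dF (i + 1) x) \<ominus>\<^bsub>?R\<^esub> b (dF i (dF (i + 1) x))" by (rule z'(2)[OF dx])
    also have "\<dots> = \<zero>\<^bsub>?R\<^esub> \<ominus>\<^bsub>?R\<^esub> \<zero>\<^bsub>?R\<^esub>"
      using zd[OF x] F.d_d[OF x] lin_zero_mod[OF F.Pmod R.left_module_axioms b(1)] by (simp add: regular_sel)
    also have "\<dots> = \<zero>\<^bsub>A\<^esub>" using RO.minus_zero[of "\<zero>\<^bsub>?R\<^esub>"] by (simp add: regular_sel A.zero_closed)
    finally show "\<eta> \<otimes>\<^bsub>A\<^esub> z' (dF (i + 1) x) = \<zero>\<^bsub>A\<^esub>" .
  qed
  moreover have "dF (i + 1) x \<in> carrier (FF i)" if "x \<in> carrier (FF (i + 1))" for x by (rule lin_mapsD(1)[OF F.d_lin' that])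
  ultimately have "restrict z' (carrier (FF i)) \<in> cocycles A FF dF ?R i"
    using lin_maps_restrict[OF F.Pmod z'(1)] by (simp add: cocycles_def regular_sel)
  moreover have "z x = b (dF i x) \<oplus>\<^bsub>A\<^esub> \<eta> \<otimes>\<^bsub>A\<^esub> restrict z' (carrier (FF i)) x" if x: "x \<in> carrier (FF i)" for x
  proof -
    have m: "z x \<in> carrier ?R" "b (dF i x) \<in> carrier ?R"
      using lin_mapsD(1)[OF zl x] lin_mapsD(1)[OF b(1) lin_mapsD(1)[OF F.d_lin x]] by auto
    have "z x = ?y x \<oplus>\<^bsub>?R\<^esub> b (dF i x)" using RO.minus_add_cancel[OF m] by simp
    also have "\<dots> = b (dF i x) \<oplus>\<^bsub>?R\<^esub> ?y x" by (rule R.M.a_comm[OF R.M.minus_closed[OF m] m(2)])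
    finally show ?thesis using z'(2)[OF x] x by (simp add: regular_sel)
  qed
  ultimately show ?thesis using b(1) by blast
qed

text \<open>The series is summed on basis vectors and extended linearly. Scalars act on Hom by right
  multiplication of values while completeness of \<open>A\<close> is stated with
  \<open>\<eta>\<close> on the left; centrality reconciles the two.\<close>

lemma hom_complete: "h_complete (hom_module A (FF i) (regular_module A) (\<lambda>a x. x \<otimes>\<^bsub>A\<^esub> a)) \<eta>"
  unfolding h_complete_def
proof (intro allI impI)
  let ?R = "regular_module A"
  let ?H = "hom_module A (FF i) ?R (\<lambda>a x. x \<otimes>\<^bsub>A\<^esub> a)"
  interpret R: left_module A ?R by (rule regular_left_module[OF A.ring_axioms])
  fix c :: "nat \<Rightarrow> _" assume c: "\<forall>n. c n \<in> carrier ?H"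
  have cl: "c n \<in> lin_maps A (FF i) ?R" for n using c by (simp add: hom_sel)
  let ?b = "\<lambda>j. basis_vector A j"
  have b: "?b j \<in> carrier (FF i)" if "j \<in> {..<rk i}" for j by (rule basis_vector_closed[OF A.ring_axioms that])
  have "\<forall>j\<in>{..<rk i}. \<exists>s. \<forall>n. s n \<in> carrier A \<and> s n = c n (?b j) \<oplus>\<^bsub>A\<^esub> \<eta> \<otimes>\<^bsub>A\<^esub> s (Suc n)"
  proof
    fix j assume "j \<in> {..<rk i}"
    then have cA: "c n (?b j) \<in> carrier A" for n using lin_mapsD(1)[OF cl b] by (simp add: regular_sel)
    obtain s where "\<And>n. s n \<in> carrier A" "\<And>n. s n = c n (?b j) \<oplus>\<^bsub>A\<^esub> \<eta> \<otimes>\<^bsub>A\<^esub> s (Suc n)"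
      by (rule complete_series[of "\<lambda>n. c n (?b j)", OF cA]) blast
    then show "\<exists>s. \<forall>n. s n \<in> carrier A \<and> s n = c n (?b j) \<oplus>\<^bsub>A\<^esub> \<eta> \<otimes>\<^bsub>A\<^esub> s (Suc n)" by (intro exI allI conjI)
  qed
  from bchoice[OF this] obtain s where s: "\<forall>j\<in>{..<rk i}. \<forall>n. s j n \<in> carrier A \<and> s j n = c n (?b j) \<oplus>\<^bsub>A\<^esub> \<eta> \<otimes>\<^bsub>A\<^esub> s j (Suc n)"
    by (rule exE)
  note sc = conjunct1[OF s[rule_format]] and se = conjunct2[OF s[rule_format]]
  have sI: "(\<lambda>j. s j n) \<in> {..<rk i} \<rightarrow> carrier ?R" for n using sc by (intro Pi_I) (simp only: regular_sel)
  define t where "t n = restrict (linear_extension A ?R (\<lambda>j. s j n)) (carrier (FF i))" for n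
  have tl: "linear_extension A ?R (\<lambda>j. s j n) \<in> lin_maps A (FF i) ?R" for n by (rule R.linext_lin[OF sI])
  have tH: "t n \<in> carrier ?H" for n unfolding t_def by (rule hom_restrictI[OF F.Pmod tl])
  interpret H: op_group "opposite A" ?H
    by (rule hom_op_group[OF F.Pmod R.left_module_axioms right_multiplication_commutes[OF A.ring_axioms]])
  have eo: "\<eta> \<in> carrier (opposite A)" using eta by (simp add: opposite_def)
  have "t n = c n \<oplus>\<^bsub>?H\<^esub> \<eta> \<odot>\<^bsub>?H\<^esub> t (Suc n)" for n
  proof (rule hom_eqI[OF tH])
    show m: "c n \<oplus>\<^bsub>?H\<^esub> \<eta> \<odot>\<^bsub>?H\<^esub> t (Suc n) \<in> carrier ?H"
      by (rule H.a_closed[OF c[rule_format] H.op_closed[OF eo tH]])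
    fix x assume x: "x \<in> carrier (FF i)"
    show "t n x = (c n \<oplus>\<^bsub>?H\<^esub> \<eta> \<odot>\<^bsub>?H\<^esub> t (Suc n)) x"
    proof (rule free_maps_eq[OF A.ring_axioms R.left_module_axioms _ _ _ x])
      show "t n \<in> lin_maps A (FF i) ?R" "c n \<oplus>\<^bsub>?H\<^esub> \<eta> \<odot>\<^bsub>?H\<^esub> t (Suc n) \<in> lin_maps A (FF i) ?R"
        using tH m by (simp_all add: hom_sel(1))
      fix j assume j: "j \<in> {..<rk i}"
      have tb: "t n (?b j) = s j n" for n unfolding t_def using R.linext_bv[OF j sI] b[OF j] by simp
      have "(c n \<oplus>\<^bsub>?H\<^esub> \<eta> \<odot>\<^bsub>?H\<^esub> t (Suc n)) (?b j) = c n (?b j) \<oplus>\<^bsub>A\<^esub> s j (Suc n) \<otimes>\<^bsub>A\<^esub> \<eta>"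
        using b[OF j] tb by (simp add: hom_sel regular_sel)
      also have "s j (Suc n) \<otimes>\<^bsub>A\<^esub> \<eta> = \<eta> \<otimes>\<^bsub>A\<^esub> s j (Suc n)" by (rule central[OF sc[OF j]])
      also have "c n (?b j) \<oplus>\<^bsub>A\<^esub> \<dots> = s j n" by (rule se[OF j, symmetric])
      finally show "t n (?b j) = (c n \<oplus>\<^bsub>?H\<^esub> \<eta> \<odot>\<^bsub>?H\<^esub> t (Suc n)) (?b j)" using tb by simp
    qed
  qed
  then show "\<exists>s. \<forall>n. s n \<in> carrier ?H \<and> s n = c n \<oplus>\<^bsub>?H\<^esub> \<eta> \<odot>\<^bsub>?H\<^esub> s (Suc n)" using tH by (intro exI[of _ t] allI conjI)
qed

lemma hom_separated: "h_separated (hom_module A (FF i) (regular_module A) (\<lambda>a x. x \<otimes>\<^bsub>A\<^esub> a)) \<eta>"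
  unfolding h_separated_def
proof (intro allI impI)
  let ?R = "regular_module A"
  let ?H = "hom_module A (FF i) ?R (\<lambda>a x. x \<otimes>\<^bsub>A\<^esub> a)"
  interpret H: op_group "opposite A" ?H
    by (rule hom_op_group[OF F.Pmod regular_left_module[OF A.ring_axioms] right_multiplication_commutes[OF A.ring_axioms]])
  fix w :: "nat \<Rightarrow> _" assume w: "\<forall>n. w n \<in> carrier ?H \<and> w n = \<eta> \<odot>\<^bsub>?H\<^esub> w (Suc n)"
  show "w 0 = \<zero>\<^bsub>?H\<^esub>"
  proof (rule hom_eqI[OF conjunct1[OF w[rule_format]] H.zero_closed])
    fix x assume x: "x \<in> carrier (FF i)"
    have c: "w n x \<in> carrier A" for n
      using lin_mapsD(1)[OF _ x, of "w n" A ?R] conjunct1[OF w[rule_format, of n]] by (simp add: hom_sel(1) regular_sel)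
    have "w n x = w (Suc n) x \<otimes>\<^bsub>A\<^esub> \<eta>" for n
      using fun_cong[OF conjunct2[OF w[rule_format, of n]], of x] x by (simp only: hom_sel restrict_apply simp_thms if_True)
    then have "w n x = \<eta> \<otimes>\<^bsub>A\<^esub> w (Suc n) x" for n using central[OF c[of "Suc n"]] by metis
    with c have "w 0 x = \<zero>\<^bsub>A\<^esub>"
      by (intro sep[unfolded h_separated_def regular_sel, rule_format, of "\<lambda>n. w n x"] conjI)
    then show "w 0 x = \<zero>\<^bsub>?H\<^esub> x" using x by (simp only: hom_sel restrict_apply regular_sel simp_thms if_True)
  qed
qed

text \<open>\<open>h_approximation\<close> with the coboundary map as \<open>G\<close> and the set
  of cocycles as \<open>Z\<close>; its hypothesis \<open>step\<close> is
  \<open>cocycle_mod_eta\<close>.\<close>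

lemma vanish_regular:
  assumes van: "cocycles A0 EE d0 (regular_module A0) i \<subseteq> coboundaries A0 EE d0 (regular_module A0) i"
  shows "cocycles A FF dF (regular_module A) i \<subseteq> coboundaries A FF dF (regular_module A) i"
proof -
  let ?R = "regular_module A"
  let ?H = "\<lambda>i. hom_module A (FF i) ?R (\<lambda>a x. x \<otimes>\<^bsub>A\<^esub> a)"
  note R = regular_left_module[OF A.ring_axioms] and rc = right_multiplication_commutes[OF A.ring_axioms]
  interpret Hi: op_group "opposite A" "?H i" by (rule F.hom_og[OF R rc])
  have Z: "op_sub (opposite A) (?H i) (cocycles A FF dF ?R i)" by (rule F.op_sub_cocycles[OF R rc])
  have eo: "\<eta> \<in> carrier (opposite A)" using eta by (simp add: opposite_def)
  have G: "(\<lambda>f. compose (carrier (FF i)) f (dF i)) \<in> lin_maps (opposite A) (?H (i - 1)) (?H i)"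
    by (rule hom_precompose[OF F.Pmod F.d_lin])
  have "cocycles A FF dF ?R i \<subseteq> (\<lambda>f. compose (carrier (FF i)) f (dF i)) ` carrier (?H (i - 1))"
  proof (rule h_approximation[OF F.hom_og[OF R rc] Hi.op_group_axioms G eo hom_complete hom_separated op_subD(1)[OF Z]])
    fix z assume z: "z \<in> cocycles A FF dF ?R i"
    from cocycle_mod_eta[OF van this] obtain b z' where b: "b \<in> lin_maps A (FF (i - 1)) ?R"
      and z': "z' \<in> cocycles A FF dF ?R i" and e: "\<forall>x\<in>carrier (FF i). z x = b (dF i x) \<oplus>\<^bsub>A\<^esub> \<eta> \<otimes>\<^bsub>A\<^esub> z' x" by (elim bexE) (rule that)
    let ?b = "restrict b (carrier (FF (i - 1)))"
    have b': "?b \<in> carrier (?H (i - 1))" by (rule hom_restrictI[OF F.Pmod b])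
    have "z = compose (carrier (FF i)) ?b (dF i) \<oplus>\<^bsub>?H i\<^esub> \<eta> \<odot>\<^bsub>?H i\<^esub> z'"
    proof (rule hom_eqI[OF op_sub_mem[OF Z z] Hi.a_closed[OF lin_mapsD(1)[OF G b'] Hi.op_closed[OF eo op_sub_mem[OF Z z']]]])
      fix x assume x: "x \<in> carrier (FF i)"
      have "z' x \<in> carrier A" using z' x by (auto simp: cocycles_def lin_maps_def regular_sel)
      then show "z x = (compose (carrier (FF i)) ?b (dF i) \<oplus>\<^bsub>?H i\<^esub> \<eta> \<odot>\<^bsub>?H i\<^esub> z') x"
        using e x lin_mapsD(1)[OF F.d_lin x] central[of "z' x"] by (simp add: hom_sel compose_def regular_sel)
    qed
    then show "\<exists>c\<in>carrier (?H (i - 1)). \<exists>z'\<in>cocycles A FF dF ?R i.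
        z = compose (carrier (FF i)) c (dF i) \<oplus>\<^bsub>?H i\<^esub> \<eta> \<odot>\<^bsub>?H i\<^esub> z'" using b' z' by blast
  qed
  then show ?thesis unfolding F.coboundaries_eq_image[where act = "\<lambda>a x. x \<otimes>\<^bsub>A\<^esub> a"] .
qed

theorem vanish_free:
  assumes van: "cocycles A0 EE d0 (regular_module A0) i \<subseteq> coboundaries A0 EE d0 (regular_module A0) i"
  shows "cocycles A FF dF (free_module A B) i \<subseteq> coboundaries A FF dF (free_module A B) i"
proof
  fix f assume f: "f \<in> cocycles A FF dF (free_module A B) i"
  show "f \<in> coboundaries A FF dF (free_module A B) i"
    by (rule coboundary_from_coordinates[where P = FF and i = i and d = dF, OF A.ring_axioms refl F.d_lin])
      (use f coordinate_cocycle[OF A.ring_axioms F.complex_axioms f] vanish_regular[OF van] in \<open>auto simp: cocycles_def\<close>)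
qed

end

section \<open>Transport of subquotients along relations\<close>

text \<open>\<open>R\<close> is the graph of a linear map from \<open>Z\<close> to \<open>Y\<close>
  with kernel \<open>B\<close>, as \<open>R_functional\<close> makes explicit. That the map is onto
  is part of the next locale, where preimages have to respect a second relation as well.\<close>

locale subquotient_relation =
  fixes S :: "('s, 'z) ring_scheme" and G :: "('s, 'g, 'v) module_scheme" and Z B :: "'g set"
    and Y :: "('s, 'y, 'w) module_scheme" and R :: "'g \<Rightarrow> 'y \<Rightarrow> bool"
  assumes G: "op_group S G" and Y: "op_group S Y" and BZ: "B \<subseteq> Z" and ZG: "Z \<subseteq> carrier G" and zB: "\<zero>\<^bsub>G\<^esub> \<in> B"
    and R_in: "R x y \<Longrightarrow> x \<in> Z \<and> y \<in> carrier Y"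
    and R_total: "x \<in> Z \<Longrightarrow> \<exists>y. R x y"
    and R_add: "R x y \<Longrightarrow> R x' y' \<Longrightarrow> R (x \<oplus>\<^bsub>G\<^esub> x') (y \<oplus>\<^bsub>Y\<^esub> y')"
    and R_minus: "R x y \<Longrightarrow> R x' y' \<Longrightarrow> R (x \<ominus>\<^bsub>G\<^esub> x') (y \<ominus>\<^bsub>Y\<^esub> y')"
    and R_smult: "s \<in> carrier S \<Longrightarrow> R x y \<Longrightarrow> R (s \<odot>\<^bsub>G\<^esub> x) (s \<odot>\<^bsub>Y\<^esub> y)"
    and R_zero: "R x y \<Longrightarrow> x \<in> B \<longleftrightarrow> y = \<zero>\<^bsub>Y\<^esub>"
begin

sublocale G: op_group S G by (rule G)
sublocale Y: op_group S Y by (rule Y)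

lemma R_B: "x \<in> B \<Longrightarrow> R x \<zero>\<^bsub>Y\<^esub>"
  using R_total R_zero BZ by (metis subsetD)

lemma R_functional:
  assumes "R x y" "R x y'" shows "y = y'"
proof -
  have m: "x \<in> carrier G" "y \<in> carrier Y" "y' \<in> carrier Y" using assms R_in ZG by blast+
  have "R (x \<ominus>\<^bsub>G\<^esub> x) (y \<ominus>\<^bsub>Y\<^esub> y')" by (rule R_minus[OF assms])
  then have "y \<ominus>\<^bsub>Y\<^esub> y' = \<zero>\<^bsub>Y\<^esub>" using R_zero zB G.minus_self[OF m(1)] by metis
  then show ?thesis using Y.minus_eq_zero[OF m(2,3)] by simp
qed

end

text \<open>Naturality is demanded for one representative of each \<open>y\<close> only, which lets
  it be checked on conveniently built cocycles. The lemma \<open>compat\<close> extends it to all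
  representatives, since two of them differ by an element of \<open>B\<close>.\<close>

locale subquotient_relation_map =
  R: subquotient_relation S G Z B Y R + R': subquotient_relation S G' Z' B' Y' R'
  for S :: "('s, 'z) ring_scheme" and G :: "('s, 'g, 'v) module_scheme" and Z B
    and Y :: "('s, 'y, 'w) module_scheme" and R and G' :: "('s, 'g', 'v') module_scheme" and Z' B'
    and Y' :: "('s, 'y', 'w') module_scheme" and R' +
  fixes f :: "'g \<Rightarrow> 'g'" and t :: "'y \<Rightarrow> 'y'"
  assumes f: "f \<in> lin_maps S G G'" and fB: "x \<in> B \<Longrightarrow> f x \<in> B'"
    and surj_compat: "y \<in> carrier Y \<Longrightarrow> \<exists>x. R x y \<and> R' (f x) (t y)"
begin

lemma compat:
  assumes "R x y" shows "R' (f x) (t y)"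
proof -
  have y: "y \<in> carrier Y" and x: "x \<in> carrier G" using R.R_in[OF assms] R.ZG by auto
  obtain x' where x': "R x' y" "R' (f x') (t y)" using surj_compat[OF y] by blast
  have x'G: "x' \<in> carrier G" using R.R_in[OF x'(1)] R.ZG by auto
  have "R (x \<ominus>\<^bsub>G\<^esub> x') \<zero>\<^bsub>Y\<^esub>" using R.R_minus[OF assms x'(1)] R.Y.minus_self[OF y] by simp
  then have "f (x \<ominus>\<^bsub>G\<^esub> x') \<in> B'" using R.R_zero fB by blast
  then have "R' (f (x \<ominus>\<^bsub>G\<^esub> x') \<oplus>\<^bsub>G'\<^esub> f x') (\<zero>\<^bsub>Y'\<^esub> \<oplus>\<^bsub>Y'\<^esub> t y)" using R'.R_add[OF R'.R_B x'(2)] by blast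
  moreover have "f (x \<ominus>\<^bsub>G\<^esub> x') \<oplus>\<^bsub>G'\<^esub> f x' = f x"
    using lin_mapsD(2)[OF f R.G.minus_closed[OF x x'G] x'G] R.G.minus_add_cancel[OF x x'G] by simp
  ultimately show ?thesis using R'.R_in[OF x'(2)] by simp
qed

end

text \<open>The left side is the homology of the sequence Z1/B1 -> Z0/B0 -> Zm/Bm, written as one
  subquotient of \<open>G0\<close>; the relations identify this sequence with Y1 -> Y0 ->
  Ym.\<close>

lemma sq_iso_transport:
  assumes "subquotient_relation_map S G1 Z1 B1 Y1 R1 G0 Z0 B0 Y0 R0 f1 t1"
    and "subquotient_relation_map S G0 Z0 B0 Y0 R0 Gm Zm Bm Ym Rm f0 t0"
    and Bm: "op_sub S Gm Bm"
  shows "sq_iso S G0 {x \<in> Z0. f0 x \<in> Bm} {b \<oplus>\<^bsub>G0\<^esub> f1 z |b z. b \<in> B0 \<and> z \<in> Z1}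
    Y0 {y \<in> carrier Y0. t0 y = \<zero>\<^bsub>Ym\<^esub>} (t1 ` carrier Y1)"
proof -
  interpret a: subquotient_relation_map S G1 Z1 B1 Y1 R1 G0 Z0 B0 Y0 R0 f1 t1 by fact
  interpret b: subquotient_relation_map S G0 Z0 B0 Y0 R0 Gm Zm Bm Ym Rm f0 t0 by fact
  have iff: "f0 x \<in> Bm \<longleftrightarrow> t0 y = \<zero>\<^bsub>Ym\<^esub>" if "R0 x y" for x y by (rule b.R'.R_zero[OF b.compat[OF that]])
  have G0: "x \<in> carrier G0" "y \<in> carrier Y0" "x \<in> Z0" if "R0 x y" for x y using a.R'.R_in[OF that] a.R'.ZG by auto
  show ?thesis
  proof (rule sq_isoI[where \<rho> = "\<lambda>x y. R0 x y \<and> f0 x \<in> Bm"])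
    show "\<exists>y. R0 x y \<and> f0 x \<in> Bm" if "x \<in> {x \<in> Z0. f0 x \<in> Bm}" for x
      using that a.R'.R_total by auto
    show "\<exists>x. R0 x y \<and> f0 x \<in> Bm" if "y \<in> {y \<in> carrier Y0. t0 y = \<zero>\<^bsub>Ym\<^esub>}" for y
      using that b.surj_compat[of y] iff by blast
    show "R0 (x \<oplus>\<^bsub>G0\<^esub> x') (y \<oplus>\<^bsub>Y0\<^esub> y') \<and> f0 (x \<oplus>\<^bsub>G0\<^esub> x') \<in> Bm"
      if "R0 x y \<and> f0 x \<in> Bm" "R0 x' y' \<and> f0 x' \<in> Bm" for x y x' y'
      using that a.R'.R_add[of x y x' y'] lin_mapsD(2)[OF b.f G0(1) G0(1), of x y x' y'] op_subD(3)[OF Bm] by auto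
    show "R0 (s \<odot>\<^bsub>G0\<^esub> x) (s \<odot>\<^bsub>Y0\<^esub> y) \<and> f0 (s \<odot>\<^bsub>G0\<^esub> x) \<in> Bm"
      if "s \<in> carrier S" "R0 x y \<and> f0 x \<in> Bm" for s x y
      using that a.R'.R_smult[of s x y] lin_mapsD(3)[OF b.f that(1) G0(1), of x y] op_subD(5)[OF Bm] by auto
    show "y \<in> t1 ` carrier Y1" if r: "R0 x y \<and> f0 x \<in> Bm" and x: "x \<in> {b \<oplus>\<^bsub>G0\<^esub> f1 z |b z. b \<in> B0 \<and> z \<in> Z1}" for x y
    proof -
      obtain b z where bz: "x = b \<oplus>\<^bsub>G0\<^esub> f1 z" "b \<in> B0" "z \<in> Z1" using x by blast
      obtain w where w: "R1 z w" using a.R.R_total[OF bz(3)] by blast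
      have "R0 x (\<zero>\<^bsub>Y0\<^esub> \<oplus>\<^bsub>Y0\<^esub> t1 w)" unfolding bz(1) by (rule a.R'.R_add[OF a.R'.R_B[OF bz(2)] a.compat[OF w]])
      then have "y = \<zero>\<^bsub>Y0\<^esub> \<oplus>\<^bsub>Y0\<^esub> t1 w" using r a.R'.R_functional by blast
      then have "y = t1 w" using G0(2)[OF a.compat[OF w]] by simp
      then show ?thesis using a.R.R_in[OF w] by blast
    qed
    show "x \<in> {b \<oplus>\<^bsub>G0\<^esub> f1 z |b z. b \<in> B0 \<and> z \<in> Z1}" if r: "R0 x y \<and> f0 x \<in> Bm" and y: "y \<in> t1 ` carrier Y1" for x y
    proof -
      obtain w where w: "w \<in> carrier Y1" "y = t1 w" using y by blast
      obtain z where z: "R1 z w" "R0 (f1 z) (t1 w)" using a.surj_compat[OF w(1)] by blast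
      have "R0 (x \<ominus>\<^bsub>G0\<^esub> f1 z) \<zero>\<^bsub>Y0\<^esub>"
        using a.R'.R_minus[of x y "f1 z" "t1 w"] r z(2) w(2) a.R'.Y.minus_self[OF G0(2)[OF z(2)]] by simp
      then have "x \<ominus>\<^bsub>G0\<^esub> f1 z \<in> B0" using a.R'.R_zero by blast
      moreover have "x = (x \<ominus>\<^bsub>G0\<^esub> f1 z) \<oplus>\<^bsub>G0\<^esub> f1 z"
        using a.R'.G.minus_add_cancel[OF G0(1) G0(1), of x y "f1 z" "t1 w"] r z(2) by simp
      ultimately show ?thesis using a.R.R_in[OF z(1)] by blast
    qed
  qed (use G0 iff in auto)
qed

section \<open>Tensor products with free modules\<close>

lemma formal_sel:
  "u \<in> carrier (formal_tensors N T act) \<longleftrightarrow> Poly_Mapping.keys u \<subseteq> carrier N \<times> carrier T"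
  "\<zero>\<^bsub>formal_tensors N T act\<^esub> = 0" "u \<oplus>\<^bsub>formal_tensors N T act\<^esub> v = u + v"
  "s \<odot>\<^bsub>formal_tensors N T act\<^esub> u = frag_extend (\<lambda>(x, y). frag_of (act s x, y)) u"
  by (simp_all add: formal_tensors_def)

lemma keys_frag_extend_product:
  assumes "\<And>x. x \<in> X \<Longrightarrow> \<alpha> x \<in> X'" "\<And>y. y \<in> Y \<Longrightarrow> \<beta> y \<in> Y'" "Poly_Mapping.keys u \<subseteq> X \<times> Y"
  shows "Poly_Mapping.keys (frag_extend (\<lambda>(x, y). frag_of (\<alpha> x, \<beta> y)) u) \<subseteq> X' \<times> Y'"
  by (rule order.trans[OF keys_frag_extend]) (use assms in auto)

lemma opposite_sel: "carrier (opposite A) = carrier A" "a \<otimes>\<^bsub>opposite A\<^esub> b = b \<otimes>\<^bsub>A\<^esub> a" "\<one>\<^bsub>opposite A\<^esub> = \<one>\<^bsub>A\<^esub>"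
  "\<zero>\<^bsub>opposite A\<^esub> = \<zero>\<^bsub>A\<^esub>" "a \<oplus>\<^bsub>opposite A\<^esub> b = a \<oplus>\<^bsub>A\<^esub> b"
  by (simp_all add: opposite_def)

lemma formal_op_group:
  assumes "commuting_action (opposite A) N S act"
  shows "op_group S (formal_tensors N T act)"
proof (intro op_group.intro abelian_groupI op_group_axioms.intro)
  fix u assume "u \<in> carrier (formal_tensors N T act)"
  then show "\<exists>v\<in>carrier (formal_tensors N T act). v \<oplus>\<^bsub>formal_tensors N T act\<^esub> u = \<zero>\<^bsub>formal_tensors N T act\<^esub>"
    by (intro bexI[of _ "- u"]) (auto simp: formal_sel)
  fix s assume "s \<in> carrier S"
  then have "act s \<in> lin_maps (opposite A) N N" using assms by (simp add: commuting_action_def)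
  then show "s \<odot>\<^bsub>formal_tensors N T act\<^esub> u \<in> carrier (formal_tensors N T act)"
    using \<open>u \<in> _\<close> unfolding formal_sel by (intro keys_frag_extend_product[where \<beta> = "\<lambda>y. y"]) (auto dest: lin_mapsD(1))
next
  fix u v assume "u \<in> carrier (formal_tensors N T act)" "v \<in> carrier (formal_tensors N T act)"
  then show "u \<oplus>\<^bsub>formal_tensors N T act\<^esub> v \<in> carrier (formal_tensors N T act)"
    unfolding formal_sel using keys_add[of u v] by blast
qed (auto simp: formal_sel frag_extend_add)

lemma formal_minus:
  assumes "commuting_action (opposite A) N S act" "u \<in> carrier (formal_tensors N T act)" "v \<in> carrier (formal_tensors N T act)"
  shows "u \<ominus>\<^bsub>formal_tensors N T act\<^esub> v = u - v"
proof -
  interpret F: op_group S "formal_tensors N T act" by (rule formal_op_group[OF assms(1)])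
  have "- v \<in> carrier (formal_tensors N T act)" using assms(3) by (simp add: formal_sel)
  then have "\<ominus>\<^bsub>formal_tensors N T act\<^esub> v = - v"
    using F.minus_equality[of "- v" v] assms(3) by (simp add: formal_sel)
  then show ?thesis by (simp add: a_minus_def formal_sel)
qed

section \<open>The subgroup of tensor relations\<close>

definition tensor_generators ::
  "('a, 'z) ring_scheme \<Rightarrow> ('a, 'n, 'y) module_scheme \<Rightarrow> ('a, 'p, 'x) module_scheme \<Rightarrow> ('n \<times> 'p \<Rightarrow>\<^sub>0 int) set" where
  "tensor_generators A N P =
    {frag_of (x \<oplus>\<^bsub>N\<^esub> x', y) - frag_of (x, y) - frag_of (x', y) |x x' y.
        x \<in> carrier N \<and> x' \<in> carrier N \<and> y \<in> carrier P} \<union>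
     {frag_of (x, y \<oplus>\<^bsub>P\<^esub> y') - frag_of (x, y) - frag_of (x, y') |x y y'.
        x \<in> carrier N \<and> y \<in> carrier P \<and> y' \<in> carrier P} \<union>
     {frag_of (a \<odot>\<^bsub>N\<^esub> x, y) - frag_of (x, a \<odot>\<^bsub>P\<^esub> y) |a x y.
        a \<in> carrier A \<and> x \<in> carrier N \<and> y \<in> carrier P}"

lemma tensor_relations_generate:
  "tensor_relations A N P = generate (free_Abelian_group (carrier N \<times> carrier P)) (tensor_generators A N P)"
  by (simp add: tensor_relations_def tensor_generators_def)

lemma tensor_generatorsI:
  "\<lbrakk>x \<in> carrier N; x' \<in> carrier N; y \<in> carrier P\<rbrakk> \<Longrightarrow>
    frag_of (x \<oplus>\<^bsub>N\<^esub> x', y) - frag_of (x, y) - frag_of (x', y) \<in> tensor_generators A N P"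
  "\<lbrakk>x \<in> carrier N; y \<in> carrier P; y' \<in> carrier P\<rbrakk> \<Longrightarrow>
    frag_of (x, y \<oplus>\<^bsub>P\<^esub> y') - frag_of (x, y) - frag_of (x, y') \<in> tensor_generators A N P"
  "\<lbrakk>a \<in> carrier A; x \<in> carrier N; y \<in> carrier P\<rbrakk> \<Longrightarrow>
    frag_of (a \<odot>\<^bsub>N\<^esub> x, y) - frag_of (x, a \<odot>\<^bsub>P\<^esub> y) \<in> tensor_generators A N P"
  unfolding tensor_generators_def by blast+

lemma tensor_generatorsE:
  assumes "h \<in> tensor_generators A N P"
  obtains x x' y where "x \<in> carrier N" "x' \<in> carrier N" "y \<in> carrier P"
      "h = frag_of (x \<oplus>\<^bsub>N\<^esub> x', y) - frag_of (x, y) - frag_of (x', y)"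
  | x y y' where "x \<in> carrier N" "y \<in> carrier P" "y' \<in> carrier P"
      "h = frag_of (x, y \<oplus>\<^bsub>P\<^esub> y') - frag_of (x, y) - frag_of (x, y')"
  | a x y where "a \<in> carrier A" "x \<in> carrier N" "y \<in> carrier P"
      "h = frag_of (a \<odot>\<^bsub>N\<^esub> x, y) - frag_of (x, a \<odot>\<^bsub>P\<^esub> y)"
  using assms unfolding tensor_generators_def by (elim UnE CollectE exE conjE)

context
  fixes A :: "('a, 'z) ring_scheme" and N :: "('a, 'n, 'y) module_scheme" and T :: "('a, 't, 'x) module_scheme"
  assumes N: "right_module A N" and T: "left_module A T"
begin

interpretation N: left_module "opposite A" N by (rule N)
interpretation T: left_module A T by (rule T)

lemma tensor_relations_gens:
  "\<lbrakk>x \<in> carrier N; x' \<in> carrier N; y \<in> carrier T\<rbrakk> \<Longrightarrow>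
    frag_of (x \<oplus>\<^bsub>N\<^esub> x', y) - frag_of (x, y) - frag_of (x', y) \<in> tensor_relations A N T"
  "\<lbrakk>x \<in> carrier N; y \<in> carrier T; y' \<in> carrier T\<rbrakk> \<Longrightarrow>
    frag_of (x, y \<oplus>\<^bsub>T\<^esub> y') - frag_of (x, y) - frag_of (x, y') \<in> tensor_relations A N T"
  "\<lbrakk>a \<in> carrier A; x \<in> carrier N; y \<in> carrier T\<rbrakk> \<Longrightarrow>
    frag_of (a \<odot>\<^bsub>N\<^esub> x, y) - frag_of (x, a \<odot>\<^bsub>T\<^esub> y) \<in> tensor_relations A N T"
  unfolding tensor_relations_generate by (rule generate.incl, erule (2) tensor_generatorsI)+

lemma tensor_relations_carrier: "u \<in> tensor_relations A N T \<Longrightarrow> Poly_Mapping.keys u \<subseteq> carrier N \<times> carrier T"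
proof -
  interpret G: comm_group "free_Abelian_group (carrier N \<times> carrier T)" by (rule abelian_free_Abelian_group)
  have k: "Poly_Mapping.keys (frag_of a - b) \<subseteq> carrier N \<times> carrier T" if "a \<in> carrier N \<times> carrier T" "Poly_Mapping.keys b \<subseteq> carrier N \<times> carrier T" for a b
    using keys_diff[of "frag_of a" b] that by auto
  have k2: "Poly_Mapping.keys (frag_of a - frag_of b - frag_of c) \<subseteq> carrier N \<times> carrier T"
    if "a \<in> carrier N \<times> carrier T" "b \<in> carrier N \<times> carrier T" "c \<in> carrier N \<times> carrier T" for a b c
    using keys_diff[of "frag_of a - frag_of b" "frag_of c"] k[of a "frag_of b"] that by auto
  assume "u \<in> tensor_relations A N T"
  moreover have "Poly_Mapping.keys h \<subseteq> carrier N \<times> carrier T" if "h \<in> tensor_generators A N T" for h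
    using that
  proof (cases rule: tensor_generatorsE)
    case (1 x x' y) then show ?thesis using k2[of "(x \<oplus>\<^bsub>N\<^esub> x', y)" "(x, y)" "(x', y)"] by simp
  next
    case (2 x y y') then show ?thesis using k2[of "(x, y \<oplus>\<^bsub>T\<^esub> y')" "(x, y)" "(x, y')"] by simp
  next
    case (3 a x y) then show ?thesis using k[of "(a \<odot>\<^bsub>N\<^esub> x, y)" "frag_of (x, a \<odot>\<^bsub>T\<^esub> y)"] by (simp add: opposite_sel)
  qed
  ultimately have "u \<in> carrier (free_Abelian_group (carrier N \<times> carrier T))"
    unfolding tensor_relations_generate
    using G.generate_incl[of "tensor_generators A N T"] by (meson carrier_free_Abelian_group_iff subsetD subsetI)
  then show ?thesis by simp
qed

lemma tensor_relations_zero: "0 \<in> tensor_relations A N T"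
  using generate.one[of "free_Abelian_group (carrier N \<times> carrier T)"] unfolding tensor_relations_def by simp

lemma tensor_relations_add: "u \<in> tensor_relations A N T \<Longrightarrow> v \<in> tensor_relations A N T \<Longrightarrow> u + v \<in> tensor_relations A N T"
  unfolding tensor_relations_def using generate.eng[of u "free_Abelian_group (carrier N \<times> carrier T)" _ v] by simp

lemma tensor_relations_least:
  assumes "0 \<in> J" and diff: "\<And>u v. u \<in> J \<Longrightarrow> v \<in> J \<Longrightarrow> u - v \<in> J"
    and "\<And>x x' y. \<lbrakk>x \<in> carrier N; x' \<in> carrier N; y \<in> carrier T\<rbrakk> \<Longrightarrow>
      frag_of (x \<oplus>\<^bsub>N\<^esub> x', y) - frag_of (x, y) - frag_of (x', y) \<in> J"
    and "\<And>x y y'. \<lbrakk>x \<in> carrier N; y \<in> carrier T; y' \<in> carrier T\<rbrakk> \<Longrightarrow>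
      frag_of (x, y \<oplus>\<^bsub>T\<^esub> y') - frag_of (x, y) - frag_of (x, y') \<in> J"
    and "\<And>a x y. \<lbrakk>a \<in> carrier A; x \<in> carrier N; y \<in> carrier T\<rbrakk> \<Longrightarrow>
      frag_of (a \<odot>\<^bsub>N\<^esub> x, y) - frag_of (x, a \<odot>\<^bsub>T\<^esub> y) \<in> J"
  shows "tensor_relations A N T \<subseteq> J"
proof
  fix u assume "u \<in> tensor_relations A N T"
  then show "u \<in> J" unfolding tensor_relations_generate
  proof (induction rule: generate.induct)
    case one then show ?case using assms(1) by simp
  next
    case (incl h) then show ?case by (cases rule: tensor_generatorsE) (use assms(3-5) in simp_all)
  next
    case (inv h)
    have "h \<in> tensor_relations A N T" unfolding tensor_relations_generate by (rule generate.incl[OF inv])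
    then have "inv\<^bsub>free_Abelian_group (carrier N \<times> carrier T)\<^esub> h = 0 - h" using tensor_relations_carrier by simp
    moreover have "h \<in> J" using inv by (cases rule: tensor_generatorsE) (use assms(3-5) in simp_all)
    ultimately show ?case using diff[OF assms(1)] by metis
  next
    case (eng h1 h2)
    have "h1 - (0 - h2) \<in> J" by (intro diff assms(1) eng.IH)
    then show ?case by simp
  qed
qed

text \<open>\<open>generate\<close> contains inverses of generators only, so closure under negation
  needs an argument: \<open>tensor_relations_least\<close> is applied to those relations whose
  negative is a relation too.\<close>

lemma tensor_relations_minus: "u \<in> tensor_relations A N T \<Longrightarrow> - u \<in> tensor_relations A N T"
proof -
  have "tensor_relations A N T \<subseteq> {u \<in> tensor_relations A N T. - u \<in> tensor_relations A N T}"
  proof (rule tensor_relations_least, goal_cases)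
    case 1 then show ?case using tensor_relations_zero by simp
  next
    case (2 u v)
    then show ?case using tensor_relations_add[of u "- v"] tensor_relations_add[of v "- u"] by simp
  next
    have i: "h \<in> {u \<in> tensor_relations A N T. - u \<in> tensor_relations A N T}" if h: "h \<in> tensor_generators A N T" for h
    proof -
      have 1: "h \<in> tensor_relations A N T" unfolding tensor_relations_generate by (rule generate.incl[OF h])
      then show ?thesis
        using generate.inv[OF h, of "free_Abelian_group (carrier N \<times> carrier T)"] tensor_relations_carrier[OF 1]
        by (simp add: tensor_relations_generate)
    qed
    {
      case (3 x x' y) then show ?case by (intro i tensor_generatorsI(1))
    next
      case (4 x y y') then show ?case by (intro i tensor_generatorsI(2))
    next
      case (5 a x y) then show ?case by (intro i tensor_generatorsI(3))
    }
  qed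
  then show "u \<in> tensor_relations A N T \<Longrightarrow> - u \<in> tensor_relations A N T" by blast
qed

lemma tensor_relations_diff: "u \<in> tensor_relations A N T \<Longrightarrow> v \<in> tensor_relations A N T \<Longrightarrow> u - v \<in> tensor_relations A N T"
  using tensor_relations_add[OF _ tensor_relations_minus, of u v] by simp

lemma tensor_relations_zero_left: "y \<in> carrier T \<Longrightarrow> frag_of (\<zero>\<^bsub>N\<^esub>, y) \<in> tensor_relations A N T"
  using tensor_relations_minus[OF tensor_relations_gens(1)[of "\<zero>\<^bsub>N\<^esub>" "\<zero>\<^bsub>N\<^esub>" y]] by simp

lemma tensor_relations_zero_right: "x \<in> carrier N \<Longrightarrow> frag_of (x, \<zero>\<^bsub>T\<^esub>) \<in> tensor_relations A N T"
  using tensor_relations_minus[OF tensor_relations_gens(2)[of x "\<zero>\<^bsub>T\<^esub>" "\<zero>\<^bsub>T\<^esub>"]] by simp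

end

lemma tensor_relations_map:
  assumes N: "right_module A N" and T: "left_module A T" and N': "right_module A N'" and T': "left_module A T'"
    and \<alpha>: "\<alpha> \<in> lin_maps (opposite A) N N'" and \<beta>: "\<beta> \<in> lin_maps A T T'" and u: "u \<in> tensor_relations A N T"
  shows "frag_extend (\<lambda>(x, y). frag_of (\<alpha> x, \<beta> y)) u \<in> tensor_relations A N' T'"
proof -
  let ?g = "frag_extend (\<lambda>(x, y). frag_of (\<alpha> x, \<beta> y))"
  have "tensor_relations A N T \<subseteq> {u. ?g u \<in> tensor_relations A N' T'}"
  proof (rule tensor_relations_least[OF N T], goal_cases)
    case 1 then show ?case using tensor_relations_zero[OF N' T'] by simp
  next
    case (2 u v) then show ?case using tensor_relations_diff[OF N' T'] by (simp add: frag_extend_diff)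
  next
    case (3 x x' y)
    then show ?case using tensor_relations_gens(1)[OF N' T', of "\<alpha> x" "\<alpha> x'" "\<beta> y"]
      by (simp add: frag_extend_diff lin_mapsD[OF \<alpha>] lin_mapsD[OF \<beta>])
  next
    case (4 x y y')
    then show ?case using tensor_relations_gens(2)[OF N' T', of "\<alpha> x" "\<beta> y" "\<beta> y'"]
      by (simp add: frag_extend_diff lin_mapsD[OF \<alpha>] lin_mapsD[OF \<beta>])
  next
    case (5 a x y)
    then show ?case using tensor_relations_gens(3)[OF N' T', of a "\<alpha> x" "\<beta> y"] lin_mapsD(3)[OF \<alpha>, of a x]
      by (simp add: frag_extend_diff lin_mapsD[OF \<alpha>] lin_mapsD[OF \<beta>] opposite_sel)
  qed
  then show ?thesis using u by blast
qed

lemma tensor_relations_op_sub: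
  assumes N: "right_module A N" and T: "left_module A T" and act: "commuting_action (opposite A) N S act"
  shows "op_sub S (formal_tensors N T act) (tensor_relations A N T)"
proof -
  interpret F: op_group S "formal_tensors N T act" by (rule formal_op_group[OF act])
  have c: "u \<in> carrier (formal_tensors N T act)" if "u \<in> tensor_relations A N T" for u
    using tensor_relations_carrier[OF N T that] by (simp add: formal_sel)
  have id: "(\<lambda>y. y) \<in> lin_maps A T T" by (rule lin_mapsI) auto
  have "\<ominus>\<^bsub>formal_tensors N T act\<^esub> u = - u" if "u \<in> tensor_relations A N T" for u
    using F.minus_equality[of "- u" u] c[OF that] c[OF tensor_relations_minus[OF N T that]] by (simp add: formal_sel)
  moreover have "s \<odot>\<^bsub>formal_tensors N T act\<^esub> u \<in> tensor_relations A N T" if "s \<in> carrier S" "u \<in> tensor_relations A N T" for s u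
    using tensor_relations_map[OF N T N T _ id that(2), of "act s"] act that(1) by (simp add: formal_sel commuting_action_def)
  ultimately show ?thesis
    unfolding op_sub_def using c tensor_relations_zero[OF N T] tensor_relations_add[OF N T] tensor_relations_minus[OF N T]
    by (auto simp: formal_sel)
qed

text \<open>The \<open>b\<close>-th coordinate under the isomorphism of \<open>N \<otimes> A\<^sup>(\<^sup>B\<^sup>)\<close> with \<open>N\<^sup>(\<^sup>B\<^sup>)\<close>, on formal tensors.\<close>

definition tensor_coord ::
  "('a, 'n, 'y) module_scheme \<Rightarrow> ('a, 'i \<Rightarrow> 'a, 'x) module_scheme \<Rightarrow> 'i \<Rightarrow> ('n \<times> ('i \<Rightarrow> 'a) \<Rightarrow>\<^sub>0 int) \<Rightarrow> 'n" where
  "tensor_coord N T b = (SOME h. h \<in> hom (free_Abelian_group (carrier N \<times> carrier T)) (add_monoid N) \<and>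
     (\<forall>x\<in>carrier N. \<forall>f\<in>carrier T. h (frag_of (x, f)) = f b \<odot>\<^bsub>N\<^esub> x))"

section \<open>Coordinates on a tensor product with a free module\<close>

context
  fixes A :: "('a, 'z) ring_scheme" and N :: "('a, 'n, 'y) module_scheme" and B :: "'i set"
  assumes A: "ring A" and N: "right_module A N"
begin

interpretation A: ring A by (rule A)
interpretation N: left_module "opposite A" N by (rule N)
interpretation NO: op_group "opposite A" N by (rule left_module_op_group[OF N])
interpretation T: left_module A "free_module A B" by (rule free_left_module[OF A])

private abbreviation (input) "T \<equiv> free_module A B"
private abbreviation (input) "co \<equiv> tensor_coord N (free_module A B)"

lemma tensor_coord:
  "tensor_coord N T b \<in> hom (free_Abelian_group (carrier N \<times> carrier T)) (add_monoid N) \<and>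
     (\<forall>x\<in>carrier N. \<forall>f\<in>carrier T. tensor_coord N T b (frag_of (x, f)) = f b \<odot>\<^bsub>N\<^esub> x)"
proof -
  have "(\<lambda>(x, f). f b \<odot>\<^bsub>N\<^esub> x) ` (carrier N \<times> carrier T) \<subseteq> carrier (add_monoid N)"
    using free_carrier_val[OF A] by (auto simp: opposite_sel intro!: N.smult_closed)
  then obtain h where "h \<in> hom (free_Abelian_group (carrier N \<times> carrier T)) (add_monoid N)"
    "\<And>x. x \<in> carrier N \<times> carrier T \<Longrightarrow> h (frag_of x) = (\<lambda>(x, f). f b \<odot>\<^bsub>N\<^esub> x) x"
    by (rule comm_group.free_Abelian_group_universal[OF N.M.a_comm_group]) blast
  then have "\<exists>h. h \<in> hom (free_Abelian_group (carrier N \<times> carrier T)) (add_monoid N) \<and>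
     (\<forall>x\<in>carrier N. \<forall>f\<in>carrier T. h (frag_of (x, f)) = f b \<odot>\<^bsub>N\<^esub> x)" by (intro exI[of _ h]) auto
  then show ?thesis unfolding tensor_coord_def by (rule someI_ex)
qed

lemma coord_pure: "x \<in> carrier N \<Longrightarrow> f \<in> carrier T \<Longrightarrow> co b (frag_of (x, f)) = f b \<odot>\<^bsub>N\<^esub> x"
  using tensor_coord by blast

lemma coord_closed: "Poly_Mapping.keys u \<subseteq> carrier N \<times> carrier T \<Longrightarrow> co b u \<in> carrier N"
  using hom_in_carrier[OF conjunct1[OF tensor_coord[of b]], of u] by simp

lemma coord_add: "Poly_Mapping.keys u \<subseteq> carrier N \<times> carrier T \<Longrightarrow> Poly_Mapping.keys v \<subseteq> carrier N \<times> carrier T \<Longrightarrow>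
  co b (u + v) = co b u \<oplus>\<^bsub>N\<^esub> co b v"
  using hom_mult[OF conjunct1[OF tensor_coord[of b]], of u v] by simp

lemma coord_diff:
  assumes "Poly_Mapping.keys u \<subseteq> carrier N \<times> carrier T" "Poly_Mapping.keys v \<subseteq> carrier N \<times> carrier T"
  shows "co b (u - v) = co b u \<ominus>\<^bsub>N\<^esub> co b v"
proof -
  have k: "Poly_Mapping.keys (u - v) \<subseteq> carrier N \<times> carrier T" using keys_diff[of u v] assms by blast
  have "co b u = co b (u - v) \<oplus>\<^bsub>N\<^esub> co b v" using coord_add[OF k assms(2)] by simp
  then show ?thesis using NO.add_minus_cancel[OF coord_closed[OF k] coord_closed[OF assms(2)]] by simp
qed

lemma coord_zero: "co b 0 = \<zero>\<^bsub>N\<^esub>"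
  using coord_diff[of 0 0 b] NO.minus_self[OF coord_closed[of 0 b]] by simp

lemma coord_relations:
  assumes u: "u \<in> tensor_relations A N T" shows "co b u = \<zero>\<^bsub>N\<^esub>"
proof -
  have "tensor_relations A N T \<subseteq> {u. Poly_Mapping.keys u \<subseteq> carrier N \<times> carrier T \<and> co b u = \<zero>\<^bsub>N\<^esub>}"
  proof (rule tensor_relations_least[OF N T.left_module_axioms], goal_cases)
    case 1 show ?case by (simp add: coord_zero)
  next
    case (2 u v)
    then show ?case using keys_diff[of u v] coord_diff[of u v b] NO.minus_self[OF N.M.zero_closed] by auto
  next
    case (3 x x' y)
    have v: "y b \<in> carrier A" by (rule free_carrier_val[OF A 3(3)])
    have k: "Poly_Mapping.keys (frag_of (x \<oplus>\<^bsub>N\<^esub> x', y) - frag_of (x, y)) \<subseteq> carrier N \<times> carrier T"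
      using 3 keys_diff[of "frag_of (x \<oplus>\<^bsub>N\<^esub> x', y)" "frag_of (x, y)"] by auto
    have "co b (frag_of (x \<oplus>\<^bsub>N\<^esub> x', y) - frag_of (x, y) - frag_of (x', y)) =
      ((y b \<odot>\<^bsub>N\<^esub> x \<oplus>\<^bsub>N\<^esub> y b \<odot>\<^bsub>N\<^esub> x') \<ominus>\<^bsub>N\<^esub> y b \<odot>\<^bsub>N\<^esub> x) \<ominus>\<^bsub>N\<^esub> y b \<odot>\<^bsub>N\<^esub> x'"
      using 3 k v by (simp add: coord_diff coord_pure N.smult_r_distr opposite_sel)
    also have "\<dots> = \<zero>\<^bsub>N\<^esub>" using 3 v by (simp add: opposite_sel a_minus_def N.M.a_ac N.M.r_neg N.M.r_neg1 N.M.r_neg2)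
    finally show ?case using tensor_relations_carrier[OF N T.left_module_axioms tensor_relations_gens(1)[OF N T.left_module_axioms 3]] by simp
  next
    case (4 x y y')
    have v: "y b \<in> carrier A" "y' b \<in> carrier A" using free_carrier_val[OF A 4(2)] free_carrier_val[OF A 4(3)] .
    have k: "Poly_Mapping.keys (frag_of (x, y \<oplus>\<^bsub>T\<^esub> y') - frag_of (x, y)) \<subseteq> carrier N \<times> carrier T"
      using 4 keys_diff[of "frag_of (x, y \<oplus>\<^bsub>T\<^esub> y')" "frag_of (x, y)"] by auto
    have "co b (frag_of (x, y \<oplus>\<^bsub>T\<^esub> y') - frag_of (x, y) - frag_of (x, y')) =
      ((y b \<odot>\<^bsub>N\<^esub> x \<oplus>\<^bsub>N\<^esub> y' b \<odot>\<^bsub>N\<^esub> x) \<ominus>\<^bsub>N\<^esub> y b \<odot>\<^bsub>N\<^esub> x) \<ominus>\<^bsub>N\<^esub> y' b \<odot>\<^bsub>N\<^esub> x"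
      using 4 k v N.smult_l_distr[of "y b" "y' b" x] by (simp add: coord_diff coord_pure opposite_sel free_sel)
    also have "\<dots> = \<zero>\<^bsub>N\<^esub>" using 4 v by (simp add: opposite_sel a_minus_def N.M.a_ac N.M.r_neg N.M.r_neg1 N.M.r_neg2)
    finally show ?case using tensor_relations_carrier[OF N T.left_module_axioms tensor_relations_gens(2)[OF N T.left_module_axioms 4]] by simp
  next
    case (5 a x y)
    have v: "y b \<in> carrier A" by (rule free_carrier_val[OF A 5(3)])
    \<comment> \<open>Read on the right, this is the identity of (x a) y_b and x (a y_b).\<close>
    have "co b (frag_of (a \<odot>\<^bsub>N\<^esub> x, y) - frag_of (x, a \<odot>\<^bsub>T\<^esub> y)) =
      y b \<odot>\<^bsub>N\<^esub> (a \<odot>\<^bsub>N\<^esub> x) \<ominus>\<^bsub>N\<^esub> (a \<otimes>\<^bsub>A\<^esub> y b) \<odot>\<^bsub>N\<^esub> x"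
      using 5 v by (simp add: coord_diff coord_pure opposite_sel free_sel)
    also have "\<dots> = \<zero>\<^bsub>N\<^esub>"
      using 5 v N.smult_assoc1[of "y b" a x] by (simp add: opposite_sel NO.minus_self)
    finally show ?case using tensor_relations_carrier[OF N T.left_module_axioms tensor_relations_gens(3)[OF N T.left_module_axioms 5]] by simp
  qed
  then show ?thesis using u by blast
qed

text \<open>Every tensor is the sum of its coordinates times the basis vectors. The claim is made
  for all finite index sets containing some \<open>F\<close>, so that two tensors can be brought to
  a common index set before they are subtracted.\<close>

lemma tensor_normal_form:
  assumes u: "Poly_Mapping.keys u \<subseteq> carrier N \<times> carrier T"
  shows "\<exists>F. finite F \<and> F \<subseteq> B \<and> (\<forall>G. finite G \<longrightarrow> F \<subseteq> G \<longrightarrow> G \<subseteq> B \<longrightarrow>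
     u - (\<Sum>b\<in>G. frag_of (co b u, basis_vector A b)) \<in> tensor_relations A N T)" (is "?C u")
proof -
  note TM = T.left_module_axioms
  note rdiff = tensor_relations_diff[OF N TM] and radd = tensor_relations_add[OF N TM] and rminus = tensor_relations_minus[OF N TM]
    and rzero = tensor_relations_zero[OF N TM]
  have rsum: "(\<Sum>b\<in>G. g b) \<in> tensor_relations A N T" if "\<And>b. b \<in> G \<Longrightarrow> g b \<in> tensor_relations A N T" for G :: "'i set" and g
    using that by (induction G rule: infinite_finite_induct) (auto intro: radd rzero)
  have bv: "basis_vector A b \<in> carrier T" if "b \<in> B" for b by (rule basis_vector_closed[OF A that])
  let ?K = "\<lambda>u. Poly_Mapping.keys u \<subseteq> carrier N \<times> carrier T"
  have C_diff: "?C (u - v)" if k: "?K u" "?K v" and C: "?C u" "?C v" for u v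
  proof -
    from C(1) obtain F1 where F1: "finite F1" "F1 \<subseteq> B" "\<forall>G. finite G \<longrightarrow> F1 \<subseteq> G \<longrightarrow> G \<subseteq> B \<longrightarrow>
     u - (\<Sum>b\<in>G. frag_of (co b u, basis_vector A b)) \<in> tensor_relations A N T" by (elim exE conjE)
    from C(2) obtain F2 where F2: "finite F2" "F2 \<subseteq> B" "\<forall>G. finite G \<longrightarrow> F2 \<subseteq> G \<longrightarrow> G \<subseteq> B \<longrightarrow>
     v - (\<Sum>b\<in>G. frag_of (co b v, basis_vector A b)) \<in> tensor_relations A N T" by (elim exE conjE)
    show ?thesis
    proof (rule exI[of _ "F1 \<union> F2"], intro conjI allI impI)
      show "finite (F1 \<union> F2)" "F1 \<union> F2 \<subseteq> B" using F1 F2 by auto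
      fix G assume G: "finite G" "F1 \<union> F2 \<subseteq> G" "G \<subseteq> B"
      have 1: "u - (\<Sum>b\<in>G. frag_of (co b u, basis_vector A b)) \<in> tensor_relations A N T" using F1(3) G by simp
      have 2: "v - (\<Sum>b\<in>G. frag_of (co b v, basis_vector A b)) \<in> tensor_relations A N T" using F2(3) G by simp
      have 3: "(\<Sum>b\<in>G. frag_of (co b u, basis_vector A b) - frag_of (co b (u - v), basis_vector A b) - frag_of (co b v, basis_vector A b))
         \<in> tensor_relations A N T"
      proof (rule rsum)
        fix b assume "b \<in> G"
        then have b: "b \<in> B" using G by blast
        have kd: "?K (u - v)" using keys_diff[of u v] k by blast
        have "co b u = co b (u - v) \<oplus>\<^bsub>N\<^esub> co b v" using coord_add[OF kd k(2), of b] by simp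
        then show "frag_of (co b u, basis_vector A b) - frag_of (co b (u - v), basis_vector A b) - frag_of (co b v, basis_vector A b)
         \<in> tensor_relations A N T"
          using tensor_relations_gens(1)[OF N TM coord_closed[OF kd] coord_closed[OF k(2)] bv[OF b], of b b] by simp
      qed
      have "(u - v) - (\<Sum>b\<in>G. frag_of (co b (u - v), basis_vector A b)) =
        (u - (\<Sum>b\<in>G. frag_of (co b u, basis_vector A b))) - (v - (\<Sum>b\<in>G. frag_of (co b v, basis_vector A b))) +
        (\<Sum>b\<in>G. frag_of (co b u, basis_vector A b) - frag_of (co b (u - v), basis_vector A b) - frag_of (co b v, basis_vector A b))"
        by (simp add: sum_subtractf)
      then show "(u - v) - (\<Sum>b\<in>G. frag_of (co b (u - v), basis_vector A b)) \<in> tensor_relations A N T"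
        using radd[OF rdiff[OF 1 2] 3] by (simp only:)
    qed
  qed
  \<comment> \<open>Not trivial on formal tensors: the sum consists of the generators with first
    entry zero, which vanish only modulo relations.\<close>
  have C_zero: "?C 0"
    using rminus[OF rsum[of _ "\<lambda>b. frag_of (\<zero>\<^bsub>N\<^esub>, basis_vector A b)"]] tensor_relations_zero_left[OF N TM bv]
    by (intro exI[of _ "{}"]) (auto simp: coord_zero)
  have C_cong: "?C u" if k: "?K u" "?K v" and uv: "u - v \<in> tensor_relations A N T" and C: "?C v" for u v
  proof -
    have co: "co b u = co b v" for b
      using coord_relations[OF uv, of b] coord_diff[OF k, of b] NO.minus_eq_zero[OF coord_closed[OF k(1)] coord_closed[OF k(2)]] by simp
    from C obtain F1 where F1: "finite F1" "F1 \<subseteq> B" "\<forall>G. finite G \<longrightarrow> F1 \<subseteq> G \<longrightarrow> G \<subseteq> B \<longrightarrow>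
     v - (\<Sum>b\<in>G. frag_of (co b v, basis_vector A b)) \<in> tensor_relations A N T" by (elim exE conjE)
    show ?thesis
    proof (rule exI[of _ F1], intro conjI allI impI)
      fix G assume "finite G" "F1 \<subseteq> G" "G \<subseteq> B"
      then have 1: "v - (\<Sum>b\<in>G. frag_of (co b v, basis_vector A b)) \<in> tensor_relations A N T" using F1(3) by simp
      have "u - (\<Sum>b\<in>G. frag_of (co b u, basis_vector A b)) = (u - v) + (v - (\<Sum>b\<in>G. frag_of (co b v, basis_vector A b)))"
        by (simp add: co)
      then show "u - (\<Sum>b\<in>G. frag_of (co b u, basis_vector A b)) \<in> tensor_relations A N T" using radd[OF uv 1] by simp
    qed (use F1 in auto)
  qed
  have C_add: "?C (u + v)" if k: "?K u" "?K v" and C: "?C u" "?C v" for u v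
  proof -
    have "?K (0 - v)" "?C (0 - v)" using C_diff[OF _ k(2) C_zero C(2)] k(2) by auto
    from C_diff[OF k(1) this(1) C(1) this(2)] show ?thesis by simp
  qed
  have C_basis: "?C (frag_of (x, basis_vector A i))" if x: "x \<in> carrier N" and i: "i \<in> B" for x i
  proof (rule exI[of _ "{i}"], intro conjI allI impI)
    show "finite {i}" "{i} \<subseteq> B" using i by auto
    fix G assume G: "finite G" "{i} \<subseteq> G" "G \<subseteq> B"
    have co: "co b (frag_of (x, basis_vector A i)) = (if b = i then x else \<zero>\<^bsub>N\<^esub>)" for b
      using coord_pure[OF x bv[OF i], of b] N.smult_one[OF x] N.smult_zero_l[OF x] by (simp add: basis_vector_def opposite_sel)
    have "(\<Sum>b\<in>G. frag_of (co b (frag_of (x, basis_vector A i)), basis_vector A b)) =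
       frag_of (x, basis_vector A i) + (\<Sum>b\<in>G - {i}. frag_of (\<zero>\<^bsub>N\<^esub>, basis_vector A b))"
      using G by (subst sum.remove[of G i]) (auto simp: co intro: sum.cong)
    moreover have "(\<Sum>b\<in>G - {i}. frag_of (\<zero>\<^bsub>N\<^esub>, basis_vector A b)) \<in> tensor_relations A N T"
      using G by (intro rsum tensor_relations_zero_left[OF N TM] bv) auto
    ultimately show "frag_of (x, basis_vector A i) - (\<Sum>b\<in>G. frag_of (co b (frag_of (x, basis_vector A i)), basis_vector A b))
      \<in> tensor_relations A N T" using rminus by simp
  qed
  have C_pure: "?C (frag_of (x, f))" if x: "x \<in> carrier N" and f: "f \<in> carrier T" for x f
    using A f
  proof (induction rule: free_induct)
    case zero
    show ?case by (rule C_cong[OF _ _ _ C_zero]) (use x tensor_relations_zero_right[OF N TM x] in auto)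
  next
    case (step a i y)
    let ?ab = "a \<odot>\<^bsub>T\<^esub> basis_vector A i"
    have ab: "?ab \<in> carrier T" using bv step by simp
    have ax: "a \<odot>\<^bsub>N\<^esub> x \<in> carrier N" using step x by (simp add: opposite_sel)
    have 1: "?C (frag_of (x, ?ab))"
    proof (rule C_cong[OF _ _ _ C_basis[OF ax \<open>i \<in> B\<close>]])
      show "frag_of (x, ?ab) - frag_of (a \<odot>\<^bsub>N\<^esub> x, basis_vector A i) \<in> tensor_relations A N T"
        using rminus[OF tensor_relations_gens(3)[OF N TM \<open>a \<in> carrier A\<close> x bv[OF \<open>i \<in> B\<close>]]] by simp
    qed (use x ab ax bv step in auto)
    have k: "?K (frag_of (x, ?ab))" "?K (frag_of (x, y))" using x ab step by auto
    show ?case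
    proof (rule C_cong[OF _ _ _ C_add[OF k 1 step(4)]])
      show "frag_of (x, ?ab \<oplus>\<^bsub>T\<^esub> y) - (frag_of (x, ?ab) + frag_of (x, y)) \<in> tensor_relations A N T"
        using tensor_relations_gens(2)[OF N TM x ab \<open>y \<in> carrier T\<close>] by (simp add: diff_diff_add)
    qed (use x ab step keys_add[of "frag_of (x, ?ab)" "frag_of (x, y)"] in auto)
  qed
  show ?thesis
    using u
  proof (rule free_Abelian_group_induct)
    fix a assume "a \<in> carrier N \<times> carrier T"
    then show "?C (frag_of a)" using C_pure by (cases a) auto
  qed (fact C_zero C_diff)+
qed

text \<open>Injectivity of the coordinate map. If all coordinates vanish, the normal form is a sum
  of tensors with first factor zero.\<close>

lemma tensor_zero_iff:
  assumes u: "Poly_Mapping.keys u \<subseteq> carrier N \<times> carrier T"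
  shows "u \<in> tensor_relations A N T \<longleftrightarrow> (\<forall>b\<in>B. co b u = \<zero>\<^bsub>N\<^esub>)"
proof
  assume "u \<in> tensor_relations A N T"
  then show "\<forall>b\<in>B. co b u = \<zero>\<^bsub>N\<^esub>" using coord_relations by blast
next
  assume z: "\<forall>b\<in>B. co b u = \<zero>\<^bsub>N\<^esub>"
  note TM = T.left_module_axioms
  from tensor_normal_form[OF u] obtain F where F: "finite F" "F \<subseteq> B" "\<forall>G. finite G \<longrightarrow> F \<subseteq> G \<longrightarrow> G \<subseteq> B \<longrightarrow>
     u - (\<Sum>b\<in>G. frag_of (co b u, basis_vector A b)) \<in> tensor_relations A N T" by (elim exE conjE)
  have 1: "u - (\<Sum>b\<in>F. frag_of (co b u, basis_vector A b)) \<in> tensor_relations A N T" using F by simp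
  have 2: "(\<Sum>b\<in>F'. frag_of (co b u, basis_vector A b)) \<in> tensor_relations A N T" if "F' \<subseteq> B" for F'
    using that
    by (induction F' rule: infinite_finite_induct)
      (use z tensor_relations_zero[OF N TM] tensor_relations_add[OF N TM] tensor_relations_zero_left[OF N TM basis_vector_closed[OF A]] in auto)
  show "u \<in> tensor_relations A N T" using tensor_relations_add[OF N TM 1 2[OF F(2)]] by simp
qed

lemma coord_act:
  assumes \<alpha>: "\<alpha> \<in> lin_maps (opposite A) N N" and u: "Poly_Mapping.keys u \<subseteq> carrier N \<times> carrier T"
  shows "co b (frag_extend (\<lambda>(x, y). frag_of (\<alpha> x, y)) u) = \<alpha> (co b u)"
  using u
proof (rule free_Abelian_group_induct)
  show "co b (frag_extend (\<lambda>(x, y). frag_of (\<alpha> x, y)) 0) = \<alpha> (co b 0)"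
    using lin_zero_mod[OF N N \<alpha>] by (simp add: coord_zero)
next
  fix u v assume k: "Poly_Mapping.keys u \<subseteq> carrier N \<times> carrier T" "Poly_Mapping.keys v \<subseteq> carrier N \<times> carrier T"
    and e: "co b (frag_extend (\<lambda>(x, y). frag_of (\<alpha> x, y)) u) = \<alpha> (co b u)" "co b (frag_extend (\<lambda>(x, y). frag_of (\<alpha> x, y)) v) = \<alpha> (co b v)"
  have k': "Poly_Mapping.keys (frag_extend (\<lambda>(x, y). frag_of (\<alpha> x, y)) w) \<subseteq> carrier N \<times> carrier T"
    if "Poly_Mapping.keys w \<subseteq> carrier N \<times> carrier T" for w :: "'n \<times> ('i \<Rightarrow> 'a) \<Rightarrow>\<^sub>0 int"
    by (rule keys_frag_extend_product[where \<beta> = "\<lambda>y. y"]) (use that lin_mapsD(1)[OF \<alpha>] in auto)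
  show "co b (frag_extend (\<lambda>(x, y). frag_of (\<alpha> x, y)) (u - v)) = \<alpha> (co b (u - v))"
    using lin_minus_mod[OF N N \<alpha> coord_closed[OF k(1)] coord_closed[OF k(2)], of b b]
    by (simp add: frag_extend_diff coord_diff[OF k] coord_diff[OF k'[OF k(1)] k'[OF k(2)]] e)
next
  fix a assume "a \<in> carrier N \<times> carrier T"
  then obtain x f where a: "a = (x, f)" "x \<in> carrier N" "f \<in> carrier T" by auto
  show "co b (frag_extend (\<lambda>(x, y). frag_of (\<alpha> x, y)) (frag_of a)) = \<alpha> (co b (frag_of a))"
    using a lin_mapsD(1)[OF \<alpha>] lin_mapsD(3)[OF \<alpha>, of "f b" x] free_carrier_val[OF A a(3), of b]
    by (simp add: coord_pure opposite_sel)
qed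

end

lemma (in op_group) minus_quotient:
  assumes B: "op_sub S C B" and xy: "x \<in> carrier C" "y \<in> carrier C"
  shows "(B +> x) \<ominus>\<^bsub>quotient_module C B\<^esub> (B +> y) = B +> (x \<ominus> y)"
proof -
  interpret Q: op_group S "quotient_module C B" by (rule op_group_quotient[OF B])
  have "B +> x = (B +> (x \<ominus> y)) \<oplus>\<^bsub>quotient_module C B\<^esub> (B +> y)"
    using add_quotient[OF B minus_closed[OF xy] xy(2)] minus_add_cancel[OF xy] by simp
  moreover have "B +> (x \<ominus> y) \<in> carrier (quotient_module C B)" "B +> y \<in> carrier (quotient_module C B)"
    using minus_closed[OF xy] xy by (auto simp: carrier_quotient)
  ultimately show ?thesis using Q.add_minus_cancel by simp
qed

lemma (in op_group) coset_self_iff: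
  assumes B: "op_sub S C B" and x: "x \<in> carrier C"
  shows "B +> x = B \<longleftrightarrow> x \<in> B"
  using coset_eq_iff[OF B x zero_closed] coset_zero[OF B] minus_zero[OF x] by simp

context subquotient_relation_map
begin

lemma t_lin:
  assumes R_surj: "\<And>y. y \<in> carrier Y \<Longrightarrow> \<exists>x. R x y"
  shows "t \<in> lin_maps S Y Y'"
proof (rule lin_mapsI)
  fix y assume y: "y \<in> carrier Y"
  obtain x where x: "R x y" using R_surj[OF y] by blast
  show "t y \<in> carrier Y'" using R'.R_in[OF compat[OF x]] by blast
  have xG: "x \<in> carrier G" using R.R_in[OF x] R.ZG by blast
  fix s assume s: "s \<in> carrier S"
  have "R' (f (s \<odot>\<^bsub>G\<^esub> x)) (t (s \<odot>\<^bsub>Y\<^esub> y))" by (rule compat[OF R.R_smult[OF s x]])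
  moreover have "R' (s \<odot>\<^bsub>G'\<^esub> f x) (s \<odot>\<^bsub>Y'\<^esub> t y)" by (rule R'.R_smult[OF s compat[OF x]])
  ultimately show "t (s \<odot>\<^bsub>Y\<^esub> y) = s \<odot>\<^bsub>Y'\<^esub> t y" using lin_mapsD(3)[OF f s xG] R'.R_functional by simp
next
  fix y z assume yz: "y \<in> carrier Y" "z \<in> carrier Y"
  obtain x where x: "R x y" using R_surj[OF yz(1)] by blast
  obtain w where w: "R w z" using R_surj[OF yz(2)] by blast
  have m: "x \<in> carrier G" "w \<in> carrier G" using R.R_in[OF x] R.R_in[OF w] R.ZG by auto
  have "R' (f (x \<oplus>\<^bsub>G\<^esub> w)) (t (y \<oplus>\<^bsub>Y\<^esub> z))" by (rule compat[OF R.R_add[OF x w]])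
  moreover have "R' (f x \<oplus>\<^bsub>G'\<^esub> f w) (t y \<oplus>\<^bsub>Y'\<^esub> t z)" by (rule R'.R_add[OF compat[OF x] compat[OF w]])
  ultimately show "t (y \<oplus>\<^bsub>Y\<^esub> z) = t y \<oplus>\<^bsub>Y'\<^esub> t z" using lin_mapsD(2)[OF f m] R'.R_functional by simp
qed

end

lemma central_action_commutes:
  assumes X: "left_module A X" and z: "\<And>s. s \<in> carrier S \<Longrightarrow> \<zeta> s \<in> carrier A"
    and c: "\<And>s a. s \<in> carrier S \<Longrightarrow> a \<in> carrier A \<Longrightarrow> \<zeta> s \<otimes>\<^bsub>A\<^esub> a = a \<otimes>\<^bsub>A\<^esub> \<zeta> s"
  shows "commuting_action A X S (\<lambda>s x. \<zeta> s \<odot>\<^bsub>X\<^esub> x)"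
  unfolding commuting_action_def
proof
  interpret X: left_module A X by fact
  fix s assume s: "s \<in> carrier S"
  show "(\<lambda>x. \<zeta> s \<odot>\<^bsub>X\<^esub> x) \<in> lin_maps A X X"
    by (rule lin_mapsI) (use z[OF s] c[OF s] in \<open>simp_all add: X.smult_r_distr X.smult_assoc1[symmetric]\<close>)
qed

text \<open>Through \<open>cls\<close> the right module \<open>N\<close> is identified with the
  cohomology of Hom(P, A) at \<open>p\<close> without being equal to it: in the application
  \<open>N\<close> is computed from the standard resolution and \<open>P\<close> is the finitely
  generated one. Finite freeness is asked in degree \<open>p\<close> alone. \<open>\<zeta>\<close>
  is the structure map from the scalars to the centre of \<open>A\<close>.\<close>

locale tensor_cohomology = complex A P d
  for A :: "('a, 'z) ring_scheme" and P :: "int \<Rightarrow> ('a, nat \<Rightarrow> 'a) module" and d +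
  fixes p :: int and m :: nat and N :: "('a, 'n) module" and cls :: "((nat \<Rightarrow> 'a) \<Rightarrow> 'a) \<Rightarrow> 'n"
    and S :: "('s, 'w) ring_scheme" and \<zeta> :: "'s \<Rightarrow> 'a"
  assumes A: "ring A" and Pp: "P p = free_module A {..<m}" and N: "right_module A N"
    and cls: "cls \<in> lin_maps (opposite A) ((hom_module A (P p) (regular_module A) (\<lambda>a x. x \<otimes>\<^bsub>A\<^esub> a))
        \<lparr>carrier := cocycles A P d (regular_module A) p\<rparr>) N"
    and cls_surj: "cls ` cocycles A P d (regular_module A) p = carrier N"
    and cls_ker: "f \<in> cocycles A P d (regular_module A) p \<Longrightarrow>
        cls f = \<zero>\<^bsub>N\<^esub> \<longleftrightarrow> f \<in> coboundaries A P d (regular_module A) p"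
    and zeta: "s \<in> carrier S \<Longrightarrow> \<zeta> s \<in> carrier A"
    and zeta_central: "s \<in> carrier S \<Longrightarrow> a \<in> carrier A \<Longrightarrow> \<zeta> s \<otimes>\<^bsub>A\<^esub> a = a \<otimes>\<^bsub>A\<^esub> \<zeta> s"
begin

abbreviation "RR \<equiv> regular_module A"
abbreviation "HR \<equiv> hom_module A (P p) RR (\<lambda>a x. x \<otimes>\<^bsub>A\<^esub> a)"
abbreviation "ZR \<equiv> cocycles A P d RR p"
abbreviation "aN \<equiv> \<lambda>s x. \<zeta> s \<odot>\<^bsub>N\<^esub> x"
abbreviation "aT \<equiv> \<lambda>B s x. \<zeta> s \<odot>\<^bsub>free_module A B\<^esub> x"
abbreviation "HT \<equiv> \<lambda>B. hom_module A (P p) (free_module A B) (aT B)"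
abbreviation "ZT \<equiv> \<lambda>B. cocycles A P d (free_module A B) p"
abbreviation "BT \<equiv> \<lambda>B. coboundaries A P d (free_module A B) p"
abbreviation "ft \<equiv> \<lambda>B. formal_tensors N (free_module A B) aN"
abbreviation "rel \<equiv> \<lambda>B. tensor_relations A N (free_module A B)"
abbreviation "YT \<equiv> \<lambda>B. tensor A N (free_module A B) aN"
abbreviation "co \<equiv> \<lambda>B. tensor_coord N (free_module A B)"
abbreviation "cm \<equiv> coordinate_map (P p)"
abbreviation "post \<equiv> \<lambda>\<beta> f. compose (carrier (P p)) \<beta> f"
abbreviation "tm \<equiv> \<lambda>\<beta>. frag_extend (\<lambda>(x, y). frag_of (x, \<beta> y))"

interpretation A: ring A by (rule A)
interpretation N: left_module "opposite A" N by (rule N)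
interpretation NO: op_group "opposite A" N by (rule left_module_op_group[OF N])

lemma T: "left_module A (free_module A B)"
  by (rule free_left_module[OF A])

lemma R: "left_module A RR"
  by (rule regular_left_module[OF A])

lemma aT: "commuting_action A (free_module A B) S (aT B)"
  by (rule central_action_commutes[OF T zeta zeta_central])

lemma aN: "commuting_action (opposite A) N S aN"
  by (rule central_action_commutes[OF N]) (simp_all add: opposite_sel zeta zeta_central)

lemma HT: "op_group S (HT B)"
  by (rule hom_op_group[OF Pmod T aT])

lemma HR: "op_group (opposite A) HR"
  by (rule hom_op_group[OF Pmod R right_multiplication_commutes[OF A]])

lemma ZR: "op_sub (opposite A) HR ZR"
  by (rule op_sub_cocycles[OF R right_multiplication_commutes[OF A]])

lemma cls_closed: "f \<in> ZR \<Longrightarrow> cls f \<in> carrier N"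
  using lin_mapsD(1)[OF cls] by simp

lemma cls_add: "f \<in> ZR \<Longrightarrow> g \<in> ZR \<Longrightarrow> cls (f \<oplus>\<^bsub>HR\<^esub> g) = cls f \<oplus>\<^bsub>N\<^esub> cls g"
  using lin_mapsD(2)[OF cls] by simp

lemma cls_smult: "f \<in> ZR \<Longrightarrow> a \<in> carrier A \<Longrightarrow> cls (a \<odot>\<^bsub>HR\<^esub> f) = a \<odot>\<^bsub>N\<^esub> cls f"
  using lin_mapsD(3)[OF cls] by (simp add: opposite_sel)

lemma cls_minus: "f \<in> ZR \<Longrightarrow> g \<in> ZR \<Longrightarrow> cls (f \<ominus>\<^bsub>HR\<^esub> g) = cls f \<ominus>\<^bsub>N\<^esub> cls g"
proof -
  interpret HR: op_group "opposite A" HR by (rule HR)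
  assume fg: "f \<in> ZR" "g \<in> ZR"
  have m: "f \<ominus>\<^bsub>HR\<^esub> g \<in> ZR" by (rule op_subD(6)[OF ZR fg])
  have "cls f = cls (f \<ominus>\<^bsub>HR\<^esub> g) \<oplus>\<^bsub>N\<^esub> cls g"
    using cls_add[OF m fg(2)] HR.minus_add_cancel[OF op_sub_mem[OF ZR fg(1)] op_sub_mem[OF ZR fg(2)]] by simp
  then show ?thesis using NO.add_minus_cancel[OF cls_closed[OF m] cls_closed[OF fg(2)]] by simp
qed

lemma ZT: "op_sub S (HT B) (ZT B)"
  by (rule op_sub_cocycles[OF T aT])

lemma BT: "op_sub S (HT B) (BT B)"
  by (rule op_sub_coboundaries[OF T aT])

lemma cm_cocycle: "f \<in> ZT B \<Longrightarrow> cm f b \<in> ZR"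
  by (rule coordinate_cocycle[OF A complex_axioms])

lemma cm_add: "cm (f \<oplus>\<^bsub>HT B\<^esub> g) b = cm f b \<oplus>\<^bsub>HR\<^esub> cm g b"
  by (auto simp: coordinate_map_def hom_sel free_sel regular_sel)

lemma cm_minus:
  assumes "f \<in> carrier (HT B)" "g \<in> carrier (HT B)"
  shows "cm (f \<ominus>\<^bsub>HT B\<^esub> g) b = cm f b \<ominus>\<^bsub>HR\<^esub> cm g b"
proof -
  interpret HT: op_group S "HT B" by (rule HT)
  interpret HR: op_group "opposite A" HR by (rule HR)
  have c: "cm f b \<in> carrier HR" if "f \<in> carrier (HT B)" for f
  proof -
    have "f \<in> lin_maps A (P p) (free_module A B)" using that by (simp add: hom_sel)
    from hom_restrictI[OF Pmod lin_maps_compose[OF this coordinate_lin[OF A]]] show ?thesis unfolding coordinate_map_def .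
  qed
  have "cm f b = cm (f \<ominus>\<^bsub>HT B\<^esub> g) b \<oplus>\<^bsub>HR\<^esub> cm g b"
    using cm_add[where f = "f \<ominus>\<^bsub>HT B\<^esub> g" and g = g and B = B and b = b] HT.minus_add_cancel[OF assms] by simp
  then show ?thesis using HR.add_minus_cancel[OF c[OF HT.minus_closed[OF assms]] c[OF assms(2)]] by simp
qed

lemma cm_smult:
  assumes "s \<in> carrier S" "f \<in> carrier (HT B)"
  shows "cm (s \<odot>\<^bsub>HT B\<^esub> f) b = \<zeta> s \<odot>\<^bsub>HR\<^esub> cm f b"
proof -
  have fl: "f \<in> lin_maps A (P p) (free_module A B)" using assms(2) by (simp add: hom_sel)
  have "f x b \<in> carrier A" if "x \<in> carrier (P p)" for x
    by (rule free_carrier_val[OF A lin_mapsD(1)[OF fl that]])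
  then show ?thesis using zeta_central[OF assms(1)] by (auto simp: coordinate_map_def hom_sel free_sel)
qed

text \<open>
  The isomorphism from the cohomology of \<open>Hom(P, A\<^sup>(\<^sup>B\<^sup>))\<close> at \<open>p\<close> to \<open>N \<otimes> A\<^sup>(\<^sup>B\<^sup>)\<close> as a relation: a cocycle and
  a formal tensor correspond if they have the same coordinates in \<open>N\<close>.
\<close>

definition frel :: "'i set \<Rightarrow> ((nat \<Rightarrow> 'a) \<Rightarrow> 'i \<Rightarrow> 'a) \<Rightarrow> ('n \<times> ('i \<Rightarrow> 'a) \<Rightarrow>\<^sub>0 int) \<Rightarrow> bool" where
  "frel B f u \<longleftrightarrow> f \<in> ZT B \<and> Poly_Mapping.keys u \<subseteq> carrier N \<times> carrier (free_module A B) \<and>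
     (\<forall>b\<in>B. cls (cm f b) = co B b u)"

lemma frel_add: "frel B f u \<Longrightarrow> frel B g v \<Longrightarrow> frel B (f \<oplus>\<^bsub>HT B\<^esub> g) (u + v)"
  unfolding frel_def using op_subD(3)[OF ZT] keys_add[of u v]
  by (auto simp: cm_add cls_add cm_cocycle coord_add[OF A N])

lemma frel_minus: "frel B f u \<Longrightarrow> frel B g v \<Longrightarrow> frel B (f \<ominus>\<^bsub>HT B\<^esub> g) (u - v)"
  unfolding frel_def using op_subD(6)[OF ZT] keys_diff[of u v]
  by (auto simp: cm_minus[OF op_sub_mem[OF ZT] op_sub_mem[OF ZT]] cls_minus cm_cocycle coord_diff[OF A N])

lemma frel_smult:
  assumes s: "s \<in> carrier S" and "frel B f u"
  shows "frel B (s \<odot>\<^bsub>HT B\<^esub> f) (s \<odot>\<^bsub>ft B\<^esub> u)"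
proof -
  have f: "f \<in> ZT B" "Poly_Mapping.keys u \<subseteq> carrier N \<times> carrier (free_module A B)" "\<forall>b\<in>B. cls (cm f b) = co B b u"
    using assms(2) by (auto simp: frel_def)
  have a: "(\<lambda>x. \<zeta> s \<odot>\<^bsub>N\<^esub> x) \<in> lin_maps (opposite A) N N" using aN s by (simp add: commuting_action_def)
  have "Poly_Mapping.keys (s \<odot>\<^bsub>ft B\<^esub> u) \<subseteq> carrier N \<times> carrier (free_module A B)"
    using op_group.op_closed[OF formal_op_group[OF aN] s, of u "free_module A B"] f(2) by (simp add: formal_sel(1))
  then show ?thesis unfolding frel_def
    using op_subD(5)[OF ZT s f(1)] f(3) coord_act[OF A N a f(2)] cm_smult[OF s op_sub_mem[OF ZT f(1)]]
      cls_smult[OF cm_cocycle[OF f(1)] zeta[OF s]] by (simp add: formal_sel)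
qed

text \<open>Both sides are detected by coordinates: coboundaries because \<open>P p\<close> has a
  finite basis, tensors by \<open>tensor_zero_iff\<close>. For single coordinates the equivalence is
  \<open>cls_ker\<close>.\<close>

lemma frel_zero:
  assumes "frel B f u"
  shows "f \<in> BT B \<longleftrightarrow> u \<in> rel B"
proof -
  have f: "f \<in> ZT B" "Poly_Mapping.keys u \<subseteq> carrier N \<times> carrier (free_module A B)" "\<forall>b\<in>B. cls (cm f b) = co B b u"
    using assms by (auto simp: frel_def)
  have "u \<in> rel B \<longleftrightarrow> (\<forall>b\<in>B. cls (cm f b) = \<zero>\<^bsub>N\<^esub>)" using tensor_zero_iff[OF A N f(2)] f(3) by simp
  also have "\<dots> \<longleftrightarrow> (\<forall>b\<in>B. cm f b \<in> coboundaries A P d RR p)" using cls_ker[OF cm_cocycle[OF f(1)]] by simp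
  also have "\<dots> \<longleftrightarrow> f \<in> BT B"
  proof
    assume c: "\<forall>b\<in>B. cm f b \<in> coboundaries A P d RR p"
    show "f \<in> BT B"
      by (rule coboundary_from_coordinates[where P = P and i = p and d = d, OF A Pp d_lin])
        (use f(1) c in \<open>auto simp: cocycles_def\<close>)
  next
    assume "f \<in> BT B"
    then show "\<forall>b\<in>B. cm f b \<in> coboundaries A P d RR p" by (intro ballI coordinate_coboundary[OF A complex_axioms])
  qed
  finally show ?thesis by simp
qed

text \<open>The cochain that corresponds to the pure tensor of \<open>cls c\<close> and
  \<open>t\<close>.\<close>

definition pure :: "'i set \<Rightarrow> ((nat \<Rightarrow> 'a) \<Rightarrow> 'a) \<Rightarrow> ('i \<Rightarrow> 'a) \<Rightarrow> (nat \<Rightarrow> 'a) \<Rightarrow> 'i \<Rightarrow> 'a" where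
  "pure B c t = restrict (\<lambda>x. c x \<odot>\<^bsub>free_module A B\<^esub> t) (carrier (P p))"

lemma frel_pure:
  assumes c: "c \<in> ZR" and t: "t \<in> carrier (free_module A B)"
  shows "frel B (pure B c t) (frag_of (cls c, t))"
proof -
  interpret T: left_module A "free_module A B" by (rule T)
  have cl: "c \<in> lin_maps A (P p) RR" and cd: "\<And>x. x \<in> carrier (P (p + 1)) \<Longrightarrow> c (d (p + 1) x) = \<zero>\<^bsub>A\<^esub>"
    using c by (auto simp: cocycles_def regular_sel)
  have "(\<lambda>x. c x \<odot>\<^bsub>free_module A B\<^esub> t) \<in> lin_maps A (P p) (free_module A B)"
    by (rule lin_mapsI)
      (use lin_mapsD[OF cl] t in \<open>simp_all add: regular_sel T.smult_l_distr T.smult_assoc1\<close>)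
  then have 1: "pure B c t \<in> ZT B"
    unfolding cocycles_def pure_def using lin_maps_restrict[OF Pmod] cd lin_mapsD(1)[OF d_lin'[of p]] T.smult_zero_l[OF t] by auto
  have 2: "cm (pure B c t) b = t b \<odot>\<^bsub>HR\<^esub> c" for b
    by (auto simp: coordinate_map_def pure_def hom_sel free_sel)
  show ?thesis unfolding frel_def 2
    using 1 cls_closed[OF c] t cls_smult[OF c free_carrier_val[OF A t]] coord_pure[OF A N cls_closed[OF c] t] by simp
qed

lemma post_pure:
  assumes \<beta>: "\<beta> \<in> lin_maps A (free_module A B) (free_module A B')" and c: "c \<in> ZR" and t: "t \<in> carrier (free_module A B)"
  shows "post \<beta> (pure B c t) = pure B' c (\<beta> t)"
proof -
  have "c x \<in> carrier A" if "x \<in> carrier (P p)" for x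
    using c lin_mapsD(1)[OF _ that, of c A RR] by (auto simp: cocycles_def regular_sel)
  then show ?thesis using lin_mapsD(3)[OF \<beta> _ t] by (auto simp: compose_def pure_def)
qed

lemma post_lin:
  assumes \<beta>: "\<beta> \<in> lin_maps A (free_module A B) (free_module A B')"
  shows "post \<beta> \<in> lin_maps S (HT B) (HT B')"
  by (rule hom_postcompose[OF Pmod \<beta>]) (use lin_mapsD(3)[OF \<beta> zeta] in simp)

text \<open>For pure tensors a partner is written down explicitly, and \<open>post_pure\<close>
  shows that it is carried along by \<open>\<beta>\<close> on the nose. Differences then give all
  tensors, always with one cocycle matching \<open>u\<close> and its image simultaneously.\<close>

lemma frel_surj:
  assumes \<beta>: "\<beta> \<in> lin_maps A (free_module A B) (free_module A B')"
    and u: "Poly_Mapping.keys u \<subseteq> carrier N \<times> carrier (free_module A B)"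
  shows "\<exists>f. frel B f u \<and> frel B' (post \<beta> f) (tm \<beta> u)"
  using u
proof (rule free_Abelian_group_induct)
  obtain c where c: "c \<in> ZR" using op_subD(2)[OF ZR] by blast
  have z: "\<zero>\<^bsub>free_module A B\<^esub> \<in> carrier (free_module A B)" "\<zero>\<^bsub>free_module A B'\<^esub> \<in> carrier (free_module A B')"
    by (auto simp: free_module_def)
  have b0: "\<beta> \<zero>\<^bsub>free_module A B\<^esub> = \<zero>\<^bsub>free_module A B'\<^esub>" by (rule lin_zero_mod[OF T T \<beta>])
  \<comment> \<open>The zero tensor is obtained as a difference of two equal pure ones, so that
    \<open>frel_minus\<close> also covers this case.\<close>
  have "frel B (pure B c \<zero>\<^bsub>free_module A B\<^esub> \<ominus>\<^bsub>HT B\<^esub> pure B c \<zero>\<^bsub>free_module A B\<^esub>) 0"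
    using frel_minus[OF frel_pure[OF c z(1)] frel_pure[OF c z(1)]] by simp
  moreover have m: "pure B c \<zero>\<^bsub>free_module A B\<^esub> \<in> carrier (HT B)"
    by (rule op_sub_mem[OF ZT]) (use frel_pure[OF c z(1)] in \<open>simp add: frel_def\<close>)
  moreover have "post \<beta> (pure B c \<zero>\<^bsub>free_module A B\<^esub> \<ominus>\<^bsub>HT B\<^esub> pure B c \<zero>\<^bsub>free_module A B\<^esub>)
    = pure B' c \<zero>\<^bsub>free_module A B'\<^esub> \<ominus>\<^bsub>HT B'\<^esub> pure B' c \<zero>\<^bsub>free_module A B'\<^esub>"
    using lin_minus[OF HT HT post_lin[OF \<beta>] m m] post_pure[OF \<beta> c z(1)] b0 by simp
  moreover have "frel B' (pure B' c \<zero>\<^bsub>free_module A B'\<^esub> \<ominus>\<^bsub>HT B'\<^esub> pure B' c \<zero>\<^bsub>free_module A B'\<^esub>) 0"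
    using frel_minus[OF frel_pure[OF c z(2)] frel_pure[OF c z(2)]] by simp
  ultimately show "\<exists>f. frel B f 0 \<and> frel B' (post \<beta> f) (tm \<beta> 0)" by auto
next
  fix u v assume "\<exists>f. frel B f u \<and> frel B' (post \<beta> f) (tm \<beta> u)" "\<exists>f. frel B f v \<and> frel B' (post \<beta> f) (tm \<beta> v)"
  then obtain f g where fg: "frel B f u" "frel B' (post \<beta> f) (tm \<beta> u)" "frel B g v" "frel B' (post \<beta> g) (tm \<beta> v)" by blast
  have "f \<in> carrier (HT B)" "g \<in> carrier (HT B)" using fg op_sub_mem[OF ZT] by (auto simp: frel_def)
  then have "post \<beta> (f \<ominus>\<^bsub>HT B\<^esub> g) = post \<beta> f \<ominus>\<^bsub>HT B'\<^esub> post \<beta> g" by (rule lin_minus[OF HT HT post_lin[OF \<beta>]])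
  then have "frel B' (post \<beta> (f \<ominus>\<^bsub>HT B\<^esub> g)) (tm \<beta> (u - v))"
    using frel_minus[OF fg(2,4)] by (simp add: frag_extend_diff)
  then show "\<exists>f. frel B f (u - v) \<and> frel B' (post \<beta> f) (tm \<beta> (u - v))" using frel_minus[OF fg(1,3)] by blast
next
  fix a assume "a \<in> carrier N \<times> carrier (free_module A B)"
  then obtain x t where a: "a = (x, t)" "x \<in> carrier N" "t \<in> carrier (free_module A B)" by auto
  obtain c where c: "c \<in> ZR" "x = cls c" using a(2) cls_surj by (metis imageE)
  show "\<exists>f. frel B f (frag_of a) \<and> frel B' (post \<beta> f) (tm \<beta> (frag_of a))"
    unfolding a(1) c(2)
    using frel_pure[OF c(1) a(3)] frel_pure[OF c(1) lin_mapsD(1)[OF \<beta> a(3)]] post_pure[OF \<beta> c(1) a(3)]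
    by (intro exI[of _ "pure B c t"]) simp
qed

text \<open>The partner of \<open>f\<close> is the sum over \<open>b\<close> of the class of the
  \<open>b\<close>-th coordinate tensored with the basis vector at \<open>b\<close>. The sum is
  finite since \<open>f\<close> meets finitely many coordinates; the other coordinates are zero and
  have class zero.\<close>

lemma frel_total:
  assumes f: "f \<in> ZT B"
  shows "\<exists>u. frel B f u"
proof -
  have fl: "f \<in> lin_maps A (free_module A {..<m}) (free_module A B)" using f by (simp add: cocycles_def Pp)
  let ?B = "{b. \<exists>x\<in>carrier (free_module A {..<m}). f x b \<noteq> \<zero>\<^bsub>A\<^esub>}"
  have fin: "finite ?B" by (rule finite_coordinates[OF A fl])
  have sub: "?B \<subseteq> B"
  proof
    fix b assume "b \<in> ?B"
    then obtain x where "x \<in> carrier (free_module A {..<m})" "f x b \<noteq> \<zero>\<^bsub>A\<^esub>" by blast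
    then show "b \<in> B" using free_zero_outside[OF lin_mapsD(1)[OF fl]] by blast
  qed
  have "\<exists>u. Poly_Mapping.keys u \<subseteq> carrier N \<times> carrier (free_module A B) \<and>
     (\<forall>b. co B b u = (if b \<in> F then cls (cm f b) else \<zero>\<^bsub>N\<^esub>))" if "finite F" "F \<subseteq> B" for F
    using that
  proof (induction F rule: finite_induct)
    case empty
    show ?case by (rule exI[of _ 0]) (simp add: coord_zero[OF A N])
  next
    case (insert i F)
    then obtain u where u: "Poly_Mapping.keys u \<subseteq> carrier N \<times> carrier (free_module A B)"
      "\<And>b. co B b u = (if b \<in> F then cls (cm f b) else \<zero>\<^bsub>N\<^esub>)" by auto
    have i: "basis_vector A i \<in> carrier (free_module A B)" using insert by (intro basis_vector_closed[OF A]) auto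
    have c: "cls (cm f i) \<in> carrier N" by (rule cls_closed[OF cm_cocycle[OF f]])
    let ?v = "frag_of (cls (cm f i), basis_vector A i)"
    have v: "Poly_Mapping.keys ?v \<subseteq> carrier N \<times> carrier (free_module A B)" using i c by simp
    have cv: "co B b ?v = (if b = i then cls (cm f i) else \<zero>\<^bsub>N\<^esub>)" for b
      using coord_pure[OF A N c i, of b] N.smult_one[OF c] N.smult_zero_l[OF c] by (simp add: basis_vector_def opposite_sel)
    have "Poly_Mapping.keys (u + ?v) \<subseteq> carrier N \<times> carrier (free_module A B)" using u(1) v keys_add[of u ?v] by blast
    moreover have "co B b (u + ?v) = (if b \<in> insert i F then cls (cm f b) else \<zero>\<^bsub>N\<^esub>)" for b
      using coord_add[OF A N u(1) v, of b] u(2)[of b] cv[of b] insert.hyps c cls_closed[OF cm_cocycle[OF f]] by auto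
    ultimately show ?case by blast
  qed
  from this[OF fin sub] obtain u where u: "Poly_Mapping.keys u \<subseteq> carrier N \<times> carrier (free_module A B)"
     "\<And>b. co B b u = (if b \<in> ?B then cls (cm f b) else \<zero>\<^bsub>N\<^esub>)" by blast
  have "cls (cm f b) = \<zero>\<^bsub>N\<^esub>" if b: "b \<notin> ?B" for b
  proof -
    have "\<forall>x\<in>carrier (P p). cm f b x = \<zero>\<^bsub>RR\<^esub>" using b by (simp add: Pp coordinate_map_def regular_sel)
    then have "\<exists>g\<in>lin_maps A (P (p - 1)) RR. \<forall>x\<in>carrier (P p). cm f b x = g (d p x)"
      by (rule bexI[OF _ lin_maps_zero[OF R]])
    then have "cm f b \<in> coboundaries A P d RR p"
      using cm_cocycle[OF f, of b] by (simp add: coboundaries_def cocycles_def)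
    then show ?thesis using cls_ker[OF cm_cocycle[OF f]] by blast
  qed
  then have "frel B f u" unfolding frel_def using f u by auto
  then show ?thesis by blast
qed

definition crel :: "'i set \<Rightarrow> ((nat \<Rightarrow> 'a) \<Rightarrow> 'i \<Rightarrow> 'a) \<Rightarrow> ('n \<times> ('i \<Rightarrow> 'a) \<Rightarrow>\<^sub>0 int) set \<Rightarrow> bool" where
  "crel B f X \<longleftrightarrow> (\<exists>u. frel B f u \<and> X = rel B +>\<^bsub>ft B\<^esub> u)"

lemma relsub: "op_sub S (ft B) (rel B)"
  by (rule tensor_relations_op_sub[OF N T aN])

lemma ft: "op_group S (ft B)"
  by (rule formal_op_group[OF aN])

lemma frel_carrier: "frel B f u \<Longrightarrow> u \<in> carrier (ft B)"
  by (simp add: frel_def formal_sel)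

lemma crel_subquotient: "subquotient_relation S (HT B) (ZT B) (BT B) (YT B) (crel B)"
proof (rule subquotient_relation.intro)
  interpret F: op_group S "ft B" by (rule ft)
  show "op_group S (HT B)" by (rule HT)
  show Y: "op_group S (YT B)" unfolding tensor_def by (rule F.op_group_quotient[OF relsub])
  show "BT B \<subseteq> ZT B" by (rule coboundaries_subset[OF T aT])
  show "ZT B \<subseteq> carrier (HT B)" by (rule op_subD(1)[OF ZT])
  show "\<zero>\<^bsub>HT B\<^esub> \<in> BT B" by (rule op_subD(2)[OF BT])
  show "\<exists>y. crel B x y" if "x \<in> ZT B" for x using frel_total[OF that] by (auto simp: crel_def)
  fix x y assume "crel B x y"
  then obtain u where u: "frel B x u" "y = rel B +>\<^bsub>ft B\<^esub> u" by (auto simp: crel_def)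
  show "x \<in> ZT B \<and> y \<in> carrier (YT B)"
    using u frel_carrier[OF u(1)] by (auto simp: tensor_def carrier_quotient frel_def)
  show "x \<in> BT B \<longleftrightarrow> y = \<zero>\<^bsub>YT B\<^esub>"
    unfolding u(2) tensor_def zero_quotient F.coset_self_iff[OF relsub frel_carrier[OF u(1)]] by (rule frel_zero[OF u(1)])
  show "crel B (s \<odot>\<^bsub>HT B\<^esub> x) (s \<odot>\<^bsub>YT B\<^esub> y)" if s: "s \<in> carrier S" for s
    unfolding u(2) tensor_def F.smult_quotient[OF relsub frel_carrier[OF u(1)] s] crel_def using frel_smult[OF s u(1)] by blast
  fix x' y' assume "crel B x' y'"
  then obtain u' where u': "frel B x' u'" "y' = rel B +>\<^bsub>ft B\<^esub> u'" by (auto simp: crel_def)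
  show "crel B (x \<oplus>\<^bsub>HT B\<^esub> x') (y \<oplus>\<^bsub>YT B\<^esub> y')"
    unfolding u(2) u'(2) tensor_def F.add_quotient[OF relsub frel_carrier[OF u(1)] frel_carrier[OF u'(1)]] crel_def
    using frel_add[OF u(1) u'(1)] by (auto simp: formal_sel)
  show "crel B (x \<ominus>\<^bsub>HT B\<^esub> x') (y \<ominus>\<^bsub>YT B\<^esub> y')"
    unfolding u(2) u'(2) tensor_def F.minus_quotient[OF relsub frel_carrier[OF u(1)] frel_carrier[OF u'(1)]] crel_def
      formal_minus[OF aN frel_carrier[OF u(1)] frel_carrier[OF u'(1)]]
    using frel_minus[OF u(1) u'(1)] by blast
qed

lemma YT: "op_group S (YT B)"
  by (rule subquotient_relation.Y[OF crel_subquotient])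

lemma tensor_map_coset:
  assumes \<beta>: "\<beta> \<in> lin_maps A (free_module A B) (free_module A B')"
  shows "tensor_map A N (free_module A B') \<beta> (rel B +>\<^bsub>ft B\<^esub> u) = rel B' +>\<^bsub>ft B'\<^esub> tm \<beta> u"
proof -
  have id: "(\<lambda>x. x) \<in> lin_maps (opposite A) N N" by (rule lin_mapsI) auto
  have r: "tm \<beta> r \<in> rel B'" if "r \<in> rel B" for r using tensor_relations_map[OF N T N T id \<beta> that] by simp
  have "(\<Union>v\<in>{r + u |r. r \<in> rel B}. {r + tm \<beta> v |r. r \<in> rel B'}) = {r + tm \<beta> u |r. r \<in> rel B'}"
  proof (intro equalityI subsetI)
    fix x assume "x \<in> (\<Union>v\<in>{r + u |r. r \<in> rel B}. {r + tm \<beta> v |r. r \<in> rel B'})"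
    then obtain r r' where "r \<in> rel B" "r' \<in> rel B'" "x = (r' + tm \<beta> r) + tm \<beta> u"
      by (auto simp: frag_extend_add add.assoc)
    then show "x \<in> {r + tm \<beta> u |r. r \<in> rel B'}" using tensor_relations_add[OF N T _ r] by blast
  next
    fix x assume "x \<in> {r + tm \<beta> u |r. r \<in> rel B'}"
    moreover have "u \<in> {r + u |r. r \<in> rel B}" using tensor_relations_zero[OF N T, of B] by force
    ultimately show "x \<in> (\<Union>v\<in>{r + u |r. r \<in> rel B}. {r + tm \<beta> v |r. r \<in> rel B'})" by blast
  qed
  moreover have "rel B +>\<^bsub>ft B\<^esub> u = {r + u |r. r \<in> rel B}" by (auto simp: a_r_coset_def' formal_sel)
  moreover have "rel B' +>\<^bsub>ft B'\<^esub> tm \<beta> u = {r + tm \<beta> u |r. r \<in> rel B'}" by (auto simp: a_r_coset_def' formal_sel)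
  ultimately show ?thesis unfolding tensor_map_def by simp
qed

lemma crel_map:
  assumes \<beta>: "\<beta> \<in> lin_maps A (free_module A B) (free_module A B')"
  shows "subquotient_relation_map S (HT B) (ZT B) (BT B) (YT B) (crel B) (HT B') (ZT B') (BT B') (YT B') (crel B')
    (post \<beta>) (tensor_map A N (free_module A B') \<beta>)"
proof (intro subquotient_relation_map.intro crel_subquotient subquotient_relation_map_axioms.intro post_lin[OF \<beta>])
  fix x assume x: "x \<in> BT B"
  then obtain g where g: "g \<in> lin_maps A (P (p - 1)) (free_module A B)" "\<forall>y\<in>carrier (P p). x y = g (d p y)"
    by (auto simp: coboundaries_def)
  have "post \<beta> x \<in> carrier (HT B')" by (rule lin_mapsD(1)[OF post_lin[OF \<beta>] op_sub_mem[OF BT x]])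
  moreover have "\<forall>y\<in>carrier (P p). post \<beta> x y = \<beta> (g (d p y))" using g(2) by (simp add: compose_def)
  ultimately show "post \<beta> x \<in> BT B'" using lin_maps_compose[OF g(1) \<beta>] by (auto simp: coboundaries_def hom_sel)
next
  fix y assume "y \<in> carrier (YT B)"
  then obtain u where u: "Poly_Mapping.keys u \<subseteq> carrier N \<times> carrier (free_module A B)" "y = rel B +>\<^bsub>ft B\<^esub> u"
    by (auto simp: tensor_def carrier_quotient formal_sel(1))
  obtain f where f: "frel B f u" "frel B' (post \<beta> f) (tm \<beta> u)" using frel_surj[OF \<beta> u(1)] by blast
  show "\<exists>x. crel B x y \<and> crel B' (post \<beta> x) (tensor_map A N (free_module A B') \<beta> y)"
    using f unfolding u(2) tensor_map_coset[OF \<beta>] crel_def by blast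
qed

lemma tensor_map_lin:
  assumes \<beta>: "\<beta> \<in> lin_maps A (free_module A B) (free_module A B')"
  shows "tensor_map A N (free_module A B') \<beta> \<in> lin_maps S (YT B) (YT B')"
proof -
  interpret subquotient_relation_map S "HT B" "ZT B" "BT B" "YT B" "crel B" "HT B'" "ZT B'" "BT B'" "YT B'" "crel B'"
    "post \<beta>" "tensor_map A N (free_module A B') \<beta>" by (rule crel_map[OF \<beta>])
  show ?thesis by (rule t_lin) (use surj_compat in blast)
qed

text \<open>A single \<open>\<beta>\<close> serves for both maps because the differential of the
  standard resolution is the same function in all degrees. The source is left as an arbitrary
  subquotient, to be filled by Ext.\<close>

theorem isomorphic_tensor_homology:
  assumes \<beta>1: "\<beta> \<in> lin_maps A (free_module A B1) (free_module A B0)"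
    and \<beta>0: "\<beta> \<in> lin_maps A (free_module A B0) (free_module A Bm)"
    and \<beta>\<beta>: "\<And>x. x \<in> carrier (free_module A B1) \<Longrightarrow> \<beta> (\<beta> x) = \<zero>\<^bsub>free_module A Bm\<^esub>"
    and C: "op_group S C" "op_sub S C Z" "op_sub S C B" "B \<subseteq> Z"
    and iso: "sq_iso S C Z B (HT B0) {x \<in> ZT B0. post \<beta> x \<in> BT Bm} {b \<oplus>\<^bsub>HT B0\<^esub> post \<beta> z |b z. b \<in> BT B0 \<and> z \<in> ZT B1}"
  shows "isomorphic_modules S (quotient_module (C\<lparr>carrier := Z\<rparr>) B)
    (homology (YT B1) (tensor_map A N (free_module A B0) \<beta>) (YT B0) (tensor_map A N (free_module A Bm) \<beta>) (YT Bm))"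
proof -
  let ?t1 = "tensor_map A N (free_module A B0) \<beta>" and ?t0 = "tensor_map A N (free_module A Bm) \<beta>"
  interpret a: subquotient_relation_map S "HT B1" "ZT B1" "BT B1" "YT B1" "crel B1" "HT B0" "ZT B0" "BT B0" "YT B0" "crel B0"
    "post \<beta>" ?t1 by (rule crel_map[OF \<beta>1])
  interpret b: subquotient_relation_map S "HT B0" "ZT B0" "BT B0" "YT B0" "crel B0" "HT Bm" "ZT Bm" "BT Bm" "YT Bm" "crel Bm"
    "post \<beta>" ?t0 by (rule crel_map[OF \<beta>0])
  have k: "op_sub S (YT B0) (a_kernel (YT B0) (YT Bm) ?t0)"
    by (rule op_sub_kernel[OF YT YT tensor_map_lin[OF \<beta>0]])
  have i: "op_sub S (YT B0) (?t1 ` carrier (YT B1))"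
    by (rule op_sub_image[OF YT YT tensor_map_lin[OF \<beta>1] op_group.op_sub_carrier[OF YT]])
  have "?t1 ` carrier (YT B1) \<subseteq> a_kernel (YT B0) (YT Bm) ?t0"
  proof
    fix y assume "y \<in> ?t1 ` carrier (YT B1)"
    then obtain w where w: "w \<in> carrier (YT B1)" "y = ?t1 w" by blast
    obtain z where z: "crel B1 z w" "crel B0 (post \<beta> z) (?t1 w)" using a.surj_compat[OF w(1)] by blast
    have zl: "z \<in> lin_maps A (P p) (free_module A B1)" using a.R.R_in[OF z(1)] by (simp add: cocycles_def)
    have "\<beta> (\<beta> (z x)) = \<zero>\<^bsub>free_module A Bm\<^esub>" if "x \<in> carrier (P p)" for x
      by (rule \<beta>\<beta>[OF lin_mapsD(1)[OF zl that]])
    then have "post \<beta> (post \<beta> z) = \<zero>\<^bsub>HT Bm\<^esub>"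
      by (auto simp: compose_def hom_sel intro!: restrict_ext)
    then have "crel Bm \<zero>\<^bsub>HT Bm\<^esub> (?t0 (?t1 w))" using b.compat[OF z(2)] by simp
    then have "?t0 (?t1 w) = \<zero>\<^bsub>YT Bm\<^esub>" using b.R'.R_zero b.R'.zB by blast
    then show "y \<in> a_kernel (YT B0) (YT Bm) ?t0" using w a.R'.R_in[OF z(2)] by (simp add: a_kernel_def')
  qed
  moreover have "sq_iso S C Z B (YT B0) (a_kernel (YT B0) (YT Bm) ?t0) (?t1 ` carrier (YT B1))"
    unfolding a_kernel_def'
    by (rule sq_iso_trans[OF iso sq_iso_transport[OF crel_map[OF \<beta>1] crel_map[OF \<beta>0] BT]])
  ultimately show ?thesis unfolding homology_def using sq_iso_isomorphic[OF C YT k i] by blast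
qed

end

section \<open>Duality over a complete deformation\<close>

text \<open>The inclusion of \<open>Z\<close> in \<open>B\<close> expresses that the subquotient
  vanishes.\<close>

lemma sq_iso_subset:
  assumes "sq_iso S C Z B C' Z' B'" "Z \<subseteq> B"
  shows "Z' \<subseteq> B'"
proof
  fix y assume y: "y \<in> Z'"
  from assms(1) obtain \<rho> where r: "\<forall>x y. \<rho> x y \<longrightarrow> x \<in> Z \<and> y \<in> Z'" "\<forall>y\<in>Z'. \<exists>x. \<rho> x y"
     "\<forall>x y. \<rho> x y \<longrightarrow> (x \<in> B \<longleftrightarrow> y \<in> B')" unfolding sq_iso_def by (elim exE conjE) (rule that; assumption)
  obtain x where "\<rho> x y" using bspec[OF r(2) y] by (rule exE)
  then show "y \<in> B'" using r(1,3) assms(2) by blast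
qed

lemma left_module_sub:
  assumes C: "left_module R C" and B: "op_sub R C B"
  shows "left_module R (C\<lparr>carrier := B\<rparr>)"
proof -
  interpret C: left_module R C by fact
  interpret O: op_group R C by (rule left_module_op_group[OF C])
  interpret B: op_group R "C\<lparr>carrier := B\<rparr>" by (rule O.op_sub_op_group[OF B])
  show ?thesis
    by (intro left_module.intro left_module_axioms.intro C.R.ring_axioms B.abelian_group_axioms)
      (use op_sub_mem[OF B] op_subD(5)[OF B] C.smult_l_distr C.smult_r_distr C.smult_assoc1 in auto)
qed

lemma left_module_quotient:
  assumes C: "left_module R C" and B: "op_sub R C B"
  shows "left_module R (quotient_module C B)"
proof -
  interpret C: left_module R C by fact
  interpret O: op_group R C by (rule left_module_op_group[OF C])
  interpret Q: op_group R "quotient_module C B" by (rule O.op_group_quotient[OF B])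
  show ?thesis
    by (intro left_module.intro left_module_axioms.intro C.R.ring_axioms Q.abelian_group_axioms)
      (auto simp: carrier_quotient O.smult_quotient[OF B] O.add_quotient[OF B] C.smult_l_distr C.smult_r_distr C.smult_assoc1)
qed

lemma opposite_ring:
  assumes "ring A" shows "ring (opposite A)"
proof -
  interpret A: ring A by fact
  show ?thesis
  proof (intro ringI abelian_groupI monoidI)
    show "x \<in> carrier (opposite A) \<Longrightarrow> \<exists>y\<in>carrier (opposite A). y \<oplus>\<^bsub>opposite A\<^esub> x = \<zero>\<^bsub>opposite A\<^esub>" for x
      unfolding opposite_sel by (rule bexI[of _ "\<ominus>\<^bsub>A\<^esub> x"]) (auto simp: A.l_neg)
  qed (auto simp: opposite_sel A.a_ac A.m_assoc A.l_distr A.r_distr)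
qed

lemma hom_right_module:
  assumes A: "ring A" and P: "left_module A P"
  shows "right_module A (hom_module A P (regular_module A) (\<lambda>a x. x \<otimes>\<^bsub>A\<^esub> a))"
proof -
  interpret A: ring A by fact
  interpret P: left_module A P by fact
  let ?H = "hom_module A P (regular_module A) (\<lambda>a x. x \<otimes>\<^bsub>A\<^esub> a)"
  interpret H: op_group "opposite A" ?H
    by (rule hom_op_group[OF P regular_left_module[OF A] right_multiplication_commutes[OF A]])
  have c: "f x \<in> carrier A" if "f \<in> carrier ?H" "x \<in> carrier P" for f x
    using that lin_mapsD(1)[OF _ that(2), of f A "regular_module A"] by (simp add: hom_sel regular_sel)
  show ?thesis
  proof (intro left_module.intro left_module_axioms.intro opposite_ring[OF A] H.abelian_group_axioms)
    fix f assume f: "f \<in> carrier ?H"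
    show "\<one>\<^bsub>opposite A\<^esub> \<odot>\<^bsub>?H\<^esub> f = f"
      by (rule extensionalityI[of _ "carrier P"]) (use f c[OF f] in \<open>auto simp: hom_sel opposite_sel\<close>)
    fix a b assume ab: "a \<in> carrier (opposite A)" "b \<in> carrier (opposite A)"
    show "(a \<oplus>\<^bsub>opposite A\<^esub> b) \<odot>\<^bsub>?H\<^esub> f = a \<odot>\<^bsub>?H\<^esub> f \<oplus>\<^bsub>?H\<^esub> b \<odot>\<^bsub>?H\<^esub> f"
      using ab c[OF f] by (auto simp: hom_sel opposite_sel regular_sel A.r_distr)
    show "(a \<otimes>\<^bsub>opposite A\<^esub> b) \<odot>\<^bsub>?H\<^esub> f = a \<odot>\<^bsub>?H\<^esub> (b \<odot>\<^bsub>?H\<^esub> f)"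
      using ab c[OF f] by (auto simp: hom_sel opposite_sel regular_sel A.m_assoc)
  qed (use H.op_add in auto)
qed

text \<open>The comparison theorem asks for some action on the coefficients. When only vanishing is
  to be transported, the identity will do.\<close>

lemma trivial_commutes: "commuting_action A X S (\<lambda>_ x. x)"
  unfolding commuting_action_def by (auto intro!: lin_mapsI)

context complex
begin

lemma cocycles_set:
  "{f \<in> carrier (hom_module A (P i) X act). compose (carrier (P (i + 1))) f (d (i + 1)) = \<zero>\<^bsub>hom_module A (P (i + 1)) X act\<^esub>}
    = cocycles A P d X i"
  unfolding cocycles_eq_kernel[where act = act] a_kernel_def' ..

lemma trivial_cocycles:
  assumes X: "left_module A X" and z: "carrier (P i) = {\<zero>\<^bsub>P i\<^esub>}"
  shows "cocycles A P d X i \<subseteq> coboundaries A P d X i"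
proof
  fix f assume f: "f \<in> cocycles A P d X i"
  then have fl: "f \<in> lin_maps A (P i) X" by (simp add: cocycles_def)
  have "\<forall>x\<in>carrier (P i). f x = \<zero>\<^bsub>X\<^esub>" using lin_zero_mod[OF Pmod X fl] z by simp
  then have "\<exists>g\<in>lin_maps A (P (i - 1)) X. \<forall>x\<in>carrier (P i). f x = g (d i x)" by (rule bexI[OF _ lin_maps_zero[OF X]])
  then show "f \<in> coboundaries A P d X i" using f by (simp add: coboundaries_def cocycles_def)
qed

end

context h_adic_resolution
begin

text \<open>Ext enters as any subquotient \<open>Z\<close> modulo \<open>B\<close> matched with the
  cohomology of Hom(F, M), and \<open>\<Omega>\<close> through \<open>cls\<close>, so neither is
  tied to the resolution \<open>F\<close>. In \<open>fd\<close> the type of \<open>X\<close> is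
  fixed, a hypothesis not being polymorphic; it is the type of the standard resolution of
  \<open>M\<close>, in which the images of the differentials live.\<close>

theorem duality:
  fixes M :: "('a, 'u) module" and S :: "('s, 't) ring_scheme" and \<Omega> :: "('a, 'o) module"
  assumes M: "left_module A M"
    and zeta: "\<And>s. s \<in> carrier S \<Longrightarrow> \<zeta> s \<in> carrier A"
    and zeta_central: "\<And>s a. s \<in> carrier S \<Longrightarrow> a \<in> carrier A \<Longrightarrow> \<zeta> s \<otimes>\<^bsub>A\<^esub> a = a \<otimes>\<^bsub>A\<^esub> \<zeta> s"
    and van: "\<And>j. j \<noteq> d \<Longrightarrow> cocycles A0 EE d0 (regular_module A0) j \<subseteq> coboundaries A0 EE d0 (regular_module A0) j"
    and fd: "\<And>i X. i > n0 \<Longrightarrow> left_module A (X :: ('a, ('a, 'u) cell \<Rightarrow> 'a) module) \<Longrightarrow>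
       cocycles A FF dF X i \<subseteq> coboundaries A FF dF X i"
    and Om: "right_module A \<Omega>"
    and cls: "cls \<in> lin_maps (opposite A) ((hom_module A (FF d) (regular_module A) (\<lambda>a x. x \<otimes>\<^bsub>A\<^esub> a))
        \<lparr>carrier := cocycles A FF dF (regular_module A) d\<rparr>) \<Omega>"
    and cls_surj: "cls ` cocycles A FF dF (regular_module A) d = carrier \<Omega>"
    and cls_ker: "\<And>f. f \<in> cocycles A FF dF (regular_module A) d \<Longrightarrow>
        cls f = \<zero>\<^bsub>\<Omega>\<^esub> \<longleftrightarrow> f \<in> coboundaries A FF dF (regular_module A) d"
    and C: "op_group S C" "op_sub S C Z" "op_sub S C B" "B \<subseteq> Z"
    and iso: "sq_iso S C Z B (hom_module A (FF i) M (\<lambda>s x. \<zeta> s \<odot>\<^bsub>M\<^esub> x))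
        (cocycles A FF dF M i) (coboundaries A FF dF M i)"
  shows "isomorphic_modules S (quotient_module (C\<lparr>carrier := Z\<rparr>) B) (Tor A \<Omega> M (\<lambda>s x. \<zeta> s \<odot>\<^bsub>\<Omega>\<^esub> x) (d - i))"
proof -
  let ?TT = "\<lambda>q. std_res A M q"
  let ?bs = "\<lambda>q::int. if q < 0 then {} else std_basis A M (nat q)"
  have TT: "?TT q = free_module A (?bs q)" for q by (simp add: std_res_def)
  interpret T: resolution A M "std_res A M" "\<lambda>_. std_diff A" "std_aug A M"
    by (rule resolution.intro[OF std_resolution[OF M] M])
  let ?C = "\<lambda>p q. hom_module A (FF p) (?TT q) (\<lambda>s x. \<zeta> s \<odot>\<^bsub>?TT q\<^esub> x)"
  let ?D = "\<lambda>p. hom_module A (FF p) M (\<lambda>s x. \<zeta> s \<odot>\<^bsub>M\<^esub> x)"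
  let ?dl = "\<lambda>p f. compose (carrier (FF (p + 1))) f (dF (p + 1))"
  let ?dD = "\<lambda>p f. compose (carrier (FF (p + 1))) f (dF (p + 1))"
  let ?dd = "\<lambda>p f. compose (carrier (FF p)) (std_diff A) f"
  let ?ep = "\<lambda>p f. compose (carrier (FF p)) (std_aug A M) f"
  have Tzero: "\<zero>\<^bsub>?TT q\<^esub> = (\<lambda>_. \<zero>\<^bsub>A\<^esub>)" for q by (simp add: TT free_module_def)
  have actT: "commuting_action A (?TT q) S (\<lambda>s x. \<zeta> s \<odot>\<^bsub>?TT q\<^esub> x)" for q
    by (rule central_action_commutes[OF T.Pmod zeta zeta_central])
  have actM: "commuting_action A M S (\<lambda>s x. \<zeta> s \<odot>\<^bsub>M\<^esub> x)"
    by (rule central_action_commutes[OF M zeta zeta_central])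
  have dl: "?dl p \<in> lin_maps S (?C p q) (?C (p + 1) q)" for p q by (rule hom_precompose[OF F.Pmod F.d_lin'])
  have dd: "?dd p \<in> lin_maps S (?C p q) (?C p (q - 1))" for p q
    by (rule hom_postcompose[OF F.Pmod T.d_lin]) (use lin_mapsD(3)[OF T.d_lin zeta] in simp)
  have ep: "?ep p \<in> lin_maps S (?C p 0) (?D p)" for p
    by (rule hom_postcompose[OF F.Pmod T.e_lin]) (use lin_mapsD(3)[OF T.e_lin zeta] in simp)
  have lin: "x \<in> lin_maps A (FF p) (?TT q)" if "x \<in> carrier (?C p q)" for x p q using that by (simp add: hom_sel)
  have dF_c: "dF (p + 1) y \<in> carrier (FF p)" if "y \<in> carrier (FF (p + 1))" for p y by (rule lin_mapsD(1)[OF F.d_lin' that])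
  \<comment> \<open>Columns are exact because each term of \<open>F\<close> is projective: a map
    into boundaries lifts to the next term of the resolution of \<open>M\<close>.\<close>
  have lift: "\<exists>y\<in>carrier (?C p (q + 1)). x = ?dd p y"
    if x: "x \<in> carrier (?C p q)" and im: "\<And>w. w \<in> carrier (FF p) \<Longrightarrow> x w \<in> std_diff A ` carrier (?TT (q + 1))" for x p q
  proof -
    obtain h where h: "h \<in> lin_maps A (FF p) (?TT (q + 1))" "\<And>w. w \<in> carrier (FF p) \<Longrightarrow> std_diff A (h w) = x w"
      by (rule projective_lift[OF F.proj T.Pmod T.Pmod lin[OF x] T.d_lin'[of q] im]) blast+
    have hC: "restrict h (carrier (FF p)) \<in> carrier (?C p (q + 1))" by (rule hom_restrictI[OF F.Pmod h(1)])
    have "x = ?dd p (restrict h (carrier (FF p)))"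
      by (rule extensionalityI[of _ "carrier (FF p)"]) (use x h(2) in \<open>auto simp: hom_sel compose_def\<close>)
    then show ?thesis using hC by blast
  qed
  have dC: "double_complex S ?C ?D ?dl ?dd ?dD ?ep d"
  proof (rule double_complex.intro)
    show "op_group S (?C p q)" for p q by (rule F.hom_og[OF T.Pmod actT])
    show "op_group S (?D p)" for p by (rule F.hom_og[OF M actM])
    show "?dl p \<in> lin_maps S (?C p q) (?C (p + 1) q)" for p q by (rule dl)
    show "?dd p \<in> lin_maps S (?C p q) (?C p (q - 1))" for p q by (rule dd)
    show "?dD p \<in> lin_maps S (?D p) (?D (p + 1))" for p by (rule hom_precompose[OF F.Pmod F.d_lin'])
    show "?ep p \<in> lin_maps S (?C p 0) (?D p)" for p by (rule ep)
    show "?dl (p + 1) (?dl p x) = \<zero>\<^bsub>?C (p + 2) q\<^esub>" if x: "x \<in> carrier (?C p q)" for x p q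
    proof -
      have p: "p + 1 + 1 = p + 2" by simp
      have "x (dF (p + 1) (dF (p + 2) y)) = \<zero>\<^bsub>?TT q\<^esub>" if "y \<in> carrier (FF (p + 2))" for y
        using F.d_d[of y "p + 1"] that lin_zero_mod[OF F.Pmod T.Pmod lin[OF x]] by (simp add: p)
      then show ?thesis using dF_c[of _ "p + 1"] by (auto simp: compose_def hom_sel p intro!: restrict_ext)
    qed
    show "?dd p (?dd p x) = \<zero>\<^bsub>?C p (q - 2)\<^esub>" if x: "x \<in> carrier (?C p q)" for x p q
    proof -
      have "std_diff A (std_diff A (x y)) = \<zero>\<^bsub>?TT (q - 2)\<^esub>" if "y \<in> carrier (FF p)" for y
        using T.d_d[of "x y" "q - 1"] lin_mapsD(1)[OF lin[OF x] that] by simp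
      then show ?thesis by (auto simp: compose_def hom_sel intro!: restrict_ext)
    qed
    show "?dl p (?dd p x) = ?dd (p + 1) (?dl p x)" for x p
      using dF_c by (auto simp: compose_def intro!: restrict_ext)
    show "?dD p (?ep p x) = ?ep (p + 1) (?dl p x)" for x p
      using dF_c by (auto simp: compose_def intro!: restrict_ext)
    show "\<exists>y\<in>carrier (?C p (q + 1)). x = ?dd p y"
      if q: "1 \<le> q" and x: "x \<in> carrier (?C p q)" and z: "?dd p x = \<zero>\<^bsub>?C p (q - 1)\<^esub>" for x p q
    proof (rule lift[OF x])
      fix w assume w: "w \<in> carrier (FF p)"
      have "std_diff A (x w) = \<zero>\<^bsub>?TT (q - 1)\<^esub>" using fun_cong[OF z, of w] w by (simp add: compose_def hom_sel)
      then show "x w \<in> std_diff A ` carrier (?TT (q + 1))" by (rule T.exact[OF q lin_mapsD(1)[OF lin[OF x] w]])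
    qed
    show "\<exists>y\<in>carrier (?C (p - 1) q). x = ?dl (p - 1) y"
      if p: "p \<noteq> d" and x: "x \<in> carrier (?C p q)" and z: "?dl p x = \<zero>\<^bsub>?C (p + 1) q\<^esub>" for x p q
    proof -
      have "x \<in> cocycles A FF dF (?TT q) p" using x z F.cocycles_set by blast
      then have "x \<in> coboundaries A FF dF (?TT q) p" using vanish_free[OF van[OF p]] unfolding TT by blast
      then show ?thesis unfolding F.coboundaries_eq_image[where act = "\<lambda>s x. \<zeta> s \<odot>\<^bsub>?TT q\<^esub> x"] by auto
    qed
    show "\<exists>x\<in>carrier (?C p 0). ?ep p x = y" if y: "y \<in> carrier (?D p)" for y p
    proof -
      have yl: "y \<in> lin_maps A (FF p) M" using y by (simp add: hom_sel)
      obtain h where h: "h \<in> lin_maps A (FF p) (?TT 0)" "\<And>w. w \<in> carrier (FF p) \<Longrightarrow> std_aug A M (h w) = y w"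
      proof (rule projective_lift[OF F.proj M T.Pmod yl T.e_lin])
        fix w assume "w \<in> carrier (FF p)"
        then show "y w \<in> std_aug A M ` carrier (?TT 0)" using T.e_surj[OF lin_mapsD(1)[OF yl]] by force
      qed blast
      have hC: "restrict h (carrier (FF p)) \<in> carrier (?C p 0)" by (rule hom_restrictI[OF F.Pmod h(1)])
      have "?ep p (restrict h (carrier (FF p))) = y"
        by (rule extensionalityI[of _ "carrier (FF p)"]) (use y h(2) in \<open>auto simp: hom_sel compose_def\<close>)
      then show ?thesis using hC by blast
    qed
    show "\<exists>y\<in>carrier (?C p 1). x = ?dd p y" if x: "x \<in> carrier (?C p 0)" and z: "?ep p x = \<zero>\<^bsub>?D p\<^esub>" for x p
    proof -
      have "x w \<in> std_diff A ` carrier (?TT (0 + 1))" if w: "w \<in> carrier (FF p)" for w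
      proof -
        have "std_aug A M (x w) = \<zero>\<^bsub>M\<^esub>" using fun_cong[OF z, of w] w by (simp add: compose_def hom_sel)
        then show ?thesis using T.e_exact[OF lin_mapsD(1)[OF lin[OF x] w]] by simp
      qed
      from lift[OF x this] show ?thesis by simp
    qed
    show "?ep p (?dd p x) = \<zero>\<^bsub>?D p\<^esub>" if x: "x \<in> carrier (?C p 1)" for x p
      using T.e_d lin_mapsD(1)[OF lin[OF x]] by (auto simp: compose_def hom_sel intro!: restrict_ext)
    show "carrier (?C p q) = {\<zero>\<^bsub>?C p q\<^esub>}" if q: "q < 0" for p q
    proof -
      interpret Cq: op_group S "?C p q" by (rule F.hom_og[OF T.Pmod actT])
      have "f = \<zero>\<^bsub>?C p q\<^esub>" if f: "f \<in> carrier (?C p q)" for f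
        by (rule hom_eqI[OF f Cq.zero_closed])
          (use T.neg[OF q] lin_mapsD(1)[OF lin[OF f]] in \<open>auto simp: hom_sel\<close>)
      then show ?thesis using Cq.zero_closed by blast
    qed
    show "\<exists>n. \<forall>p>n. \<forall>q\<ge>0. \<forall>x\<in>carrier (?C p (q + 1)). ?dl p (?dd p x) = \<zero>\<^bsub>?C (p + 1) q\<^esub> \<longrightarrow>
        (\<exists>u\<in>carrier (?C (p - 1) (q + 1)). ?dd p x = ?dl (p - 1) (?dd (p - 1) u))"
    proof (intro exI[of _ n0] allI impI ballI)
      fix p q x assume p: "n0 < p" and q: "(0::int) \<le> q" and x: "x \<in> carrier (?C p (q + 1))"
        and z: "?dl p (?dd p x) = \<zero>\<^bsub>?C (p + 1) q\<^esub>"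
      \<comment> \<open>The image of the differential becomes a coefficient module \<open>?X\<close>
        of its own. A cocycle with values in \<open>?X\<close> bounds in high degree by
        \<open>fd\<close>, with a primitive \<open>v\<close> again valued in \<open>?X\<close>; by
        projectivity \<open>v\<close> lifts to the required \<open>u\<close>.\<close>
      let ?I = "std_diff A ` carrier (?TT (q + 1))"
      let ?X = "(?TT q)\<lparr>carrier := ?I\<rparr>"
      have I: "op_sub A (?TT q) ?I"
        by (rule op_sub_image[OF left_module_op_group[OF T.Pmod] left_module_op_group[OF T.Pmod] T.d_lin'
            op_group.op_sub_carrier[OF left_module_op_group[OF T.Pmod]]])
      have X: "left_module A ?X" by (rule left_module_sub[OF T.Pmod I])
      have xq: "x w \<in> carrier (?TT (q + 1))" if "w \<in> carrier (FF p)" for w by (rule lin_mapsD(1)[OF lin[OF x] that])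
      have d': "std_diff A \<in> lin_maps A (?TT (q + 1)) ?X"
        by (rule lin_mapsI) (use lin_mapsD[OF T.d_lin'[of q]] in simp_all)
      let ?y = "?dd p x"
      have "(\<lambda>w. std_diff A (x w)) \<in> lin_maps A (FF p) ?X" by (rule lin_maps_compose[OF lin[OF x] d'])
      from lin_maps_restrict[OF F.Pmod this] have y1: "?y \<in> lin_maps A (FF p) ?X" by (simp add: compose_def)
      have "?y (dF (p + 1) w) = \<zero>\<^bsub>?TT q\<^esub>" if w: "w \<in> carrier (FF (p + 1))" for w
        using fun_cong[OF z, of w] w dF_c[OF w] by (simp add: compose_def hom_sel)
      then have "?y \<in> cocycles A FF dF ?X p" using y1 by (simp add: cocycles_def compose_def)
      then have "?y \<in> coboundaries A FF dF ?X p" using fd[OF p X] by blast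
      then obtain v where v: "v \<in> lin_maps A (FF (p - 1)) ?X" "\<forall>w\<in>carrier (FF p). ?y w = v (dF p w)"
        unfolding coboundaries_def by blast
      obtain u where u: "u \<in> lin_maps A (FF (p - 1)) (?TT (q + 1))" "\<And>w. w \<in> carrier (FF (p - 1)) \<Longrightarrow> std_diff A (u w) = v w"
        by (rule projective_lift[OF F.proj X T.Pmod v(1) d']) (use lin_mapsD(1)[OF v(1)] in auto)
      have uC: "restrict u (carrier (FF (p - 1))) \<in> carrier (?C (p - 1) (q + 1))" by (rule hom_restrictI[OF F.Pmod u(1)])
      have "?y = ?dl (p - 1) (?dd (p - 1) (restrict u (carrier (FF (p - 1)))))"
        by (rule extensionalityI[of _ "carrier (FF p)"])
          (use v(2) u(2) lin_mapsD(1)[OF F.d_lin[of p]] in \<open>auto simp: compose_def\<close>)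
      then show "\<exists>u\<in>carrier (?C (p - 1) (q + 1)). ?dd p x = ?dl (p - 1) (?dd (p - 1) u)" using uC by blast
    qed
  qed
  interpret DC: double_complex S ?C ?D ?dl ?dd ?dD ?ep d by (rule dC)
  interpret TC: tensor_cohomology A FF dF d "rk d" \<Omega> cls S \<zeta>
    by (intro tensor_cohomology.intro tensor_cohomology_axioms.intro F.complex_axioms A.ring_axioms refl Om cls cls_surj cls_ker zeta zeta_central)
  let ?q = "d - i"
  have 1: "sq_iso S C Z B (?C d ?q) (DC.HZ ?q) (DC.HB ?q)"
  proof (rule sq_iso_trans[OF iso])
    have "(\<lambda>f. compose (carrier (FF i)) f (dF i)) ` carrier (?D (i - 1)) = coboundaries A FF dF M i"
      by (rule F.coboundaries_eq_image[symmetric])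
    then show "sq_iso S (?D i) (cocycles A FF dF M i) (coboundaries A FF dF M i) (?C d ?q) (DC.HZ ?q) (DC.HB ?q)"
      using DC.D_to_H[of i] unfolding F.cocycles_set by simp
  qed
  have im: "(\<lambda>f. compose (carrier (FF d)) f (dF d)) ` carrier (?C (d - 1) q) = coboundaries A FF dF (?TT q) d" for q
    by (rule F.coboundaries_eq_image[symmetric])
  \<comment> \<open>Rewritten with row cocycles and coboundaries, \<open>HZ\<close> and
    \<open>HB\<close> become the preimages of kernel and image for the maps induced on cohomology at
    \<open>d\<close>, the form expected by \<open>isomorphic_tensor_homology\<close>.\<close>
  have HZ: "DC.HZ ?q = {x \<in> cocycles A FF dF (?TT ?q) d. ?dd d x \<in> coboundaries A FF dF (?TT (?q - 1)) d}"
    unfolding DC.HZ_def F.cocycles_set[symmetric, where act = "\<lambda>s x. \<zeta> s \<odot>\<^bsub>?TT ?q\<^esub> x"] im[symmetric] by auto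
  have HB: "DC.HB ?q = {b \<oplus>\<^bsub>?C d ?q\<^esub> ?dd d z |b z. b \<in> coboundaries A FF dF (?TT ?q) d \<and> z \<in> cocycles A FF dF (?TT (?q + 1)) d}"
    unfolding DC.HB_def F.cocycles_set[symmetric, where act = "\<lambda>s x. \<zeta> s \<odot>\<^bsub>?TT (?q + 1)\<^esub> x"] im[symmetric] by auto
  have bb: "std_diff A (std_diff A x) = \<zero>\<^bsub>?TT (?q - 1)\<^esub>" if "x \<in> carrier (?TT (?q + 1))" for x
    by (rule T.d_d[OF that])
  note b1 = T.d_lin'[of ?q] and b0 = T.d_lin[of ?q]
  show ?thesis unfolding Tor_def Tor_of_def
    using TC.isomorphic_tensor_homology[OF b1[unfolded TT] b0[unfolded TT] bb[unfolded TT] C 1[unfolded HZ HB, unfolded TT]]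
    unfolding TT .
qed

end

section \<open>Topologically free modules\<close>

text \<open>\<open>h\<close> acts as a shift of coefficients; the three properties of topologically
  free modules below are read off from this.\<close>

lemma power_series_X:
  assumes V: "Module.module type_ring V" and f: "f \<in> carrier (power_series_module V)"
  shows "(fps_X \<odot>\<^bsub>power_series_module V\<^esub> f) n = (if n = 0 then \<zero>\<^bsub>V\<^esub> else f (n - 1))"
proof -
  interpret V: Module.module type_ring V by fact
  have fV: "f k \<in> carrier V" for k using f by (simp add: power_series_module_def)
  have z: "0 \<odot>\<^bsub>V\<^esub> x = \<zero>\<^bsub>V\<^esub>" if "x \<in> carrier V" for x using V.smult_l_null[OF that] by (simp add: type_ring_def)
  have o: "1 \<odot>\<^bsub>V\<^esub> x = x" if "x \<in> carrier V" for x using V.smult_one[OF that] by (simp add: type_ring_def)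
  have e: "(fps_X \<odot>\<^bsub>power_series_module V\<^esub> f) n = (\<Oplus>\<^bsub>V\<^esub>i\<in>{..n}. fps_nth fps_X i \<odot>\<^bsub>V\<^esub> f (n - i))"
    by (simp add: power_series_module_def)
  also have "\<dots> = (\<Oplus>\<^bsub>V\<^esub>i\<in>{..n}. if 1 = i then f (n - 1) else \<zero>\<^bsub>V\<^esub>)"
    by (rule V.finsum_cong') (auto simp: fV z o fps_X_def)
  also have "\<dots> = (if n = 0 then \<zero>\<^bsub>V\<^esub> else f (n - 1))"
  proof (cases "n = 0")
    case True then show ?thesis by simp
  next
    case False
    then show ?thesis using V.finsum_singleton[of 1 "{..n}" "\<lambda>_. f (n - 1)"] fV by simp
  qed
  finally show ?thesis .
qed

lemma topologically_free_properties:
  assumes M: "op_group type_ring M" and tfree: "topologically_free M"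
  shows "h_torsion_free M fps_X" "h_complete M fps_X" "h_separated M fps_X"
proof -
  interpret M: op_group type_ring M by fact
  from tfree obtain V :: "('a, 'b) module" and f where V: "Module.module type_ring V"
    and f: "f \<in> lin_maps type_ring M (power_series_module V)" and bij: "bij_betw f (carrier M) (carrier (power_series_module V))"
    unfolding topologically_free_def isomorphic_modules_def by blast
  interpret V: Module.module type_ring V by fact
  have S: "s \<in> carrier (type_ring :: 'a fps ring)" for s by (simp add: type_ring_def)
  have fc: "f x n \<in> carrier V" if "x \<in> carrier M" for x n using lin_mapsD(1)[OF f that] by (simp add: power_series_module_def)
  have fadd: "f (x \<oplus>\<^bsub>M\<^esub> y) n = f x n \<oplus>\<^bsub>V\<^esub> f y n" if "x \<in> carrier M" "y \<in> carrier M" for x y n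
    using lin_mapsD(2)[OF f that] by (simp add: power_series_module_def)
  have fX: "f (fps_X \<odot>\<^bsub>M\<^esub> x) n = (if n = 0 then \<zero>\<^bsub>V\<^esub> else f x (n - 1))" if "x \<in> carrier M" for x n
    using lin_mapsD(3)[OF f S that, of fps_X] power_series_X[OF V lin_mapsD(1)[OF f that]] by simp
  have inj: "x = y" if "x \<in> carrier M" "y \<in> carrier M" "\<And>n. f x n = f y n" for x y
    using bij that unfolding bij_betw_def inj_on_def by blast
  have f0: "f \<zero>\<^bsub>M\<^esub> n = \<zero>\<^bsub>V\<^esub>" for n
    using fadd[of "\<zero>\<^bsub>M\<^esub>" "\<zero>\<^bsub>M\<^esub>" n] fc[of "\<zero>\<^bsub>M\<^esub>" n] by simp
  show "h_torsion_free M fps_X" unfolding h_torsion_free_def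
  proof (intro ballI impI)
    fix x assume x: "x \<in> carrier M" "fps_X \<odot>\<^bsub>M\<^esub> x = \<zero>\<^bsub>M\<^esub>"
    have "f x n = \<zero>\<^bsub>V\<^esub>" for n using fX[OF x(1), of "Suc n"] x(2) f0 by simp
    then show "x = \<zero>\<^bsub>M\<^esub>" using x(1) f0 by (rule_tac inj) simp_all
  qed
  show "h_separated M fps_X" unfolding h_separated_def
  proof (intro allI impI)
    fix w :: "nat \<Rightarrow> 'b" assume w: "\<forall>n. w n \<in> carrier M \<and> w n = fps_X \<odot>\<^bsub>M\<^esub> w (Suc n)"
    note wc = conjunct1[OF w[rule_format]] and we = conjunct2[OF w[rule_format]]
    \<comment> \<open>Coefficient \<open>k + 1\<close> of \<open>w n\<close> is coefficient
      \<open>k\<close> of \<open>w (n + 1)\<close>, so the induction on \<open>k\<close> has to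
      range over all \<open>n\<close>.\<close>
    have "f (w n) k = \<zero>\<^bsub>V\<^esub>" for n k
    proof (induction k arbitrary: n)
      case 0
      have "f (w n) 0 = f (fps_X \<odot>\<^bsub>M\<^esub> w (Suc n)) 0" by (rule arg_cong[OF we])
      then show ?case using fX[OF wc] by simp
    next
      case (Suc k)
      have "f (w n) (Suc k) = f (fps_X \<odot>\<^bsub>M\<^esub> w (Suc n)) (Suc k)" by (rule arg_cong[OF we])
      then show ?case using fX[OF wc] Suc by simp
    qed
    then show "w 0 = \<zero>\<^bsub>M\<^esub>" using f0 wc by (rule_tac inj) simp_all
  qed
  show "h_complete M fps_X" unfolding h_complete_def
  proof (intro allI impI)
    fix c :: "nat \<Rightarrow> 'b" assume c: "\<forall>n. c n \<in> carrier M"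
    \<comment> \<open>\<open>t k n\<close> is the coefficient of index \<open>k\<close> of the tail
      starting at \<open>n\<close>, that is, the sum over \<open>j \<le> k\<close> of the
      coefficient of index \<open>k - j\<close> of \<open>c (n + j)\<close>.\<close>
    define t where "t k = rec_nat (\<lambda>n. f (c n) 0) (\<lambda>k g n. f (c n) (Suc k) \<oplus>\<^bsub>V\<^esub> g (Suc n)) k" for k :: nat
    have t0: "t 0 n = f (c n) 0" and tS: "t (Suc k) n = f (c n) (Suc k) \<oplus>\<^bsub>V\<^esub> t k (Suc n)" for k n
      by (simp_all add: t_def)
    have tV: "t k n \<in> carrier V" for k n by (induction k arbitrary: n) (use c fc in \<open>simp_all add: t0 tS\<close>)
    have "\<exists>s. s \<in> carrier M \<and> f s = (\<lambda>k. t k n)" for n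
    proof -
      have "(\<lambda>k. t k n) \<in> carrier (power_series_module V)" using tV by (simp add: power_series_module_def)
      then show ?thesis using bij unfolding bij_betw_def by (metis imageE)
    qed
    then obtain s where s: "\<And>n. s n \<in> carrier M" "\<And>n. f (s n) = (\<lambda>k. t k n)" by metis
    have "s n = c n \<oplus>\<^bsub>M\<^esub> fps_X \<odot>\<^bsub>M\<^esub> s (Suc n)" for n
    proof (rule inj[OF s(1) M.a_closed[OF c[rule_format] M.op_closed[OF S s(1)]]])
      fix k show "f (s n) k = f (c n \<oplus>\<^bsub>M\<^esub> fps_X \<odot>\<^bsub>M\<^esub> s (Suc n)) k"
        using fadd[OF c[rule_format] M.op_closed[OF S s(1)], of n fps_X "Suc n" k] fX[OF s(1), of "Suc n" k] c fc
        by (cases k) (simp_all add: s(2) t0 tS)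
    qed
    then show "\<exists>s. \<forall>n. s n \<in> carrier M \<and> s n = c n \<oplus>\<^bsub>M\<^esub> fps_X \<odot>\<^bsub>M\<^esub> s (Suc n)"
      using s(1) by (intro exI[of _ s] allI conjI)
  qed
qed

section \<open>Algebras over the base ring and deformations\<close>

lemma algebra_ring: "assoc_algebra R A \<Longrightarrow> ring A"
  by (rule assoc_algebra.axioms(2))

context
  fixes A :: "('k::comm_ring_1, 'a) module"
  assumes A: "assoc_algebra type_ring A"
begin

interpretation al: assoc_algebra type_ring A by (rule A)
interpretation A: ring A by (rule algebra_ring[OF A])

lemma algebra_smult_closed: "x \<in> carrier A \<Longrightarrow> c \<odot>\<^bsub>A\<^esub> x \<in> carrier A"
  by (rule al.smult_closed) (simp_all add: type_ring_def)

lemma algebra_op_group: "op_group type_ring A"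
  by (intro op_group.intro op_group_axioms.intro ring.is_abelian_group[OF algebra_ring[OF A]]) (auto simp: algebra_smult_closed al.smult_r_distr)

lemma scalar_mult: "x \<in> carrier A \<Longrightarrow> (c \<odot>\<^bsub>A\<^esub> \<one>\<^bsub>A\<^esub>) \<otimes>\<^bsub>A\<^esub> x = c \<odot>\<^bsub>A\<^esub> x"
  using al.smult_mult_left[of c "\<one>\<^bsub>A\<^esub>" x] by (simp add: type_ring_def)

lemma mult_scalar: "x \<in> carrier A \<Longrightarrow> x \<otimes>\<^bsub>A\<^esub> (c \<odot>\<^bsub>A\<^esub> \<one>\<^bsub>A\<^esub>) = c \<odot>\<^bsub>A\<^esub> x"
  using al.smult_mult_right[of c x "\<one>\<^bsub>A\<^esub>"] by (simp add: type_ring_def)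

lemma scalar_smult_lin: "(\<lambda>x. c \<odot>\<^bsub>A\<^esub> x) \<in> lin_maps type_ring A A"
proof (rule lin_mapsI)
  fix a x assume x: "x \<in> carrier A" and "a \<in> carrier (type_ring :: 'k ring)"
  show "c \<odot>\<^bsub>A\<^esub> (a \<odot>\<^bsub>A\<^esub> x) = a \<odot>\<^bsub>A\<^esub> (c \<odot>\<^bsub>A\<^esub> x)"
    using al.smult_assoc1[of c a x] al.smult_assoc1[of a c x] x by (simp add: type_ring_def mult.commute)
next
  fix x y assume "x \<in> carrier A" "y \<in> carrier A"
  then show "c \<odot>\<^bsub>A\<^esub> (x \<oplus>\<^bsub>A\<^esub> y) = c \<odot>\<^bsub>A\<^esub> x \<oplus>\<^bsub>A\<^esub> c \<odot>\<^bsub>A\<^esub> y"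
    using al.smult_r_distr[of c x y] by (simp add: type_ring_def)
qed (rule algebra_smult_closed)

lemma scalar_central:
  assumes "x \<in> carrier A"
  shows "(c \<odot>\<^bsub>A\<^esub> \<one>\<^bsub>A\<^esub>) \<otimes>\<^bsub>A\<^esub> x = x \<otimes>\<^bsub>A\<^esub> (c \<odot>\<^bsub>A\<^esub> \<one>\<^bsub>A\<^esub>)"
  using scalar_mult[OF assms] mult_scalar[OF assms] by simp

end

lemma base_action_eq: "base_action A X = (\<lambda>c x. (c \<odot>\<^bsub>A\<^esub> \<one>\<^bsub>A\<^esub>) \<odot>\<^bsub>X\<^esub> x)"
  by (simp add: base_action_def fun_eq_iff)

lemma base_action_commutes:
  assumes A: "assoc_algebra (type_ring :: 'k::comm_ring_1 ring) A" and X: "left_module A X"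
  shows "commuting_action A X (type_ring :: 'k ring) (base_action A X)"
  unfolding base_action_eq
  by (rule central_action_commutes[OF X algebra_smult_closed[OF A ring.ring_simprules(6)[OF algebra_ring[OF A]]] scalar_central[OF A]])

lemma h_multiples_image: "h_multiples A = (\<lambda>x. fps_X \<odot>\<^bsub>A\<^esub> x) ` carrier A"
  by (auto simp: h_multiples_def)

lemma h_multiples_op_sub:
  fixes A :: "('k::field fps, 'a) module"
  assumes A: "assoc_algebra type_ring A"
  shows "op_sub type_ring A (h_multiples A)"
  unfolding h_multiples_image
  by (rule op_sub_image[OF algebra_op_group[OF A] algebra_op_group[OF A] scalar_smult_lin[OF A]
        op_group.op_sub_carrier[OF algebra_op_group[OF A]]])

lemma h_multiples_ideal:
  fixes A :: "('k::field fps, 'a) module"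
  assumes A: "assoc_algebra type_ring A"
  shows "ideal (h_multiples A) A"
proof -
  interpret A: ring A by (rule algebra_ring[OF A])
  interpret al: assoc_algebra type_ring A by (rule A)
  note h = h_multiples_image[of A]
  have "submodule (h_multiples A) type_ring A"
    using op_sub_iff_submodule[OF algebra_op_group[OF A]] h_multiples_op_sub[OF A] by blast
  then have s: "subgroup (h_multiples A) (add_monoid A)" by (rule submodule.axioms(1))
  show ?thesis
  proof (rule idealI[OF A.ring_axioms s])
    fix a x assume "a \<in> h_multiples A" and x: "x \<in> carrier A"
    then obtain y where y: "y \<in> carrier A" "a = fps_X \<odot>\<^bsub>A\<^esub> y" unfolding h by blast
    have "x \<otimes>\<^bsub>A\<^esub> a = fps_X \<odot>\<^bsub>A\<^esub> (x \<otimes>\<^bsub>A\<^esub> y)" "a \<otimes>\<^bsub>A\<^esub> x = fps_X \<odot>\<^bsub>A\<^esub> (y \<otimes>\<^bsub>A\<^esub> x)"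
      using al.smult_mult_left[of fps_X y x] al.smult_mult_right[of fps_X x y] x y by (simp_all add: type_ring_def)
    then show "x \<otimes>\<^bsub>A\<^esub> a \<in> h_multiples A" "a \<otimes>\<^bsub>A\<^esub> x \<in> h_multiples A" unfolding h using x y by auto
  qed
qed

text \<open>With \<open>\<eta>\<close> the multiple of the unit by \<open>h\<close>, multiplication
  by \<open>\<eta>\<close> is the action of \<open>h\<close>, so the properties of the topologically
  free module pass to the ring. Injectivity of \<open>\<phi>\<close> identifies the kernel of the
  reduction with the multiples of \<open>h\<close>.\<close>

lemma deformation_h_adic:
  fixes A0 :: "('k::field, 'b) module" and A :: "('k fps, 'a) module"
  assumes alg0: "assoc_algebra type_ring A0" and noe: "noetherian A0" and def: "deformation A0 A \<phi>"
  shows "h_adic A A0 (fps_X \<odot>\<^bsub>A\<^esub> \<one>\<^bsub>A\<^esub>) (\<lambda>a. \<phi> (h_multiples A +>\<^bsub>A\<^esub> a))"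
proof -
  have alg: "assoc_algebra type_ring A" and top: "topologically_free A"
    and \<phi>: "\<phi> \<in> ring_iso (A Quot h_multiples A) A0" using def by (auto simp: deformation_def)
  let ?I = "h_multiples A"
  interpret A: ring A by (rule algebra_ring[OF alg])
  interpret A0: ring A0 by (rule algebra_ring[OF alg0])
  interpret I: ideal ?I A by (rule h_multiples_ideal[OF alg])
  have ph: "\<phi> \<in> ring_hom (A Quot ?I) A0" and bij: "bij_betw \<phi> (carrier (A Quot ?I)) (carrier A0)"
    using \<phi> by (auto simp: ring_iso_def)
  have hom: "(\<lambda>a. \<phi> (?I +>\<^bsub>A\<^esub> a)) \<in> ring_hom A A0"
    using ring_hom_trans[OF I.rcos_ring_hom ph] by (simp add: comp_def)
  have cq: "carrier (A Quot ?I) = (\<lambda>a. ?I +>\<^bsub>A\<^esub> a) ` carrier A" by (auto simp: FactRing_def A_RCOSETS_def')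
  have zq: "\<phi> ?I = \<zero>\<^bsub>A0\<^esub>"
    using ring_hom_zero[OF ph I.quotient_is_ring A0.ring_axioms] by (simp add: FactRing_def)
  have e1: "fps_X \<odot>\<^bsub>A\<^esub> \<one>\<^bsub>A\<^esub> \<in> carrier A" by (rule algebra_smult_closed[OF alg A.one_closed])
  note tp = topologically_free_properties[OF algebra_op_group[OF alg] top]
  have m: "(fps_X \<odot>\<^bsub>A\<^esub> \<one>\<^bsub>A\<^esub>) \<otimes>\<^bsub>A\<^esub> x = fps_X \<odot>\<^bsub>A\<^esub> x" if "x \<in> carrier A" for x by (rule scalar_mult[OF alg that])
  note ops = h_multiples_op_sub[OF alg]
  have coset: "?I +>\<^bsub>A\<^esub> a = ?I \<longleftrightarrow> a \<in> ?I" if "a \<in> carrier A" for a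
    by (rule op_group.coset_self_iff[OF algebra_op_group[OF alg] ops that])
  show ?thesis
  proof (intro h_adic.intro h_adic_axioms.intro A.ring_axioms A0.ring_axioms e1 hom)
    show "a \<otimes>\<^bsub>A\<^esub> (fps_X \<odot>\<^bsub>A\<^esub> \<one>\<^bsub>A\<^esub>) = (fps_X \<odot>\<^bsub>A\<^esub> \<one>\<^bsub>A\<^esub>) \<otimes>\<^bsub>A\<^esub> a" if "a \<in> carrier A" for a
      by (rule scalar_central[OF alg that, symmetric])
    show "h_torsion_free (regular_module A) (fps_X \<odot>\<^bsub>A\<^esub> \<one>\<^bsub>A\<^esub>)"
      using tp(1) by (simp add: h_torsion_free_def regular_sel m)
    show "h_separated (regular_module A) (fps_X \<odot>\<^bsub>A\<^esub> \<one>\<^bsub>A\<^esub>)"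
      unfolding h_separated_def regular_sel
    proof (intro allI impI)
      fix w :: "nat \<Rightarrow> 'a" assume w: "\<forall>n. w n \<in> carrier A \<and> w n = (fps_X \<odot>\<^bsub>A\<^esub> \<one>\<^bsub>A\<^esub>) \<otimes>\<^bsub>A\<^esub> w (Suc n)"
      note wc = conjunct1[OF w[rule_format]] and we = conjunct2[OF w[rule_format]]
      have "w n = fps_X \<odot>\<^bsub>A\<^esub> w (Suc n)" for n by (rule trans[OF we m[OF wc]])
      then show "w 0 = \<zero>\<^bsub>A\<^esub>" by (intro tp(3)[unfolded h_separated_def, rule_format, of w] conjI wc)
    qed
    show "h_complete (regular_module A) (fps_X \<odot>\<^bsub>A\<^esub> \<one>\<^bsub>A\<^esub>)"
      unfolding h_complete_def regular_sel
    proof (intro allI impI)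
      fix c :: "nat \<Rightarrow> 'a" assume "\<forall>n. c n \<in> carrier A"
      from tp(2)[unfolded h_complete_def, rule_format, OF this[rule_format]]
      obtain s where s: "\<forall>n. s n \<in> carrier A \<and> s n = c n \<oplus>\<^bsub>A\<^esub> fps_X \<odot>\<^bsub>A\<^esub> s (Suc n)" by (rule exE)
      note sc = conjunct1[OF s[rule_format]] and se = conjunct2[OF s[rule_format]]
      have "s n = c n \<oplus>\<^bsub>A\<^esub> (fps_X \<odot>\<^bsub>A\<^esub> \<one>\<^bsub>A\<^esub>) \<otimes>\<^bsub>A\<^esub> s (Suc n)" for n
        unfolding m[OF sc] by (rule se)
      then show "\<exists>s. \<forall>n. s n \<in> carrier A \<and> s n = c n \<oplus>\<^bsub>A\<^esub> (fps_X \<odot>\<^bsub>A\<^esub> \<one>\<^bsub>A\<^esub>) \<otimes>\<^bsub>A\<^esub> s (Suc n)"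
        using sc by (intro exI[of _ s] allI conjI)
    qed
    show "(\<lambda>a. \<phi> (?I +>\<^bsub>A\<^esub> a)) ` carrier A = carrier A0"
      using bij unfolding bij_betw_def cq by (simp add: image_image)
    show "\<exists>b\<in>carrier A. a = (fps_X \<odot>\<^bsub>A\<^esub> \<one>\<^bsub>A\<^esub>) \<otimes>\<^bsub>A\<^esub> b" if a: "a \<in> carrier A" and z: "\<phi> (?I +>\<^bsub>A\<^esub> a) = \<zero>\<^bsub>A0\<^esub>" for a
    proof -
      have "?I +>\<^bsub>A\<^esub> a \<in> carrier (A Quot ?I)" using a cq by blast
      moreover have "?I \<in> carrier (A Quot ?I)" using ring.ring_simprules(2)[OF I.quotient_is_ring] by (simp add: FactRing_def)
      ultimately have "?I +>\<^bsub>A\<^esub> a = ?I" using z zq bij unfolding bij_betw_def inj_on_def by simp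
      then have "a \<in> ?I" using coset[OF a] by simp
      then obtain b where b: "a = fps_X \<odot>\<^bsub>A\<^esub> b" "b \<in> carrier A" unfolding h_multiples_image by (rule imageE)
      show ?thesis by (rule bexI[OF _ b(2)]) (simp only: m[OF b(2)] b(1))
    qed
    have "fps_X \<odot>\<^bsub>A\<^esub> \<one>\<^bsub>A\<^esub> \<in> ?I" unfolding h_multiples_image by (rule imageI[OF A.one_closed])
    then show "\<phi> (?I +>\<^bsub>A\<^esub> (fps_X \<odot>\<^bsub>A\<^esub> \<one>\<^bsub>A\<^esub>)) = \<zero>\<^bsub>A0\<^esub>" using coset[OF e1] zq by simp
    show "left_noetherian A0" using noe by (simp add: noetherian_def)
  qed
qed

lemma type_module_sel:
  "carrier (type_module act) = UNIV" "\<zero>\<^bsub>type_module act\<^esub> = 0" "x \<oplus>\<^bsub>type_module act\<^esub> y = x + y"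
  "a \<odot>\<^bsub>type_module act\<^esub> x = act a x"
  by (simp_all add: type_module_def)

text \<open>Composing the coset map with the isomorphism replaces an abstract isomorphism by a
  surjection with known kernel, the form in which \<open>duality\<close> takes
  \<open>\<Omega>\<close>.\<close>

lemma isomorphic_modules_classes:
  assumes A: "op_group S C" "op_sub S C Z" "op_sub S C B" "B \<subseteq> Z"
    and D: "op_group S D" and iso: "isomorphic_modules S (quotient_module (C\<lparr>carrier := Z\<rparr>) B) D"
  obtains cls where "cls \<in> lin_maps S (C\<lparr>carrier := Z\<rparr>) D" "cls ` Z = carrier D"
    "\<And>x. x \<in> Z \<Longrightarrow> cls x = \<zero>\<^bsub>D\<^esub> \<longleftrightarrow> x \<in> B"
proof -
  let ?C = "C\<lparr>carrier := Z\<rparr>"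
  interpret C: op_group S C by fact
  interpret Z: op_group S ?C by (rule C.op_sub_op_group) fact
  have B: "op_sub S ?C B" by (rule C.op_sub_restrict) fact+
  obtain \<theta> where t: "\<theta> \<in> lin_maps S (quotient_module ?C B) D" and bij: "bij_betw \<theta> (carrier (quotient_module ?C B)) (carrier D)"
    using iso unfolding isomorphic_modules_def by blast
  have p: "(\<lambda>x. B +>\<^bsub>?C\<^esub> x) \<in> lin_maps S ?C (quotient_module ?C B)"
    by (rule lin_mapsI) (simp_all add: carrier_quotient Z.add_quotient[OF B] Z.smult_quotient[OF B])
  show thesis
  proof (rule that)
    show "(\<lambda>x. \<theta> (B +>\<^bsub>?C\<^esub> x)) \<in> lin_maps S ?C D" by (rule lin_maps_compose[OF p t])
    show "(\<lambda>x. \<theta> (B +>\<^bsub>?C\<^esub> x)) ` Z = carrier D"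
      using bij unfolding bij_betw_def carrier_quotient by (simp add: image_image)
    fix x assume x: "x \<in> Z"
    have t0: "\<theta> B = \<zero>\<^bsub>D\<^esub>" using lin_zero[OF Z.op_group_quotient[OF B] D t] by (simp add: zero_quotient)
    have "B +>\<^bsub>?C\<^esub> x \<in> carrier (quotient_module ?C B)" "B \<in> carrier (quotient_module ?C B)"
      using x op_group.op_sub_carrier[OF Z.op_group_quotient[OF B]] op_subD(2)[of S "quotient_module ?C B"]
      by (auto simp: carrier_quotient zero_quotient)
    then have "\<theta> (B +>\<^bsub>?C\<^esub> x) = \<zero>\<^bsub>D\<^esub> \<longleftrightarrow> B +>\<^bsub>?C\<^esub> x = B"
      using bij t0 unfolding bij_betw_def inj_on_def by metis
    then show "\<theta> (B +>\<^bsub>?C\<^esub> x) = \<zero>\<^bsub>D\<^esub> \<longleftrightarrow> x \<in> B" using Z.coset_self_iff[OF B, of x] x by simp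
  qed
qed

theorem theorem8p1p1:
  fixes A0 :: "('k::field_char_0, 'a0) module"
    and Ah :: "('k fps, 'a) module"
    and \<phi> :: "'a set \<Rightarrow> 'a0"
    and act0 :: "'a0 \<Rightarrow> 'k \<Rightarrow> 'k"
    and acth :: "'a \<Rightarrow> 'k fps \<Rightarrow> 'k fps"
    and M :: "('a, 'm) module"
    and d :: int
  assumes "assoc_algebra type_ring A0"
    and "noetherian A0"
    and "deformation A0 Ah \<phi>"
    and "module_structure_on_base A0 act0"
    and "\<forall>j. j \<noteq> d \<longrightarrow>
      (let E = Ext A0 (type_module act0) (regular_module A0) (base_action A0 (regular_module A0)) j
       in carrier E = {\<zero>\<^bsub>E\<^esub>})"
    and "isomorphic_modules (type_ring :: 'k ring)
      (Ext A0 (type_module act0) (regular_module A0) (base_action A0 (regular_module A0)) d)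
      (type_module (*))"
    and "module_structure_on_base Ah acth"
    and "reduces_to Ah \<phi> acth act0"
    and "finite_projective_dimension Ah (type_module acth)"
    and "left_module Ah M"
  shows "\<forall>i :: int.
    (let \<Omega> = Ext_regular Ah (type_module acth) d
     in isomorphic_modules (type_ring :: 'k fps ring)
          (Ext Ah (type_module acth) M (base_action Ah M) i)
          (Tor Ah \<Omega> M (base_action Ah \<Omega>) (d - i)))"
proof -
  let ?K = "type_module acth" and ?k = "type_module act0"
  let ?\<eta> = "fps_X \<odot>\<^bsub>Ah\<^esub> \<one>\<^bsub>Ah\<^esub>" and ?\<pi> = "\<lambda>a. \<phi> (h_multiples Ah +>\<^bsub>Ah\<^esub> a)"
  have alg: "assoc_algebra type_ring Ah" using assms(3) by (simp add: deformation_def)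
  have Km: "left_module Ah ?K" and Kb: "\<And>c x. acth (c \<odot>\<^bsub>Ah\<^esub> \<one>\<^bsub>Ah\<^esub>) x = c * x"
    using assms(7) by (simp_all add: module_structure_on_base_def base_action_def type_module_sel)
  have km: "left_module A0 ?k" using assms(4) by (simp add: module_structure_on_base_def)
  interpret A: ring Ah by (rule algebra_ring[OF alg])
  interpret A0: ring A0 by (rule algebra_ring[OF assms(1)])
  interpret K: left_module Ah ?K by (rule Km)
  have had: "h_adic Ah A0 ?\<eta> ?\<pi>" by (rule deformation_h_adic[OF assms(1,2,3)])
  then interpret h: h_adic Ah A0 ?\<eta> ?\<pi> .
  have Ktf: "h_torsion_free ?K ?\<eta>" by (simp add: h_torsion_free_def type_module_sel Kb)
  have g: "(\<lambda>_. 1) \<in> {..<1::nat} \<rightarrow> carrier ?K" by (simp add: type_module_sel)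
  \<comment> \<open>\<open>K\<close> is cyclic: multiples of the unit of \<open>Ah\<close> by power
    series act on 1 and reach every series. Hence rank 1 suffices in degree 0.\<close>
  let ?e = "linear_extension Ah ?K (\<lambda>_::nat. 1)"
  have e: "?e \<in> lin_maps Ah (free_module Ah {..<1::nat}) ?K" by (rule K.linext_lin[OF g])
  have es: "?e ` carrier (free_module Ah {..<1::nat}) = carrier ?K"
  proof
    show "?e ` carrier (free_module Ah {..<1::nat}) \<subseteq> carrier ?K" by (simp add: type_module_sel)
    show "carrier ?K \<subseteq> ?e ` carrier (free_module Ah {..<1::nat})"
    proof
      fix x :: "'k fps"
      interpret F: left_module Ah "free_module Ah {..<1::nat}" by (rule free_left_module[OF A.ring_axioms])
      have b: "basis_vector Ah 0 \<in> carrier (free_module Ah {..<1::nat})" by (rule basis_vector_closed[OF A.ring_axioms]) simp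
      have x1: "x \<odot>\<^bsub>Ah\<^esub> \<one>\<^bsub>Ah\<^esub> \<in> carrier Ah" by (rule algebra_smult_closed[OF alg A.one_closed])
      have "?e ((x \<odot>\<^bsub>Ah\<^esub> \<one>\<^bsub>Ah\<^esub>) \<odot>\<^bsub>free_module Ah {..<1::nat}\<^esub> basis_vector Ah 0) = x"
        using lin_mapsD(3)[OF e x1 b] K.linext_bv[OF _ g, of 0] by (simp add: type_module_sel Kb)
      then show "x \<in> ?e ` carrier (free_module Ah {..<1::nat})" using F.smult_closed[OF x1 b] by (metis imageI)
    qed
  qed
  obtain rk :: "int \<Rightarrow> nat" and dF where res: "projective_resolution Ah ?K (\<lambda>i. free_module Ah {..<rk i}) dF ?e"
    by (rule h.finite_free_resolution[OF Km Ktf e es])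
  \<comment> \<open>The reduction of \<open>K\<close> is the constant coefficient, linear by the
    hypothesis that the structure on \<open>K\<close> reduces to the one on \<open>k\<close>. A
    series without constant term is \<open>h\<close> times its shift.\<close>
  have "h_adic_resolution Ah A0 ?\<eta> ?\<pi> ?K rk dF ?e ?k (\<lambda>x. fps_nth x 0)"
  proof (intro h_adic_resolution.intro had resolution.intro[OF res Km] h_adic_resolution_axioms.intro km Ktf)
    show "(\<lambda>x. fps_nth x 0) \<in> lin_maps Ah ?K (h.rs ?k)"
    proof (rule lin_mapsI)
      fix a x assume "a \<in> carrier Ah"
      then show "fps_nth (a \<odot>\<^bsub>?K\<^esub> x) 0 = a \<odot>\<^bsub>h.rs ?k\<^esub> fps_nth x 0"
        using assms(8) by (simp add: reduces_to_def h.rs_sel type_module_sel)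
    qed (simp_all add: h.rs_sel type_module_sel)
    show "(\<lambda>x. fps_nth x 0) ` carrier ?K = carrier ?k"
    proof -
      have "y \<in> range (\<lambda>x. fps_nth x 0)" for y :: 'k by (rule image_eqI[of _ _ "fps_const y"]) simp_all
      then show ?thesis by (auto simp: type_module_sel)
    qed
    fix x assume "fps_nth x 0 = \<zero>\<^bsub>?k\<^esub>"
    then have "x = fps_X * fps_shift 1 x" by (intro fps_ext) (simp add: type_module_sel)
    then show "\<exists>y\<in>carrier ?K. x = ?\<eta> \<odot>\<^bsub>?K\<^esub> y" by (auto simp: type_module_sel Kb)
  qed
  then interpret H: h_adic_resolution Ah A0 ?\<eta> ?\<pi> ?K rk dF ?e ?k "\<lambda>x. fps_nth x 0" .
  \<comment> \<open>The hypothesis speaks of the standard resolution over \<open>A0\<close>;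
    comparison moves it to the reduction of the finitely generated resolution.\<close>
  have van: "cocycles A0 H.EE H.d0 (regular_module A0) j \<subseteq> coboundaries A0 H.EE H.d0 (regular_module A0) j" if j: "j \<noteq> d" for j
  proof -
    interpret C: two_resolutions A0 ?k "std_res A0 ?k" "\<lambda>_. std_diff A0" "std_aug A0 ?k" H.EE H.d0 H.e0
      by (intro two_resolutions.intro resolution.intro std_resolution km H.reduced_resolution)
    have R: "left_module A0 (regular_module A0)" by (rule regular_left_module[OF A0.ring_axioms])
    note a = base_action_commutes[OF assms(1) R]
    have E: "Ext A0 ?k (regular_module A0) (base_action A0 (regular_module A0)) j =
      quotient_module ((hom_module A0 (std_res A0 ?k j) (regular_module A0) (base_action A0 (regular_module A0)))
         \<lparr>carrier := cocycles A0 (std_res A0 ?k) (\<lambda>_. std_diff A0) (regular_module A0) j\<rparr>)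
        (coboundaries A0 (std_res A0 ?k) (\<lambda>_. std_diff A0) (regular_module A0) j)"
      unfolding Ext_def by (rule C.P.Ext_of_eq)
    note Ez = assms(5)[unfolded Let_def, rule_format, OF j, unfolded E]
    have "cocycles A0 (std_res A0 ?k) (\<lambda>_. std_diff A0) (regular_module A0) j =
      coboundaries A0 (std_res A0 ?k) (\<lambda>_. std_diff A0) (regular_module A0) j"
      by (rule quotient_trivial[OF C.P.hom_og[OF R a] C.P.op_sub_cocycles[OF R a] C.P.op_sub_coboundaries[OF R a] C.P.coboundaries_subset[OF R a]])
        (rule Ez)
    then show ?thesis by (rule sq_iso_subset[OF C.comparison[OF R a] equalityD1])
  qed
  obtain P d' e' n0 where P: "projective_resolution Ah ?K (P :: int \<Rightarrow> ('a, ('a, 'k fps) cell \<Rightarrow> 'a) module) d' e'"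
    and Pz: "\<forall>i>n0. carrier (P i) = {\<zero>\<^bsub>P i\<^esub>}" using assms(9) unfolding finite_projective_dimension_def by blast
  \<comment> \<open>The bounded resolution \<open>P\<close> has no nontrivial cochains beyond
    \<open>n0\<close>, for any coefficients. Comparison transfers this to \<open>F\<close> as the
    statement that cocycles beyond \<open>n0\<close> bound.\<close>
  have fd: "cocycles Ah H.FF dF X i \<subseteq> coboundaries Ah H.FF dF X i"
    if i: "i > n0" and X: "left_module Ah X" for i and X :: "('a, ('a, 'm) cell \<Rightarrow> 'a) module"
  proof -
    interpret C: two_resolutions Ah ?K P d' e' H.FF dF ?e
      by (intro two_resolutions.intro resolution.intro P res Km)
    show ?thesis
      by (rule sq_iso_subset[OF C.comparison[OF X trivial_commutes] C.P.trivial_cocycles[OF X]]) (use Pz i in simp)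
  qed
  interpret C: two_resolutions Ah ?K "std_res Ah ?K" "\<lambda>_. std_diff Ah" "std_aug Ah ?K" H.FF dF ?e
    by (intro two_resolutions.intro resolution.intro std_resolution Km res)
  have R: "left_module Ah (regular_module Ah)" by (rule regular_left_module[OF A.ring_axioms])
  note rc = right_multiplication_commutes[OF A.ring_axioms]
  let ?\<Omega> = "Ext_regular Ah ?K d"
  have O: "?\<Omega> = quotient_module ((hom_module Ah (std_res Ah ?K d) (regular_module Ah) (\<lambda>a x. x \<otimes>\<^bsub>Ah\<^esub> a))
         \<lparr>carrier := cocycles Ah (std_res Ah ?K) (\<lambda>_. std_diff Ah) (regular_module Ah) d\<rparr>)
        (coboundaries Ah (std_res Ah ?K) (\<lambda>_. std_diff Ah) (regular_module Ah) d)"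
    unfolding Ext_regular_def Ext_def by (rule C.P.Ext_of_eq)
  note oP = C.P.hom_og[OF R rc] C.P.op_sub_cocycles[OF R rc] C.P.op_sub_coboundaries[OF R rc] C.P.coboundaries_subset[OF R rc]
  note oQ = H.F.hom_og[OF R rc] H.F.op_sub_cocycles[OF R rc] H.F.op_sub_coboundaries[OF R rc] H.F.coboundaries_subset[OF R rc]
  have Om: "right_module Ah ?\<Omega>"
    unfolding O
    by (rule left_module_quotient[OF left_module_sub[OF hom_right_module[OF A.ring_axioms C.P.Pmod] oP(2)]
        op_group.op_sub_restrict[OF oP(1,2,3,4)]])
  \<comment> \<open>The comparison is made with right multiplication on the coefficients, so the
    isomorphism is one of right modules, as needed to form tensor products with
    \<open>?\<Omega>\<close>.\<close>
  have "isomorphic_modules (opposite Ah) (quotient_module ((hom_module Ah (H.FF d) (regular_module Ah) (\<lambda>a x. x \<otimes>\<^bsub>Ah\<^esub> a))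
         \<lparr>carrier := cocycles Ah H.FF dF (regular_module Ah) d\<rparr>)
        (coboundaries Ah H.FF dF (regular_module Ah) d)) ?\<Omega>"
    unfolding O by (rule sq_iso_isomorphic[OF oQ oP sq_iso_sym[OF C.comparison[OF R rc]]])
  then obtain cls where cls: "cls \<in> lin_maps (opposite Ah) ((hom_module Ah (H.FF d) (regular_module Ah) (\<lambda>a x. x \<otimes>\<^bsub>Ah\<^esub> a))
         \<lparr>carrier := cocycles Ah H.FF dF (regular_module Ah) d\<rparr>) ?\<Omega>"
     "cls ` cocycles Ah H.FF dF (regular_module Ah) d = carrier ?\<Omega>"
     "\<And>f. f \<in> cocycles Ah H.FF dF (regular_module Ah) d \<Longrightarrow>
        cls f = \<zero>\<^bsub>?\<Omega>\<^esub> \<longleftrightarrow> f \<in> coboundaries Ah H.FF dF (regular_module Ah) d"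
    by (rule isomorphic_modules_classes[OF oQ left_module_op_group[OF Om]]) blast
  have bM: "commuting_action Ah M type_ring (base_action Ah M)" by (rule base_action_commutes[OF alg assms(10)])
  note oM = C.P.hom_og[OF assms(10) bM] C.P.op_sub_cocycles[OF assms(10) bM] C.P.op_sub_coboundaries[OF assms(10) bM]
    C.P.coboundaries_subset[OF assms(10) bM]
  show ?thesis unfolding Let_def
  proof
    fix i
    have E: "Ext Ah ?K M (base_action Ah M) i = quotient_module ((hom_module Ah (std_res Ah ?K i) M (base_action Ah M))
         \<lparr>carrier := cocycles Ah (std_res Ah ?K) (\<lambda>_. std_diff Ah) M i\<rparr>)
        (coboundaries Ah (std_res Ah ?K) (\<lambda>_. std_diff Ah) M i)"
      unfolding Ext_def by (rule C.P.Ext_of_eq)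
    show "isomorphic_modules (type_ring :: 'k fps ring) (Ext Ah ?K M (base_action Ah M) i)
        (Tor Ah ?\<Omega> M (base_action Ah ?\<Omega>) (d - i))"
      unfolding E base_action_eq[of Ah ?\<Omega>]
      by (rule H.duality[OF assms(10) _ _ van fd Om cls oM])
        (use algebra_smult_closed[OF alg A.one_closed] scalar_central[OF alg] C.comparison[OF assms(10) bM, of i] in
          \<open>auto simp: base_action_eq\<close>)
  qed
qed

end
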